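(* Let $G$ be a locally compact group with left Haar measure $m_G$, let $\mathbb F$ be $\mathbb R$ or $\mathbb C$, and take $p$ with $1\le p<\infty$. For $\mu\in\mathrm{M}(G,\mathbb F)$ and $g\in\mathrm{L}^p(G,\mathbb F)$, define $$(\pi_\mu g)(s):=\int_G g(t^{-1}s)\,d\mu(t)$$ for those $m_G$-almost all $s\in G$ for which the integral exists. Then $\pi_\mu g\in\mathrm{L}^p(G,\mathbb F)$ for all $\mu\in\mathrm{M}(G,\mathbb F)$ and $g\in\mathrm{L}^p(G,\mathbb F)$, $\pi_\mu$ is a regular operator on $\mathrm{L}^p(G,\mathbb F)$ for all $\mu\in\mathrm{M}(G,\mathbb F)$, and the map $\mu\mapsto\pi_\mu$ is an injective Banach lattice algebra homomorphism $\pi:\mathrm{M}(G,\mathbb F)\to\mathrm{L}_{\mathrm r}(\mathrm{L}^p(G,\mathbb F))$ (a complex Banach lattice algebra homomorphism if $\mathbb F=\mathbb C$).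
   Context: Locally compact groups are Hausdorff. $\mathrm{M}(G,\mathbb R)$ (resp. $\mathrm{M}(G,\mathbb C)$) is the space of finite real-valued (resp. complex-valued) regular Borel measures on $G$, with the norm $\|\mu\|=|\mu|(G)$ ($|\mu|$ the total variation measure) and the convolution product $\langle\mu\star\nu,f\rangle=\int_G\int_G f(st)\,d\mu(s)\,d\nu(t)$ for continuous $f$ on $G$ vanishing at infinity. $\mathrm{M}(G,\mathbb R)$, ordered by $\mu\ge\nu$ iff $\mu(A)\ge\nu(A)$ for all Borel sets $A$, is a Dedekind complete Banach lattice and a Banach algebra in which the product of positive elements is positive (a Banach lattice algebra); $\mathrm{M}(G,\mathbb C)$ is its complexification. $\mathrm{L}^p(G,\mathbb F)$ is the usual $\mathrm{L}^p$-space of $\mathbb F$-valued functions with respect to $m_G$, with the almost everywhere ordering for $\mathbb F=\mathbb R$; $\mathrm{L}^p(G,\mathbb C)$ is the complexification of $\mathrm{L}^p(G,\mathbb R)$. For a Dedekind complete Banach lattice $E$, $\mathrm{L}_{\mathrm r}(E)$ is the space of regular operators on $E$ (differences of two positive linear operators), ordered by $S\ge T$ iff $Sx\ge Tx$ for all $x\ge0$. It is a Dedekind complete Banach lattice algebra under the regular norm $\|T\|_{\mathrm r}=\|\,|T|\,\|$ (operator norm of the modulus of $T$ in $\mathrm{L}_{\mathrm r}(E)$). The complexification $E_{\mathbb C}$ of a Banach lattice $E$ has modulus $|x+iy|_{\mathbb C}=\sup\{x\cos\theta+y\sin\theta:0\le\theta\le2\pi\}\in E$ and norm $\|z\|_{\mathbb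 C}=\|\,|z|_{\mathbb C}\|$. $\mathrm{L}_{\mathrm r}(E_{\mathbb C})$ is the space of complex-linear operators $S_1+iS_2$ with $S_1,S_2\in\mathrm{L}_{\mathrm r}(E)$; it is identified with the complexification of $\mathrm{L}_{\mathrm r}(E)$, with the corresponding modulus and norm. A Banach lattice algebra homomorphism is a continuous algebra homomorphism $\pi$ between Banach lattice algebras that is also a lattice homomorphism ($|\pi(a)|=\pi(|a|)$ for all $a$). A complex Banach lattice algebra homomorphism is a continuous complex algebra homomorphism between complexifications of Banach lattice algebras with $|\pi(z)|_{\mathbb C}=\pi(|z|_{\mathbb C})$ for all $z$. *)

theory Defs
  imports "HOL-Analysis.Analysis"
begin

section \<open>Real Banach lattices and Banach lattice algebras as carrier-based structures\<close>

text \<open>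
  The spaces \<open>L\<^sup>p(G)\<close> depend on a measure and an exponent, so they cannot be types. The records
  hold only the data of a space; that the structures below satisfy the respective axioms is not
  part of the definitions.
\<close>

record ('f, 'b) nvs =
  vs_carrier :: "'b set"
  vs_zero :: 'b
  vs_add :: "'b \<Rightarrow> 'b \<Rightarrow> 'b"
  vs_scale :: "'f \<Rightarrow> 'b \<Rightarrow> 'b"
  vs_norm :: "'b \<Rightarrow> real"

record 'b blat = "(real, 'b) nvs" +
  bl_le :: "'b \<Rightarrow> 'b \<Rightarrow> bool"

record 'b bla = "'b blat" +
  bla_mult :: "'b \<Rightarrow> 'b \<Rightarrow> 'b"

definition vs_diff :: "('f::ring_1, 'b, 'x) nvs_scheme \<Rightarrow> 'b \<Rightarrow> 'b \<Rightarrow> 'b" where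
  "vs_diff V x y = vs_add V x (vs_scale V (- 1) y)"

definition linear_map ::
  "('f, 'b, 'x) nvs_scheme \<Rightarrow> ('f, 'c, 'y) nvs_scheme \<Rightarrow> ('b \<Rightarrow> 'c) \<Rightarrow> bool" where
  "linear_map V W T \<longleftrightarrow>
     T \<in> vs_carrier V \<rightarrow> vs_carrier W \<and>
     (\<forall>x\<in>vs_carrier V. \<forall>y\<in>vs_carrier V. T (vs_add V x y) = vs_add W (T x) (T y)) \<and>
     (\<forall>c. \<forall>x\<in>vs_carrier V. T (vs_scale V c x) = vs_scale W c (T x))"

definition continuous_map_nvs ::
  "('f::ring_1, 'b, 'x) nvs_scheme \<Rightarrow> ('f, 'c, 'y) nvs_scheme \<Rightarrow> ('b \<Rightarrow> 'c) \<Rightarrow> bool" where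
  "continuous_map_nvs V W T \<longleftrightarrow>
     (\<forall>x\<in>vs_carrier V. \<forall>\<epsilon>>0. \<exists>\<delta>>0. \<forall>y\<in>vs_carrier V.
        vs_norm V (vs_diff V y x) < \<delta> \<longrightarrow> vs_norm W (vs_diff W (T y) (T x)) < \<epsilon>)"

definition op_norm :: "('f, 'b, 'x) nvs_scheme \<Rightarrow> ('b \<Rightarrow> 'b) \<Rightarrow> real" where
  "op_norm V T = (SUP x\<in>{x \<in> vs_carrier V. vs_norm V x \<le> 1}. vs_norm V (T x))"

definition least_ub :: "'b set \<Rightarrow> ('b \<Rightarrow> 'b \<Rightarrow> bool) \<Rightarrow> 'b set \<Rightarrow> 'b" where
  "least_ub C le A = (THE s. s \<in> C \<and> (\<forall>a\<in>A. le a s) \<and>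
     (\<forall>u\<in>C. (\<forall>a\<in>A. le a u) \<longrightarrow> le s u))"

definition modulus :: "('b, 'x) blat_scheme \<Rightarrow> 'b \<Rightarrow> 'b" where
  "modulus E x = least_ub (vs_carrier E) (bl_le E) {x, vs_scale E (- 1) x}"

definition positive_op :: "('b, 'x) blat_scheme \<Rightarrow> ('b \<Rightarrow> 'b) \<Rightarrow> bool" where
  "positive_op E T \<longleftrightarrow> linear_map E E T \<and>
     (\<forall>x\<in>vs_carrier E. bl_le E (vs_zero E) x \<longrightarrow> bl_le E (vs_zero E) (T x))"

text \<open>Operators on a carrier are functions that are \<^const>\<open>undefined\<close> outside of it, so that
  equality of operators is equality of functions.\<close>

definition reg_ops :: "('b, 'x) blat_scheme \<Rightarrow> ('b \<Rightarrow> 'b) set" where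
  "reg_ops E = {T \<in> extensional (vs_carrier E). \<exists>A B. positive_op E A \<and> positive_op E B \<and>
     (\<forall>x\<in>vs_carrier E. T x = vs_diff E (A x) (B x))}"

definition reg_le :: "('b, 'x) blat_scheme \<Rightarrow> ('b \<Rightarrow> 'b) \<Rightarrow> ('b \<Rightarrow> 'b) \<Rightarrow> bool" where
  "reg_le E S T \<longleftrightarrow> (\<forall>x\<in>vs_carrier E. bl_le E (vs_zero E) x \<longrightarrow> bl_le E (S x) (T x))"

definition op_scale :: "('f, 'b, 'x) nvs_scheme \<Rightarrow> 'f \<Rightarrow> ('b \<Rightarrow> 'b) \<Rightarrow> 'b \<Rightarrow> 'b" where
  "op_scale V c T = (\<lambda>x\<in>vs_carrier V. vs_scale V c (T x))"

definition op_add :: "('f, 'b, 'x) nvs_scheme \<Rightarrow> ('b \<Rightarrow> 'b) \<Rightarrow> ('b \<Rightarrow> 'b) \<Rightarrow> 'b \<Rightarrow> 'b" where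
  "op_add V S T = (\<lambda>x\<in>vs_carrier V. vs_add V (S x) (T x))"

definition regular_norm :: "('b, 'x) blat_scheme \<Rightarrow> ('b \<Rightarrow> 'b) \<Rightarrow> real" where
  "regular_norm E T =
     op_norm E (least_ub (reg_ops E) (reg_le E) {T, op_scale E (- 1) T})"

definition Lr :: "('b, 'x) blat_scheme \<Rightarrow> ('b \<Rightarrow> 'b) bla" where
  "Lr E = \<lparr>
     vs_carrier = reg_ops E,
     vs_zero = (\<lambda>x\<in>vs_carrier E. vs_zero E),
     vs_add = op_add E,
     vs_scale = op_scale E,
     vs_norm = regular_norm E,
     bl_le = reg_le E,
     bla_mult = compose (vs_carrier E)\<rparr>"

definition bla_hom :: "('b, 'x) bla_scheme \<Rightarrow> ('c, 'y) bla_scheme \<Rightarrow> ('b \<Rightarrow> 'c) \<Rightarrow> bool" where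
  "bla_hom A B \<phi> \<longleftrightarrow>
     linear_map A B \<phi> \<and>
     (\<forall>a\<in>vs_carrier A. \<forall>b\<in>vs_carrier A. \<phi> (bla_mult A a b) = bla_mult B (\<phi> a) (\<phi> b)) \<and>
     continuous_map_nvs A B \<phi> \<and>
     (\<forall>a\<in>vs_carrier A. modulus B (\<phi> a) = \<phi> (modulus A a))"


section \<open>Complexifications\<close>

text \<open>
  A complexification \<open>V\<close> of a Banach lattice \<open>E\<close> need not consist of pairs: \<open>cx_re\<close> and \<open>cx_im\<close>
  take an element to its two components in \<open>E\<close> (the field \<open>cx_real\<close>), and \<open>cx_embed\<close> is the
  inclusion of \<open>E\<close> into \<open>V\<close>.
\<close>

record ('b, 'c) cblat = "(complex, 'c) nvs" +
  cx_real :: "'b blat"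
  cx_re :: "'c \<Rightarrow> 'b"
  cx_im :: "'c \<Rightarrow> 'b"

record ('b, 'c) cbla = "('b, 'c) cblat" +
  cbla_mult :: "'c \<Rightarrow> 'c \<Rightarrow> 'c"

definition cx_embed :: "('b, 'c, 'x) cblat_scheme \<Rightarrow> 'b \<Rightarrow> 'c" where
  "cx_embed V x = (THE z. z \<in> vs_carrier V \<and> cx_re V z = x \<and> cx_im V z = vs_zero (cx_real V))"

definition cx_modulus :: "('b, 'c, 'x) cblat_scheme \<Rightarrow> 'c \<Rightarrow> 'b" where
  "cx_modulus V z = (let E = cx_real V in
     least_ub (vs_carrier E) (bl_le E)
       {vs_add E (vs_scale E (cos \<theta>) (cx_re V z)) (vs_scale E (sin \<theta>) (cx_im V z)) | \<theta>.
          0 \<le> \<theta> \<and> \<theta> \<le> 2 * pi})"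

text \<open>The complex-linear operators \<open>S\<^sub>1 + iS\<^sub>2\<close>, where
  \<open>(S\<^sub>1 + iS\<^sub>2)(x + iy) = (S\<^sub>1x - S\<^sub>2y) + i(S\<^sub>1y + S\<^sub>2x)\<close>.\<close>

definition creg_ops :: "('b, 'c, 'x) cblat_scheme \<Rightarrow> ('c \<Rightarrow> 'c) set" where
  "creg_ops V = {T \<in> extensional (vs_carrier V). linear_map V V T \<and>
     (\<exists>S\<^sub>1\<in>reg_ops (cx_real V). \<exists>S\<^sub>2\<in>reg_ops (cx_real V). \<forall>z\<in>vs_carrier V.
        cx_re V (T z) = vs_diff (cx_real V) (S\<^sub>1 (cx_re V z)) (S\<^sub>2 (cx_im V z)) \<and>
        cx_im V (T z) = vs_add (cx_real V) (S\<^sub>1 (cx_im V z)) (S\<^sub>2 (cx_re V z)))}"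

text \<open>For \<open>T = S\<^sub>1 + iS\<^sub>2\<close> these are \<open>S\<^sub>1\<close> and \<open>S\<^sub>2\<close>.\<close>

definition op_re :: "('b, 'c, 'x) cblat_scheme \<Rightarrow> ('c \<Rightarrow> 'c) \<Rightarrow> 'b \<Rightarrow> 'b" where
  "op_re V T = (\<lambda>x\<in>vs_carrier (cx_real V). cx_re V (T (cx_embed V x)))"

definition op_im :: "('b, 'c, 'x) cblat_scheme \<Rightarrow> ('c \<Rightarrow> 'c) \<Rightarrow> 'b \<Rightarrow> 'b" where
  "op_im V T = (\<lambda>x\<in>vs_carrier (cx_real V). cx_im V (T (cx_embed V x)))"

definition creg_modulus :: "('b, 'c, 'x) cblat_scheme \<Rightarrow> ('c \<Rightarrow> 'c) \<Rightarrow> 'b \<Rightarrow> 'b" where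
  "creg_modulus V T = (let E = cx_real V in
     least_ub (reg_ops E) (reg_le E)
       {op_add E (op_scale E (cos \<theta>) (op_re V T)) (op_scale E (sin \<theta>) (op_im V T)) | \<theta>.
          0 \<le> \<theta> \<and> \<theta> \<le> 2 * pi})"

definition cLr :: "('b, 'c, 'x) cblat_scheme \<Rightarrow> ('b \<Rightarrow> 'b, 'c \<Rightarrow> 'c) cbla" where
  "cLr V = \<lparr>
     vs_carrier = creg_ops V,
     vs_zero = (\<lambda>z\<in>vs_carrier V. vs_zero V),
     vs_add = op_add V,
     vs_scale = op_scale V,
     vs_norm = (\<lambda>T. regular_norm (cx_real V) (creg_modulus V T)),
     cx_real = blat.truncate (Lr (cx_real V)),
     cx_re = op_re V,
     cx_im = op_im V,
     cbla_mult = compose (vs_carrier V)\<rparr>"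

definition cbla_hom ::
  "('b, 'c, 'x) cbla_scheme \<Rightarrow> ('d, 'e, 'y) cbla_scheme \<Rightarrow> ('c \<Rightarrow> 'e) \<Rightarrow> bool" where
  "cbla_hom A B \<phi> \<longleftrightarrow>
     linear_map A B \<phi> \<and>
     (\<forall>a\<in>vs_carrier A. \<forall>b\<in>vs_carrier A. \<phi> (cbla_mult A a b) = cbla_mult B (\<phi> a) (\<phi> b)) \<and>
     continuous_map_nvs A B \<phi> \<and>
     (\<forall>a\<in>vs_carrier A. cx_embed B (cx_modulus B (\<phi> a)) = \<phi> (cx_embed A (cx_modulus A a)))"


section \<open>Real and complex regular Borel measures\<close>

text \<open>
  A finite real or complex Borel measure is a countably additive set function on the Borel sets,
  extended by 0 to all other sets.
\<close>

definition variation :: "('a::topological_space set \<Rightarrow> 'f::real_normed_field) \<Rightarrow> 'a set \<Rightarrow> ennreal"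
  where
  "variation \<mu> A = (SUP P\<in>{P. finite P \<and> P \<subseteq> sets borel \<and> disjoint P \<and> \<Union>P = A}.
     \<Sum>B\<in>P. ennreal (norm (\<mu> B)))"

definition tv :: "('a::topological_space set \<Rightarrow> 'f::real_normed_field) \<Rightarrow> 'a measure" where
  "tv \<mu> = measure_of UNIV (sets borel) (variation \<mu>)"

definition regular_measures :: "('a::topological_space set \<Rightarrow> 'f::real_normed_field) set" where
  "regular_measures = {\<mu>.
     (\<forall>A. A \<notin> sets borel \<longrightarrow> \<mu> A = 0) \<and>
     (\<forall>A :: nat \<Rightarrow> 'a set. range A \<subseteq> sets borel \<longrightarrow> disjoint_family A \<longrightarrow>
        (\<lambda>n. \<mu> (A n)) sums \<mu> (\<Union>n. A n)) \<and>
     (\<forall>A\<in>sets borel.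
        emeasure (tv \<mu>) A = (INF U\<in>{U. open U \<and> A \<subseteq> U}. emeasure (tv \<mu>) U) \<and>
        emeasure (tv \<mu>) A = (SUP K\<in>{K. compact K \<and> K \<subseteq> A}. emeasure (tv \<mu>) K))}"

text \<open>The density of \<open>\<mu>\<close> with respect to its total variation measure, unique almost everywhere
  (polar decomposition).\<close>

definition tv_density ::
  "('a::topological_space set \<Rightarrow> 'f::{real_normed_field,banach,second_countable_topology}) \<Rightarrow> 'a \<Rightarrow> 'f"
  where
  "tv_density \<mu> = (SOME h. integrable (tv \<mu>) h \<and>
     (\<forall>A\<in>sets borel. \<mu> A = (LINT x:A|tv \<mu>. h x)))"

definition vm_integral ::
  "('a::topological_space set \<Rightarrow> 'f::{real_normed_field,banach,second_countable_topology})
     \<Rightarrow> ('a \<Rightarrow> 'f) \<Rightarrow> 'f" where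
  "vm_integral \<mu> f = (LINT x|tv \<mu>. f x * tv_density \<mu> x)"

definition C0 :: "('a::topological_space \<Rightarrow> 'f::real_normed_field) set" where
  "C0 = {f. continuous_on UNIV f \<and> (\<forall>\<epsilon>>0. \<exists>K. compact K \<and> (\<forall>x. x \<notin> K \<longrightarrow> norm (f x) < \<epsilon>))}"

text \<open>Groups are written additively: \<^class>\<open>topological_group_add\<close> does not assume
  commutativity.\<close>

definition convolution ::
  "('a::topological_group_add set \<Rightarrow> 'f::{real_normed_field,banach,second_countable_topology})
     \<Rightarrow> ('a set \<Rightarrow> 'f) \<Rightarrow> 'a set \<Rightarrow> 'f" where
  "convolution \<mu> \<nu> = (THE \<rho>. \<rho> \<in> regular_measures \<and>
     (\<forall>f\<in>C0. vm_integral \<rho> f = vm_integral \<nu> (\<lambda>t. vm_integral \<mu> (\<lambda>s. f (s + t)))))"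

definition MG_real :: "('a::topological_group_add set \<Rightarrow> real) bla" where
  "MG_real = \<lparr>
     vs_carrier = regular_measures,
     vs_zero = (\<lambda>A. 0),
     vs_add = (\<lambda>\<mu> \<nu> A. \<mu> A + \<nu> A),
     vs_scale = (\<lambda>c \<mu> A. c * \<mu> A),
     vs_norm = (\<lambda>\<mu>. measure (tv \<mu>) UNIV),
     bl_le = (\<lambda>\<mu> \<nu>. \<forall>A\<in>sets borel. \<mu> A \<le> \<nu> A),
     bla_mult = convolution\<rparr>"

definition MG_complex ::
  "('a::topological_group_add set \<Rightarrow> real, 'a set \<Rightarrow> complex) cbla" where
  "MG_complex = \<lparr>
     vs_carrier = regular_measures,
     vs_zero = (\<lambda>A. 0),
     vs_add = (\<lambda>\<mu> \<nu> A. \<mu> A + \<nu> A),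
     vs_scale = (\<lambda>c \<mu> A. c * \<mu> A),
     vs_norm = (\<lambda>\<mu>. measure (tv \<mu>) UNIV),
     cx_real = blat.truncate MG_real,
     cx_re = (\<lambda>\<mu> A. Re (\<mu> A)),
     cx_im = (\<lambda>\<mu> A. Im (\<mu> A)),
     cbla_mult = convolution\<rparr>"


section \<open>Haar measure and the spaces \<open>L\<^sup>p(G)\<close>\<close>

text \<open>Regularity is that of Radon measures which need not be \<open>\<sigma>\<close>-finite: outer regularity on all Borel
  sets, inner regularity on the open ones.\<close>

definition left_haar_measure :: "'a::topological_group_add measure \<Rightarrow> bool" where
  "left_haar_measure m \<longleftrightarrow>
     sets m = sets borel \<and>
     emeasure m UNIV \<noteq> 0 \<and>
     (\<forall>K. compact K \<longrightarrow> emeasure m K < \<infinity>) \<and>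
     (\<forall>A\<in>sets borel. emeasure m A = (INF U\<in>{U. open U \<and> A \<subseteq> U}. emeasure m U)) \<and>
     (\<forall>U. open U \<longrightarrow> emeasure m U = (SUP K\<in>{K. compact K \<and> K \<subseteq> U}. emeasure m K)) \<and>
     (\<forall>a. \<forall>A\<in>sets borel. emeasure m ((+) a ` A) = emeasure m A)"

definition Lp_fun :: "'a measure \<Rightarrow> real \<Rightarrow> ('a \<Rightarrow> 'f::real_normed_field) set" where
  "Lp_fun m p = {f \<in> borel_measurable m. integrable m (\<lambda>x. norm (f x) powr p)}"

definition Lp_class ::
  "'a measure \<Rightarrow> real \<Rightarrow> ('a \<Rightarrow> 'f::real_normed_field) \<Rightarrow> ('a \<Rightarrow> 'f) set" where
  "Lp_class m p f = {g \<in> Lp_fun m p. AE x in m. g x = f x}"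

definition Lp_norm :: "'a measure \<Rightarrow> real \<Rightarrow> ('a \<Rightarrow> 'f::real_normed_field) set \<Rightarrow> real" where
  "Lp_norm m p X = (THE r. \<exists>f\<in>X. r = (LINT x|m. norm (f x) powr p) powr (1 / p))"

definition Lp_real :: "'a measure \<Rightarrow> real \<Rightarrow> ('a \<Rightarrow> real) set blat" where
  "Lp_real m p = \<lparr>
     vs_carrier = Lp_class m p ` Lp_fun m p,
     vs_zero = Lp_class m p (\<lambda>x. 0),
     vs_add = (\<lambda>X Y. \<Union>f\<in>X. \<Union>g\<in>Y. Lp_class m p (\<lambda>x. f x + g x)),
     vs_scale = (\<lambda>c X. \<Union>f\<in>X. Lp_class m p (\<lambda>x. c * f x)),
     vs_norm = Lp_norm m p,
     bl_le = (\<lambda>X Y. \<exists>f\<in>X. \<exists>g\<in>Y. AE x in m. f x \<le> g x)\<rparr>"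

definition Lp_complex ::
  "'a measure \<Rightarrow> real \<Rightarrow> (('a \<Rightarrow> real) set, ('a \<Rightarrow> complex) set) cblat" where
  "Lp_complex m p = \<lparr>
     vs_carrier = Lp_class m p ` Lp_fun m p,
     vs_zero = Lp_class m p (\<lambda>x. 0),
     vs_add = (\<lambda>X Y. \<Union>f\<in>X. \<Union>g\<in>Y. Lp_class m p (\<lambda>x. f x + g x)),
     vs_scale = (\<lambda>c X. \<Union>f\<in>X. Lp_class m p (\<lambda>x. c * f x)),
     vs_norm = Lp_norm m p,
     cx_real = Lp_real m p,
     cx_re = (\<lambda>X. \<Union>f\<in>X. Lp_class m p (\<lambda>x. Re (f x))),
     cx_im = (\<lambda>X. \<Union>f\<in>X. Lp_class m p (\<lambda>x. Im (f x)))\<rparr>"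


section \<open>The operators \<open>\<pi>\<^sub>\<mu>\<close>\<close>

text \<open>The integrand of \<open>(\<pi>\<^sub>\<mu>g)(s)\<close> in additive notation is \<open>g (- t + s)\<close>. Where the integral does not exist,
  \<open>pi_fun\<close> is set to 0.\<close>

definition pi_integral_exists ::
  "('a::topological_group_add set \<Rightarrow> 'f::{real_normed_field,banach,second_countable_topology})
     \<Rightarrow> ('a \<Rightarrow> 'f) \<Rightarrow> 'a \<Rightarrow> bool" where
  "pi_integral_exists \<mu> g s \<longleftrightarrow> integrable (tv \<mu>) (\<lambda>t. g (- t + s))"

definition pi_fun ::
  "('a::topological_group_add set \<Rightarrow> 'f::{real_normed_field,banach,second_countable_topology})
     \<Rightarrow> ('a \<Rightarrow> 'f) \<Rightarrow> 'a \<Rightarrow> 'f" where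
  "pi_fun \<mu> g s =
     (if pi_integral_exists \<mu> g s then vm_integral \<mu> (\<lambda>t. g (- t + s)) else 0)"

text \<open>The union below is a single element of \<open>L\<^sup>p(G)\<close> only if the class of \<^term>\<open>pi_fun \<mu> g\<close> does
  not depend on the choice of the representative \<open>g\<close>.\<close>

definition pi_op ::
  "'a::topological_group_add measure \<Rightarrow> real
     \<Rightarrow> ('a set \<Rightarrow> 'f::{real_normed_field,banach,second_countable_topology})
     \<Rightarrow> ('a \<Rightarrow> 'f) set \<Rightarrow> ('a \<Rightarrow> 'f) set" where
  "pi_op m p \<mu> = (\<lambda>X\<in>Lp_class m p ` Lp_fun m p. \<Union>g\<in>X. Lp_class m p (pi_fun \<mu> g))"

end

(* The operator inequality |pi_mu| <= pi_|mu| is clear; equality is the point. If T dominates all the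
operators that define |pi_mu|, then for a compact set K, cut into small pieces K_j, T 1_K is the sum of
the T 1_{K_j} and hence is at least the sum of the |mu(s - K_j)| at almost every s. As the pieces shrink,
this sum tends to |mu|(s - K), uniformly in s: |mu| is almost carried by finitely many disjoint compact
sets on each of which mu has almost no cancellation, and a small translate s - K_j meets at most one of
them. So T 1_K >= pi_|mu| 1_K, and inner regularity and monotone limits give T >= pi_|mu|. Injectivity
is a consequence, since pi_mu = 0 forces pi_|mu| = 0.

The group need not be second countable, so products of Borel sigma-algebras are too small for Fubini's
theorem. It is proved for Radon measures on the Borel sets of the product space, where x |-> N(E_x) is
lower semicontinuous for open E. *)

theory Submission
  imports Defs
begin

section \<open>Variation of a vector measure\<close>

text \<open>Both moduli are suprema, of the pair \<mu>, -\<mu> or of all rotations of \<mu>. What is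
  used of an upper bound on the operator side is its positivity and that it dominates norm (\<mu> (s
  - A)) at almost every s, for each A of finite Haar measure. So the real and the complex case share
  one domination lemma; in the complex case the uncountably many inequalities, each valid almost
  everywhere, are cut down to rational angles. The Haar measure need not be sigma-finite and is
  assumed inner regular on open sets only. Fubini is therefore applied to its restrictions to open
  sets V of finite measure. These reach far enough: for U open of finite measure, s |-> N (s - U)
  vanishes off a countable union of such V, since its superlevel sets are open and, by Chebyshev, of
  finite measure. Densities with respect to |\<mu>| and representatives in L^p come from choice
  operators and cannot be compared pointwise. Identities between integrals are thus proved by
  comparing L1-bounded functionals on indicators, and the laws of operators on representatives hold
  only almost everywhere.\<close>

text \<open>The clauses of \<open>regular_measures\<close> other than regularity, for values in any
  normed space: components, sums and images of measures satisfy them before their regularity is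
  known.\<close>

definition vector_measure :: "('a::topological_space set \<Rightarrow> 'f::real_normed_vector) \<Rightarrow> bool" where
  "vector_measure \<mu> \<longleftrightarrow> (\<forall>A. A \<notin> sets borel \<longrightarrow> \<mu> A = 0) \<and>
     (\<forall>A :: nat \<Rightarrow> 'a set. range A \<subseteq> sets borel \<longrightarrow> disjoint_family A \<longrightarrow>
        (\<lambda>n. \<mu> (A n)) sums \<mu> (\<Union>n. A n))"

lemma vector_measure_nonborel: "vector_measure \<mu> \<Longrightarrow> A \<notin> sets borel \<Longrightarrow> \<mu> A = 0"
  by (simp add: vector_measure_def)

lemma vector_measure_sums:
  "vector_measure \<mu> \<Longrightarrow> range A \<subseteq> sets borel \<Longrightarrow> disjoint_family A \<Longrightarrow> (\<lambda>n::nat. \<mu> (A n)) sums \<mu> (\<Union>n. A n)"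
  by (simp add: vector_measure_def)

text \<open>The constant sequence of empty sets is disjoint, so its values form a convergent series
  and tend to 0.\<close>

lemma vector_measure_empty [simp]: assumes "vector_measure \<mu>" shows "\<mu> {} = 0"
proof -
  have "(\<lambda>n::nat. \<mu> {}) sums \<mu> (\<Union>n::nat. {})"
    by (rule vector_measure_sums[OF assms]) (auto simp: disjoint_family_on_def)
  then have "(\<lambda>n::nat. \<mu> {}) \<longlonglongrightarrow> 0"
    by (intro summable_LIMSEQ_zero) (auto simp: sums_iff)
  then show ?thesis by (simp add: LIMSEQ_const_iff)
qed

lemma vector_measure_Un:
  assumes "vector_measure \<mu>" "A \<in> sets borel" "B \<in> sets borel" "A \<inter> B = {}"
  shows "\<mu> (A \<union> B) = \<mu> A + \<mu> B"
proof -
  have "(\<lambda>n. \<mu> (binaryset A B n)) sums \<mu> (\<Union>n. binaryset A B n)"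
    using assms by (intro vector_measure_sums) (auto simp: range_binaryset_eq disjoint_family_on_def binaryset_def)
  moreover have "(\<lambda>n. \<mu> (binaryset A B n)) sums (\<Sum>n\<in>{0,1}. \<mu> (binaryset A B n))"
    using assms(1) by (intro sums_finite) (auto simp: binaryset_def)
  ultimately show ?thesis
    by (auto simp: sums_iff UN_binaryset_eq) (simp add: binaryset_def)
qed

lemma vector_measure_UN:
  assumes "vector_measure \<mu>" "finite I" "\<And>i. i \<in> I \<Longrightarrow> A i \<in> sets borel" "disjoint_family_on A I"
  shows "\<mu> (\<Union>i\<in>I. A i) = (\<Sum>i\<in>I. \<mu> (A i))"
  using assms(2-4)
proof (induction I)
  case (insert i I)
  have "A i \<inter> A j = {}" if "j \<in> I" for j
    using insert.hyps(2) that by (intro disjoint_family_onD[OF insert.prems(2)]) auto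
  then have "A i \<inter> (\<Union>i\<in>I. A i) = {}" by blast
  then have "\<mu> (A i \<union> (\<Union>i\<in>I. A i)) = \<mu> (A i) + \<mu> (\<Union>i\<in>I. A i)"
    using insert.prems insert.hyps by (intro vector_measure_Un[OF assms(1)]) (simp_all add: sets.finite_UN)
  moreover have "\<mu> (\<Union>i\<in>I. A i) = (\<Sum>i\<in>I. \<mu> (A i))"
    using insert.prems by (intro insert.IH) (auto simp: disjoint_family_on_def)
  ultimately show ?case using insert.hyps by simp
qed (use assms in auto)

lemma vector_measure_Diff:
  assumes "vector_measure \<mu>" "A \<in> sets borel" "B \<in> sets borel" "B \<subseteq> A"
  shows "\<mu> (A - B) = \<mu> A - \<mu> B"
proof -
  have "(A - B) \<inter> B = {}" "(A - B) \<union> B = A" using assms by auto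
  then show ?thesis using vector_measure_Un[of \<mu> "A - B" B] assms by auto
qed

lemma vector_measure_add: "vector_measure \<mu> \<Longrightarrow> vector_measure \<nu> \<Longrightarrow> vector_measure (\<lambda>A. \<mu> A + \<nu> A)"
  by (auto simp: vector_measure_def intro!: sums_add)

lemma vector_measure_bounded_linear:
  "bounded_linear T \<Longrightarrow> vector_measure \<mu> \<Longrightarrow> vector_measure (\<lambda>A. T (\<mu> A))"
  by (auto simp: vector_measure_def linear_simps(3) intro: bounded_linear.sums)

lemma vector_measure_mult:
  fixes \<mu> :: "'a::topological_space set \<Rightarrow> 'f::real_normed_field"
  shows "vector_measure \<mu> \<Longrightarrow> vector_measure (\<lambda>A. c * \<mu> A)"
  by (rule vector_measure_bounded_linear[OF bounded_linear_mult_right])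

lemma vector_measure_measure:
  assumes "finite_measure N" "sets N = sets borel"
  shows "vector_measure (\<lambda>A. measure N A)"
proof -
  interpret finite_measure N by fact
  show ?thesis
    using assms finite_measure_UNION by (auto simp: vector_measure_def measure_notin_sets)
qed

text \<open>The right-hand sum lives in \<open>ennreal\<close>: where the norms are not summable it
  is infinite and the bound is trivial.\<close>

lemma sums_norm_le:
  fixes f :: "nat \<Rightarrow> 'f::banach"
  assumes "f sums s" shows "ennreal (norm s) \<le> (\<Sum>i. ennreal (norm (f i)))"
proof (cases "summable (\<lambda>i. norm (f i))")
  case True
  then have "norm s \<le> (\<Sum>i. norm (f i))" using assms summable_norm by (auto simp: sums_iff)
  then show ?thesis using True by (simp add: suminf_ennreal2 ennreal_leI)
next
  case False
  then have "(\<Sum>i. ennreal (norm (f i))) = top"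
    using summable_suminf_not_top[of "\<lambda>i. norm (f i)", OF norm_ge_zero] by blast
  then show ?thesis by simp
qed

section \<open>The variation as a measure\<close>

text \<open>\<open>variation\<close> ranges over sets of sets that cover \<open>A\<close> exactly.
  Indexed families filling only part of \<open>A\<close> are completed by the remainder
  \<open>R\<close>, and indices with equal members collapse harmlessly: two equal members of a
  disjoint family are empty.\<close>

lemma variation_ge_sum:
  fixes \<mu> :: "'a::topological_space set \<Rightarrow> 'f::real_normed_field"
  assumes "vector_measure \<mu>" "finite I" "\<And>i. i \<in> I \<Longrightarrow> D i \<in> sets borel" "disjoint_family_on D I"
    and "\<And>i. i \<in> I \<Longrightarrow> D i \<subseteq> A" "A \<in> sets borel"
  shows "(\<Sum>i\<in>I. ennreal (norm (\<mu> (D i)))) \<le> variation \<mu> A"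
proof -
  define R where "R = A - (\<Union>i\<in>I. D i)"
  have R: "R \<in> sets borel" unfolding R_def using assms by auto
  let ?P = "insert R (D ` I)"
  have "\<mu> (D i) = 0" if "i \<in> I" "j \<in> I" "i \<noteq> j" "D i = D j" for i j
  proof -
    have "D i = {}" using assms(4) that by (force simp: disjoint_family_on_def)
    then show ?thesis using assms(1) by simp
  qed
  then have "(\<Sum>B\<in>D ` I. ennreal (norm (\<mu> B))) = sum ((\<lambda>B. ennreal (norm (\<mu> B))) \<circ> D) I"
    by (intro sum.reindex_nontrivial[OF assms(2)]) simp
  then have "(\<Sum>i\<in>I. ennreal (norm (\<mu> (D i)))) = (\<Sum>B\<in>D ` I. ennreal (norm (\<mu> B)))"
    by (simp add: o_def)
  also have "\<dots> \<le> (\<Sum>B\<in>?P. ennreal (norm (\<mu> B)))"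
    using assms by (intro sum_mono2) auto
  also have "\<dots> \<le> variation \<mu> A"
    unfolding variation_def
  proof (rule SUP_upper, intro CollectI conjI)
    show "finite ?P" using assms by auto
    have "R \<inter> D i = {}" "D i \<inter> R = {}" if "i \<in> I" for i
      using that unfolding R_def by auto
    moreover have "D i \<inter> D j = {}" if "i \<in> I" "j \<in> I" "D i \<noteq> D j" for i j
      using that assms(4) unfolding disjoint_family_on_def by metis
    ultimately show "disjoint ?P"
      by (auto simp: pairwise_insert pairwise_def disjnt_def)
  qed (use R assms in \<open>auto simp: R_def\<close>)
  finally show ?thesis .
qed

lemma norm_le_variation:
  fixes \<mu> :: "'a::topological_space set \<Rightarrow> 'f::real_normed_field"
  shows "vector_measure \<mu> \<Longrightarrow> A \<in> sets borel \<Longrightarrow> ennreal (norm (\<mu> A)) \<le> variation \<mu> A"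
  using variation_ge_sum[of \<mu> "{()}" "\<lambda>_. A" A] by (auto simp: disjoint_family_on_def)

lemma variation_leI:
  assumes "\<And>P. finite P \<Longrightarrow> P \<subseteq> sets borel \<Longrightarrow> disjoint P \<Longrightarrow> \<Union>P = A \<Longrightarrow> (\<Sum>B\<in>P. ennreal (norm (\<mu> B))) \<le> c"
  shows "variation \<mu> A \<le> c"
  unfolding variation_def using assms by (intro SUP_least) auto

lemma variation_empty:
  fixes \<mu> :: "'a::topological_space set \<Rightarrow> 'f::real_normed_field"
  assumes "vector_measure \<mu>" shows "variation \<mu> {} = 0"
proof -
  have "variation \<mu> {} \<le> 0"
  proof (rule variation_leI)
    fix P :: "'a set set" assume "\<Union>P = {}"
    then have "\<And>B. B \<in> P \<Longrightarrow> \<mu> B = 0" using assms by (metis Union_empty_conv vector_measure_empty)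
    then have "(\<Sum>B\<in>P. ennreal (norm (\<mu> B))) = 0" using assms by (intro sum.neutral) auto
    then show "(\<Sum>B\<in>P. ennreal (norm (\<mu> B))) \<le> 0" by simp
  qed
  then show ?thesis by simp
qed

lemma variation_mono:
  fixes \<mu> :: "'a::topological_space set \<Rightarrow> 'f::real_normed_field"
  assumes "vector_measure \<mu>" "B \<in> sets borel" "A \<subseteq> B" shows "variation \<mu> A \<le> variation \<mu> B"
proof (rule variation_leI)
  fix P :: "'a set set" assume "finite P" "P \<subseteq> sets borel" "disjoint P" "\<Union>P = A"
  then show "(\<Sum>B\<in>P. ennreal (norm (\<mu> B))) \<le> variation \<mu> B"
    using assms by (intro variation_ge_sum) (auto simp: disjoint_family_on_def pairwise_def disjnt_def)
qed

text \<open>The union of a partition of \<open>A\<close> and one of \<open>B\<close> is a partition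
  of the union; the two share at most the empty set. The sum of the suprema is the supremum over
  pairs.\<close>

lemma variation_superadditive:
  fixes \<mu> :: "'a::topological_space set \<Rightarrow> 'f::real_normed_field"
  assumes "vector_measure \<mu>" "A \<in> sets borel" "B \<in> sets borel" "A \<inter> B = {}"
  shows "variation \<mu> A + variation \<mu> B \<le> variation \<mu> (A \<union> B)"
proof -
  let ?\<P> = "\<lambda>A. {P. finite P \<and> P \<subseteq> sets borel \<and> disjoint P \<and> \<Union>P = A}"
  let ?s = "\<lambda>P. \<Sum>B\<in>P. ennreal (norm (\<mu> B))"
  have ne: "?\<P> C \<noteq> {}" if "C \<in> sets borel" for C :: "'a set"
    using that by (auto intro!: exI[of _ "{C}"])
  have le: "?s P + ?s Q \<le> variation \<mu> (A \<union> B)" if P: "P \<in> ?\<P> A" and Q: "Q \<in> ?\<P> B" for P Q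
  proof -
    have "?s P + ?s Q = ?s (P \<union> Q) + ?s (P \<inter> Q)"
      using P Q by (intro sum.union_inter[symmetric]) auto
    also have "?s (P \<inter> Q) = 0"
    proof (intro sum.neutral ballI)
      fix C assume "C \<in> P \<inter> Q"
      then have "C = {}" using P Q assms(4) by blast
      then show "ennreal (norm (\<mu> C)) = 0" using assms(1) by simp
    qed
    also have "?s (P \<union> Q) + 0 \<le> variation \<mu> (A \<union> B)"
    proof -
      have "X = Y \<or> X \<inter> Y = {}" if "X \<in> P \<union> Q" "Y \<in> P \<union> Q" for X Y
        using that P Q assms(4) unfolding pairwise_def disjnt_def by blast
      then show ?thesis
        using assms P Q unfolding add_0_right by (intro variation_ge_sum) (auto simp: disjoint_family_on_def)
    qed
    finally show ?thesis .
  qed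
  have "variation \<mu> A + variation \<mu> B = (SUP P\<in>?\<P> A. ?s P + variation \<mu> B)"
    unfolding variation_def[of \<mu> A] by (subst ennreal_SUP_add_left[OF ne]) (use assms in auto)
  also have "\<dots> = (SUP P\<in>?\<P> A. SUP Q\<in>?\<P> B. ?s P + ?s Q)"
    unfolding variation_def[of \<mu> B] by (subst ennreal_SUP_add_right[OF ne]) (use assms in auto)
  also have "\<dots> \<le> variation \<mu> (A \<union> B)"
    by (intro SUP_least le)
  finally show ?thesis .
qed

text \<open>One direction is superadditivity and monotonicity for finite unions. For the other,
  every member of a partition of the union is cut along the \<open>A i\<close>, and the norm of a
  convergent sum is at most the sum of the norms.\<close>

lemma variation_suminf:
  fixes \<mu> :: "'a::topological_space set \<Rightarrow> 'f::{real_normed_field,banach}"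
  assumes \<mu>: "vector_measure \<mu>" and A: "range A \<subseteq> sets borel" "disjoint_family A"
  shows "(\<Sum>i::nat. variation \<mu> (A i)) = variation \<mu> (\<Union>i. A i)"
proof (rule antisym)
  have "(\<Sum>i<n. variation \<mu> (A i)) \<le> variation \<mu> (\<Union>i<n. A i)" for n
  proof (induction n)
    case (Suc n)
    have "(\<Sum>i<Suc n. variation \<mu> (A i)) \<le> variation \<mu> (\<Union>i<n. A i) + variation \<mu> (A n)"
      using Suc by (simp add: add_right_mono)
    also have "\<dots> \<le> variation \<mu> ((\<Union>i<n. A i) \<union> A n)"
      using A disjoint_family_onD[OF A(2), of _ n]
      by (intro variation_superadditive \<mu>) (auto, metis disjoint_iff less_irrefl)
    finally show ?case by (simp add: lessThan_Suc Un_commute)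
  qed (simp add: variation_empty[OF \<mu>])
  also have "variation \<mu> (\<Union>i<n. A i) \<le> variation \<mu> (\<Union>i. A i)" for n
    using A by (intro variation_mono \<mu>) auto
  finally show "(\<Sum>i. variation \<mu> (A i)) \<le> variation \<mu> (\<Union>i. A i)"
    by (intro suminf_le_const) auto
next
  show "variation \<mu> (\<Union>i. A i) \<le> (\<Sum>i. variation \<mu> (A i))"
  proof (rule variation_leI)
    fix P :: "'a set set" assume P: "finite P" "P \<subseteq> sets borel" "disjoint P" "\<Union>P = (\<Union>i. A i)"
    have "(\<Sum>B\<in>P. ennreal (norm (\<mu> B))) \<le> (\<Sum>B\<in>P. \<Sum>i. ennreal (norm (\<mu> (B \<inter> A i))))"
    proof (intro sum_mono sums_norm_le)
      fix B assume "B \<in> P"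
      then have "(\<lambda>i. \<mu> (B \<inter> A i)) sums \<mu> (\<Union>i. B \<inter> A i)"
        using P A by (intro vector_measure_sums \<mu>) (auto simp: disjoint_family_on_def, blast)
      moreover have "(\<Union>i. B \<inter> A i) = B" using P \<open>B \<in> P\<close> by auto
      ultimately show "(\<lambda>i. \<mu> (B \<inter> A i)) sums \<mu> B" by simp
    qed
    also have "\<dots> = (\<Sum>i. \<Sum>B\<in>P. ennreal (norm (\<mu> (B \<inter> A i))))"
      by (intro suminf_sum[symmetric]) auto
    also have "\<dots> \<le> (\<Sum>i. variation \<mu> (A i))"
    proof (intro suminf_le)
      fix i show "(\<Sum>B\<in>P. ennreal (norm (\<mu> (B \<inter> A i)))) \<le> variation \<mu> (A i)"
        using P A by (intro variation_ge_sum \<mu>) (auto simp: disjoint_family_on_def pairwise_def disjnt_def)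
    qed auto
    finally show "(\<Sum>B\<in>P. ennreal (norm (\<mu> B))) \<le> (\<Sum>i. variation \<mu> (A i))" .
  qed
qed

lemma sets_tv [simp, measurable_cong]: "sets (tv \<mu>) = sets borel"
  unfolding tv_def by (metis sets.sets_measure_of_eq space_borel)

lemma space_tv [simp]: "space (tv \<mu>) = UNIV"
  unfolding tv_def by (simp add: space_measure_of_conv)

lemma emeasure_tv:
  fixes \<mu> :: "'a::topological_space set \<Rightarrow> 'f::{real_normed_field,banach}"
  assumes "vector_measure \<mu>" "A \<in> sets borel"
  shows "emeasure (tv \<mu>) A = variation \<mu> A"
proof (rule emeasure_measure_of[OF tv_def])
  show "positive (sets (tv \<mu>)) (variation \<mu>)" by (simp add: positive_def variation_empty assms)
  show "countably_additive (sets (tv \<mu>)) (variation \<mu>)"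
    using variation_suminf[OF assms(1)] by (auto simp: countably_additive_def)
qed (use assms in auto)

text \<open>Half of the fact that the variation is the least measure dominating the norm: each sum
  over a partition is at most the corresponding sum for \<open>N\<close>, which is the
  \<open>N\<close>-measure of \<open>A\<close>.\<close>

lemma variation_le_measure:
  fixes \<mu> :: "'a::topological_space set \<Rightarrow> 'f::real_normed_field"
  assumes "\<And>A. A \<in> sets borel \<Longrightarrow> ennreal (norm (\<mu> A)) \<le> emeasure N A" "sets N = sets borel"
  shows "variation \<mu> A \<le> emeasure N A"
proof (rule variation_leI)
  fix P :: "'a set set" assume P: "finite P" "P \<subseteq> sets borel" "disjoint P" "\<Union>P = A"
  have "(\<Sum>B\<in>P. ennreal (norm (\<mu> B))) \<le> (\<Sum>B\<in>P. emeasure N B)"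
    using P assms by (intro sum_mono) auto
  also have "\<dots> = emeasure N (\<Union>B\<in>P. B)"
    using P assms by (intro sum_emeasure) (auto simp: disjoint_family_on_def pairwise_def disjnt_def)
  finally show "(\<Sum>B\<in>P. ennreal (norm (\<mu> B))) \<le> emeasure N A" using P by simp
qed

lemma variation_Un:
  fixes \<mu> :: "'a::topological_space set \<Rightarrow> 'f::{real_normed_field,banach}"
  assumes "vector_measure \<mu>" "A \<in> sets borel" "B \<in> sets borel" "A \<inter> B = {}"
  shows "variation \<mu> (A \<union> B) = variation \<mu> A + variation \<mu> B"
  using plus_emeasure[of A "tv \<mu>" B] assms by (simp add: emeasure_tv)

section \<open>Finiteness of the variation\<close>

text \<open>The members of a partition with a large sum of absolute values are grouped by sign. One
  group has a union \<open>S\<close> of large measure, and \<open>E - S\<close> has large measure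
  too because \<mu> E is fixed. One of the two carries infinite variation; the other one is the set
  \<open>A\<close>.\<close>

lemma real_variation_split:
  fixes \<mu> :: "'a::topological_space set \<Rightarrow> real"
  assumes \<mu>: "vector_measure \<mu>" and E: "E \<in> sets borel" "variation \<mu> E = \<infinity>"
  shows "\<exists>A\<in>sets borel. A \<subseteq> E \<and> 1 \<le> \<bar>\<mu> A\<bar> \<and> variation \<mu> (E - A) = \<infinity>"
proof -
  \<comment> \<open>The factor 2 pays for keeping one sign only; the summand \<bar>\<mu> E\<bar>
    keeps \<bar>\<mu> (E - S)\<bar> at least 1.\<close>
  define t where "t = 2 * (1 + \<bar>\<mu> E\<bar>)"
  have "ennreal t < variation \<mu> E" using E by simp
  then obtain P where P: "finite P" "P \<subseteq> sets borel" "disjoint P" "\<Union>P = E"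
    and t: "ennreal t < (\<Sum>B\<in>P. ennreal (norm (\<mu> B)))"
    unfolding variation_def less_SUP_iff by auto
  from t have "ennreal t < ennreal (\<Sum>B\<in>P. \<bar>\<mu> B\<bar>)" by (simp add: sum_ennreal)
  moreover have "0 \<le> t" by (simp add: t_def)
  ultimately have t: "t < (\<Sum>B\<in>P. \<bar>\<mu> B\<bar>)" by (simp add: ennreal_less_iff)
  \<comment> \<open>Members of measure 0 lie in both groups, whence an inequality below instead of
    an equality.\<close>
  define Q where "Q s = {B \<in> P. 0 \<le> s * \<mu> B}" for s
  have \<mu>Q: "\<mu> (\<Union>(Q s)) = (\<Sum>B\<in>Q s. \<mu> B)" for s
    using vector_measure_UN[OF \<mu>, of "Q s" "\<lambda>B. B"] P
    by (auto simp: Q_def disjoint_family_on_def pairwise_def disjnt_def)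
  have "(\<Sum>B\<in>P. \<bar>\<mu> B\<bar>) \<le> (\<Sum>B\<in>Q 1. \<bar>\<mu> B\<bar>) + (\<Sum>B\<in>Q (-1). \<bar>\<mu> B\<bar>)"
  proof -
    have "P = Q 1 \<union> Q (-1)" by (auto simp: Q_def)
    then have "(\<Sum>B\<in>P. \<bar>\<mu> B\<bar>) + (\<Sum>B\<in>Q 1 \<inter> Q (-1). \<bar>\<mu> B\<bar>) = (\<Sum>B\<in>Q 1. \<bar>\<mu> B\<bar>) + (\<Sum>B\<in>Q (-1). \<bar>\<mu> B\<bar>)"
      using P(1) by (metis finite_Un sum.union_inter)
    moreover have "0 \<le> (\<Sum>B\<in>Q 1 \<inter> Q (-1). \<bar>\<mu> B\<bar>)" by (intro sum_nonneg) auto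
    ultimately show ?thesis by linarith
  qed
  also have "(\<Sum>B\<in>Q 1. \<bar>\<mu> B\<bar>) = \<mu> (\<Union>(Q 1))" unfolding \<mu>Q by (intro sum.cong) (auto simp: Q_def)
  also have "(\<Sum>B\<in>Q (-1). \<bar>\<mu> B\<bar>) = - \<mu> (\<Union>(Q (-1)))"
    unfolding \<mu>Q sum_negf[symmetric] by (intro sum.cong) (auto simp: Q_def)
  finally have "\<exists>s. t / 2 < \<bar>\<mu> (\<Union>(Q s))\<bar>" using t by (smt (verit) field_sum_of_halves)
  then obtain s where s: "t / 2 < \<bar>\<mu> (\<Union>(Q s))\<bar>" ..
  define S where "S = \<Union>(Q s)"
  have "finite (Q s)" using P(1) by (simp add: Q_def)
  then have S: "S \<in> sets borel" "S \<subseteq> E"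
    using P unfolding S_def by (auto simp: Q_def intro!: sets.finite_Union)
  have "\<mu> (E - S) = \<mu> E - \<mu> S" using S E by (intro vector_measure_Diff \<mu>)
  then have 1: "1 \<le> \<bar>\<mu> S\<bar>" "1 \<le> \<bar>\<mu> (E - S)\<bar>" using s unfolding S_def[symmetric] t_def by auto
  have "S \<union> (E - S) = E" using S by auto
  then have "variation \<mu> S + variation \<mu> (E - S) = \<infinity>"
    using variation_Un[OF \<mu>, of S "E - S"] S E by auto
  moreover have "E - (E - S) = S" using S by auto
  ultimately have "\<exists>A\<in>{S, E - S}. variation \<mu> (E - A) = \<infinity>"
    by (auto simp: ennreal_add_eq_top)
  then show ?thesis using S E 1 by blast
qed

text \<open>Splitting again and again the part of infinite variation leaves disjoint sets
  \<open>A n\<close> with \<bar>\<mu> (A n)\<bar> at least 1, against the convergence of the series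
  of their measures.\<close>

lemma real_variation_finite:
  fixes \<mu> :: "'a::topological_space set \<Rightarrow> real"
  assumes \<mu>: "vector_measure \<mu>"
  shows "variation \<mu> UNIV \<noteq> \<infinity>"
proof
  assume inf: "variation \<mu> UNIV = \<infinity>"
  obtain a where a: "\<And>E. E \<in> sets borel \<Longrightarrow> variation \<mu> E = \<infinity> \<Longrightarrow>
      a E \<in> sets borel \<and> a E \<subseteq> E \<and> 1 \<le> \<bar>\<mu> (a E)\<bar> \<and> variation \<mu> (E - a E) = \<infinity>"
    using real_variation_split[OF \<mu>] by metis
  define E where "E n = ((\<lambda>E. E - a E) ^^ n) UNIV" for n
  have E_Suc: "E (Suc n) = E n - a (E n)" for n by (simp add: E_def)
  have E: "E n \<in> sets borel \<and> variation \<mu> (E n) = \<infinity>" for n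
  proof (induction n)
    case 0 then show ?case using inf by (simp add: E_def)
  next
    case (Suc n) then show ?case using a[of "E n"] by (auto simp: E_Suc)
  qed
  define A where "A n = a (E n)" for n
  have A: "A n \<in> sets borel" "A n \<subseteq> E n" "1 \<le> \<bar>\<mu> (A n)\<bar>" for n
    using a[of "E n"] E[of n] by (auto simp: A_def)
  have sub: "E n \<subseteq> E m" if "m \<le> n" for m n
    using that by (induction rule: dec_induct) (auto simp: E_Suc)
  have disj: "A m \<inter> A n = {}" if "m < n" for m n
    using sub[of "Suc m" n] A(2)[of n] that by (auto simp: E_Suc A_def)
  have "disjoint_family A"
    unfolding disjoint_family_on_def by (metis disj Int_commute linorder_neqE_nat)
  then have "(\<lambda>n. \<mu> (A n)) \<longlonglongrightarrow> 0"
    using vector_measure_sums[OF \<mu>, of A] A(1) by (intro summable_LIMSEQ_zero) (auto simp: sums_iff)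
  then have "eventually (\<lambda>n. \<bar>\<mu> (A n)\<bar> < 1) sequentially"
    using tendstoD[of "\<lambda>n. \<mu> (A n)" 0 sequentially 1] by (simp add: dist_real_def)
  then show False using A(3) by (auto simp: eventually_sequentially not_less[symmetric])
qed

text \<open>Reduction to real measures: the norm is at most the sum of the absolute coordinates with
  respect to \<open>Basis\<close>.\<close>

lemma finite_measure_tv:
  fixes \<mu> :: "'a::topological_space set \<Rightarrow> 'f::{real_normed_field,euclidean_space}"
  assumes \<mu>: "vector_measure \<mu>"
  shows "finite_measure (tv \<mu>)"
proof (rule finite_measureI)
  have "variation \<mu> UNIV \<le> (\<Sum>b\<in>Basis. variation (\<lambda>A. \<mu> A \<bullet> b) UNIV)"
  proof (rule variation_leI)
    fix P :: "'a set set" assume P: "finite P" "P \<subseteq> sets borel" "disjoint P" "\<Union>P = UNIV"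
    have "(\<Sum>B\<in>P. ennreal (norm (\<mu> B))) \<le> (\<Sum>B\<in>P. \<Sum>b\<in>Basis. ennreal (norm (\<mu> B \<bullet> b)))"
      by (intro sum_mono) (use norm_le_l1 in \<open>auto simp: sum_ennreal intro!: ennreal_leI\<close>)
    also have "\<dots> = (\<Sum>b\<in>Basis. \<Sum>B\<in>P. ennreal (norm (\<mu> B \<bullet> b)))" by (rule sum.swap)
    also have "\<dots> \<le> (\<Sum>b\<in>Basis. variation (\<lambda>A. \<mu> A \<bullet> b) UNIV)"
      using P by (intro sum_mono variation_ge_sum vector_measure_bounded_linear[OF bounded_linear_inner_left \<mu>])
        (auto simp: disjoint_family_on_def pairwise_def disjnt_def)
    finally show "(\<Sum>B\<in>P. ennreal (norm (\<mu> B))) \<le> (\<Sum>b\<in>Basis. variation (\<lambda>A. \<mu> A \<bullet> b) UNIV)" .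
  qed
  also have "\<dots> < \<infinity>"
    using real_variation_finite[OF vector_measure_bounded_linear[OF bounded_linear_inner_left \<mu>]]
    by (auto simp: less_top)
  finally show "emeasure (tv \<mu>) (space (tv \<mu>)) \<noteq> \<infinity>"
    using \<mu> by (simp add: emeasure_tv)
qed

lemma norm_le_tv:
  fixes \<mu> :: "'a::topological_space set \<Rightarrow> 'f::{real_normed_field,euclidean_space}"
  assumes \<mu>: "vector_measure \<mu>"
  shows "norm (\<mu> A) \<le> measure (tv \<mu>) A"
proof (cases "A \<in> sets borel")
  case True
  interpret finite_measure "tv \<mu>" by (rule finite_measure_tv[OF \<mu>])
  show ?thesis
    using norm_le_variation[OF \<mu> True] emeasure_tv[OF \<mu> True]
    by (simp add: emeasure_eq_measure) (metis ennreal_le_iff measure_nonneg)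
qed (use vector_measure_nonborel[OF \<mu>] in simp)

lemma emeasure_tv_le:
  fixes \<mu> :: "'a::topological_space set \<Rightarrow> 'f::{real_normed_field,banach}"
  assumes "vector_measure \<mu>" "\<And>A. A \<in> sets borel \<Longrightarrow> ennreal (norm (\<mu> A)) \<le> emeasure N A" "sets N = sets borel"
  shows "emeasure (tv \<mu>) A \<le> emeasure N A"
proof (cases "A \<in> sets borel")
  case True
  then show ?thesis using assms by (simp add: emeasure_tv variation_le_measure)
qed (simp add: emeasure_notin_sets)

lemma emeasure_tv_nonneg:
  fixes \<mu> :: "'a::topological_space set \<Rightarrow> real"
  assumes \<mu>: "vector_measure \<mu>" and nn: "\<And>A. 0 \<le> \<mu> A"
  shows "emeasure (tv \<mu>) A = ennreal (\<mu> A)"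
proof (cases "A \<in> sets borel")
  case True
  have "variation \<mu> A \<le> ennreal (\<mu> A)"
  proof (rule variation_leI)
    fix P assume P: "finite P" "P \<subseteq> sets borel" "disjoint P" "\<Union>P = A"
    have "\<mu> A = (\<Sum>B\<in>P. \<mu> B)"
      using vector_measure_UN[OF \<mu>, of P "\<lambda>B. B"] P
      by (auto simp: disjoint_family_on_def pairwise_def disjnt_def)
    then show "(\<Sum>B\<in>P. ennreal (norm (\<mu> B))) \<le> ennreal (\<mu> A)" using nn by (simp add: sum_ennreal)
  qed
  moreover have "ennreal (\<mu> A) \<le> variation \<mu> A" using norm_le_variation[OF \<mu> True] nn[of A] by simp
  ultimately show ?thesis using True by (simp add: emeasure_tv[OF \<mu>])
qed (simp add: emeasure_notin_sets vector_measure_nonborel[OF \<mu>])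

lemma tv_measure:
  assumes "finite_measure N" "sets N = sets borel"
  shows "tv (measure N) = N"
proof (rule measure_eqI)
  interpret finite_measure N by fact
  show "emeasure (tv (measure N)) A = emeasure N A" for A
    using emeasure_tv_nonneg[OF vector_measure_measure[OF assms]] by (simp add: emeasure_eq_measure)
qed (use assms in simp)

section \<open>The density with respect to the variation\<close>

text \<open>Radon-Nikodym for positive measures suffices: \<open>N\<close> dominates the signed
  measure \<nu>, so their sum \<sigma> is positive and absolutely continuous, and the density 1 of
  \<open>N\<close> is subtracted at the end.\<close>

lemma real_vector_measure_density:
  fixes \<nu> :: "'a::topological_space set \<Rightarrow> real"
  assumes N: "finite_measure N" "sets N = sets borel" and \<nu>: "vector_measure \<nu>"
    and le: "\<And>A. A \<in> sets borel \<Longrightarrow> \<bar>\<nu> A\<bar> \<le> measure N A"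
  shows "\<exists>h. integrable N h \<and> (\<forall>A\<in>sets borel. \<nu> A = (LINT x:A|N. h x))"
proof -
  interpret finite_measure N by fact
  note [measurable_cong] = N(2)
  define \<sigma> where "\<sigma> = (\<lambda>A. measure N A + \<nu> A)"
  have \<sigma>: "vector_measure \<sigma>" unfolding \<sigma>_def
    by (intro vector_measure_add vector_measure_measure assms)
  have nn: "0 \<le> \<sigma> A" for A
    using le[of A] vector_measure_nonborel[OF \<sigma>, of A] by (cases "A \<in> sets borel") (auto simp: \<sigma>_def)
  have em: "emeasure (tv \<sigma>) A = ennreal (\<sigma> A)" for A by (rule emeasure_tv_nonneg[OF \<sigma> nn])
  have "absolutely_continuous N (tv \<sigma>)"
    unfolding absolutely_continuous_def
  proof
    fix A assume "A \<in> null_sets N"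
    then have "measure N A = 0" "A \<in> sets borel" using N by (auto simp: measure_def)
    moreover from this have "\<sigma> A = 0" using le[of A] by (auto simp: \<sigma>_def)
    ultimately show "A \<in> null_sets (tv \<sigma>)" by (auto simp: em null_sets_def)
  qed
  then obtain f where f[measurable]: "f \<in> borel_measurable N" and d: "density N f = tv \<sigma>"
    using Radon_Nikodym[of "tv \<sigma>"] N by auto
  have fin: "(\<integral>\<^sup>+x. f x \<partial>N) \<noteq> \<infinity>"
    using emeasure_density[OF f, of "space N"] unfolding d by (auto simp: em)
  \<comment> \<open>The integral of \<open>f\<close> is finite, so \<open>f\<close> is finite almost
    everywhere and \<open>enn2real\<close> changes it on a null set only.\<close>
  then have ae: "AE x in N. f x \<noteq> \<infinity>" using f by (intro nn_integral_PInf_AE) auto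
  have int: "integrable N (\<lambda>x. enn2real (f x))"
  proof (rule integrableI_bounded)
    have "(\<integral>\<^sup>+x. ennreal (norm (enn2real (f x))) \<partial>N) = (\<integral>\<^sup>+x. f x \<partial>N)"
      using ae by (intro nn_integral_cong_AE) (auto elim!: eventually_mono simp: less_top)
    then show "(\<integral>\<^sup>+x. ennreal (norm (enn2real (f x))) \<partial>N) < \<infinity>" using fin by (simp add: less_top)
  qed simp
  have \<sigma>f: "\<sigma> A = (LINT x:A|N. enn2real (f x))" if "A \<in> sets borel" for A
  proof -
    have A[measurable]: "A \<in> sets N" using that N by simp
    have "ennreal (\<sigma> A) = (\<integral>\<^sup>+x. f x * indicator A x \<partial>N)"
      using emeasure_density[OF f A] unfolding d em .
    also have "\<dots> = (\<integral>\<^sup>+x. ennreal (indicator A x *\<^sub>R enn2real (f x)) \<partial>N)"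
      using ae by (intro nn_integral_cong_AE) (auto elim!: eventually_mono simp: less_top indicator_def)
    also have "\<dots> = ennreal (LINT x:A|N. enn2real (f x))"
      unfolding set_lebesgue_integral_def
      by (intro nn_integral_eq_integral integrable_mult_indicator int) (auto simp: that N)
    finally show ?thesis
      using nn[of A] by (subst (asm) ennreal_inj) (auto simp: set_lebesgue_integral_def intro!: integral_nonneg)
  qed
  show ?thesis
  proof (intro exI[of _ "\<lambda>x. enn2real (f x) - 1"] conjI ballI)
    fix A :: "'a set" assume "A \<in> sets borel"
    then have A: "A \<in> sets N" using N by simp
    have "(LINT x:A|N. enn2real (f x) - 1) = (LINT x:A|N. enn2real (f x)) - (LINT x:A|N. 1)"
      using A int by (intro set_integral_diff) (auto simp: set_integrable_def simp del: real_scaleR_def intro!: integrable_mult_indicator)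
    also have "(LINT x:A|N. 1) = measure N A" using A by (simp add: set_lebesgue_integral_def)
    finally show "\<nu> A = (LINT x:A|N. enn2real (f x) - 1)"
      using \<sigma>f[OF \<open>A \<in> sets borel\<close>] by (simp add: \<sigma>_def)
  qed (use int in auto)
qed

text \<open>Coordinate by coordinate, as \<open>tv \<mu>\<close> dominates every coordinate of
  \<mu>. This gives meaning to the choice in \<open>tv_density\<close>.\<close>

lemma tv_density_exists:
  fixes \<mu> :: "'a::topological_space set \<Rightarrow> 'f::{real_normed_field,euclidean_space}"
  assumes \<mu>: "vector_measure \<mu>"
  shows "\<exists>h. integrable (tv \<mu>) h \<and> (\<forall>A\<in>sets borel. \<mu> A = (LINT x:A|tv \<mu>. h x))"
proof -
  have "\<exists>h. integrable (tv \<mu>) h \<and> (\<forall>A\<in>sets borel. \<mu> A \<bullet> b = (LINT x:A|tv \<mu>. h x))" if "b \<in> Basis" for b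
  proof (rule real_vector_measure_density)
    show "\<bar>\<mu> A \<bullet> b\<bar> \<le> measure (tv \<mu>) A" for A
      using norm_le_tv[OF \<mu>, of A] Basis_le_norm[OF that, of "\<mu> A"] by linarith
  qed (use \<mu> in \<open>auto intro: finite_measure_tv vector_measure_bounded_linear[OF bounded_linear_inner_left]\<close>)
  then obtain h where h: "\<And>b. b \<in> Basis \<Longrightarrow> integrable (tv \<mu>) (h b)"
      "\<And>b A. b \<in> Basis \<Longrightarrow> A \<in> sets borel \<Longrightarrow> \<mu> A \<bullet> b = (LINT x:A|tv \<mu>. h b x)"
    by metis
  show ?thesis
  proof (intro exI[of _ "\<lambda>x. \<Sum>b\<in>Basis. h b x *\<^sub>R b"] conjI ballI)
    fix A :: "'a set" assume A: "A \<in> sets borel"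
    have "(LINT x:A|tv \<mu>. (\<Sum>b\<in>Basis. h b x *\<^sub>R b)) = (LINT x|tv \<mu>. (\<Sum>b\<in>Basis. (indicator A x *\<^sub>R h b x) *\<^sub>R b))"
      by (simp add: set_lebesgue_integral_def scaleR_sum_right)
    also have "\<dots> = (\<Sum>b\<in>Basis. (LINT x:A|tv \<mu>. h b x) *\<^sub>R b)"
      unfolding set_lebesgue_integral_def using h A
      by (subst Bochner_Integration.integral_sum)
        (auto intro!: integrable_scaleR_left integrable_mult_indicator sum.cong integral_scaleR_left simp del: real_scaleR_def)
    also have "\<dots> = \<mu> A"
      using h(2) A by (subst (2) euclidean_representation[symmetric]) (auto intro!: sum.cong)
    finally show "\<mu> A = (LINT x:A|tv \<mu>. (\<Sum>b\<in>Basis. h b x *\<^sub>R b))" by simp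
  qed (use h in auto)
qed

lemma
  fixes \<mu> :: "'a::topological_space set \<Rightarrow> 'f::{real_normed_field,euclidean_space}"
  assumes \<mu>: "vector_measure \<mu>"
  shows integrable_tv_density: "integrable (tv \<mu>) (tv_density \<mu>)"
    and set_integral_tv_density: "A \<in> sets borel \<Longrightarrow> (LINT x:A|tv \<mu>. tv_density \<mu> x) = \<mu> A"
  using someI_ex[OF tv_density_exists[OF \<mu>]] unfolding tv_density_def by auto

text \<open>The average of the density over \<open>A\<close> is \<mu> A divided by the variation of
  \<open>A\<close>, hence in the closed unit ball; a function whose averages lie in a closed set
  takes its values there almost everywhere.\<close>

lemma norm_tv_density_le:
  fixes \<mu> :: "'a::topological_space set \<Rightarrow> 'f::{real_normed_field,euclidean_space}"
  assumes \<mu>: "vector_measure \<mu>"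
  shows "AE x in tv \<mu>. norm (tv_density \<mu> x) \<le> 1"
proof -
  interpret finite_measure "tv \<mu>" by (rule finite_measure_tv[OF \<mu>])
  have "AE x in tv \<mu>. tv_density \<mu> x \<in> cball 0 1"
  proof (rule averaging_theorem[OF integrable_tv_density[OF \<mu>]])
    fix A assume "A \<in> sets (tv \<mu>)" "0 < measure (tv \<mu>) A"
    then show "(1 / measure (tv \<mu>) A) *\<^sub>R (LINT x:A|tv \<mu>. tv_density \<mu> x) \<in> cball 0 1"
      using norm_le_tv[OF \<mu>, of A] set_integral_tv_density[OF \<mu>, of A] by (simp add: divide_simps)
  qed auto
  then show ?thesis by simp
qed

section \<open>Radon measures and regular measures\<close>

text \<open>Simple functions below \<open>f\<close> are the same for both measures, and each has the
  smaller integral for \<open>M\<close>.\<close>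

lemma nn_integral_mono_measures:
  assumes sets: "sets M = sets N" and le: "\<And>A. A \<in> sets M \<Longrightarrow> emeasure M A \<le> emeasure N A"
  shows "(\<integral>\<^sup>+x. f x \<partial>M) \<le> (\<integral>\<^sup>+x. f x \<partial>N)"
  unfolding nn_integral_def
proof (rule SUP_mono)
  fix g assume g: "g \<in> {g. simple_function M g \<and> g \<le> f}"
  have sp: "space M = space N" by (rule sets_eq_imp_space_eq[OF sets])
  have "simple_function N g" using g by (simp add: simple_function_cong_algebra[OF sets sp])
  moreover have "simple_integral M g \<le> simple_integral N g"
    unfolding simple_integral_def sp[symmetric]
    using g by (intro sum_mono mult_left_mono le) (auto dest: simple_functionD)
  ultimately show "\<exists>h\<in>{g. simple_function N g \<and> g \<le> f}. simple_integral M g \<le> simple_integral N h"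
    using g by auto
qed

lemma integrable_mono_measures:
  fixes f :: "'a \<Rightarrow> 'f::{banach,second_countable_topology}"
  assumes sets: "sets M = sets N" and le: "\<And>A. A \<in> sets M \<Longrightarrow> emeasure M A \<le> emeasure N A"
    and f: "integrable N f"
  shows "integrable M f" "(LINT x|M. norm (f x)) \<le> (LINT x|N. norm (f x))"
proof -
  have m: "f \<in> borel_measurable M"
    using borel_measurable_integrable[OF f] by (simp add: measurable_cong_sets[OF sets refl])
  have nn: "(\<integral>\<^sup>+x. norm (f x) \<partial>M) \<le> (\<integral>\<^sup>+x. norm (f x) \<partial>N)"
    by (rule nn_integral_mono_measures[OF sets le])
  then show M: "integrable M f" using f m by (auto simp: integrable_iff_bounded intro: le_less_trans)
  have "ennreal (LINT x|M. norm (f x)) \<le> ennreal (LINT x|N. norm (f x))"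
    using nn M f by (subst (1 2) nn_integral_eq_integral[symmetric]) auto
  then show "(LINT x|M. norm (f x)) \<le> (LINT x|N. norm (f x))" by (simp add: ennreal_le_iff)
qed

text \<open>Finite Radon measures. As the measure is finite, approximation from inside can be stated
  as a small difference; complements then give outer regularity in Hausdorff spaces, where compact
  sets are closed.\<close>

definition radon :: "'a::topological_space measure \<Rightarrow> bool" where
  "radon N \<longleftrightarrow> finite_measure N \<and> sets N = sets borel \<and>
     (\<forall>A\<in>sets borel. \<forall>e>0. \<exists>K. compact K \<and> K \<subseteq> A \<and> measure N (A - K) < e)"

lemma radonD:
  assumes "radon N" shows "finite_measure N" "sets N = sets borel" "space N = UNIV"
  using assms sets_eq_imp_space_eq[of N borel] by (auto simp: radon_def)

lemma radon_compactE:
  assumes "radon N" "A \<in> sets borel" "0 < e"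
  obtains K where "compact K" "K \<subseteq> A" "measure N (A - K) < e"
  using assms unfolding radon_def by blast

lemma regular_measures_iff:
  fixes \<mu> :: "'a::t2_space set \<Rightarrow> 'f::{real_normed_field,euclidean_space}"
  shows "\<mu> \<in> regular_measures \<longleftrightarrow> vector_measure \<mu> \<and> radon (tv \<mu>)"
proof -
  have "(\<forall>A\<in>sets borel.
        emeasure (tv \<mu>) A = (INF U\<in>{U. open U \<and> A \<subseteq> U}. emeasure (tv \<mu>) U) \<and>
        emeasure (tv \<mu>) A = (SUP K\<in>{K. compact K \<and> K \<subseteq> A}. emeasure (tv \<mu>) K)) \<longleftrightarrow> radon (tv \<mu>)" (is "?L = _")
    if \<mu>: "vector_measure \<mu>"
  proof
    interpret finite_measure "tv \<mu>" by (rule finite_measure_tv[OF \<mu>])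
    assume L: ?L
    show "radon (tv \<mu>)" unfolding radon_def
    proof (intro conjI ballI allI impI)
      fix A :: "'a set" and e :: real assume A: "A \<in> sets borel" "0 < e"
      show "\<exists>K. compact K \<and> K \<subseteq> A \<and> measure (tv \<mu>) (A - K) < e"
      proof (cases "measure (tv \<mu>) A < e")
        case True then show ?thesis by (intro exI[of _ "{}"]) auto
      next
        case False
        have "ennreal (measure (tv \<mu>) A - e) < emeasure (tv \<mu>) A"
          using A False by (simp add: emeasure_eq_measure ennreal_less_iff)
        also have "\<dots> = (SUP K\<in>{K. compact K \<and> K \<subseteq> A}. emeasure (tv \<mu>) K)" using L A by blast
        finally obtain K where K: "compact K" "K \<subseteq> A" "ennreal (measure (tv \<mu>) A - e) < emeasure (tv \<mu>) K"
          unfolding less_SUP_iff by auto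
        have "measure (tv \<mu>) A - e < measure (tv \<mu>) K"
          using K(3) False by (simp add: emeasure_eq_measure ennreal_less_iff)
        moreover have "measure (tv \<mu>) (A - K) = measure (tv \<mu>) A - measure (tv \<mu>) K"
          using A K by (intro finite_measure_Diff) (auto intro: borel_compact)
        ultimately show ?thesis using K by (intro exI[of _ K]) auto
      qed
    qed (use finite_measure_axioms in auto)
  next
    assume R: "radon (tv \<mu>)"
    interpret finite_measure "tv \<mu>" by (rule finite_measure_tv[OF \<mu>])
    show ?L
    proof (intro ballI conjI antisym)
      fix A :: "'a set" assume A: "A \<in> sets borel"
      show "emeasure (tv \<mu>) A \<le> (INF U\<in>{U. open U \<and> A \<subseteq> U}. emeasure (tv \<mu>) U)"
        by (intro INF_greatest emeasure_mono) auto
      show "(SUP K\<in>{K. compact K \<and> K \<subseteq> A}. emeasure (tv \<mu>) K) \<le> emeasure (tv \<mu>) A"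
        using A by (intro SUP_least emeasure_mono) auto
      show "emeasure (tv \<mu>) A \<le> (SUP K\<in>{K. compact K \<and> K \<subseteq> A}. emeasure (tv \<mu>) K)"
      proof (rule ennreal_le_epsilon)
        fix e :: real assume "0 < e"
        then obtain K where K: "compact K" "K \<subseteq> A" "measure (tv \<mu>) (A - K) < e"
          using radon_compactE[OF R A] by metis
        have "emeasure (tv \<mu>) A = emeasure (tv \<mu>) K + emeasure (tv \<mu>) (A - K)"
          using A K by (subst plus_emeasure) (auto simp: Un_absorb1 intro: borel_compact)
        also have "\<dots> \<le> (SUP K\<in>{K. compact K \<and> K \<subseteq> A}. emeasure (tv \<mu>) K) + e"
          using K by (intro add_mono SUP_upper) (auto simp: emeasure_eq_measure intro: ennreal_leI)
        finally show "emeasure (tv \<mu>) A \<le> (SUP K\<in>{K. compact K \<and> K \<subseteq> A}. emeasure (tv \<mu>) K) + e" .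
      qed
      show "(INF U\<in>{U. open U \<and> A \<subseteq> U}. emeasure (tv \<mu>) U) \<le> emeasure (tv \<mu>) A"
      proof (rule ennreal_le_epsilon)
        fix e :: real assume "0 < e"
        \<comment> \<open>The complement of a compact subset of \<open>- A\<close> is an open set
          around \<open>A\<close>, so outer regularity of \<open>A\<close> is inner regularity of
          its complement.\<close>
        then obtain K where K: "compact K" "K \<subseteq> - A" "measure (tv \<mu>) (- A - K) < e"
          using radon_compactE[OF R, of "- A"] A by (metis borel_comp)
        have "(INF U\<in>{U. open U \<and> A \<subseteq> U}. emeasure (tv \<mu>) U) \<le> emeasure (tv \<mu>) (- K)"
          using K by (intro INF_lower) (auto intro: compact_imp_closed)
        also have "\<dots> = emeasure (tv \<mu>) (A \<union> (- A - K))"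
          using K by (intro arg_cong[where f="emeasure _"]) auto
        also have "\<dots> \<le> emeasure (tv \<mu>) A + emeasure (tv \<mu>) (- A - K)"
          using A K by (intro emeasure_subadditive) (auto intro: borel_compact)
        also have "\<dots> \<le> emeasure (tv \<mu>) A + e"
          using K by (intro add_mono) (auto simp: emeasure_eq_measure intro: ennreal_leI)
        finally show "(INF U\<in>{U. open U \<and> A \<subseteq> U}. emeasure (tv \<mu>) U) \<le> emeasure (tv \<mu>) A + e" .
      qed
    qed
  qed
  then show ?thesis unfolding regular_measures_def vector_measure_def by blast
qed

lemma regular_measuresD:
  fixes \<mu> :: "'a::t2_space set \<Rightarrow> 'f::{real_normed_field,euclidean_space}"
  assumes "\<mu> \<in> regular_measures" shows "vector_measure \<mu>" "radon (tv \<mu>)"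
  using assms by (auto simp: regular_measures_iff)

lemma radon_le:
  fixes M N :: "'a::t2_space measure"
  assumes N: "radon N" and M: "sets M = sets borel" and le: "\<And>A. A \<in> sets borel \<Longrightarrow> emeasure M A \<le> emeasure N A"
  shows "radon M"
proof -
  interpret N: finite_measure N by (rule radonD[OF N])
  have sp: "space M = UNIV" using sets_eq_imp_space_eq[OF M] by simp
  interpret M: finite_measure M
    using le[of UNIV] N.emeasure_finite[of UNIV] by (intro finite_measureI) (auto simp: sp top_unique)
  show ?thesis unfolding radon_def
  proof (intro conjI ballI allI impI M M.finite_measure_axioms)
    fix A :: "'a set" and e :: real assume A: "A \<in> sets borel" "0 < e"
    then obtain K where K: "compact K" "K \<subseteq> A" "measure N (A - K) < e"
      using radon_compactE[OF N] by metis
    have "A - K \<in> sets borel" using A K by (auto intro: borel_compact)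
    from le[OF this] have "measure M (A - K) \<le> measure N (A - K)"
      by (simp add: M.emeasure_eq_measure N.emeasure_eq_measure)
    then show "\<exists>K. compact K \<and> K \<subseteq> A \<and> measure M (A - K) < e" using K by (intro exI[of _ K]) auto
  qed
qed

lemma regular_measuresI:
  fixes \<mu> :: "'a::t2_space set \<Rightarrow> 'f::{real_normed_field,euclidean_space}"
  assumes "vector_measure \<mu>" "radon N" "\<And>A. A \<in> sets borel \<Longrightarrow> ennreal (norm (\<mu> A)) \<le> emeasure N A"
  shows "\<mu> \<in> regular_measures"
  unfolding regular_measures_iff
  using assms radon_le[OF assms(2)] emeasure_tv_le[OF assms(1,3)] radonD[OF assms(2)] by auto

text \<open>A compact set that fills most of the preimage of \<open>A\<close> has a compact image
  inside \<open>A\<close>, and the preimage of that image is at least as large.\<close>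

lemma radon_distr:
  fixes Q :: "'a::t2_space measure" and \<phi> :: "'a \<Rightarrow> 'b::t2_space"
  assumes Q: "radon Q" and \<phi>: "continuous_on UNIV \<phi>"
  shows "radon (distr Q borel \<phi>)"
proof -
  interpret finite_measure Q by (rule radonD[OF Q])
  have m: "\<phi> \<in> measurable Q borel"
    using borel_measurable_continuous_onI[OF \<phi>] by (simp add: measurable_cong_sets[OF radonD(2)[OF Q] refl])
  show ?thesis unfolding radon_def
  proof (intro conjI ballI allI impI)
    show "finite_measure (distr Q borel \<phi>)" by (rule finite_measure_distr[OF m])
    fix A :: "'b set" and e :: real assume A: "A \<in> sets borel" "0 < e"
    have "\<phi> -` A \<in> sets borel" using measurable_sets[OF m A(1)] radonD[OF Q] by simp
    then obtain K where K: "compact K" "K \<subseteq> \<phi> -` A" "measure Q (\<phi> -` A - K) < e"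
      using radon_compactE[OF Q _ A(2)] by metis
    have c: "compact (\<phi> ` K)" using \<phi> K by (meson compact_continuous_image continuous_on_subset subset_UNIV)
    have "measure (distr Q borel \<phi>) (A - \<phi> ` K) = measure Q (\<phi> -` (A - \<phi> ` K) \<inter> space Q)"
      using A c by (intro measure_distr m) (auto intro: borel_compact)
    also have "\<dots> \<le> measure Q (\<phi> -` A - K)"
      using K radonD[OF Q] \<open>\<phi> -` A \<in> sets borel\<close> by (intro finite_measure_mono) (auto intro: borel_compact)
    finally show "\<exists>K. compact K \<and> K \<subseteq> A \<and> measure (distr Q borel \<phi>) (A - K) < e"
      using K c by (intro exI[of _ "\<phi> ` K"]) auto
  qed simp
qed

text \<open>The sets squeezed between a closed and an open set with small difference form a
  sigma-algebra, to which open sets belong by hypothesis. The closed set found for \<open>A\<close>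
  is made compact by intersecting it with a compact set that carries almost all of
  \<open>N\<close>.\<close>

lemma radon_openI:
  fixes N :: "'a::t2_space measure"
  assumes fin: "finite_measure N" and N: "sets N = sets borel"
    and inner: "\<And>U e. open U \<Longrightarrow> 0 < e \<Longrightarrow> \<exists>K. compact K \<and> K \<subseteq> U \<and> measure N (U - K) < e"
  shows "radon N"
proof -
  interpret finite_measure N by fact
  have app: "\<forall>e>0. \<exists>F U. closed F \<and> open U \<and> F \<subseteq> A \<and> A \<subseteq> U \<and> measure N (U - F) < e"
    if "A \<in> sigma_sets UNIV {U. open U}" for A
    using that
  proof induction
    case (Basic A)
    show ?case
    proof (intro allI impI)
      fix e :: real assume "0 < e"
      then obtain K where "compact K" "K \<subseteq> A" "measure N (A - K) < e" using inner[of A e] Basic by auto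
      with Basic show "\<exists>F U. closed F \<and> open U \<and> F \<subseteq> A \<and> A \<subseteq> U \<and> measure N (U - F) < e"
        by (intro exI[of _ K] exI[of _ A]) (auto intro: compact_imp_closed)
    qed
  next
    case Empty show ?case by (auto intro!: exI[of _ "{}"])
  next
    case (Compl A)
    show ?case
    proof (intro allI impI)
      fix e :: real assume "0 < e"
      then obtain F U where FU: "closed F" "open U" "F \<subseteq> A" "A \<subseteq> U" "measure N (U - F) < e"
        using Compl.IH by metis
      then have "closed (- U)" "open (- F)" "- U \<subseteq> UNIV - A" "UNIV - A \<subseteq> - F" by auto
      moreover have "- F - (- U) = U - F" by auto
      then have "measure N (- F - (- U)) < e" using FU(5) by metis
      ultimately show "\<exists>F U. closed F \<and> open U \<and> F \<subseteq> UNIV - A \<and> UNIV - A \<subseteq> U \<and> measure N (U - F) < e"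
        by blast
    qed
  next
    case (Union A)
    show ?case
    proof (intro allI impI)
      fix e :: real assume e: "0 < e"
      \<comment> \<open>These errors sum to e/2. The other half is spent on replacing the union of
        the closed sets \<open>F i\<close>, which need not be closed, by a finite one.\<close>
      have "\<exists>F U. closed F \<and> open U \<and> F \<subseteq> A i \<and> A i \<subseteq> U \<and> measure N (U - F) < e / 4 * (1/2)^i" for i :: nat
        by (intro Union.IH[rule_format]) (use e in auto)
      then obtain F U where FU: "\<And>i. closed (F i)" "\<And>i. open (U i)" "\<And>i. F i \<subseteq> A i" "\<And>i. A i \<subseteq> U i"
          "\<And>i. measure N (U i - F i) < e / 4 * (1/2)^i" by metis
      have b: "F i \<in> sets N" "U i \<in> sets N" for i using FU N by auto
      have "measure N (\<Union>i. U i - F i) \<le> (\<Sum>i. measure N (U i - F i))"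
      proof (intro finite_measure_subadditive_countably)
        show "summable (\<lambda>i. measure N (U i - F i))"
          by (rule summable_comparison_test[of _ "\<lambda>i. e / 4 * (1/2)^i"])
            (use FU(5) in \<open>auto intro!: exI[of _ 0] summable_geometric summable_mult simp: less_imp_le\<close>)
      qed (use b in auto)
      also have "\<dots> \<le> (\<Sum>i. e / 4 * (1/2)^i)"
        by (intro suminf_le summable_comparison_test[of "\<lambda>i. measure N (U i - F i)" "\<lambda>i. e / 4 * (1/2)^i"])
            (use FU(5) in \<open>auto intro!: exI[of _ 0] summable_geometric summable_mult simp: less_imp_le\<close>)
      also have "\<dots> = e / 2" by (subst suminf_mult) (auto simp: suminf_geometric summable_geometric)
      finally have 1: "measure N (\<Union>i. U i - F i) \<le> e / 2" .
      have "(\<lambda>n. measure N (\<Union>i<n. F i)) \<longlonglongrightarrow> measure N (\<Union>n. \<Union>i<n. F i)"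
        using b by (intro finite_Lim_measure_incseq) (auto simp: incseq_def image_subset_iff intro!: UN_mono, fastforce)
      then obtain n where n: "\<bar>measure N (\<Union>i<n. F i) - measure N (\<Union>n. \<Union>i<n. F i)\<bar> < e / 2"
        using e by (metis LIMSEQ_D half_gt_zero le_refl real_norm_def)
      have UN: "(\<Union>n. \<Union>i<n. F i) = (\<Union>i. F i)" by auto
      have "measure N ((\<Union>i. F i) - (\<Union>i<n. F i)) = measure N (\<Union>i. F i) - measure N (\<Union>i<n. F i)"
        using b by (intro finite_measure_Diff) auto
      then have 2: "measure N ((\<Union>i. F i) - (\<Union>i<n. F i)) < e / 2"
        using n unfolding UN by linarith
      have "measure N ((\<Union>i. U i) - (\<Union>i<n. F i)) \<le> measure N ((\<Union>i. U i - F i) \<union> ((\<Union>i. F i) - (\<Union>i<n. F i)))"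
        using b by (intro finite_measure_mono) auto
      also have "\<dots> \<le> measure N (\<Union>i. U i - F i) + measure N ((\<Union>i. F i) - (\<Union>i<n. F i))"
        using b by (intro measure_Un_le) auto
      also have "\<dots> < e" using 1 2 by simp
      finally show "\<exists>F U. closed F \<and> open U \<and> F \<subseteq> (\<Union>i. A i) \<and> (\<Union>i. A i) \<subseteq> U \<and> measure N (U - F) < e"
      proof (intro exI conjI)
        show "closed (\<Union>i<n. F i)" "open (\<Union>i. U i)" using FU by (auto intro!: closed_UN open_UN)
        show "(\<Union>i<n. F i) \<subseteq> (\<Union>i. A i)" using FU(3) by blast
        show "(\<Union>i. A i) \<subseteq> (\<Union>i. U i)" using FU(4) by blast
      qed
    qed
  qed
  show ?thesis unfolding radon_def
  proof (intro conjI ballI allI impI fin N)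
    fix A :: "'a set" and e :: real assume A: "A \<in> sets borel" "0 < e"
    then have "A \<in> sigma_sets UNIV {U. open U}" by (simp add: borel_def)
    then obtain F U where F: "closed F" "open U" "F \<subseteq> A" "A \<subseteq> U" "measure N (U - F) < e / 2"
      using app[rule_format, OF _ half_gt_zero[OF A(2)]] by metis
    obtain K where K: "compact K" "measure N (UNIV - K) < e / 2"
      using inner[OF open_UNIV half_gt_zero[OF A(2)]] by auto
    have b: "F \<in> sets N" "U \<in> sets N" "K \<in> sets N" using F K N by (auto intro: borel_compact)
    have "measure N (A - F \<inter> K) \<le> measure N ((U - F) \<union> (UNIV - K))"
      using F b N by (intro finite_measure_mono) (auto)
    also have "\<dots> \<le> measure N (U - F) + measure N (UNIV - K)"
      using b N by (intro measure_Un_le) auto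
    also have "\<dots> < e" using F K by simp
    finally show "\<exists>K. compact K \<and> K \<subseteq> A \<and> measure N (A - K) < e"
      using F K by (intro exI[of _ "F \<inter> K"]) (auto intro: closed_Int_compact)
  qed
qed

section \<open>Integrals against a vector measure\<close>

text \<open>Densities of different measures, each chosen by \<open>tv_density\<close>, cannot be
  compared pointwise; integrals are compared as functionals instead. Scalars enter through the
  vectors \<open>c\<close> in the functions \<open>indicator A x *\<^sub>R c\<close> on which two
  functionals are compared below.\<close>

definition L1_functional :: "'a measure \<Rightarrow> (('a \<Rightarrow> 'f::{banach,second_countable_topology}) \<Rightarrow> 'g::real_normed_vector) \<Rightarrow> bool" where
  "L1_functional R L \<longleftrightarrow>
     (\<forall>f g. integrable R f \<longrightarrow> integrable R g \<longrightarrow> L (\<lambda>x. f x + g x) = L f + L g) \<and>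
     (\<exists>C. \<forall>f. integrable R f \<longrightarrow> norm (L f) \<le> C * (LINT x|R. norm (f x)))"

lemma L1_functionalI:
  assumes "\<And>f g. integrable R f \<Longrightarrow> integrable R g \<Longrightarrow> L (\<lambda>x. f x + g x) = L f + L g"
    and "\<And>f. integrable R f \<Longrightarrow> norm (L f) \<le> C * (LINT x|R. norm (f x))"
  shows "L1_functional R L"
  using assms unfolding L1_functional_def by blast

lemma L1_functional_plus:
  "L1_functional R L \<Longrightarrow> integrable R f \<Longrightarrow> integrable R g \<Longrightarrow> L (\<lambda>x. f x + g x) = L f + L g"
  by (simp add: L1_functional_def)

lemma L1_functional_bound:
  assumes "L1_functional R L"
  obtains C where "0 \<le> C" "\<And>f. integrable R f \<Longrightarrow> norm (L f) \<le> C * (LINT x|R. norm (f x))"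
proof -
  from assms obtain C where C: "\<And>f. integrable R f \<Longrightarrow> norm (L f) \<le> C * (LINT x|R. norm (f x))"
    unfolding L1_functional_def by blast
  have "norm (L f) \<le> max C 0 * (LINT x|R. norm (f x))" if "integrable R f" for f
    by (rule order_trans[OF C[OF that]]) (intro mult_right_mono, auto)
  then show ?thesis by (intro that[of "max C 0"]) auto
qed

lemma L1_functional_tendsto:
  assumes L: "L1_functional R L" and f: "integrable R f" "\<And>i. integrable R (s i)"
    and s: "(\<lambda>i. LINT x|R. norm (s i x - f x)) \<longlonglongrightarrow> 0"
  shows "(\<lambda>i. L (s i)) \<longlonglongrightarrow> L f"
proof -
  obtain C where C: "\<And>f. integrable R f \<Longrightarrow> norm (L f) \<le> C * (LINT x|R. norm (f x))"
    using L1_functional_bound[OF L] by blast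
  have eq: "L (s i) - L f = L (\<lambda>x. s i x - f x)" for i
  proof -
    have "L (\<lambda>x. (s i x - f x) + f x) = L (\<lambda>x. s i x - f x) + L f"
      using f by (intro L1_functional_plus[OF L]) auto
    then show ?thesis by simp
  qed
  have "(\<lambda>i. L (s i) - L f) \<longlonglongrightarrow> 0"
  proof (rule Lim_null_comparison)
    show "\<forall>\<^sub>F i in sequentially. norm (L (s i) - L f) \<le> C * (LINT x|R. norm (s i x - f x))"
      unfolding eq using f by (intro always_eventually allI C) auto
    show "(\<lambda>i. C * (LINT x|R. norm (s i x - f x))) \<longlonglongrightarrow> 0"
      using tendsto_mult_right_zero[OF s] .
  qed
  then show ?thesis by (simp add: LIM_zero_iff)
qed

text \<open>Induction over integrable functions; in the limit case the L1-bound makes both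
  functionals continuous along the dominated sequence.\<close>

lemma L1_functional_eqI:
  assumes L: "L1_functional R L1" "L1_functional R L2"
    and ind: "\<And>A c. A \<in> sets R \<Longrightarrow> emeasure R A < \<infinity> \<Longrightarrow>
      L1 (\<lambda>x. indicator A x *\<^sub>R c) = L2 (\<lambda>x. indicator A x *\<^sub>R c)"
    and f: "integrable R f"
  shows "L1 f = L2 f"
  using f
proof induction
  case (base A c) then show ?case by (rule ind)
next
  case (add f g)
  then show ?case by (simp add: L1_functional_plus[OF L(1)] L1_functional_plus[OF L(2)])
next
  case (lim f s)
  have "(\<lambda>i. LINT x|R. norm (s i x - f x)) \<longlonglongrightarrow> (LINT x|R. 0)"
  \<comment> \<open>The approximants satisfy norm (s i x) \<le> 2 * norm (f x), hence the factor 3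
    for the difference.\<close>
  proof (rule integral_dominated_convergence[where w="\<lambda>x. 3 * norm (f x)"])
    show "AE x in R. (\<lambda>i. norm (s i x - f x)) \<longlonglongrightarrow> 0"
      by (intro AE_I2 tendsto_norm_zero LIM_zero) (use lim in auto)
    show "AE x in R. norm (norm (s i x - f x)) \<le> 3 * norm (f x)" for i
    proof (rule AE_I2)
      fix x assume "x \<in> space R"
      then have "norm (s i x) \<le> 2 * norm (f x)" using lim by auto
      with norm_triangle_ineq4[of "s i x" "f x"]
      show "norm (norm (s i x - f x)) \<le> 3 * norm (f x)" by auto
    qed
  qed (use lim in auto)
  then have c: "(\<lambda>i. LINT x|R. norm (s i x - f x)) \<longlonglongrightarrow> 0" by simp
  have "(\<lambda>i. L1 (s i)) \<longlonglongrightarrow> L1 f" "(\<lambda>i. L2 (s i)) \<longlonglongrightarrow> L2 f"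
    using lim by (intro L1_functional_tendsto[OF _ _ _ c] L; simp)+
  moreover have "L1 (s i) = L2 (s i)" for i using lim by auto
  ultimately show ?case using LIMSEQ_unique by auto
qed

lemma L1_functional_add:
  fixes L1 L2 :: "('a \<Rightarrow> 'f::{banach,second_countable_topology}) \<Rightarrow> 'g::real_normed_vector"
  assumes "L1_functional R L1" "L1_functional R L2"
  shows "L1_functional R (\<lambda>f. L1 f + L2 f)"
proof -
  from L1_functional_bound[OF assms(1)] obtain C where C: "\<And>f. integrable R f \<Longrightarrow> norm (L1 f) \<le> C * (LINT x|R. norm (f x))" by metis
  from L1_functional_bound[OF assms(2)] obtain D where D: "\<And>f. integrable R f \<Longrightarrow> norm (L2 f) \<le> D * (LINT x|R. norm (f x))" by metis
  show ?thesis
  proof (rule L1_functionalI[where C="C + D"])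
    fix f :: "'a \<Rightarrow> 'f" assume "integrable R f"
    from C[OF this] D[OF this] show "norm (L1 f + L2 f) \<le> (C + D) * (LINT x|R. norm (f x))"
      using norm_triangle_ineq[of "L1 f" "L2 f"] by (simp add: distrib_right)
  next
    fix f g :: "'a \<Rightarrow> 'f" assume "integrable R f" "integrable R g"
    then show "L1 (\<lambda>x. f x + g x) + L2 (\<lambda>x. f x + g x) = L1 f + L2 f + (L1 g + L2 g)"
      by (simp add: L1_functional_plus[OF assms(1)] L1_functional_plus[OF assms(2)])
  qed
qed

lemma L1_functional_compose:
  fixes L :: "('a \<Rightarrow> 'f::{banach,second_countable_topology}) \<Rightarrow> 'g::real_normed_vector"
  assumes T: "bounded_linear T" and L: "L1_functional R L"
  shows "L1_functional R (\<lambda>f. T (L f))"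
proof -
  from L1_functional_bound[OF L] obtain C where C: "0 \<le> C" "\<And>f. integrable R f \<Longrightarrow> norm (L f) \<le> C * (LINT x|R. norm (f x))" by metis
  from bounded_linear.nonneg_bounded[OF T] obtain K where K: "0 \<le> K" "\<And>x. norm (T x) \<le> norm x * K" by metis
  show ?thesis
  proof (rule L1_functionalI[where C="C * K"])
    fix f :: "'a \<Rightarrow> 'f" assume "integrable R f"
    from mult_right_mono[OF C(2)[OF this] K(1)] K(2)[of "L f"]
    show "norm (T (L f)) \<le> C * K * (LINT x|R. norm (f x))" by (simp add: ac_simps)
  next
    fix f g :: "'a \<Rightarrow> 'f" assume "integrable R f" "integrable R g"
    then show "T (L (\<lambda>x. f x + g x)) = T (L f) + T (L g)"
      by (simp add: L1_functional_plus[OF L] linear_add[OF bounded_linear.linear[OF T]])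
  qed
qed

text \<open>Meant for real and imaginary parts of the integrand, which are integrated against real
  measures.\<close>

lemma L1_functional_precompose:
  fixes T :: "'f::{banach,second_countable_topology} \<Rightarrow> 'g::{banach,second_countable_topology}" and R :: "'a measure"
  assumes T: "bounded_linear T" and L: "L1_functional R L"
  shows "L1_functional R (\<lambda>f. L (\<lambda>x. T (f x)))"
proof -
  from L1_functional_bound[OF L] obtain C where C: "0 \<le> C" "\<And>f. integrable R f \<Longrightarrow> norm (L f) \<le> C * (LINT x|R. norm (f x))" by metis
  from bounded_linear.nonneg_bounded[OF T] obtain K where K: "0 \<le> K" "\<And>x. norm (T x) \<le> norm x * K" by metis
  show ?thesis
  proof (rule L1_functionalI[where C="C * K"])
    fix f :: "'a \<Rightarrow> 'f" assume f: "integrable R f"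
    then have Tf: "integrable R (\<lambda>x. T (f x))" by (rule integrable_bounded_linear[OF T])
    have "(LINT x|R. norm (T (f x))) \<le> (LINT x|R. norm (f x) * K)"
      using K f Tf by (intro integral_mono) auto
    then have "C * (LINT x|R. norm (T (f x))) \<le> C * (K * (LINT x|R. norm (f x)))"
      using C by (intro mult_left_mono) (auto simp: ac_simps)
    then show "norm (L (\<lambda>x. T (f x))) \<le> C * K * (LINT x|R. norm (f x))"
      using C(2)[OF Tf] by (simp add: ac_simps)
  next
    fix f g :: "'a \<Rightarrow> 'f" assume "integrable R f" "integrable R g"
    then have "integrable R (\<lambda>x. T (f x))" "integrable R (\<lambda>x. T (g x))" by (auto intro: integrable_bounded_linear[OF T])
    then show "L (\<lambda>x. T (f x + g x)) = L (\<lambda>x. T (f x)) + L (\<lambda>x. T (g x))"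
      by (simp add: L1_functional_plus[OF L] linear_add[OF bounded_linear.linear[OF T]])
  qed
qed

lemma integrable_mult_bounded:
  fixes f H :: "'a \<Rightarrow> 'f::{real_normed_field,banach,second_countable_topology}"
  assumes f: "integrable Q f" and H: "H \<in> borel_measurable Q" "AE z in Q. norm (H z) \<le> 1"
  shows "integrable Q (\<lambda>z. f z * H z)" "norm (LINT z|Q. f z * H z) \<le> (LINT z|Q. norm (f z))"
proof -
  have ae: "AE z in Q. norm (f z * H z) \<le> norm (f z)"
    using H(2) by (auto elim!: eventually_mono simp: norm_mult intro!: mult_left_le)
  show 1: "integrable Q (\<lambda>z. f z * H z)"
    using f H ae by (intro Bochner_Integration.integrable_bound[OF f]) auto
  show "norm (LINT z|Q. f z * H z) \<le> (LINT z|Q. norm (f z))"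
    by (rule order_trans[OF integral_norm_bound integral_mono_AE]) (use 1 f ae in auto)
qed

lemma
  fixes \<mu> :: "'a::topological_space set \<Rightarrow> 'f::{real_normed_field,euclidean_space}"
  assumes \<mu>: "vector_measure \<mu>" and f: "integrable (tv \<mu>) f"
  shows integrable_tv_density_mult: "integrable (tv \<mu>) (\<lambda>x. f x * tv_density \<mu> x)"
    and norm_vm_integral_le: "norm (vm_integral \<mu> f) \<le> (LINT x|tv \<mu>. norm (f x))"
  using integrable_mult_bounded[OF f borel_measurable_integrable[OF integrable_tv_density[OF \<mu>]] norm_tv_density_le[OF \<mu>]]
  by (auto simp: vm_integral_def)

lemma vm_integral_cong_AE:
  fixes \<mu> :: "'a::topological_space set \<Rightarrow> 'f::{real_normed_field,euclidean_space}"
  assumes \<mu>: "vector_measure \<mu>" and "f \<in> borel_measurable borel" "g \<in> borel_measurable borel"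
    "AE x in tv \<mu>. f x = g x"
  shows "vm_integral \<mu> f = vm_integral \<mu> g"
  unfolding vm_integral_def
  using borel_measurable_integrable[OF integrable_tv_density[OF \<mu>]] assms
  by (intro integral_cong_AE) (auto elim!: eventually_mono)

lemma vm_integral_indicator:
  fixes \<mu> :: "'a::topological_space set \<Rightarrow> 'f::{real_normed_field,euclidean_space}"
  assumes \<mu>: "vector_measure \<mu>" and A: "A \<in> sets borel"
  shows "vm_integral \<mu> (\<lambda>x. indicator A x *\<^sub>R c) = c * \<mu> A"
proof -
  have "vm_integral \<mu> (\<lambda>x. indicator A x *\<^sub>R c) = (LINT x|tv \<mu>. c * (indicator A x *\<^sub>R tv_density \<mu> x))"
    unfolding vm_integral_def by (intro Bochner_Integration.integral_cong) auto
  also have "\<dots> = c * (LINT x|tv \<mu>. indicator A x *\<^sub>R tv_density \<mu> x)"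
    by (rule integral_mult_right_zero)
  also have "\<dots> = c * \<mu> A"
    using set_integral_tv_density[OF \<mu> A] by (simp add: set_lebesgue_integral_def)
  finally show ?thesis .
qed

text \<open>The dominating measure \<open>R\<close> is left free, so that integrals against
  different measures become functionals on one common L1-space.\<close>

lemma vm_integral_functional:
  fixes \<mu> :: "'a::topological_space set \<Rightarrow> 'f::{real_normed_field,euclidean_space}"
  assumes \<mu>: "vector_measure \<mu>" and R: "sets R = sets borel" "\<And>A. A \<in> sets borel \<Longrightarrow> emeasure (tv \<mu>) A \<le> emeasure R A"
  shows "L1_functional R (vm_integral \<mu>)"
proof (rule L1_functionalI[where C=1])
  have tv: "integrable (tv \<mu>) f" "(LINT x|tv \<mu>. norm (f x)) \<le> (LINT x|R. norm (f x))" if "integrable R f" for f :: "'a \<Rightarrow> 'f"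
    using integrable_mono_measures[OF _ _ that, of "tv \<mu>"] R by auto
  fix f :: "'a \<Rightarrow> 'f" assume f: "integrable R f"
  show "norm (vm_integral \<mu> f) \<le> 1 * (LINT x|R. norm (f x))"
    using norm_vm_integral_le[OF \<mu>] tv[OF f] by fastforce
  fix g :: "'a \<Rightarrow> 'f" assume g: "integrable R g"
  show "vm_integral \<mu> (\<lambda>x. f x + g x) = vm_integral \<mu> f + vm_integral \<mu> g"
    using integrable_tv_density_mult[OF \<mu>] tv[OF f] tv[OF g] by (simp add: vm_integral_def distrib_right)
qed

lemma vm_integral_add_measure:
  fixes \<mu> \<nu> :: "'a::topological_space set \<Rightarrow> 'f::{real_normed_field,euclidean_space}"
  assumes \<mu>: "vector_measure \<mu>" and \<nu>: "vector_measure \<nu>" and R: "sets R = sets borel"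
    and le: "\<And>A. A \<in> sets borel \<Longrightarrow> emeasure (tv \<mu>) A + emeasure (tv \<nu>) A \<le> emeasure R A"
    and f: "integrable R f"
  shows "vm_integral (\<lambda>A. \<mu> A + \<nu> A) f = vm_integral \<mu> f + vm_integral \<nu> f"
proof -
  have s: "vector_measure (\<lambda>A. \<mu> A + \<nu> A)" by (intro vector_measure_add \<mu> \<nu>)
  have "emeasure (tv \<mu>) A \<le> emeasure R A" "emeasure (tv \<nu>) A \<le> emeasure R A" if "A \<in> sets borel" for A
    using le[OF that] by (meson add_increasing2 add_increasing order_trans zero_le order_refl)+
  moreover have "emeasure (tv (\<lambda>A. \<mu> A + \<nu> A)) A \<le> emeasure R A" for A
  proof (rule emeasure_tv_le[OF s _ R])
    fix A :: "'a set" assume A: "A \<in> sets borel"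
    have "ennreal (norm (\<mu> A + \<nu> A)) \<le> ennreal (norm (\<mu> A)) + ennreal (norm (\<nu> A))"
      by (simp add: ennreal_plus[symmetric] norm_triangle_ineq del: ennreal_plus)
    also have "\<dots> \<le> emeasure (tv \<mu>) A + emeasure (tv \<nu>) A"
      using A norm_le_variation[OF \<mu> A] norm_le_variation[OF \<nu> A] by (intro add_mono) (auto simp: emeasure_tv \<mu> \<nu>)
    finally show "ennreal (norm (\<mu> A + \<nu> A)) \<le> emeasure R A" using le[OF A] by simp
  qed
  ultimately show ?thesis
    using R by (intro L1_functional_eqI[OF vm_integral_functional[OF s] L1_functional_add[OF vm_integral_functional[OF \<mu>] vm_integral_functional[OF \<nu>]] _ f])
      (auto simp: vm_integral_indicator \<mu> \<nu> s distrib_left)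
qed

lemma emeasure_tv_mult:
  fixes \<mu> :: "'a::topological_space set \<Rightarrow> 'f::{real_normed_field,euclidean_space}"
  assumes \<mu>: "vector_measure \<mu>" and A: "A \<in> sets borel"
  shows "emeasure (tv (\<lambda>A. c * \<mu> A)) A = ennreal (norm c) * emeasure (tv \<mu>) A"
proof -
  have "(\<Sum>B\<in>P. ennreal (norm (c * \<mu> B))) = ennreal (norm c) * (\<Sum>B\<in>P. ennreal (norm (\<mu> B)))" for P
    by (simp add: norm_mult ennreal_mult sum_distrib_left del: sum_ennreal)
  then have "variation (\<lambda>A. c * \<mu> A) A = ennreal (norm c) * variation \<mu> A"
    unfolding variation_def by (simp add: SUP_mult_left_ennreal)
  then show ?thesis using A \<mu> vector_measure_mult[OF \<mu>] by (simp add: emeasure_tv)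
qed

text \<open>Here \<mu> is the image under \<phi> of the measure with density \<open>H\<close> on
  \<open>Q\<close>. \<open>H\<close> and \<open>tv_density \<mu>\<close> live on different spaces,
  so the change of variables is checked on indicators, in L1 of the image of
  \<open>Q\<close>.\<close>

lemma vm_integral_pushforward:
  fixes \<mu> :: "'a::topological_space set \<Rightarrow> 'f::{real_normed_field,euclidean_space}"
  assumes \<mu>: "vector_measure \<mu>" and Q: "finite_measure Q" and \<phi>: "\<phi> \<in> measurable Q borel"
    and H: "H \<in> borel_measurable Q" "AE z in Q. norm (H z) \<le> 1"
    and \<mu>H: "\<And>A. A \<in> sets borel \<Longrightarrow> \<mu> A = (LINT z|Q. indicator A (\<phi> z) *\<^sub>R H z)"
  shows "\<And>A. A \<in> sets borel \<Longrightarrow> ennreal (norm (\<mu> A)) \<le> emeasure (distr Q borel \<phi>) A"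
    and "\<And>f. integrable Q (\<lambda>z. f (\<phi> z)) \<Longrightarrow> f \<in> borel_measurable borel \<Longrightarrow> vm_integral \<mu> f = (LINT z|Q. f (\<phi> z) * H z)"
proof -
  interpret finite_measure Q by fact
  let ?R = "distr Q borel \<phi>"
  show le: "ennreal (norm (\<mu> A)) \<le> emeasure (distr Q borel \<phi>) A" if A: "A \<in> sets borel" for A
  proof -
    have eq: "indicat_real A (\<phi> z) *\<^sub>R H z = indicator A (\<phi> z) * H z" for z by (simp add: indicator_def)
    have "norm (\<mu> A) \<le> (LINT z|Q. norm (indicator A (\<phi> z) :: 'f))"
    proof -
      have "integrable Q (\<lambda>z. indicator A (\<phi> z) :: 'f)"
        using A \<phi> by (intro integrable_const_bound[where B=1]) (auto simp: indicator_def)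
      from integrable_mult_bounded(2)[OF this H] show ?thesis
        unfolding \<mu>H[OF A] eq .
    qed
    also have "(LINT z|Q. norm (indicator A (\<phi> z) :: 'f)) = (LINT z|Q. indicator (\<phi> -` A \<inter> space Q) z)"
      by (intro Bochner_Integration.integral_cong) (auto simp: indicator_def)
    also have "\<dots> = measure Q (\<phi> -` A \<inter> space Q)" using \<phi> A by simp
    finally show ?thesis using \<phi> A
      by (simp add: emeasure_distr emeasure_eq_measure ennreal_leI)
  qed
  fix f :: "'a \<Rightarrow> 'f" assume f: "integrable Q (\<lambda>z. f (\<phi> z))" "f \<in> borel_measurable borel"
  then have fR: "integrable ?R f" using \<phi> by (simp add: integrable_distr_eq)
  have tvle: "emeasure (tv \<mu>) A \<le> emeasure ?R A" for A by (rule emeasure_tv_le[OF \<mu> le]) auto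
  have "L1_functional ?R (\<lambda>f. LINT z|Q. f (\<phi> z) * H z)"
  proof (rule L1_functionalI[where C=1])
    have i: "integrable Q (\<lambda>z. f (\<phi> z))" if "integrable ?R f" for f :: "'a \<Rightarrow> 'f"
      using that borel_measurable_integrable[OF that] \<phi> by (simp add: integrable_distr_eq)
    fix f :: "'a \<Rightarrow> 'f" assume f: "integrable ?R f"
    show "norm (LINT z|Q. f (\<phi> z) * H z) \<le> 1 * (LINT x|?R. norm (f x))"
      using integrable_mult_bounded(2)[OF i[OF f] H] \<phi> borel_measurable_integrable[OF f]
      by (simp add: integral_distr)
    fix g :: "'a \<Rightarrow> 'f" assume g: "integrable ?R g"
    show "(LINT z|Q. (f (\<phi> z) + g (\<phi> z)) * H z) = (LINT z|Q. f (\<phi> z) * H z) + (LINT z|Q. g (\<phi> z) * H z)"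
      using integrable_mult_bounded(1)[OF i[OF f] H] integrable_mult_bounded(1)[OF i[OF g] H]
      by (simp add: distrib_right)
  qed
  then show "vm_integral \<mu> f = (LINT z|Q. f (\<phi> z) * H z)"
  proof (intro L1_functional_eqI[OF vm_integral_functional[OF \<mu>] _ _ fR])
    fix A :: "'a set" and c :: 'f assume A: "A \<in> sets (distr Q borel \<phi>)"
    have "(LINT z|Q. indicat_real A (\<phi> z) *\<^sub>R c * H z) = (LINT z|Q. c * (indicator A (\<phi> z) *\<^sub>R H z))"
      by (intro Bochner_Integration.integral_cong) auto
    also have "\<dots> = c * (LINT z|Q. indicator A (\<phi> z) *\<^sub>R H z)"
      by (rule integral_mult_right_zero)
    finally have "(LINT z|Q. indicat_real A (\<phi> z) *\<^sub>R c * H z) = c * (LINT z|Q. indicator A (\<phi> z) *\<^sub>R H z)" .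
    then show "vm_integral \<mu> (\<lambda>x. indicat_real A x *\<^sub>R c) = (LINT z|Q. indicat_real A (\<phi> z) *\<^sub>R c * H z)"
      using A by (simp add: vm_integral_indicator[OF \<mu>] \<mu>H)
  qed (use tvle in auto)
qed

text \<open>Countable additivity is dominated convergence along finite unions, with the norm of
  \<open>H\<close> as dominating function. The value 0 off the Borel sets is the convention of
  \<open>vector_measure\<close>.\<close>

lemma vector_measure_pushforward:
  fixes H :: "'z \<Rightarrow> 'f::{banach,second_countable_topology}" and \<phi> :: "'z \<Rightarrow> 'a::topological_space"
  assumes \<phi>: "\<phi> \<in> measurable Q borel" and H: "integrable Q H"
  shows "vector_measure (\<lambda>A. if A \<in> sets borel then LINT z|Q. indicator A (\<phi> z) *\<^sub>R H z else 0)"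
  unfolding vector_measure_def
proof (intro conjI allI impI)
  fix A :: "nat \<Rightarrow> 'a set" assume A: "range A \<subseteq> sets borel" "disjoint_family A"
  have m: "(\<lambda>z. indicat_real B (\<phi> z)) \<in> borel_measurable Q" if "B \<in> sets borel" for B
    using \<phi> that by measurable
  have i: "integrable Q (\<lambda>z. indicat_real B (\<phi> z) *\<^sub>R H z)" if "B \<in> sets borel" for B
    using m[OF that] H by (intro Bochner_Integration.integrable_bound[OF H]) (auto simp: indicator_def)
  have "(\<lambda>n. LINT z|Q. indicat_real (\<Union>i<n. A i) (\<phi> z) *\<^sub>R H z) \<longlonglongrightarrow> (LINT z|Q. indicat_real (\<Union>i. A i) (\<phi> z) *\<^sub>R H z)"
  proof (rule integral_dominated_convergence[where w="\<lambda>z. norm (H z)"])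
    show "AE z in Q. (\<lambda>n. indicat_real (\<Union>i<n. A i) (\<phi> z) *\<^sub>R H z) \<longlonglongrightarrow> indicat_real (\<Union>i. A i) (\<phi> z) *\<^sub>R H z"
      by (intro AE_I2 tendsto_intros LIMSEQ_indicator_UN)
    show "AE z in Q. norm (indicat_real (\<Union>i<n. A i) (\<phi> z) *\<^sub>R H z) \<le> norm (H z)" for n
      by (auto simp: indicator_def)
  qed (use A H in \<open>auto intro!: borel_measurable_integrable i\<close>)
  moreover have "(LINT z|Q. indicat_real (\<Union>i<n. A i) (\<phi> z) *\<^sub>R H z) = (\<Sum>i<n. LINT z|Q. indicator (A i) (\<phi> z) *\<^sub>R H z)" for n
  proof -
    have "indicat_real (\<Union>i<n. A i) x = (\<Sum>i<n. indicator (A i) x)" for x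
      using A(2) by (intro indicator_UN_disjoint) (auto simp: disjoint_family_on_def)
    then have "(LINT z|Q. indicat_real (\<Union>i<n. A i) (\<phi> z) *\<^sub>R H z) = (LINT z|Q. (\<Sum>i<n. indicat_real (A i) (\<phi> z) *\<^sub>R H z))"
      by (simp only: scaleR_sum_left)
    also have "\<dots> = (\<Sum>i<n. LINT z|Q. indicator (A i) (\<phi> z) *\<^sub>R H z)"
      using A by (intro Bochner_Integration.integral_sum i) auto
    finally show ?thesis .
  qed
  ultimately show "(\<lambda>n. if A n \<in> sets borel then LINT z|Q. indicator (A n) (\<phi> z) *\<^sub>R H z else 0) sums
      (if (\<Union>n. A n) \<in> sets borel then LINT z|Q. indicator (\<Union>n. A n) (\<phi> z) *\<^sub>R H z else 0)"
    using A by (auto simp: sums_def image_subset_iff)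
qed auto

section \<open>Products of Radon measures\<close>

lemma vimage_Pair_borel:
  fixes E :: "('a::topological_space \<times> 'b::topological_space) set"
  assumes "E \<in> sets borel" shows "Pair x -` E \<in> sets borel" "(\<lambda>x. (x, y)) -` E \<in> sets borel"
proof -
  have 1: "Pair x \<in> measurable borel (borel :: ('a \<times> 'b) measure)"
    by (intro borel_measurable_continuous_onI continuous_intros)
  have 2: "(\<lambda>x. (x, y)) \<in> measurable borel (borel :: ('a \<times> 'b) measure)"
    by (intro borel_measurable_continuous_onI continuous_intros)
  show "Pair x -` E \<in> sets borel" "(\<lambda>x. (x, y)) -` E \<in> sets borel"
    using measurable_sets[OF 1 assms] measurable_sets[OF 2 assms] by auto
qed

lemma measurable_section:
  assumes "f \<in> measurable (borel :: ('a::topological_space \<times> 'b::topological_space) measure) K"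
  shows "(\<lambda>y. f (x, y)) \<in> measurable borel K" "(\<lambda>x. f (x, y)) \<in> measurable borel K"
  by (rule measurable_compose[OF _ assms], intro borel_measurable_continuous_onI continuous_intros)+

text \<open>The tube lemma: finitely many of the open rectangles around the points of
  \<open>{x} \<times> L\<close> suffice, and their first sides are intersected.\<close>

lemma open_rectangle_around_compact:
  fixes E :: "('a::topological_space \<times> 'b::topological_space) set"
  assumes "open E" "compact L" "{x} \<times> L \<subseteq> E"
  obtains W V where "open W" "open V" "x \<in> W" "L \<subseteq> V" "W \<times> V \<subseteq> E"
proof -
  let ?\<V> = "{V. open V \<and> (\<exists>W. open W \<and> x \<in> W \<and> W \<times> V \<subseteq> E)}"
  have "L \<subseteq> \<Union>?\<V>"
  proof
    fix y assume "y \<in> L"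
    then have "(x, y) \<in> E" using assms(3) by auto
    then obtain W V where "open W" "open V" "(x, y) \<in> W \<times> V" "W \<times> V \<subseteq> E"
      using assms(1) by (metis open_prod_elim)
    then show "y \<in> \<Union>?\<V>" by blast
  qed
  then obtain D where D: "D \<subseteq> ?\<V>" "finite D" "L \<subseteq> \<Union>D"
    by (rule compactE[OF assms(2)]) auto
  have "\<forall>V\<in>D. \<exists>W. open W \<and> x \<in> W \<and> W \<times> V \<subseteq> E" "\<forall>V\<in>D. open V"
    using subsetD[OF D(1)] by simp_all
  from this(1) obtain W where W: "\<forall>V\<in>D. open (W V) \<and> x \<in> W V \<and> W V \<times> V \<subseteq> E"
    by (rule bchoice[THEN exE])
  show ?thesis
  proof
    show "open (\<Inter>V\<in>D. W V)" using D(2) W by (intro open_INT) simp_all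
    show "open (\<Union>D)" using \<open>\<forall>V\<in>D. open V\<close> by (intro open_Union)
    show "x \<in> (\<Inter>V\<in>D. W V)" using W by simp
    show "L \<subseteq> \<Union>D" by (rule D(3))
    show "(\<Inter>V\<in>D. W V) \<times> \<Union>D \<subseteq> E" using W by fast
  qed
qed

locale radon_pair =
  fixes M :: "'a::t2_space measure" and N :: "'b::t2_space measure"
  assumes M: "radon M" and N: "radon N"
begin

sublocale M: finite_measure M by (rule radonD[OF M])
sublocale N: finite_measure N by (rule radonD[OF N])

lemma sets_MN [simp, measurable_cong]: "sets M = sets borel" "sets N = sets borel"
  using radonD[OF M] radonD[OF N] by auto

lemma space_MN [simp]: "space M = UNIV" "space N = UNIV"
  using radonD[OF M] radonD[OF N] by auto

lemma borel_measurable_MN [simp]: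
  "borel_measurable M = borel_measurable borel" "borel_measurable N = borel_measurable borel"
  by (auto intro!: measurable_cong_sets)

text \<open>A compact subset of the section at \<open>x\<close> whose measure still exceeds
  \<open>c\<close> stays inside the sections at all nearby points, by the tube lemma.\<close>

lemma open_superlevel_section:
  assumes E: "open (E :: ('a \<times> 'b) set)"
  shows "open {x. c < measure N (Pair x -` E)}"
proof (subst open_subopen, intro ballI)
  fix x assume "x \<in> {x. c < measure N (Pair x -` E)}"
  then have c: "c < measure N (Pair x -` E)" by simp
  have b: "Pair x -` E \<in> sets borel" for x using E by (intro vimage_Pair_borel) auto
  obtain K where K: "compact K" "K \<subseteq> Pair x -` E" "measure N (Pair x -` E - K) < measure N (Pair x -` E) - c"
    using radon_compactE[OF N b, of "measure N (Pair x -` E) - c" x] c by auto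
  have "measure N (Pair x -` E - K) = measure N (Pair x -` E) - measure N K"
    using K b by (intro N.finite_measure_Diff) (auto intro: borel_compact)
  then have cK: "c < measure N K" using K by simp
  obtain W V where W: "open W" "open V" "x \<in> W" "K \<subseteq> V" "W \<times> V \<subseteq> E"
    using open_rectangle_around_compact[OF E K(1), of x] K by auto
  have "c < measure N (Pair y -` E)" if "y \<in> W" for y
  proof -
    have "measure N K \<le> measure N (Pair y -` E)"
      using W that b by (intro N.finite_measure_mono) auto
    then show ?thesis using cK by simp
  qed
  then show "\<exists>T. open T \<and> x \<in> T \<and> T \<subseteq> {x. c < measure N (Pair x -` E)}" using W by auto
qed

text \<open>Open sets are stable under intersection and generate the Borel sets; the sets with
  measurable section measure form a Dynkin system, complements being handled by the finiteness of
  \<open>N\<close>.\<close>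

lemma measurable_measure_section:
  assumes "E \<in> sets (borel :: ('a \<times> 'b) measure)"
  shows "(\<lambda>x. measure N (Pair x -` E)) \<in> borel_measurable borel"
proof -
  have "E \<in> sigma_sets UNIV {U. open U}" using assms by (simp add: borel_def)
  have b: "E \<in> sets borel" if "E \<in> sigma_sets UNIV {U. open U}" for E :: "('a \<times> 'b) set"
    using that by (simp add: borel_def)
  have "Int_stable {U :: ('a \<times> 'b) set. open U}" by (auto simp: Int_stable_def)
  moreover have "{U :: ('a \<times> 'b) set. open U} \<subseteq> Pow UNIV" by simp
  moreover note \<open>E \<in> sigma_sets UNIV {U. open U}\<close>
  ultimately show ?thesis
  proof (induction rule: sigma_sets_induct_disjoint)
    case (basic E)
    then show ?case using open_superlevel_section[of E]
      by (auto simp: borel_measurable_iff_greater)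
  next
    case (compl E)
    have "measure N (Pair x -` (UNIV - E)) = measure N UNIV - measure N (Pair x -` E)" for x
      using N.finite_measure_compl[of "Pair x -` E"] vimage_Pair_borel(1)[OF b[OF compl(1)], of x]
      by (simp add: vimage_Diff)
    then show ?case using compl by simp
  next
    case (union A)
    have "(\<lambda>i. measure N (Pair x -` A i)) sums measure N (Pair x -` (\<Union>i. A i))" for x
      unfolding vimage_UN
      using union(1,2) b
      by (intro N.finite_measure_UNION) (auto simp: disjoint_family_on_def image_subset_iff intro!: vimage_Pair_borel)
    then have "measure N (Pair x -` (\<Union>i. A i)) = (\<Sum>i. measure N (Pair x -` A i))" for x by (simp add: sums_iff)
    then show ?case using union(3) by simp
  qed auto
qed

lemma measurable_emeasure_section:
  assumes "E \<in> sets (borel :: ('a \<times> 'b) measure)"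
  shows "(\<lambda>x. emeasure N (Pair x -` E)) \<in> borel_measurable borel"
  using measurable_measure_section[OF assms] by (simp add: N.emeasure_eq_measure)

text \<open>Built by iterating in one order, on all Borel sets of the product space. This order of
  integration is available by construction; the other one is the content of
  \<open>radon_prod_swap\<close>.\<close>

definition prodm :: "('a \<times> 'b) measure" where
  "prodm = measure_of UNIV (sets borel) (\<lambda>E. \<integral>\<^sup>+x. emeasure N (Pair x -` E) \<partial>M)"

lemma sets_prod [simp, measurable_cong]: "sets prodm = sets borel"
  unfolding prodm_def by (metis sets.sets_measure_of_eq space_borel)

lemma space_prod [simp]: "space prodm = UNIV"
  unfolding prodm_def by (simp add: space_measure_of_conv)

lemma emeasure_prod:
  assumes "E \<in> sets borel"
  shows "emeasure prodm E = (\<integral>\<^sup>+x. emeasure N (Pair x -` E) \<partial>M)"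
proof (rule emeasure_measure_of[OF prodm_def])
  show "positive (sets prodm) (\<lambda>E. \<integral>\<^sup>+x. emeasure N (Pair x -` E) \<partial>M)" by (simp add: positive_def)
  show "countably_additive (sets prodm) (\<lambda>E. \<integral>\<^sup>+x. emeasure N (Pair x -` E) \<partial>M)"
  proof (intro countably_additiveI)
    fix A :: "nat \<Rightarrow> ('a \<times> 'b) set" assume A: "range A \<subseteq> sets prodm" "disjoint_family A"
    have "(\<Sum>i. \<integral>\<^sup>+x. emeasure N (Pair x -` A i) \<partial>M) = (\<integral>\<^sup>+x. (\<Sum>i. emeasure N (Pair x -` A i)) \<partial>M)"
      using A measurable_emeasure_section by (intro nn_integral_suminf[symmetric]) auto
    also have "\<dots> = (\<integral>\<^sup>+x. emeasure N (Pair x -` (\<Union>i. A i)) \<partial>M)"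
      unfolding vimage_UN using A
      by (intro nn_integral_cong suminf_emeasure) (auto simp: disjoint_family_on_def image_subset_iff intro!: vimage_Pair_borel)
    finally show "(\<Sum>i. \<integral>\<^sup>+x. emeasure N (Pair x -` A i) \<partial>M) = (\<integral>\<^sup>+x. emeasure N (Pair x -` (\<Union>i. A i)) \<partial>M)" .
  qed
qed (use assms in auto)

sublocale P: finite_measure prodm
  by (intro finite_measureI) (simp add: emeasure_prod ennreal_mult_eq_top_iff)

lemma nn_integral_prod:
  assumes "f \<in> borel_measurable borel"
  shows "(\<lambda>x. \<integral>\<^sup>+y. f (x, y) \<partial>N) \<in> borel_measurable borel"
    and "(\<integral>\<^sup>+z. f z \<partial>prodm) = (\<integral>\<^sup>+x. (\<integral>\<^sup>+y. f (x, y) \<partial>N) \<partial>M)"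
proof -
  have m: "(\<lambda>y. f (x, y)) \<in> borel_measurable borel" if "f \<in> borel_measurable borel" for f :: "'a \<times> 'b \<Rightarrow> ennreal" and x
    by (rule measurable_section[OF that])
  have "(\<lambda>x. \<integral>\<^sup>+y. f (x, y) \<partial>N) \<in> borel_measurable borel \<and>
    (\<integral>\<^sup>+z. f z \<partial>prodm) = (\<integral>\<^sup>+x. (\<integral>\<^sup>+y. f (x, y) \<partial>N) \<partial>M)"
    using assms
  proof (induction)
    case (cong f g) then show ?case by auto
  next
    case (set A)
    have "(\<integral>\<^sup>+y. indicator A (x, y) \<partial>N) = (\<integral>\<^sup>+y. indicator (Pair x -` A) y \<partial>N)" for x
      by (intro nn_integral_cong) (auto simp: indicator_def)
    then have "(\<integral>\<^sup>+y. indicator A (x, y) \<partial>N) = emeasure N (Pair x -` A)" for x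
      using vimage_Pair_borel(1)[OF set, of x] by simp
    then show ?case using measurable_emeasure_section[OF set] set by (simp add: emeasure_prod)
  next
    case (mult u c)
    have eq: "(\<integral>\<^sup>+y. c * u (x, y) \<partial>N) = c * (\<integral>\<^sup>+y. u (x, y) \<partial>N)" for x
      using m[OF mult.hyps(2)] by (intro nn_integral_cmult) simp
    have [measurable]: "(\<lambda>x. \<integral>\<^sup>+y. u (x, y) \<partial>N) \<in> borel_measurable borel" using mult.IH by blast
    have "(\<lambda>x. c * (\<integral>\<^sup>+y. u (x, y) \<partial>N)) \<in> borel_measurable borel" by measurable
    then show ?case using mult.hyps conjunct2[OF mult.IH] unfolding eq by (simp add: nn_integral_cmult)
  next
    case (add u v)
    have eq: "(\<integral>\<^sup>+y. v (x, y) + u (x, y) \<partial>N) = (\<integral>\<^sup>+y. v (x, y) \<partial>N) + (\<integral>\<^sup>+y. u (x, y) \<partial>N)" for x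
      using m[OF add.hyps(1)] m[OF add.hyps(3)] by (intro nn_integral_add) simp_all
    have "(\<integral>\<^sup>+z. v z + u z \<partial>prodm) = (\<integral>\<^sup>+z. v z \<partial>prodm) + (\<integral>\<^sup>+z. u z \<partial>prodm)"
      using add.hyps by (intro nn_integral_add) simp_all
    moreover have [measurable]: "(\<lambda>x. \<integral>\<^sup>+y. u (x, y) \<partial>N) \<in> borel_measurable borel" "(\<lambda>x. \<integral>\<^sup>+y. v (x, y) \<partial>N) \<in> borel_measurable borel"
      using add.IH by blast+
    moreover have "(\<lambda>x. (\<integral>\<^sup>+y. v (x, y) \<partial>N) + (\<integral>\<^sup>+y. u (x, y) \<partial>N)) \<in> borel_measurable borel" by measurable
    ultimately show ?case using conjunct2[OF add.IH(1)] conjunct2[OF add.IH(2)] unfolding eq by (simp add: nn_integral_add)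
  next
    case (seq U)
    have eq: "(\<integral>\<^sup>+y. (SUP i. U i) (x, y) \<partial>N) = (SUP i. \<integral>\<^sup>+y. U i (x, y) \<partial>N)" for x
      using seq m unfolding SUP_apply
      by (intro nn_integral_monotone_convergence_SUP) (auto simp: incseq_def le_fun_def)
    have "(\<integral>\<^sup>+z. (SUP i. U i) z \<partial>prodm) = (SUP i. \<integral>\<^sup>+z. U i z \<partial>prodm)"
      using seq.hyps unfolding SUP_apply
      by (intro nn_integral_monotone_convergence_SUP) (auto simp: incseq_def le_fun_def)
    also have "\<dots> = (\<integral>\<^sup>+x. (SUP i. \<integral>\<^sup>+y. U i (x, y) \<partial>N) \<partial>M)"
      using seq m by (subst nn_integral_monotone_convergence_SUP)
        (auto simp: incseq_def le_fun_def intro!: nn_integral_mono)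
    finally have "(\<integral>\<^sup>+z. (SUP i. U i) z \<partial>prodm) = (\<integral>\<^sup>+x. (SUP i. \<integral>\<^sup>+y. U i (x, y) \<partial>N) \<partial>M)" .
    moreover have [measurable]: "(\<lambda>x. \<integral>\<^sup>+y. U i (x, y) \<partial>N) \<in> borel_measurable borel" for i
      using seq.IH by blast
    have "(\<lambda>x. SUP i. \<integral>\<^sup>+y. U i (x, y) \<partial>N) \<in> borel_measurable borel" by measurable
    ultimately show ?case unfolding eq by blast
  qed
  then show "(\<lambda>x. \<integral>\<^sup>+y. f (x, y) \<partial>N) \<in> borel_measurable borel"
    and "(\<integral>\<^sup>+z. f z \<partial>prodm) = (\<integral>\<^sup>+x. (\<integral>\<^sup>+y. f (x, y) \<partial>N) \<partial>M)" by auto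
qed

lemma measurable_integral_section:
  fixes f :: "'a \<times> 'b \<Rightarrow> 'f::euclidean_space"
  assumes f: "f \<in> borel_measurable borel"
  shows "(\<lambda>x. LINT y|N. f (x, y)) \<in> borel_measurable borel"
    and "{x. integrable N (\<lambda>y. f (x, y))} \<in> sets borel"
proof -
  have m: "(\<lambda>y. f (x, y)) \<in> borel_measurable borel" for x
    by (rule measurable_section[OF f])
  have "(\<lambda>x. \<integral>\<^sup>+y. norm (f (x, y)) \<partial>N) \<in> borel_measurable borel"
    using f by (intro nn_integral_prod(1)[of "\<lambda>z. ennreal (norm (f z))"]) auto
  then have "{x. (\<integral>\<^sup>+y. norm (f (x, y)) \<partial>N) < \<infinity>} \<in> sets borel" by measurable
  moreover have "{x. (\<integral>\<^sup>+y. norm (f (x, y)) \<partial>N) < \<infinity>} = {x. integrable N (\<lambda>y. f (x, y))}"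
    using m by (auto simp: integrable_iff_bounded)
  ultimately show I: "{x. integrable N (\<lambda>y. f (x, y))} \<in> sets borel" by simp
  \<comment> \<open>\<open>F b 1\<close> and \<open>F b (-1)\<close> integrate the positive and the
    negative part of the coordinate along \<open>b\<close>, since \<open>ennreal\<close> sends
    negative reals to 0. Where the section is not integrable its Bochner integral is 0, which the
    indicator in the next formula reproduces.\<close>
  define F where "F b s x = enn2real (\<integral>\<^sup>+y. ennreal (s * (f (x, y) \<bullet> b)) \<partial>N)" for b s x
  have F: "F b s \<in> borel_measurable borel" for b s
    unfolding F_def using f by (intro measurable_compose[OF nn_integral_prod(1)[of "\<lambda>z. ennreal (s * (f z \<bullet> b))"]]) auto
  have "(LINT y|N. f (x, y)) = (\<Sum>b\<in>Basis. (indicator {x. integrable N (\<lambda>y. f (x, y))} x * (F b 1 x - F b (-1) x)) *\<^sub>R b)" for x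
  proof (cases "integrable N (\<lambda>y. f (x, y))")
    case True
    have "(LINT y|N. f (x, y)) = (\<Sum>b\<in>Basis. ((LINT y|N. f (x, y)) \<bullet> b) *\<^sub>R b)" by (simp add: euclidean_representation)
    also have "\<dots> = (\<Sum>b\<in>Basis. (LINT y|N. f (x, y) \<bullet> b) *\<^sub>R b)" using True by simp
    also have "\<dots> = (\<Sum>b\<in>Basis. (F b 1 x - F b (-1) x) *\<^sub>R b)"
      using True by (intro sum.cong refl) (subst real_lebesgue_integral_def, auto simp: F_def)
    finally show ?thesis using True by simp
  qed (simp add: not_integrable_integral_eq)
  then show "(\<lambda>x. LINT y|N. f (x, y)) \<in> borel_measurable borel" using F I by simp
qed

text \<open>Both sides of the last equation are L1-bounded functionals of \<open>f\<close>; on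
  indicators they agree by the construction of \<open>prodm\<close>.\<close>

lemma integral_prod:
  fixes f :: "'a \<times> 'b \<Rightarrow> 'f::euclidean_space"
  assumes f: "integrable prodm f"
  shows "AE x in M. integrable N (\<lambda>y. f (x, y))"
    and "integrable M (\<lambda>x. LINT y|N. f (x, y))"
    and "(LINT z|prodm. f z) = (LINT x|M. LINT y|N. f (x, y))"
proof -
  have ae: "AE x in M. integrable N (\<lambda>y. f (x, y))" if f: "integrable prodm f" for f :: "'a \<times> 'b \<Rightarrow> 'f"
  proof -
    have b: "f \<in> borel_measurable borel" using borel_measurable_integrable[OF f] by simp
    have m: "(\<lambda>y. f (x, y)) \<in> borel_measurable borel" for x
      by (rule measurable_section[OF b])
    have "(\<integral>\<^sup>+z. norm (f z) \<partial>prodm) = (\<integral>\<^sup>+x. (\<integral>\<^sup>+y. norm (f (x, y)) \<partial>N) \<partial>M)"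
      using b by (intro nn_integral_prod) auto
    then have "AE x in M. (\<integral>\<^sup>+y. norm (f (x, y)) \<partial>N) \<noteq> \<infinity>"
      using f b nn_integral_prod(1)[of "\<lambda>z. ennreal (norm (f z))"]
      by (intro nn_integral_PInf_AE) (auto simp: integrable_iff_bounded)
    then show ?thesis using m by (auto elim!: eventually_mono simp: integrable_iff_bounded less_top)
  qed
  then show "AE x in M. integrable N (\<lambda>y. f (x, y))" using f .
  have bound: "(\<integral>\<^sup>+x. norm (LINT y|N. f (x, y)) \<partial>M) \<le> (\<integral>\<^sup>+z. norm (f z) \<partial>prodm)" if f: "integrable prodm f" for f :: "'a \<times> 'b \<Rightarrow> 'f"
  proof -
    have b: "f \<in> borel_measurable borel" using borel_measurable_integrable[OF f] by simp
    have "(\<integral>\<^sup>+x. norm (LINT y|N. f (x, y)) \<partial>M) \<le> (\<integral>\<^sup>+x. (\<integral>\<^sup>+y. norm (f (x, y)) \<partial>N) \<partial>M)"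
      using ae[OF f] by (intro nn_integral_mono_AE) (auto elim!: eventually_mono intro!: integral_norm_bound_ennreal)
    also have "\<dots> = (\<integral>\<^sup>+z. norm (f z) \<partial>prodm)"
      using b by (intro nn_integral_prod(2)[symmetric]) auto
    finally show ?thesis .
  qed
  have int: "integrable M (\<lambda>x. LINT y|N. f (x, y))" if f: "integrable prodm f" for f :: "'a \<times> 'b \<Rightarrow> 'f"
    using bound[OF f] f measurable_integral_section(1)[of f] borel_measurable_integrable[OF f]
    by (auto simp: integrable_iff_bounded intro: le_less_trans)
  then show "integrable M (\<lambda>x. LINT y|N. f (x, y))" using f .
  have L: "L1_functional prodm (\<lambda>f. LINT z|prodm. f z :: 'f)"
    by (rule L1_functionalI[where C=1]) (auto intro: integral_norm_bound)
  have L': "L1_functional prodm (\<lambda>f. LINT x|M. LINT y|N. f (x, y) :: 'f)"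
  proof (rule L1_functionalI[where C=1])
    fix f :: "'a \<times> 'b \<Rightarrow> 'f" assume f: "integrable prodm f"
    have "ennreal (norm (LINT x|M. LINT y|N. f (x, y))) \<le> (\<integral>\<^sup>+x. norm (LINT y|N. f (x, y)) \<partial>M)"
      by (rule integral_norm_bound_ennreal[OF int[OF f]])
    also have "\<dots> \<le> (\<integral>\<^sup>+z. norm (f z) \<partial>prodm)" by (rule bound[OF f])
    also have "\<dots> = ennreal (LINT z|prodm. norm (f z))" using f by (intro nn_integral_eq_integral) auto
    finally show "norm (LINT x|M. LINT y|N. f (x, y)) \<le> 1 * (LINT z|prodm. norm (f z))" by (simp add: ennreal_le_iff)
    fix g :: "'a \<times> 'b \<Rightarrow> 'f" assume g: "integrable prodm g"
    have "(LINT x|M. LINT y|N. f (x, y) + g (x, y)) = (LINT x|M. (LINT y|N. f (x, y)) + (LINT y|N. g (x, y)))"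
    proof (rule integral_cong_AE)
      show "(\<lambda>x. LINT y|N. f (x, y) + g (x, y)) \<in> borel_measurable M"
        using borel_measurable_integrable[OF int[of "\<lambda>z. f z + g z"]] f g by simp
      show "(\<lambda>x. (LINT y|N. f (x, y)) + (LINT y|N. g (x, y))) \<in> borel_measurable M"
        using borel_measurable_integrable[OF int[OF f]] borel_measurable_integrable[OF int[OF g]] by simp
      show "AE x in M. (LINT y|N. f (x, y) + g (x, y)) = (LINT y|N. f (x, y)) + (LINT y|N. g (x, y))"
        using ae[OF f] ae[OF g] by eventually_elim simp
    qed
    then show "(LINT x|M. LINT y|N. f (x, y) + g (x, y)) = (LINT x|M. LINT y|N. f (x, y)) + (LINT x|M. LINT y|N. g (x, y))"
      using int[OF f] int[OF g] by simp
  qed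
  show "(LINT z|prodm. f z) = (LINT x|M. LINT y|N. f (x, y))"
  proof (rule L1_functional_eqI[OF L L' _ f])
    fix A :: "('a \<times> 'b) set" and c :: 'f assume "A \<in> sets prodm"
    then have A: "A \<in> sets borel" by simp
    have s: "(LINT y|N. indicat_real A (x, y) *\<^sub>R c) = measure N (Pair x -` A) *\<^sub>R c" for x
    proof -
      have "(LINT y|N. indicat_real A (x, y) *\<^sub>R c) = (LINT y|N. indicat_real (Pair x -` A) y *\<^sub>R c)"
        by (intro Bochner_Integration.integral_cong) (auto simp: indicator_def)
      also have "\<dots> = measure N (Pair x -` A) *\<^sub>R c"
        using vimage_Pair_borel(1)[OF A, of x]
        by (subst integral_scaleR_left) (auto simp: N.emeasure_eq_measure integrable_indicator_iff)
      finally show ?thesis .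
    qed
    have i: "integrable M (\<lambda>x. measure N (Pair x -` A))"
      using measurable_measure_section[OF A]
      by (intro M.integrable_const_bound[where B="measure N UNIV"]) (auto intro!: AE_I2 N.finite_measure_mono)
    have "ennreal (measure prodm A) = (\<integral>\<^sup>+x. ennreal (measure N (Pair x -` A)) \<partial>M)"
      using emeasure_prod[OF A] by (simp add: P.emeasure_eq_measure N.emeasure_eq_measure)
    also have "\<dots> = ennreal (LINT x|M. measure N (Pair x -` A))"
      by (rule nn_integral_eq_integral[OF i]) auto
    finally have "measure prodm A = (LINT x|M. measure N (Pair x -` A))" by (subst (asm) ennreal_inj) auto
    then show "(LINT z|prodm. indicat_real A z *\<^sub>R c) = (LINT x|M. LINT y|N. indicat_real A (x, y) *\<^sub>R c)"
      using A i by (subst integral_scaleR_left) (auto simp: s P.emeasure_eq_measure)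
  qed
qed

section \<open>Rectangles, regularity and symmetry of the product\<close>

text \<open>The values of the section measure \<phi> are sliced into levels of height \<delta>. Over
  a compact part of the open set where \<phi> exceeds k\<delta>, finitely many rectangles with
  second side of measure above k\<delta> cover all points. Taken over all levels they miss at most
  \<delta> of each section, except over a small set \<open>X\<close>.\<close>

lemma open_rectangles_approx:
  assumes E: "open (E :: ('a \<times> 'b) set)" and e: "0 < e"
  shows "\<exists>\<R>. finite \<R> \<and> (\<forall>(A, B)\<in>\<R>. open A \<and> open B \<and> A \<times> B \<subseteq> E) \<and>
    measure prodm (E - (\<Union>(A, B)\<in>\<R>. A \<times> B)) < e"
proof -
  define a where "a = measure M UNIV"
  define b where "b = measure N UNIV"
  \<comment> \<open>Missing at most \<delta> of every section costs at most \<delta> times the mass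
    \<open>a\<close> of \<open>M\<close>, below e/4. Adding 1 keeps the denominator
    positive.\<close>
  define \<delta> where "\<delta> = e / (4 * (a + 1))"
  have ab: "0 \<le> a" "0 \<le> b" by (auto simp: a_def b_def)
  then have \<delta>: "0 < \<delta>" using e by (auto simp: \<delta>_def)
  \<comment> \<open>Enough levels of height \<delta> to exhaust the range of \<phi>, which is
    bounded by \<open>b\<close>.\<close>
  obtain m0 :: nat where "b / \<delta> < real m0" using reals_Archimedean2 by blast
  define m where "m = Suc m0"
  have m: "b \<le> m * \<delta>" "0 < m"
    using \<open>b / \<delta> < real m0\<close> \<delta> by (auto simp: m_def field_simps)
  \<comment> \<open>The \<open>m\<close> exceptional sets have total mass at most m\<eta>, and a
    section over them costs at most \<open>b\<close>: together at most e/4.\<close>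
  define \<eta> where "\<eta> = e / (4 * (b + 1) * m)"
  have \<eta>: "0 < \<eta>" using ab e m by (auto simp: \<eta>_def)
  define \<phi> where "\<phi> x = measure N (Pair x -` E)" for x
  have bE: "Pair x -` E \<in> sets borel" for x using E by (intro vimage_Pair_borel) auto
  have \<phi>b: "\<phi> x \<le> b" for x unfolding \<phi>_def b_def using bE by (intro N.finite_measure_mono) auto
  define G where "G k = {x. real k * \<delta> < \<phi> x}" for k
  have G: "open (G k)" for k unfolding G_def \<phi>_def by (rule open_superlevel_section[OF E])
  have "\<exists>C. compact C \<and> C \<subseteq> G k \<and> measure M (G k - C) < \<eta>" for k
    by (rule radon_compactE[OF M borel_open[OF G] \<eta>]) blast
  then obtain C where C: "\<And>k. compact (C k)" "\<And>k. C k \<subseteq> G k" "\<And>k. measure M (G k - C k) < \<eta>" by metis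
  have "\<exists>\<R>. finite \<R> \<and> (\<forall>(A, B)\<in>\<R>. open A \<and> open B \<and> A \<times> B \<subseteq> E \<and> k * \<delta> < measure N B) \<and> C k \<subseteq> \<Union>(fst ` \<R>)" for k
  proof -
    have "\<exists>R. open (fst R) \<and> open (snd R) \<and> x \<in> fst R \<and> fst R \<times> snd R \<subseteq> E \<and> k * \<delta> < measure N (snd R)" if x: "x \<in> C k" for x
    proof -
      have "k * \<delta> < \<phi> x" using x C(2)[of k] by (auto simp: G_def)
      then obtain L where L: "compact L" "L \<subseteq> Pair x -` E" "measure N (Pair x -` E - L) < \<phi> x - k * \<delta>"
        using radon_compactE[OF N bE, of "\<phi> x - k * \<delta>"] by auto
      have "measure N (Pair x -` E - L) = \<phi> x - measure N L"
        using L bE unfolding \<phi>_def by (intro N.finite_measure_Diff) (auto intro: borel_compact)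
      then have kL: "k * \<delta> < measure N L" using L by simp
      obtain W V where W: "open W" "open V" "x \<in> W" "L \<subseteq> V" "W \<times> V \<subseteq> E"
        using open_rectangle_around_compact[OF E L(1), of x] L by auto
      have "measure N L \<le> measure N V" using W by (intro N.finite_measure_mono) auto
      then show ?thesis using W kL by (intro exI[of _ "(W, V)"]) auto
    qed
    then obtain R where R: "\<And>x. x \<in> C k \<Longrightarrow> open (fst (R x)) \<and> open (snd (R x)) \<and> x \<in> fst (R x) \<and> fst (R x) \<times> snd (R x) \<subseteq> E \<and> k * \<delta> < measure N (snd (R x))"
      by metis
    obtain D where D: "D \<subseteq> C k" "finite D" "C k \<subseteq> (\<Union>x\<in>D. fst (R x))"
      by (rule compactE_image[OF C(1)[of k], of "C k" "\<lambda>x. fst (R x)"]) (use R in auto)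
    have "case R x of (A, B) \<Rightarrow> open A \<and> open B \<and> A \<times> B \<subseteq> E \<and> k * \<delta> < measure N B" if "x \<in> D" for x
      using R[of x] D(1) that by (cases "R x") auto
    then show ?thesis using D by (intro exI[of _ "R ` D"]) (auto simp: image_image)
  qed
  then have "\<forall>k. \<exists>\<R>. finite \<R> \<and> (\<forall>(A, B)\<in>\<R>. open A \<and> open B \<and> A \<times> B \<subseteq> E \<and> real k * \<delta> < measure N B) \<and> C k \<subseteq> \<Union>(fst ` \<R>)"
    by blast
  from choice[OF this] obtain \<R> where "\<forall>k. finite (\<R> k) \<and> (\<forall>(A, B)\<in>\<R> k. open A \<and> open B \<and> A \<times> B \<subseteq> E \<and> real k * \<delta> < measure N B) \<and> C k \<subseteq> \<Union>(fst ` \<R> k)"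
    by (rule exE)
  then have \<R>: "\<And>k. finite (\<R> k)"
    "\<And>k A B. (A, B) \<in> \<R> k \<Longrightarrow> open A \<and> open B \<and> A \<times> B \<subseteq> E \<and> real k * \<delta> < measure N B"
    "\<And>k. C k \<subseteq> \<Union>(fst ` \<R> k)"
    by fast+
  define \<S> where "\<S> = (\<Union>k<m. \<R> k)"
  define R where "R = (\<Union>(A, B)\<in>\<S>. A \<times> B)"
  have RE: "R \<subseteq> E" unfolding R_def \<S>_def using \<R>(2) by fastforce
  have oR: "open R" unfolding R_def \<S>_def using \<R>(2) by (intro open_UN) (auto intro: open_Times)
  have bR: "Pair x -` R \<in> sets borel" for x using oR by (intro vimage_Pair_borel) auto
  define X where "X = (\<Union>k<m. G k - C k)"
  have GC: "G k - C k \<in> sets borel" for k by (intro sets.Diff borel_open[OF G] borel_compact[OF C(1)])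
  then have X: "X \<in> sets borel" unfolding X_def by (intro sets.finite_UN) auto
  have pt: "measure N (Pair x -` (E - R)) \<le> \<delta> + b * indicator X x" for x
  proof -
    have diff: "measure N (Pair x -` (E - R)) = \<phi> x - measure N (Pair x -` R)"
      unfolding \<phi>_def vimage_Diff using RE bE bR by (intro N.finite_measure_Diff) auto
    consider "x \<in> X" | "\<phi> x \<le> \<delta>" | "x \<notin> X" "\<delta> < \<phi> x" by force
    then show ?thesis
    proof cases
      case 1
      then have "\<delta> + b * indicator X x = \<delta> + b" by simp
      then show ?thesis using diff \<phi>b[of x] \<delta> measure_nonneg[of N "Pair x -` R"] by linarith
    next
      case 2 then show ?thesis using diff ab measure_nonneg[of N "Pair x -` R"]
        by (smt (verit) indicator_pos_le mult_nonneg_nonneg)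
    next
      case 3
      \<comment> \<open>The level of \<open>x\<close>, with k\<delta> < \<phi> x \<le> (k +
        1)\<delta>. The left inequality is the minimality of \<open>k\<close>, which is positive
        because \<delta> < \<phi> x.\<close>
      define k where "k = (LEAST k. \<phi> x \<le> (real k + 1) * \<delta>)"
      have "\<phi> x \<le> (real m0 + 1) * \<delta>" using \<phi>b[of x] m(1) by (auto simp: m_def algebra_simps)
      then have k: "\<phi> x \<le> (real k + 1) * \<delta>" "k \<le> m0"
        unfolding k_def by (rule LeastI, rule Least_le)
      have "k \<noteq> 0" using k 3 by (intro notI) auto
      then obtain j where j: "k = Suc j" by (cases k) auto
      have "\<not> \<phi> x \<le> (real j + 1) * \<delta>" using not_less_Least[of j "\<lambda>k. \<phi> x \<le> (real k + 1) * \<delta>"] j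
        unfolding k_def[symmetric] by auto
      then have "x \<in> G k" by (simp add: G_def j algebra_simps)
      moreover have "k < m" using k by (simp add: m_def)
      ultimately have "x \<in> C k" using 3 by (auto simp: X_def)
      then obtain A B where AB: "(A, B) \<in> \<R> k" "x \<in> A" using \<R>(3)[of k] by auto
      have "measure N B \<le> measure N (Pair x -` R)"
        using AB \<open>k < m\<close> bR by (intro N.finite_measure_mono) (auto simp: R_def \<S>_def)
      then have "real k * \<delta> < measure N (Pair x -` R)" using \<R>(2)[OF AB(1)] by simp
      then show ?thesis using diff k 3 by (simp add: algebra_simps)
    qed
  qed
  have "measure M X \<le> (\<Sum>k<m. measure M (G k - C k))"
    unfolding X_def using GC by (intro measure_UNION_le) auto
  also have "\<dots> \<le> (\<Sum>k<m. \<eta>)" using C(3) by (intro sum_mono) (simp add: less_imp_le)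
  finally have MX: "measure M X \<le> m * \<eta>" by simp
  have bER: "E - R \<in> sets borel" using E oR by auto
  have iX: "integrable M (indicat_real X)" using X by (simp add: integrable_indicator_iff M.emeasure_eq_measure)
  have "emeasure prodm (E - R) \<le> (\<integral>\<^sup>+x. ennreal (\<delta> + b * indicator X x) \<partial>M)"
    unfolding emeasure_prod[OF bER] N.emeasure_eq_measure
    by (intro nn_integral_mono ennreal_leI pt)
  also have "\<dots> = ennreal (LINT x|M. \<delta> + b * indicator X x)"
    using iX \<delta> ab by (intro nn_integral_eq_integral) (auto intro!: Bochner_Integration.integrable_add integrable_mult_right)
  also have "(LINT x|M. \<delta> + b * indicator X x) = \<delta> * a + b * measure M X"
    using iX X by (subst Bochner_Integration.integral_add) (auto simp: a_def)
  finally have "measure prodm (E - R) \<le> \<delta> * a + b * measure M X"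
    using \<delta> ab unfolding P.emeasure_eq_measure by (subst (asm) ennreal_le_iff) simp_all
  also have "\<dots> \<le> \<delta> * a + b * (m * \<eta>)" using MX ab by (intro add_left_mono mult_left_mono)
  also have "\<dots> < e"
  proof -
    have "\<delta> * a = e / 4 * (a / (a + 1))" by (simp add: \<delta>_def)
    also have "\<dots> \<le> e / 4 * 1" using ab e by (intro mult_left_mono) auto
    finally have "\<delta> * a \<le> e / 4" by simp
    moreover have "m * \<eta> = e / (4 * (b + 1))" using m(2) by (simp add: \<eta>_def)
    then have "b * (m * \<eta>) = e / 4 * (b / (b + 1))" by simp
    moreover have "e / 4 * (b / (b + 1)) \<le> e / 4 * 1" using ab e by (intro mult_left_mono) auto
    ultimately show ?thesis using e by linarith
  qed
  finally have "measure prodm (E - R) < e" .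
  moreover have "finite \<S>" using \<R>(1) by (simp add: \<S>_def)
  moreover have "\<forall>(A, B)\<in>\<S>. open A \<and> open B \<and> A \<times> B \<subseteq> E"
  proof (intro ballI, split prod.split, intro allI impI)
    fix S A B assume "S \<in> \<S>" "S = (A, B)"
    then obtain k where "(A, B) \<in> \<R> k" by (auto simp: \<S>_def)
    from \<R>(2)[OF this] show "open A \<and> open B \<and> A \<times> B \<subseteq> E" by blast
  qed
  ultimately show ?thesis unfolding R_def by blast
qed

lemma measure_prod_Times:
  assumes "A \<in> sets borel" "B \<in> sets borel" "A \<times> B \<in> sets borel"
  shows "measure prodm (A \<times> B) = measure M A * measure N B"
proof -
  have "emeasure prodm (A \<times> B) = (\<integral>\<^sup>+x. emeasure N B * indicator A x \<partial>M)"
    unfolding emeasure_prod[OF assms(3)] by (intro nn_integral_cong) (auto simp: indicator_def vimage_def)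
  also have "\<dots> = emeasure N B * emeasure M A" using assms by (intro nn_integral_cmult_indicator) simp
  finally show ?thesis
    by (simp add: P.emeasure_eq_measure M.emeasure_eq_measure N.emeasure_eq_measure ennreal_mult[symmetric])
qed

text \<open>By \<open>radon_openI\<close> only open sets matter. Such a set is almost filled by
  finitely many open rectangles, and each of these by the product of compact subsets of its
  sides.\<close>

lemma radon_prod: "radon prodm"
proof (rule radon_openI)
  fix E :: "('a \<times> 'b) set" and e :: real assume E: "open E" and e: "0 < e"
  obtain \<R> where \<R>: "finite \<R>" "\<And>A B. (A, B) \<in> \<R> \<Longrightarrow> open A \<and> open B \<and> A \<times> B \<subseteq> E"
      "measure prodm (E - (\<Union>(A, B)\<in>\<R>. A \<times> B)) < e / 2"
    using open_rectangles_approx[OF E half_gt_zero[OF e]] by fast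
  define n where "n = real (card \<R>) + 1"
  \<comment> \<open>Fewer than \<open>n\<close> rectangles, each losing at most \<eta> times the sum
    of the two total masses, lose at most e/4 together.\<close>
  define \<eta> where "\<eta> = e / (4 * n * (measure M UNIV + measure N UNIV + 1))"
  have n: "0 < n" by (simp add: n_def)
  have MN: "0 < measure M UNIV + measure N UNIV + 1" by (simp add: add_nonneg_pos)
  have \<eta>: "0 < \<eta>" using e n MN by (simp add: \<eta>_def)
  have "\<exists>C. compact C \<and> C \<subseteq> A \<and> measure M (A - C) < \<eta>" if "open A" for A
    by (rule radon_compactE[OF M borel_open[OF that] \<eta>]) blast
  then obtain C where C: "\<And>A. open A \<Longrightarrow> compact (C A) \<and> C A \<subseteq> A \<and> measure M (A - C A) < \<eta>" by metis
  have "\<exists>D. compact D \<and> D \<subseteq> B \<and> measure N (B - D) < \<eta>" if "open B" for B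
    by (rule radon_compactE[OF N borel_open[OF that] \<eta>]) blast
  then obtain D where D: "\<And>B. open B \<Longrightarrow> compact (D B) \<and> D B \<subseteq> B \<and> measure N (B - D B) < \<eta>" by metis
  have rect: "A \<times> B - C A \<times> D B \<in> sets borel \<and> measure prodm (A \<times> B - C A \<times> D B) \<le> \<eta> * (measure M UNIV + measure N UNIV)"
    if "open A" "open B" for A B
  proof -
    have cA: "compact (C A)" "closed (C A)" "measure M (A - C A) \<le> \<eta>" using C[OF that(1)] by (auto intro: compact_imp_closed)
    have cB: "compact (D B)" "closed (D B)" "measure N (B - D B) \<le> \<eta>" using D[OF that(2)] by (auto intro: compact_imp_closed)
    \<comment> \<open>Compact sets are closed, so the differences and the strips over them are open;
      the strips are thus Borel, as \<open>measure_prod_Times\<close> requires.\<close>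
    have o: "open (A - C A)" "open (B - D B)" using that cA cB by (auto intro: open_Diff)
    have "compact (C A \<times> D B)" using cA cB by (intro compact_Times)
    then have b: "A \<times> B - C A \<times> D B \<in> sets borel"
      using borel_open[OF open_Times[OF that]] borel_compact by (metis sets.Diff)
    have "measure prodm (A \<times> B - C A \<times> D B) \<le> measure prodm ((A - C A) \<times> UNIV \<union> UNIV \<times> (B - D B))"
      using o by (intro P.finite_measure_mono) (auto intro!: borel_open open_Un open_Times)
    also have "\<dots> \<le> measure prodm ((A - C A) \<times> UNIV) + measure prodm (UNIV \<times> (B - D B))"
      using o by (intro measure_Un_le) (auto intro!: borel_open open_Times)
    also have "\<dots> = measure M (A - C A) * measure N UNIV + measure M UNIV * measure N (B - D B)"
      using o by (subst (1 2) measure_prod_Times) (auto intro!: borel_open open_Times)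
    also have "\<dots> \<le> \<eta> * measure N UNIV + measure M UNIV * \<eta>"
      using cA cB \<eta> by (intro add_mono mult_mono) auto
    finally show ?thesis using b by (simp add: algebra_simps)
  qed
  define K where "K = (\<Union>(A, B)\<in>\<R>. C A \<times> D B)"
  have "compact (case R of (A, B) \<Rightarrow> C A \<times> D B)" if "R \<in> \<R>" for R
  proof -
    obtain A B where R: "R = (A, B)" by (cases R)
    then have "open A" "open B" using \<R>(2)[of A B] that by simp_all
    then show ?thesis using C[of A] D[of B] by (simp add: R compact_Times)
  qed
  then have K: "compact K" unfolding K_def using \<R>(1) by (intro compact_UN) simp_all
  have KE: "K \<subseteq> E"
  proof
    fix z assume "z \<in> K"
    then obtain A B where AB: "(A, B) \<in> \<R>" "z \<in> C A \<times> D B" unfolding K_def by blast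
    note R = \<R>(2)[OF AB(1)]
    have "C A \<subseteq> A" "D B \<subseteq> B" using C[of A] D[of B] R by simp_all
    then have "z \<in> A \<times> B" using AB(2) by auto
    then show "z \<in> E" using R by auto
  qed
  let ?R = "\<Union>(A, B)\<in>\<R>. A \<times> B"
  let ?X = "\<Union>(A, B)\<in>\<R>. A \<times> B - C A \<times> D B"
  have oR: "open ?R" using \<R>(2) by (intro open_UN) (auto intro: open_Times)
  have bX: "?X \<in> sets borel" using \<R> rect by (intro sets.finite_UN) auto
  have "measure prodm ?X \<le> (\<Sum>R\<in>\<R>. measure prodm (case R of (A, B) \<Rightarrow> A \<times> B - C A \<times> D B))"
    using \<R>(1,2) rect by (intro measure_UNION_le) auto
  also have "\<dots> \<le> (\<Sum>R\<in>\<R>. \<eta> * (measure M UNIV + measure N UNIV))"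
    using \<R>(2) rect by (intro sum_mono) auto
  also have "\<dots> \<le> n * (\<eta> * (measure M UNIV + measure N UNIV + 1))"
    using \<eta> by (simp add: n_def) (intro mult_mono; simp add: mult_left_mono)
  also have "\<dots> = e / 4" using n MN by (simp add: \<eta>_def)
  finally have X: "measure prodm ?X \<le> e / 4" .
  have "measure prodm (E - K) \<le> measure prodm ((E - ?R) \<union> ?X)"
    using E oR bX by (intro P.finite_measure_mono) (auto simp: K_def)
  also have "\<dots> \<le> measure prodm (E - ?R) + measure prodm ?X"
    using E oR bX by (intro measure_Un_le) auto
  also have "\<dots> < e" using \<R>(3) X e by linarith
  finally show "\<exists>K. compact K \<and> K \<subseteq> E \<and> measure prodm (E - K) < e" using K KE by blast
qed (auto intro: P.finite_measure_axioms)

text \<open>A finite union of open rectangles lies in the product sigma-algebra, where the classical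
  theorem reverses the order of integration; the rest of \<open>E\<close> has measure below
  \<open>e\<close>.\<close>

lemma emeasure_prod_open_le:
  assumes E: "open E"
  shows "emeasure prodm E \<le> (\<integral>\<^sup>+y. emeasure M ((\<lambda>x. (x, y)) -` E) \<partial>N)"
proof (rule ennreal_le_epsilon)
  interpret pair_sigma_finite M N by unfold_locales
  fix e :: real assume e: "0 < e"
  obtain \<R> where \<R>: "finite \<R>" "\<And>A B. (A, B) \<in> \<R> \<Longrightarrow> open A \<and> open B \<and> A \<times> B \<subseteq> E"
      "measure prodm (E - (\<Union>(A, B)\<in>\<R>. A \<times> B)) < e"
    using open_rectangles_approx[OF E e] by fast
  let ?R = "\<Union>(A, B)\<in>\<R>. A \<times> B"
  have RE: "?R \<subseteq> E" using \<R>(2) by fast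
  have oR: "open ?R" using \<R>(2) by (intro open_UN) (auto intro: open_Times)
  have R: "?R \<in> sets (M \<Otimes>\<^sub>M N)" using \<R>(1,2) by (intro sets.finite_UN) (auto intro!: pair_measureI)
  have "emeasure prodm E = emeasure prodm ?R + emeasure prodm (E - ?R)"
    using E oR RE by (subst plus_emeasure) (auto simp: Un_absorb1)
  also have "emeasure prodm ?R = (\<integral>\<^sup>+y. emeasure M ((\<lambda>x. (x, y)) -` ?R) \<partial>N)"
    using oR by (simp add: emeasure_prod N.emeasure_pair_measure_alt[OF R, symmetric] emeasure_pair_measure_alt2[OF R, symmetric])
  also have "\<dots> \<le> (\<integral>\<^sup>+y. emeasure M ((\<lambda>x. (x, y)) -` E) \<partial>N)"
    using RE E vimage_Pair_borel(2)[of E] by (intro nn_integral_mono emeasure_mono) auto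
  also have "emeasure prodm (E - ?R) \<le> e" using \<R>(3) by (simp add: P.emeasure_eq_measure ennreal_leI)
  finally show "emeasure prodm E \<le> (\<integral>\<^sup>+y. emeasure M ((\<lambda>x. (x, y)) -` E) \<partial>N) + e" by (simp add: add_mono)
qed

end

text \<open>The preceding inequality, applied to an open set and to its reflection, gives equality
  on open sets, which generate the Borel sets and are stable under intersection.\<close>

lemma radon_prod_swap:
  fixes M :: "'a::t2_space measure" and N :: "'b::t2_space measure"
  assumes M: "radon M" and N: "radon N"
  shows "radon_pair.prodm M N = distr (radon_pair.prodm N M) borel prod.swap"
proof -
  interpret A: radon_pair M N by unfold_locales fact+
  interpret B: radon_pair N M by unfold_locales fact+
  have c: "continuous_on UNIV (prod.swap :: 'b \<times> 'a \<Rightarrow> _)" "continuous_on UNIV (prod.swap :: 'a \<times> 'b \<Rightarrow> _)"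
    by (rule continuous_on_swap)+
  have m: "prod.swap \<in> measurable B.prodm borel"
    using borel_measurable_continuous_onI[OF c(1)] by (simp add: measurable_cong_sets[OF B.sets_prod refl])
  show ?thesis
  proof (rule measure_eqI_generator_eq[of "{U. open U}" UNIV])
    show "Int_stable {U :: ('a \<times> 'b) set. open U}" by (auto simp: Int_stable_def)
    fix E :: "('a \<times> 'b) set" assume "E \<in> {U. open U}"
    then have E: "open E" by simp
    have oS: "open (prod.swap -` E)" using c(1) E by (metis continuous_on_open_vimage open_UNIV Int_UNIV_right)
    have s: "Pair y -` prod.swap -` E = (\<lambda>x. (x, y)) -` E" "(\<lambda>y. (y, x)) -` prod.swap -` E = Pair x -` E" for x y by auto
    have "emeasure (distr B.prodm borel prod.swap) E = emeasure B.prodm (prod.swap -` E)"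
      using E m by (simp add: emeasure_distr)
    moreover have "emeasure A.prodm E \<le> emeasure B.prodm (prod.swap -` E)"
      using A.emeasure_prod_open_le[OF E] oS by (simp add: B.emeasure_prod s)
    moreover have "emeasure B.prodm (prod.swap -` E) \<le> emeasure A.prodm E"
      using B.emeasure_prod_open_le[OF oS] E unfolding s by (simp add: A.emeasure_prod)
    ultimately show "emeasure A.prodm E = emeasure (distr B.prodm borel prod.swap) E" by simp
  next
    show "range (\<lambda>_::nat. UNIV) \<subseteq> {U :: ('a \<times> 'b) set. open U}" by auto
  qed (auto simp: borel_def)
qed

lemma integral_radon_prod_swap:
  fixes M :: "'a::t2_space measure" and N :: "'b::t2_space measure" and f :: "'a \<times> 'b \<Rightarrow> 'f::euclidean_space"
  assumes M: "radon M" and N: "radon N" and f: "integrable (radon_pair.prodm M N) f"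
  shows "AE y in N. integrable M (\<lambda>x. f (x, y))"
    and "integrable N (\<lambda>y. LINT x|M. f (x, y))"
    and "(LINT z|radon_pair.prodm M N. f z) = (LINT y|N. LINT x|M. f (x, y))"
proof -
  interpret A: radon_pair M N by unfold_locales fact+
  interpret B: radon_pair N M by unfold_locales fact+
  have m: "prod.swap \<in> measurable B.prodm (borel :: ('a \<times> 'b) measure)"
    using borel_measurable_continuous_onI[OF continuous_on_swap] by (simp add: measurable_cong_sets[OF B.sets_prod refl])
  have fm: "f \<in> borel_measurable borel" using borel_measurable_integrable[OF f] by simp
  have i: "integrable B.prodm (\<lambda>z. f (prod.swap z))"
    using f unfolding radon_prod_swap[OF M N] using m fm by (simp add: integrable_distr_eq)
  show "AE y in N. integrable M (\<lambda>x. f (x, y))" "integrable N (\<lambda>y. LINT x|M. f (x, y))"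
    using B.integral_prod(1,2)[OF i] by auto
  have "(LINT z|A.prodm. f z) = (LINT z|B.prodm. f (prod.swap z))"
    unfolding radon_prod_swap[OF M N] using m fm by (simp add: integral_distr)
  then show "(LINT z|A.prodm. f z) = (LINT y|N. LINT x|M. f (x, y))"
    using B.integral_prod(3)[OF i] by simp
qed

lemma nn_integral_radon_swap:
  fixes M :: "'a::t2_space measure" and N :: "'b::t2_space measure" and f :: "'a \<times> 'b \<Rightarrow> ennreal"
  assumes M: "radon M" and N: "radon N" and f: "f \<in> borel_measurable borel"
  shows "(\<integral>\<^sup>+x. (\<integral>\<^sup>+y. f (x, y) \<partial>N) \<partial>M) = (\<integral>\<^sup>+y. (\<integral>\<^sup>+x. f (x, y) \<partial>M) \<partial>N)"
proof -
  interpret A: radon_pair M N by unfold_locales fact+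
  interpret B: radon_pair N M by unfold_locales fact+
  have c: "prod.swap \<in> measurable borel (borel :: ('a \<times> 'b) measure)"
    by (rule borel_measurable_continuous_onI[OF continuous_on_swap])
  then have m: "prod.swap \<in> measurable B.prodm (borel :: ('a \<times> 'b) measure)"
    by (simp add: measurable_cong_sets[OF B.sets_prod refl])
  have "(\<integral>\<^sup>+z. f z \<partial>A.prodm) = (\<integral>\<^sup>+z. f (prod.swap z) \<partial>B.prodm)"
    unfolding radon_prod_swap[OF M N] using m f by (simp add: nn_integral_distr)
  then show ?thesis
    using A.nn_integral_prod(2)[OF f] B.nn_integral_prod(2)[of "\<lambda>z. f (prod.swap z)"] measurable_compose[OF c f] by simp
qed

section \<open>Convolution\<close>

lemma (in radon_pair) AE_prodI:
  assumes Q: "{z. \<not> Q z} \<in> sets borel" and ae: "AE x in M. AE y in N. Q (x, y)"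
  shows "AE z in prodm. Q z"
proof -
  have "emeasure prodm {z. \<not> Q z} = (\<integral>\<^sup>+x. 0 \<partial>M)"
    unfolding emeasure_prod[OF Q]
  proof (rule nn_integral_cong_AE)
    show "AE x in M. emeasure N (Pair x -` {z. \<not> Q z}) = 0"
      using ae
    proof eventually_elim
      case (elim x)
      then show ?case
        using vimage_Pair_borel(1)[OF Q, of x] by (subst (asm) AE_iff_measurable[OF _ refl]) (auto simp: vimage_def)
    qed
  qed
  then show ?thesis using Q by (subst AE_iff_measurable[OF _ refl]) auto
qed

text \<open>The projections are measurable for the Borel sets of the product space, which may be
  more than the product sigma-algebra.\<close>

lemma borel_measurable_fst_snd [measurable]:
  "fst \<in> measurable (borel :: ('a::topological_space \<times> 'b::topological_space) measure) borel"
  "snd \<in> measurable (borel :: ('a::topological_space \<times> 'b::topological_space) measure) borel"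
  by (intro borel_measurable_continuous_onI continuous_intros)+

lemma tv_density_borel:
  fixes \<mu> :: "'a::topological_space set \<Rightarrow> 'f::{real_normed_field,euclidean_space}"
  assumes "vector_measure \<mu>" shows "tv_density \<mu> \<in> borel_measurable borel"
  using borel_measurable_integrable[OF integrable_tv_density[OF assms]] by simp

text \<open>The image under addition of the product of the two variations, weighted by the product
  of the densities: the candidate for the measure that \<open>convolution\<close> describes.\<close>

definition conv_fun :: "('a::{topological_group_add,t2_space} set \<Rightarrow> 'f::{real_normed_field,euclidean_space}) \<Rightarrow> ('a set \<Rightarrow> 'f) \<Rightarrow> 'a set \<Rightarrow> 'f" where
  "conv_fun \<mu> \<nu> A = (if A \<in> sets borel
     then LINT z|radon_pair.prodm (tv \<mu>) (tv \<nu>). indicator A (fst z + snd z) *\<^sub>R (tv_density \<mu> (fst z) * tv_density \<nu> (snd z))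
     else 0)"

locale regular_pair =
  fixes \<mu> \<nu> :: "'a::{topological_group_add,t2_space} set \<Rightarrow> 'f::{real_normed_field,euclidean_space}"
  assumes \<mu>: "\<mu> \<in> regular_measures" and \<nu>: "\<nu> \<in> regular_measures"
begin

lemmas \<mu>v = regular_measuresD(1)[OF \<mu>] and \<nu>v = regular_measuresD(1)[OF \<nu>]

sublocale radon_pair "tv \<mu>" "tv \<nu>"
  using regular_measuresD[OF \<mu>] regular_measuresD[OF \<nu>] by unfold_locales

definition H :: "'a \<times> 'a \<Rightarrow> 'f" where "H z = tv_density \<mu> (fst z) * tv_density \<nu> (snd z)"

lemma H_borel [measurable]: "H \<in> borel_measurable borel"
  unfolding H_def using tv_density_borel[OF \<mu>v] tv_density_borel[OF \<nu>v] by measurable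

lemma norm_H_le: "AE z in prodm. norm (H z) \<le> 1"
proof (rule AE_prodI)
  have "{z. norm (H z) \<le> 1} \<in> sets borel" by measurable
  then show "{z. \<not> norm (H z) \<le> 1} \<in> sets borel" by measurable
  show "AE x in tv \<mu>. AE y in tv \<nu>. norm (H (x, y)) \<le> 1"
    using norm_tv_density_le[OF \<mu>v]
  proof eventually_elim
    case (elim x)
    show ?case using norm_tv_density_le[OF \<nu>v]
      by eventually_elim (use elim in \<open>auto simp: H_def norm_mult intro: mult_le_one\<close>)
  qed
qed

lemma add_borel [measurable]: "(\<lambda>z. fst z + snd z :: 'a) \<in> measurable borel borel"
  by (intro borel_measurable_continuous_onI continuous_intros)

lemma add_borel' [measurable]: "(\<lambda>z. fst z + snd z :: 'a) \<in> measurable prodm borel"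
  by measurable

text \<open>The image of the product measure under addition is Radon and dominates
  \<open>conv_fun \<mu> \<nu>\<close>, which is therefore regular.\<close>

lemma conv_fun_regular: "conv_fun \<mu> \<nu> \<in> regular_measures"
  and vm_integral_conv_fun: "\<And>f. integrable prodm (\<lambda>z. f (fst z + snd z)) \<Longrightarrow> f \<in> borel_measurable borel \<Longrightarrow>
    vm_integral (conv_fun \<mu> \<nu>) f = (LINT z|prodm. f (fst z + snd z) * H z)"
proof -
  have Hm: "H \<in> borel_measurable prodm" by simp
  have Hi: "integrable prodm H"
    using norm_H_le by (intro P.integrable_const_bound[where B=1]) auto
  have v: "vector_measure (conv_fun \<mu> \<nu>)"
    using vector_measure_pushforward[OF add_borel' Hi] unfolding conv_fun_def H_def by simp
  have eq: "conv_fun \<mu> \<nu> A = (LINT z|prodm. indicator A (fst z + snd z) *\<^sub>R H z)" if "A \<in> sets borel" for A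
    using that by (simp add: conv_fun_def H_def)
  note pf = vm_integral_pushforward[OF v P.finite_measure_axioms add_borel' Hm norm_H_le eq]
  show "conv_fun \<mu> \<nu> \<in> regular_measures"
    by (rule regular_measuresI[OF v radon_distr[OF radon_prod] pf(1)]) (intro continuous_intros)
  show "vm_integral (conv_fun \<mu> \<nu>) f = (LINT z|prodm. f (fst z + snd z) * H z)"
    if "integrable prodm (\<lambda>z. f (fst z + snd z))" "f \<in> borel_measurable borel" for f
    by (rule pf(2)) (use that in auto)
qed

text \<open>The right-hand order of integration is the one in the definition of
  \<open>convolution\<close>; the left-hand one matches the composition of operators, in which \<mu>
  acts last.\<close>

lemma
  assumes f: "integrable prodm (\<lambda>z. f (fst z + snd z))" "f \<in> borel_measurable borel"
  shows vm_integral_conv_fun_left: "vm_integral (conv_fun \<mu> \<nu>) f = vm_integral \<mu> (\<lambda>s. vm_integral \<nu> (\<lambda>t. f (s + t)))"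
    and vm_integral_conv_fun_right: "vm_integral (conv_fun \<mu> \<nu>) f = vm_integral \<nu> (\<lambda>t. vm_integral \<mu> (\<lambda>s. f (s + t)))"
proof -
  have i: "integrable prodm (\<lambda>z. f (fst z + snd z) * H z)"
    using norm_H_le by (intro integrable_mult_bounded f) auto
  have 1: "(LINT y|tv \<nu>. f (x + y) * H (x, y)) = vm_integral \<nu> (\<lambda>t. f (x + t)) * tv_density \<mu> x" for x
  proof -
    have "(LINT y|tv \<nu>. f (x + y) * H (x, y)) = (LINT y|tv \<nu>. f (x + y) * tv_density \<nu> y * tv_density \<mu> x)"
      by (simp add: H_def ac_simps)
    then show ?thesis by (simp add: vm_integral_def)
  qed
  show "vm_integral (conv_fun \<mu> \<nu>) f = vm_integral \<mu> (\<lambda>s. vm_integral \<nu> (\<lambda>t. f (s + t)))"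
    using integral_prod(3)[OF i] unfolding vm_integral_conv_fun[OF f] by (simp add: 1 vm_integral_def[of \<mu>])
  have 2: "(LINT x|tv \<mu>. f (x + y) * H (x, y)) = vm_integral \<mu> (\<lambda>s. f (s + y)) * tv_density \<nu> y" for y
  proof -
    have "(LINT x|tv \<mu>. f (x + y) * H (x, y)) = (LINT x|tv \<mu>. f (x + y) * tv_density \<mu> x * tv_density \<nu> y)"
      by (simp add: H_def ac_simps)
    then show ?thesis by (simp add: vm_integral_def)
  qed
  show "vm_integral (conv_fun \<mu> \<nu>) f = vm_integral \<nu> (\<lambda>t. vm_integral \<mu> (\<lambda>s. f (s + t)))"
    using integral_radon_prod_swap(3)[OF M N i] unfolding vm_integral_conv_fun[OF f] by (simp add: 2 vm_integral_def[of \<nu>])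
qed

end

section \<open>Functions vanishing at infinity determine a regular measure\<close>

lemma C0_bounded:
  fixes f :: "'a::topological_space \<Rightarrow> 'f::real_normed_field"
  assumes "f \<in> C0" obtains B where "\<And>x. norm (f x) \<le> B"
proof -
  from assms have c: "continuous_on UNIV f" and "\<forall>\<epsilon>>0. \<exists>K. compact K \<and> (\<forall>x. x \<notin> K \<longrightarrow> norm (f x) < \<epsilon>)"
    by (auto simp: C0_def)
  then obtain K where K: "compact K" "\<And>x. x \<notin> K \<Longrightarrow> norm (f x) < 1" by (metis zero_less_one)
  have "compact (f ` K)" using K c by (meson compact_continuous_image continuous_on_subset subset_UNIV)
  then obtain B where "\<And>x. x \<in> K \<Longrightarrow> norm (f x) \<le> B" using compact_imp_bounded by (metis bounded_iff image_eqI)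
  then have "norm (f x) \<le> max B 1" for x using K(2)[of x] by (cases "x \<in> K") force+
  then show ?thesis using that by blast
qed

text \<open>Every point of \<open>K\<close> has a bump function that vanishes off \<open>U\<close>
  and off a neighbourhood inside a compact set. Finitely many of them exceed 1/2 somewhere around
  each point of \<open>K\<close>, so twice their sum, cut off at 1, has the required values. The
  compact \<open>C\<close> is what later puts the function into \<open>C0\<close>.\<close>

lemma locally_compact_Urysohn:
  fixes K U :: "'a::t2_space set"
  assumes lc: "locally_compact_space (euclidean :: 'a topology)" and K: "compact K" and U: "open U" "K \<subseteq> U"
  obtains f :: "'a \<Rightarrow> real" and C where "continuous_on UNIV f" "\<And>x. 0 \<le> f x" "\<And>x. f x \<le> 1" "\<And>x. x \<in> K \<Longrightarrow> f x = 1"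
    "\<And>x. x \<notin> U \<Longrightarrow> f x = 0" "compact C" "\<And>x. x \<notin> C \<Longrightarrow> f x = 0"
proof -
  have "Hausdorff_space (euclidean :: 'a topology)"
    unfolding Hausdorff_space_def disjnt_def
  proof (intro allI impI)
    fix x y :: 'a assume "x \<in> topspace euclidean \<and> y \<in> topspace euclidean \<and> x \<noteq> y"
    then show "\<exists>U V. openin euclidean U \<and> openin euclidean V \<and> x \<in> U \<and> y \<in> V \<and> U \<inter> V = {}"
      using hausdorff[of x y] by auto
  qed
  then have cr: "completely_regular_space (euclidean :: 'a topology)"
    using lc by (intro locally_compact_regular_imp_completely_regular_space) auto
  have "\<forall>x::'a. \<exists>V C. open V \<and> compact C \<and> x \<in> V \<and> V \<subseteq> C"
    using lc by (simp add: locally_compact_space_def)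
  then obtain V C where VC: "\<And>x::'a. open (V x) \<and> x \<in> V x \<and> compact (C x) \<and> V x \<subseteq> C x" by metis
  have "\<exists>g. continuous_on UNIV g \<and> (\<forall>y. 0 \<le> g y \<and> g y \<le> (1::real)) \<and> g x = 1 \<and> (\<forall>y. y \<notin> U \<inter> V x \<longrightarrow> g y = 0)" if "x \<in> K" for x
  proof -
    have cl: "closedin euclidean (- (U \<inter> V x))" "x \<in> topspace euclidean - (- (U \<inter> V x))"
      using U VC[of x] that by auto
    obtain f where f: "continuous_map euclidean (top_of_set {0..1::real}) f" "f x = 0" "f ` (- (U \<inter> V x)) \<subseteq> {1}"
      using cr[unfolded completely_regular_space_def, rule_format, OF conjI[OF cl]] by blast
    have fc: "continuous_on UNIV f" "\<And>y. 0 \<le> f y \<and> f y \<le> 1"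
      using f(1) by (auto simp: continuous_map_in_subtopology)
    have "f y = 1" if "y \<notin> U \<inter> V x" for y using f(3) that by blast
    with fc f(2) show ?thesis
      by (intro exI[of _ "\<lambda>y. 1 - f y"]) (auto intro!: continuous_intros)
  qed
  then obtain g where g: "\<And>x. x \<in> K \<Longrightarrow> continuous_on UNIV (g x)" "\<And>x y. x \<in> K \<Longrightarrow> 0 \<le> g x y \<and> g x y \<le> (1::real)"
    "\<And>x. x \<in> K \<Longrightarrow> g x x = 1" "\<And>x y. x \<in> K \<Longrightarrow> y \<notin> U \<inter> V x \<Longrightarrow> g x y = 0" by metis
  have o: "open {y. 1/2 < g x y}" if "x \<in> K" for x
    using g(1)[OF that] by (intro open_Collect_less continuous_intros)
  obtain D where D: "D \<subseteq> K" "finite D" "K \<subseteq> (\<Union>x\<in>D. {y. 1/2 < g x y})"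
    by (rule compactE_image[OF K, of K "\<lambda>x. {y. 1/2 < g x y}"]) (use o g(3) in auto)
  show ?thesis
  proof (rule that[of "\<lambda>y. min 1 (\<Sum>x\<in>D. 2 * g x y)" "\<Union>x\<in>D. C x"])
    show "continuous_on UNIV (\<lambda>y. min 1 (\<Sum>x\<in>D. 2 * g x y))" using g(1) D(1) by (intro continuous_intros) auto
    have pos: "0 \<le> 2 * g x y" if "x \<in> D" for x y using g(2)[of x y] D(1) that by auto
    show "0 \<le> min 1 (\<Sum>x\<in>D. 2 * g x y)" for y using pos by (auto intro: sum_nonneg)
    show "min 1 (\<Sum>x\<in>D. 2 * g x y) = 1" if y: "y \<in> K" for y
    proof -
      obtain x where x: "x \<in> D" "1/2 < g x y" using D(3) y by blast
      then have "1 \<le> 2 * g x y" by simp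
      also have "\<dots> \<le> (\<Sum>x\<in>D. 2 * g x y)" using x D(2) pos by (intro member_le_sum) auto
      finally show ?thesis by simp
    qed
    have z: "g x y = 0" if "y \<notin> U \<or> y \<notin> (\<Union>x\<in>D. C x)" "x \<in> D" for x y
      using that VC[of x] D(1) by (intro g(4)) auto
    show "min 1 (\<Sum>x\<in>D. 2 * g x y) = 0" if "y \<notin> U" for y
      using z that by simp
    show "min 1 (\<Sum>x\<in>D. 2 * g x y) = 0" if "y \<notin> (\<Union>x\<in>D. C x)" for y
      using z[OF disjI2[OF that]] by simp
    show "compact (\<Union>x\<in>D. C x)" using D(2) VC by (intro compact_UN) auto
  qed auto
qed

lemma radon_openE:
  fixes N :: "'a::t2_space measure"
  assumes "radon N" "A \<in> sets borel" "0 < e"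
  obtains U where "open U" "A \<subseteq> U" "measure N (U - A) < e"
proof -
  obtain K where K: "compact K" "K \<subseteq> - A" "measure N (- A - K) < e"
    using radon_compactE[OF assms(1), of "- A" e] assms by (metis borel_comp)
  have "- A - K = - K - A" by auto
  then show ?thesis using K compact_imp_closed[OF K(1)] by (intro that[of "- K"]) auto
qed

text \<open>For compact \<open>K\<close>, a Urysohn function that vanishes off a small neighbourhood
  has integrals close to \<mu> K and \<nu> K. Inner regularity passes from compact to Borel
  sets.\<close>

lemma regular_measures_eqI:
  fixes \<mu> \<nu> :: "'a::t2_space set \<Rightarrow> 'f::{real_normed_field,euclidean_space}"
  assumes lc: "locally_compact_space (euclidean :: 'a topology)"
    and \<mu>: "\<mu> \<in> regular_measures" and \<nu>: "\<nu> \<in> regular_measures"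
    and eq: "\<And>f. f \<in> C0 \<Longrightarrow> vm_integral \<mu> f = vm_integral \<nu> f"
  shows "\<mu> = \<nu>"
proof -
  note \<mu>v = regular_measuresD[OF \<mu>] and \<nu>v = regular_measuresD[OF \<nu>]
  have K: "\<mu> K = \<nu> K" if K: "compact K" for K
  proof (rule ccontr)
    assume ne: "\<mu> K \<noteq> \<nu> K"
    \<comment> \<open>Half the distance: two errors, each below \<open>e\<close>, cannot add up to
      it.\<close>
    define e where "e = norm (\<mu> K - \<nu> K) / 2"
    have e: "0 < e" using ne by (simp add: e_def)
    have bK: "K \<in> sets borel" using K by (rule borel_compact)
    obtain U1 where U1: "open U1" "K \<subseteq> U1" "measure (tv \<mu>) (U1 - K) < e" using radon_openE[OF \<mu>v(2) bK e] .
    obtain U2 where U2: "open U2" "K \<subseteq> U2" "measure (tv \<nu>) (U2 - K) < e" using radon_openE[OF \<nu>v(2) bK e] .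
    have "open (U1 \<inter> U2)" "K \<subseteq> U1 \<inter> U2" using U1 U2 by auto
    then obtain f :: "'a \<Rightarrow> real" and C where f: "continuous_on UNIV f" "\<And>x. 0 \<le> f x" "\<And>x. f x \<le> 1" "\<And>x. x \<in> K \<Longrightarrow> f x = 1"
      "\<And>x. x \<notin> U1 \<inter> U2 \<Longrightarrow> f x = 0" "compact C" "\<And>x. x \<notin> C \<Longrightarrow> f x = 0"
      using locally_compact_Urysohn[OF lc K] by metis
    let ?f = "\<lambda>x. of_real (f x) :: 'f"
    have f0: "?f \<in> C0" using f by (auto simp: C0_def intro!: continuous_intros exI[of _ C])
    \<comment> \<open>Each measure has its own open set \<open>U\<close>; the function vanishes off
      the intersection of the two, so that it serves both.\<close>
    have close: "norm (vm_integral \<rho> ?f - \<rho> K) < e"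
      if \<rho>: "vector_measure \<rho>" and U: "open U" "U1 \<inter> U2 \<subseteq> U" "measure (tv \<rho>) (U - K) < e" for \<rho> :: "'a set \<Rightarrow> 'f" and U
    proof -
      interpret finite_measure "tv \<rho>" by (rule finite_measure_tv[OF \<rho>])
      have [measurable]: "f \<in> borel_measurable borel" using f(1) by (rule borel_measurable_continuous_onI)
      have [measurable]: "K \<in> sets borel" "U - K \<in> sets borel" using bK U by auto
      have i: "integrable (tv \<rho>) ?f" "integrable (tv \<rho>) (\<lambda>x. - (indicat_real K x *\<^sub>R (1 :: 'f)))"
        using f(2,3) by (intro integrable_const_bound[where B=1]; auto simp: indicator_def)+
      have L: "L1_functional (tv \<rho>) (vm_integral \<rho>)" by (rule vm_integral_functional[OF \<rho>]) auto
      have "vm_integral \<rho> (\<lambda>x. - (indicat_real K x *\<^sub>R (1 :: 'f))) = - \<rho> K"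
        using vm_integral_indicator[OF \<rho> bK, of "-1"] by simp
      then have "vm_integral \<rho> ?f - \<rho> K = vm_integral \<rho> (\<lambda>x. ?f x + - (indicat_real K x *\<^sub>R 1))"
        unfolding L1_functional_plus[OF L i] by simp
      also have "norm \<dots> \<le> (LINT x|tv \<rho>. norm (?f x + - (indicat_real K x *\<^sub>R 1)))"
        using i by (intro norm_vm_integral_le[OF \<rho>] Bochner_Integration.integrable_add)
      also have "\<dots> \<le> (LINT x|tv \<rho>. indicator (U - K) x)"
      proof (intro integral_mono integrable_norm Bochner_Integration.integrable_add i)
        show "integrable (tv \<rho>) (indicat_real (U - K))" by (simp add: integrable_indicator_iff emeasure_eq_measure)
        fix x show "norm (?f x + - (indicat_real K x *\<^sub>R 1)) \<le> indicat_real (U - K) x"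
          using f(2,3,4,5)[of x] U(2) by (cases "x \<in> K"; cases "x \<in> U1 \<inter> U2") (auto simp: indicator_def)
      qed
      also have "\<dots> = measure (tv \<rho>) (U - K)" by simp
      finally show ?thesis using U by simp
    qed
    have "norm (vm_integral \<mu> ?f - \<mu> K) < e" using \<mu>v(1) U1 by (intro close) auto
    moreover have "norm (vm_integral \<nu> ?f - \<nu> K) < e" using \<nu>v(1) U2 by (intro close) auto
    ultimately have "norm ((vm_integral \<mu> ?f - \<mu> K) - (vm_integral \<nu> ?f - \<nu> K)) < e + e"
      using norm_triangle_ineq4[of "vm_integral \<mu> ?f - \<mu> K" "vm_integral \<nu> ?f - \<nu> K"] by linarith
    then show False using eq[OF f0] by (simp add: e_def norm_minus_commute)
  qed
  show ?thesis
  proof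
    fix A show "\<mu> A = \<nu> A"
    proof (cases "A \<in> sets borel")
      case False then show ?thesis using \<mu>v(1) \<nu>v(1) by (simp add: vector_measure_nonborel)
    next
      case A: True
      show ?thesis
      proof (rule ccontr)
        assume ne: "\<mu> A \<noteq> \<nu> A"
        define e where "e = norm (\<mu> A - \<nu> A) / 2"
        have e: "0 < e" using ne by (simp add: e_def)
        obtain K1 where K1: "compact K1" "K1 \<subseteq> A" "measure (tv \<mu>) (A - K1) < e" using radon_compactE[OF \<mu>v(2) A e] .
        obtain K2 where K2: "compact K2" "K2 \<subseteq> A" "measure (tv \<nu>) (A - K2) < e" using radon_compactE[OF \<nu>v(2) A e] .
        \<comment> \<open>The union is still compact and inside \<open>A\<close>, and it
          approximates \<open>A\<close> for both measures at once.\<close>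
        let ?K = "K1 \<union> K2"
        have cK: "compact ?K" "?K \<in> sets borel" using K1 K2 by (auto intro: borel_compact)
        have close: "norm (\<rho> A - \<rho> ?K) < e" if \<rho>: "vector_measure \<rho>" and L: "compact L" "L \<subseteq> ?K" "measure (tv \<rho>) (A - L) < e" for \<rho> :: "'a set \<Rightarrow> 'f" and L
        proof -
          interpret finite_measure "tv \<rho>" by (rule finite_measure_tv[OF \<rho>])
          have "norm (\<rho> A - \<rho> ?K) = norm (\<rho> (A - ?K))"
            using K1 K2 cK A by (subst vector_measure_Diff[OF \<rho>]) auto
          also have "\<dots> \<le> measure (tv \<rho>) (A - ?K)" by (rule norm_le_tv[OF \<rho>])
          also have "\<dots> \<le> measure (tv \<rho>) (A - L)"
            using A L borel_compact[OF L(1)] by (intro finite_measure_mono) auto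
          finally show ?thesis using L by simp
        qed
        have "norm (\<mu> A - \<mu> ?K) < e" by (rule close[OF \<mu>v(1) K1(1) _ K1(3)]) simp
        moreover have "norm (\<nu> A - \<nu> ?K) < e" by (rule close[OF \<nu>v(1) K2(1) _ K2(3)]) simp
        ultimately have "norm ((\<mu> A - \<mu> ?K) - (\<nu> A - \<nu> ?K)) < e + e"
          using norm_triangle_ineq4[of "\<mu> A - \<mu> ?K" "\<nu> A - \<nu> ?K"] by linarith
        then show False using K[OF cK(1)] by (simp add: e_def)
      qed
    qed
  qed
qed

text \<open>\<open>conv_fun\<close> gives existence in the description of
  \<open>convolution\<close>, and the separation of regular measures by \<open>C0\<close> gives
  uniqueness.\<close>

lemma convolution_eq:
  fixes \<mu> \<nu> :: "'a::{topological_group_add,t2_space} set \<Rightarrow> 'f::{real_normed_field,euclidean_space}"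
  assumes lc: "locally_compact_space (euclidean :: 'a topology)"
    and \<mu>: "\<mu> \<in> regular_measures" and \<nu>: "\<nu> \<in> regular_measures"
  shows "convolution \<mu> \<nu> = conv_fun \<mu> \<nu>"
proof -
  interpret regular_pair \<mu> \<nu> by unfold_locales fact+
  have eq: "vm_integral (conv_fun \<mu> \<nu>) f = vm_integral \<nu> (\<lambda>t. vm_integral \<mu> (\<lambda>s. f (s + t)))" if f: "f \<in> C0" for f
  proof (rule vm_integral_conv_fun_right)
    show fb: "f \<in> borel_measurable borel" using f by (auto simp: C0_def intro: borel_measurable_continuous_onI)
    obtain B where "\<And>x. norm (f x) \<le> B" using C0_bounded[OF f] by blast
    then show "integrable prodm (\<lambda>z. f (fst z + snd z))"
      using fb by (intro P.integrable_const_bound[where B=B]) auto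
  qed
  show ?thesis unfolding convolution_def
  proof (rule the_equality)
    fix \<rho> assume "\<rho> \<in> regular_measures \<and> (\<forall>f\<in>C0. vm_integral \<rho> f = vm_integral \<nu> (\<lambda>t. vm_integral \<mu> (\<lambda>s. f (s + t))))"
    then show "\<rho> = conv_fun \<mu> \<nu>"
      using eq by (intro regular_measures_eqI[OF lc _ conv_fun_regular]) auto
  qed (use conv_fun_regular eq in auto)
qed

section \<open>Translates and Haar measure\<close>

locale haar =
  fixes m :: "'a::{topological_group_add,t2_space} measure"
  assumes lc: "locally_compact_space (euclidean :: 'a topology)" and haar: "left_haar_measure m"
begin

lemma sets_m [simp, measurable_cong]: "sets m = sets borel"
  using haar by (simp add: left_haar_measure_def)

lemma space_m [simp]: "space m = UNIV"
  using sets_eq_imp_space_eq[OF sets_m] by simp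

lemma borel_measurable_m [simp]: "borel_measurable m = borel_measurable borel"
  by (rule measurable_cong_sets) auto

lemma outer_regular:
  assumes "A \<in> sets borel" "emeasure m A < c"
  obtains U where "open U" "A \<subseteq> U" "emeasure m U < c"
proof -
  have "emeasure m A = (INF U\<in>{U. open U \<and> A \<subseteq> U}. emeasure m U)"
    using haar assms(1) by (simp add: left_haar_measure_def)
  then have "(INF U\<in>{U. open U \<and> A \<subseteq> U}. emeasure m U) < c" using assms(2) by metis
  then show ?thesis using that unfolding INF_less_iff by blast
qed

lemma inner_regular: "open U \<Longrightarrow> emeasure m U = (SUP K\<in>{K. compact K \<and> K \<subseteq> U}. emeasure m K)"
  using haar unfolding left_haar_measure_def by blast

lemma emeasure_compact_finite: "compact K \<Longrightarrow> emeasure m K < \<infinity>"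
  using haar by (simp add: left_haar_measure_def)

lemma emeasure_translate:
  assumes "A \<in> sets borel" shows "emeasure m {s. - t + s \<in> A} = emeasure m A"
proof -
  have "{s. - t + s \<in> A} = (+) t ` A"
  proof (intro set_eqI iffI)
    fix s assume "s \<in> {s. - t + s \<in> A}"
    then show "s \<in> (+) t ` A" by (intro image_eqI[of _ _ "- t + s"]) (auto simp: add.assoc[symmetric])
  qed (auto simp: add.assoc[symmetric])
  then show ?thesis using haar assms by (simp add: left_haar_measure_def)
qed

text \<open>The Haar measure need not be sigma-finite. Restricted to an open set of finite measure
  it becomes a finite Radon measure, to which the product construction applies.\<close>

definition restr :: "'a set \<Rightarrow> 'a measure" where "restr V = density m (indicator V)"

lemma emeasure_restr: "V \<in> sets borel \<Longrightarrow> A \<in> sets borel \<Longrightarrow> emeasure (restr V) A = emeasure m (V \<inter> A)"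
  unfolding restr_def by (subst emeasure_density) (auto simp flip: indicator_inter_arith)

text \<open>The Haar measure is inner regular on the open set V \<inter> U, which gives the
  approximation for open \<open>U\<close>; \<open>radon_openI\<close> extends it to Borel
  sets.\<close>

lemma radon_restr:
  assumes V: "open V" "emeasure m V < \<infinity>"
  shows "radon (restr V)"
proof (rule radon_openI)
  have s: "sets (restr V) = sets borel" "space (restr V) = UNIV" by (auto simp: restr_def)
  show "sets (restr V) = sets borel" by (rule s)
  show fin: "finite_measure (restr V)" using V s by (intro finite_measureI) (simp add: emeasure_restr)
  interpret finite_measure "restr V" by (rule fin)
  fix U :: "'a set" and e :: real assume U: "open U" and e: "0 < e"
  show "\<exists>K. compact K \<and> K \<subseteq> U \<and> measure (restr V) (U - K) < e"
  proof (cases "measure (restr V) U < e")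
    case True then show ?thesis by (intro exI[of _ "{}"]) auto
  next
    case False
    have "ennreal (measure (restr V) U - e) < emeasure (restr V) U"
      using e False by (simp add: emeasure_eq_measure ennreal_less_iff)
    also have "\<dots> = (SUP K\<in>{K. compact K \<and> K \<subseteq> V \<inter> U}. emeasure m K)"
      using U V by (subst inner_regular[symmetric]) (auto simp: emeasure_restr)
    finally obtain K where K: "compact K" "K \<subseteq> V \<inter> U" "ennreal (measure (restr V) U - e) < emeasure m K"
      unfolding less_SUP_iff by auto
    have bK: "K \<in> sets borel" using K(1) by (rule borel_compact)
    have "emeasure m K = emeasure (restr V) K"
      using K V bK by (simp add: emeasure_restr Int_absorb1)
    then have "measure (restr V) U - e < measure (restr V) K"
      using K(3) False by (simp add: emeasure_eq_measure ennreal_less_iff)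
    moreover have "measure (restr V) (U - K) = measure (restr V) U - measure (restr V) K"
      using U K bK s by (intro finite_measure_Diff) auto
    ultimately show ?thesis using K by (intro exI[of _ K]) auto
  qed
qed

lemma shift_borel [measurable]: "(\<lambda>z :: 'a \<times> 'a. - snd z + fst z) \<in> measurable borel borel"
  by (intro borel_measurable_continuous_onI continuous_intros)

lemma shift_borel1 [measurable]: "(\<lambda>t :: 'a. - t + s) \<in> measurable borel borel" "(\<lambda>s :: 'a. - t + s) \<in> measurable borel borel"
  by (intro borel_measurable_continuous_onI continuous_intros)+

lemma shift_vimage_borel:
  fixes s t :: 'a assumes A: "A \<in> sets borel"
  shows "{t. - t + s \<in> A} \<in> sets borel" "{s. - t + s \<in> A} \<in> sets borel"
  using measurable_sets[OF shift_borel1(1)[of s] A] measurable_sets[OF shift_borel1(2)[of t] A] by (auto simp: vimage_def)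

lemma nn_integral_shift_indicator:
  fixes s :: 'a assumes "sets N = sets borel" "A \<in> sets borel"
  shows "(\<integral>\<^sup>+t. indicator A (- t + s) \<partial>N) = emeasure N {t. - t + s \<in> A}"
proof -
  have "(\<integral>\<^sup>+t. indicator A (- t + s) \<partial>N) = (\<integral>\<^sup>+t. indicator {t. - t + s \<in> A} t \<partial>N)"
    by (intro nn_integral_cong) (simp add: indicator_def)
  then show ?thesis using shift_vimage_borel(1)[OF assms(2), of s] assms(1) by simp
qed

section \<open>Integrals of translates\<close>

context
  fixes N :: "'a measure" assumes N: "radon N"
begin

text \<open>The section lemmas of the locale integrate over its second measure; \<open>N\<close>
  fills both places to make them available.\<close>

interpretation radon_pair N N by unfold_locales (rule N)+

lemma measurable_nn_integral_shift:
  fixes g :: "'a \<Rightarrow> ennreal"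
  assumes g: "g \<in> borel_measurable borel"
  shows "(\<lambda>s. \<integral>\<^sup>+t. g (- t + s) \<partial>N) \<in> borel_measurable borel"
  using nn_integral_prod(1)[of "\<lambda>z. g (- snd z + fst z)"] measurable_compose[OF shift_borel g] by simp

text \<open>The set \<open>{t. - t + s \<in> A}\<close> is s - A. Fubini over \<open>V\<close> turns
  the left side into the integral of m (V \<inter> (t + A)) over \<open>t\<close>, and left
  invariance bounds the integrand by m A.\<close>

lemma nn_integral_shift_restr:
  fixes g :: "'a \<Rightarrow> ennreal"
  assumes V: "open V" "emeasure m V < \<infinity>" and A: "A \<in> sets borel"
  shows "(\<integral>\<^sup>+s. emeasure N {t. - t + s \<in> A} * indicator V s \<partial>m) \<le> emeasure N UNIV * emeasure m A"
proof -
  note sh = shift_vimage_borel[OF A]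
  have i: "(\<integral>\<^sup>+t. indicator A (- t + s) \<partial>N) = emeasure N {t. - t + s \<in> A}" for s
    using A by (intro nn_integral_shift_indicator) auto
  have m: "(\<lambda>s. emeasure N {t. - t + s \<in> A}) \<in> borel_measurable borel"
    using measurable_nn_integral_shift[of "indicator A"] A by (simp add: i)
  have "(\<integral>\<^sup>+s. emeasure N {t. - t + s \<in> A} * indicator V s \<partial>m) = (\<integral>\<^sup>+s. emeasure N {t. - t + s \<in> A} \<partial>restr V)"
    unfolding restr_def using V m by (subst nn_integral_density) (auto simp: mult.commute)
  also have "\<dots> = (\<integral>\<^sup>+s. (\<integral>\<^sup>+t. indicator A (- t + s) \<partial>N) \<partial>restr V)" by (simp add: i)
  also have "\<dots> = (\<integral>\<^sup>+t. (\<integral>\<^sup>+s. indicator A (- t + s) \<partial>restr V) \<partial>N)"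
    using nn_integral_radon_swap[OF radon_restr[OF V] N, of "\<lambda>z. indicator A (- snd z + fst z)"]
      measurable_compose[OF shift_borel borel_measurable_indicator[OF A]] by simp
  also have "\<dots> = (\<integral>\<^sup>+t. emeasure m (V \<inter> {s. - t + s \<in> A}) \<partial>N)"
  proof (intro nn_integral_cong)
    fix t
    have "(\<integral>\<^sup>+s. indicator A (- t + s) \<partial>restr V) = (\<integral>\<^sup>+s. indicator {s. - t + s \<in> A} s \<partial>restr V)"
      by (intro nn_integral_cong) (auto simp: indicator_def)
    also have "\<dots> = emeasure (restr V) {s. - t + s \<in> A}" using sh by (intro nn_integral_indicator) (auto simp: restr_def)
    finally show "(\<integral>\<^sup>+s. indicator A (- t + s) \<partial>restr V) = emeasure m (V \<inter> {s. - t + s \<in> A})"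
      using V sh by (simp add: emeasure_restr)
  qed
  also have "\<dots> \<le> (\<integral>\<^sup>+t. emeasure m A \<partial>N)"
  proof (intro nn_integral_mono)
    fix t
    have "emeasure m (V \<inter> {s. - t + s \<in> A}) \<le> emeasure m {s. - t + s \<in> A}" using sh by (intro emeasure_mono) auto
    then show "emeasure m (V \<inter> {s. - t + s \<in> A}) \<le> emeasure m A" by (simp add: emeasure_translate[OF A])
  qed
  finally show ?thesis by (simp add: mult.commute)
qed

text \<open>Chebyshev's inequality bounds the measure of each compact subset of the superlevel set,
  inside some open set of finite measure. The superlevel set is open, so inner regularity carries
  the bound over to it.\<close>

lemma superlevel_finite:
  assumes U: "open U" "emeasure m U < \<infinity>" and c: "0 < c"
  shows "open {s. c < measure N {t. - t + s \<in> U}}" "emeasure m {s. c < measure N {t. - t + s \<in> U}} < \<infinity>"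
proof -
  let ?G = "{s. c < measure N {t. - t + s \<in> U}}"
  let ?E = "(\<lambda>z :: 'a \<times> 'a. - snd z + fst z) -` U"
  have oE: "open ?E" using U(1) by (intro open_vimage continuous_intros)
  have "Pair s -` ?E = {t. - t + s \<in> U}" for s by auto
  then show oG: "open ?G" using open_superlevel_section[OF oE, of c] by simp
  have "emeasure m K \<le> emeasure N UNIV * emeasure m U / c" if K: "compact K" "K \<subseteq> ?G" for K
  proof -
    obtain V where V: "open V" "K \<subseteq> V" "emeasure m V < \<infinity>"
      using outer_regular[OF borel_compact[OF K(1)] emeasure_compact_finite[OF K(1)]] .
    let ?V = "V \<inter> ?G"
    have oV: "open ?V" "emeasure m ?V < \<infinity>"
      using V oG emeasure_mono[of ?V V m] by (auto intro: le_less_trans)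
    have "ennreal c * emeasure m K \<le> ennreal c * emeasure m ?V"
      using V K oV by (intro mult_left_mono emeasure_mono) auto
    also have "\<dots> = (\<integral>\<^sup>+s. ennreal c * indicator ?V s \<partial>m)" using oV by (intro nn_integral_cmult_indicator[symmetric]) auto
    also have "\<dots> \<le> (\<integral>\<^sup>+s. emeasure N {t. - t + s \<in> U} * indicator ?V s \<partial>m)"
      using c by (intro nn_integral_mono) (auto simp: indicator_def M.emeasure_eq_measure intro!: ennreal_leI)
    also have "\<dots> \<le> emeasure N UNIV * emeasure m U" using U by (intro nn_integral_shift_restr oV) auto
    finally have "ennreal c * emeasure m K / ennreal c \<le> emeasure N UNIV * emeasure m U / ennreal c"
      by (rule divide_right_mono_ennreal)
    then show ?thesis using c by (simp add: ennreal_mult_divide_eq mult.commute[of "ennreal c"])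
  qed
  then have "emeasure m ?G \<le> emeasure N UNIV * emeasure m U / c"
    unfolding inner_regular[OF oG] by (intro SUP_least) auto
  also have "\<dots> < \<infinity>" using U c M.emeasure_finite[of UNIV]
    by (auto simp: ennreal_divide_eq_top_iff less_top[symmetric] ennreal_mult_eq_top_iff)
  finally show "emeasure m ?G < \<infinity>" .
qed

text \<open>Let \<open>A\<close> have finite measure and lie in an open \<open>U\<close> of finite
  measure. Then N (s - A) vanishes off the union of the sets \<open>V n\<close>, where N (s - U)
  exceeds 1/(n + 1). These are open, increasing and of finite measure, so the bound over each
  \<open>V n\<close> passes to the limit.\<close>

lemma emeasure_shift_le:
  assumes A: "A \<in> sets borel"
  shows "(\<integral>\<^sup>+s. emeasure N {t. - t + s \<in> A} \<partial>m) \<le> emeasure N UNIV * emeasure m A"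
proof (cases "emeasure m A < \<infinity>")
  case True
  then obtain U where U: "open U" "A \<subseteq> U" "emeasure m U < \<infinity>" using outer_regular[OF A] by blast
  have i: "(\<integral>\<^sup>+t. indicator A (- t + s) \<partial>N) = emeasure N {t. - t + s \<in> A}" for s
    using A by (intro nn_integral_shift_indicator) auto
  have m [measurable]: "(\<lambda>s. emeasure N {t. - t + s \<in> A}) \<in> borel_measurable borel"
    using measurable_nn_integral_shift[of "indicator A"] A by (simp add: i)
  define V where "V n = {s. 1 / real (Suc n) < measure N {t. - t + s \<in> U}}" for n
  have V: "open (V n)" "emeasure m (V n) < \<infinity>" for n
    unfolding V_def using superlevel_finite[OF U(1,3), of "1 / real (Suc n)"] by auto
  have inc: "incseq V"
  proof (intro incseq_SucI subsetI)
    fix n s assume "s \<in> V n"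
    moreover have "1 / real (Suc (Suc n)) \<le> 1 / real (Suc n)" by (intro divide_left_mono) auto
    ultimately show "s \<in> V (Suc n)" unfolding V_def by (simp del: of_nat_Suc)
  qed
  have "emeasure N {t. - t + s \<in> A} = (SUP n. emeasure N {t. - t + s \<in> A} * indicator (V n) s)" for s
  proof (cases "\<exists>n. s \<in> V n")
    case True
    then obtain n where "s \<in> V n" ..
    then have "emeasure N {t. - t + s \<in> A} \<le> (SUP n. emeasure N {t. - t + s \<in> A} * indicator (V n) s)"
      by (intro SUP_upper2[of n]) auto
    moreover have "(SUP n. emeasure N {t. - t + s \<in> A} * indicator (V n) s) \<le> emeasure N {t. - t + s \<in> A}"
      by (intro SUP_least) (auto simp: indicator_def)
    ultimately show ?thesis by (rule antisym)
  next
    case False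
    have "measure N {t. - t + s \<in> U} \<le> 0"
    proof (rule ccontr)
      assume "\<not> measure N {t. - t + s \<in> U} \<le> 0"
      then obtain n where "1 / real (Suc n) < measure N {t. - t + s \<in> U}"
        using nat_approx_posE[of "measure N {t. - t + s \<in> U}"] by auto
      then show False using False by (auto simp: V_def)
    qed
    moreover have "measure N {t. - t + s \<in> A} \<le> measure N {t. - t + s \<in> U}"
      using U shift_vimage_borel(1)[OF borel_open[OF U(1)], of s] by (intro M.finite_measure_mono) auto
    ultimately have "measure N {t. - t + s \<in> A} = 0"
      using measure_nonneg[of N "{t. - t + s \<in> A}"] by linarith
    then have "emeasure N {t. - t + s \<in> A} = 0" by (simp add: M.emeasure_eq_measure)
    then show ?thesis by simp
  qed
  then have "(\<integral>\<^sup>+s. emeasure N {t. - t + s \<in> A} \<partial>m) = (\<integral>\<^sup>+s. (SUP n. emeasure N {t. - t + s \<in> A} * indicator (V n) s) \<partial>m)"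
    by simp
  also have "\<dots> = (SUP n. \<integral>\<^sup>+s. emeasure N {t. - t + s \<in> A} * indicator (V n) s \<partial>m)"
  proof (intro nn_integral_monotone_convergence_SUP)
    show "incseq (\<lambda>n s. emeasure N {t. - t + s \<in> A} * indicator (V n) s)"
      using inc by (auto simp: incseq_def le_fun_def indicator_def)
    show "(\<lambda>s. emeasure N {t. - t + s \<in> A} * indicator (V n) s) \<in> borel_measurable m" for n
      using V(1)[of n] by simp
  qed
  also have "\<dots> \<le> emeasure N UNIV * emeasure m A"
    by (intro SUP_least nn_integral_shift_restr V A)
  finally show ?thesis .
next
  case False
  show ?thesis
  \<comment> \<open>In \<open>ennreal\<close> 0 times infinity is 0, so the zero measure is treated
    apart.\<close>
  proof (cases "emeasure N UNIV = 0")
    case True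
    have "emeasure N B = 0" for B
      using emeasure_mono[of B UNIV N] emeasure_notin_sets[of B N] True by (cases "B \<in> sets N") auto
    then show ?thesis by simp
  next
    case nz: False
    then have "emeasure N UNIV * emeasure m A = \<infinity>"
      using False by (auto simp: ennreal_mult_eq_top_iff not_less top_unique)
    then show ?thesis by simp
  qed
qed

text \<open>The L1-estimate for convolution with \<open>N\<close>, by induction over measurable
  functions from the case of sets. Its main use is with |g|^p in place of \<open>g\<close>.\<close>

lemma nn_integral_shift_le:
  fixes g :: "'a \<Rightarrow> ennreal"
  assumes g: "g \<in> borel_measurable borel"
  shows "(\<integral>\<^sup>+s. (\<integral>\<^sup>+t. g (- t + s) \<partial>N) \<partial>m) \<le> emeasure N UNIV * (\<integral>\<^sup>+s. g s \<partial>m)"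
proof -
  have c: "(\<lambda>t. g (- t + s)) \<in> borel_measurable borel" if "g \<in> borel_measurable borel" for g :: "'a \<Rightarrow> ennreal" and s
    by (rule measurable_compose[OF shift_borel1(1) that])
  show ?thesis using g
  proof (induction)
    case (cong f g) then show ?case by auto
  next
    case (set A)
    have i: "(\<integral>\<^sup>+t. indicator A (- t + s) \<partial>N) = emeasure N {t. - t + s \<in> A}" for s
      using set by (intro nn_integral_shift_indicator) auto
    show ?case using emeasure_shift_le[OF set] set by (simp add: i)
  next
    case (mult u c)
    have eq: "(\<integral>\<^sup>+t. c * u (- t + s) \<partial>N) = c * (\<integral>\<^sup>+t. u (- t + s) \<partial>N)" for s
      using c[OF mult.hyps(2)] by (intro nn_integral_cmult) simp
    have "(\<integral>\<^sup>+s. c * (\<integral>\<^sup>+t. u (- t + s) \<partial>N) \<partial>m) = c * (\<integral>\<^sup>+s. (\<integral>\<^sup>+t. u (- t + s) \<partial>N) \<partial>m)"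
      using measurable_nn_integral_shift[OF mult.hyps(2)] by (intro nn_integral_cmult) simp
    also have "\<dots> \<le> c * (emeasure N UNIV * (\<integral>\<^sup>+s. u s \<partial>m))" using mult.IH by (rule mult_left_mono) simp
    also have "\<dots> = emeasure N UNIV * (\<integral>\<^sup>+s. c * u s \<partial>m)"
      using mult.hyps(2) by (simp add: nn_integral_cmult ac_simps)
    finally show ?case unfolding eq .
  next
    case (add u v)
    have eq: "(\<integral>\<^sup>+t. v (- t + s) + u (- t + s) \<partial>N) = (\<integral>\<^sup>+t. v (- t + s) \<partial>N) + (\<integral>\<^sup>+t. u (- t + s) \<partial>N)" for s
      using c[OF add.hyps(1)] c[OF add.hyps(3)] by (intro nn_integral_add) simp_all
    have "(\<integral>\<^sup>+s. (\<integral>\<^sup>+t. v (- t + s) \<partial>N) + (\<integral>\<^sup>+t. u (- t + s) \<partial>N) \<partial>m)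
      = (\<integral>\<^sup>+s. (\<integral>\<^sup>+t. v (- t + s) \<partial>N) \<partial>m) + (\<integral>\<^sup>+s. (\<integral>\<^sup>+t. u (- t + s) \<partial>N) \<partial>m)"
      using measurable_nn_integral_shift[OF add.hyps(1)] measurable_nn_integral_shift[OF add.hyps(3)] by (intro nn_integral_add) simp_all
    also have "\<dots> \<le> emeasure N UNIV * (\<integral>\<^sup>+s. v s \<partial>m) + emeasure N UNIV * (\<integral>\<^sup>+s. u s \<partial>m)"
      using add.IH by (intro add_mono)
    also have "\<dots> = emeasure N UNIV * (\<integral>\<^sup>+s. v s + u s \<partial>m)"
      using add.hyps by (subst nn_integral_add) (auto simp: distrib_left)
    finally show ?case unfolding eq .
  next
    case (seq U)
    have inc: "incseq (\<lambda>i t. U i (f t))" for f :: "'b \<Rightarrow> 'a" using seq.hyps by (auto simp: incseq_def le_fun_def)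
    have eq: "(\<integral>\<^sup>+t. (SUP i. U i) (- t + s) \<partial>N) = (SUP i. \<integral>\<^sup>+t. U i (- t + s) \<partial>N)" for s
      unfolding SUP_apply using c[OF seq.hyps(1)] inc[of "\<lambda>t. - t + s"] by (intro nn_integral_monotone_convergence_SUP) auto
    have "(\<integral>\<^sup>+s. (SUP i. \<integral>\<^sup>+t. U i (- t + s) \<partial>N) \<partial>m) = (SUP i. \<integral>\<^sup>+s. (\<integral>\<^sup>+t. U i (- t + s) \<partial>N) \<partial>m)"
      using measurable_nn_integral_shift[OF seq.hyps(1)] seq.hyps
      by (intro nn_integral_monotone_convergence_SUP) (auto simp: incseq_def le_fun_def intro!: nn_integral_mono)
    also have "\<dots> \<le> (SUP i. emeasure N UNIV * (\<integral>\<^sup>+s. U i s \<partial>m))" using seq.IH by (intro SUP_mono) auto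
    also have "\<dots> = emeasure N UNIV * (SUP i. \<integral>\<^sup>+s. U i s \<partial>m)" by (simp add: SUP_mult_left_ennreal)
    also have "(SUP i. \<integral>\<^sup>+s. U i s \<partial>m) = (\<integral>\<^sup>+s. (SUP i. U i) s \<partial>m)"
      unfolding SUP_apply using seq.hyps by (intro nn_integral_monotone_convergence_SUP[symmetric]) auto
    finally show ?case unfolding eq .
  qed
qed

end

text \<open>A Haar null set \<open>Z\<close> satisfies N (s - Z) = 0 for almost every
  \<open>s\<close>, by the estimate for sets. This is why \<open>pi_op\<close> does not depend on
  the representative of a class.\<close>

lemma AE_shift:
  assumes N: "radon N" and ae: "AE x in m. Q x"
  shows "AE s in m. AE t in N. Q (- t + s)"
proof -
  interpret N: radon_pair N N by unfold_locales (rule N)+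
  obtain Z where Z: "{x. \<not> Q x} \<subseteq> Z" "Z \<in> null_sets m" using ae by (auto simp: eventually_ae_filter)
  then have ZB: "Z \<in> sets borel" "emeasure m Z = 0" by (auto simp: null_sets_def)
  note sh = shift_vimage_borel(1)[OF ZB(1)]
  have i: "(\<integral>\<^sup>+t. indicator Z (- t + s) \<partial>N) = emeasure N {t. - t + s \<in> Z}" for s
    using ZB by (intro nn_integral_shift_indicator) auto
  have "(\<integral>\<^sup>+s. emeasure N {t. - t + s \<in> Z} \<partial>m) = 0"
    using emeasure_shift_le[OF N ZB(1)] ZB(2) by simp
  then have "AE s in m. emeasure N {t. - t + s \<in> Z} = 0"
    using measurable_nn_integral_shift[OF N, of "indicator Z"] ZB(1) by (subst (asm) nn_integral_0_iff_AE) (auto simp: i)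
  then show ?thesis
  proof eventually_elim
    case (elim s)
    then have "{t. - t + s \<in> Z} \<in> null_sets N" using sh by (auto simp: null_sets_def)
    then show ?case by (rule AE_I') (use Z(1) in auto)
  qed
qed

end

section \<open>The operators on functions\<close>

text \<open>Jensen's inequality for the power \<open>p\<close>, obtained from Young's inequality for
  \<open>f x\<close> and a constant weight \<open>w\<close>.\<close>

lemma (in finite_measure) powr_integral_le:
  fixes f :: "'a \<Rightarrow> real"
  assumes p: "1 \<le> p" and f: "integrable M f" "\<And>x. 0 \<le> f x" and fp: "integrable M (\<lambda>x. f x powr p)"
  shows "(LINT x|M. f x) powr p \<le> measure M (space M) powr (p - 1) * (LINT x|M. f x powr p)"
proof -
  define I where "I = (LINT x|M. f x)"
  define c where "c = measure M (space M)"
  have I0: "0 \<le> I" unfolding I_def using f by simp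
  show ?thesis
  proof (cases "I = 0")
    case True
    then show ?thesis unfolding I_def using p by (auto intro!: mult_nonneg_nonneg)
  next
    case False
    with I0 have I: "0 < I" by simp
    have c: "0 < c"
    proof (rule ccontr)
      assume "\<not> 0 < c"
      then have "c = 0" using measure_nonneg[of M "space M"] unfolding c_def by linarith
      then have "emeasure M (space M) = 0" by (simp add: emeasure_eq_measure c_def)
      then have "AE x in M. f x = 0" by (intro AE_I[of _ _ "space M"]) auto
      then have "I = 0" unfolding I_def by (simp add: integral_eq_zero_AE)
      then show False using I by simp
    qed
    show ?thesis
    \<comment> \<open>The conjugate exponent \<open>q\<close> below requires 1 < p.\<close>
    proof (cases "p = 1")
      case True
      then show ?thesis using f c unfolding I_def c_def by simp
    next
      case False
      with p have p: "1 < p" by simp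
      define q where "q = p / (p - 1)"
      have q: "1 < q" "1 / p + 1 / q = 1" using p by (auto simp: q_def field_simps)
      \<comment> \<open>The weight for which Young's inequality becomes an equality at the mean
        value I / c of \<open>f\<close>.\<close>
      define w where "w = (I / c) powr (p - 1)"
      have w: "0 \<le> w" "w powr q = (I / c) powr p" using p I c by (auto simp: w_def powr_powr q_def)
      have "f x * w \<le> f x powr p / p + w powr q / q" for x
        by (rule Youngs_inequality[OF p q(1) q(2) f(2) w(1)])
      then have "(LINT x|M. f x * w) \<le> (LINT x|M. f x powr p / p + w powr q / q)"
        using f fp by (intro integral_mono) auto
      also have "\<dots> = (LINT x|M. f x powr p) / p + c * (w powr q / q)"
        using fp by (simp add: c_def)
      finally have 1: "I * w \<le> (LINT x|M. f x powr p) / p + c * ((I / c) powr p) / q" using w by (simp add: I_def)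
      define J where "J = I powr p / c powr (p - 1)"
      have "I * w = J" using I c by (simp add: w_def J_def powr_divide powr_mult_base)
      moreover have "c * ((I / c) powr p) = J" using I c
        by (simp add: J_def powr_divide powr_diff)
      ultimately have "J \<le> (LINT x|M. f x powr p) / p + J / q" using 1 by simp
      moreover have "J / q = J - J / p"
      proof -
        have "1 / q = 1 - 1 / p" using q(2) by simp
        then have "J * (1 / q) = J * (1 - 1 / p)" by simp
        then show ?thesis by (simp add: right_diff_distrib)
      qed
      ultimately have "J / p \<le> (LINT x|M. f x powr p) / p" by simp
      then have "J \<le> (LINT x|M. f x powr p)" using p by (simp add: divide_le_cancel)
      then show ?thesis using c unfolding J_def I_def c_def by (simp add: field_simps)
    qed
  qed
qed

text \<open>The integrable bound is t \<le> 1 + t^p, where the constant is integrable because the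
  measure is finite.\<close>

lemma integrable_of_powr:
  fixes f :: "'a \<Rightarrow> 'f::{banach,second_countable_topology}"
  assumes "finite_measure M" and p: "1 \<le> p" and f: "f \<in> borel_measurable M" and fp: "integrable M (\<lambda>x. norm (f x) powr p)"
  shows "integrable M f"
proof (rule Bochner_Integration.integrable_bound[OF _ f])
  interpret finite_measure M by fact
  show "integrable M (\<lambda>x. 1 + norm (f x) powr p)" using fp by simp
  have "norm (f x) \<le> 1 + norm (f x) powr p" for x
  proof (cases "norm (f x) \<le> 1")
    case True then show ?thesis by (simp add: add_increasing2)
  next
    case False
    then have "norm (f x) powr 1 \<le> norm (f x) powr p" using p by (intro powr_mono) auto
    then show ?thesis using False by simp
  qed
  then show "AE x in M. norm (f x) \<le> norm (1 + norm (f x) powr p)" by (intro AE_I2) simp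
qed

locale haar_Lp = haar m for m :: "'a::{topological_group_add,t2_space} measure" +
  fixes p :: real
  assumes p: "1 \<le> p"
begin

lemma Lp_funD:
  fixes f :: "'a \<Rightarrow> 'f::real_normed_field"
  assumes "f \<in> Lp_fun m p"
  shows "f \<in> borel_measurable borel" "integrable m (\<lambda>x. norm (f x) powr p)"
  using assms by (auto simp: Lp_fun_def)

lemma Lp_fun_iff:
  fixes f :: "'a \<Rightarrow> 'f::{real_normed_field,euclidean_space}"
  assumes f: "f \<in> borel_measurable borel"
  shows "f \<in> Lp_fun m p \<longleftrightarrow> (\<integral>\<^sup>+x. ennreal (norm (f x) powr p) \<partial>m) < \<infinity>"
  using f by (auto simp: Lp_fun_def integrable_iff_bounded)

lemma Lp_fun_bound:
  fixes f :: "'a \<Rightarrow> 'f::{real_normed_field,euclidean_space}" and g :: "'a \<Rightarrow> 'g::{real_normed_field,euclidean_space}"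
  assumes f: "f \<in> Lp_fun m p" and g: "g \<in> borel_measurable borel" and le: "\<And>x. norm (g x) \<le> norm (f x)"
  shows "g \<in> Lp_fun m p"
proof -
  have "integrable m (\<lambda>x. norm (g x) powr p)"
    using g le p by (intro Bochner_Integration.integrable_bound[OF Lp_funD(2)[OF f]]) (auto intro!: powr_mono2)
  then show ?thesis using g by (simp add: Lp_fun_def)
qed

lemma Lp_fun_add:
  fixes f g :: "'a \<Rightarrow> 'f::{real_normed_field,euclidean_space}"
  assumes f: "f \<in> Lp_fun m p" and g: "g \<in> Lp_fun m p"
  shows "(\<lambda>x. f x + g x) \<in> Lp_fun m p"
proof -
  have b: "norm (f x + g x) powr p \<le> 2 powr p * (norm (f x) powr p + norm (g x) powr p)" for x
  proof -
    have "norm (f x + g x) powr p \<le> (2 * max (norm (f x)) (norm (g x))) powr p"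
      using p norm_triangle_ineq[of "f x" "g x"] by (intro powr_mono2) auto
    also have "\<dots> = 2 powr p * max (norm (f x)) (norm (g x)) powr p" by (simp add: powr_mult)
    also have "\<dots> \<le> 2 powr p * (norm (f x) powr p + norm (g x) powr p)"
      by (intro mult_left_mono) (auto simp: max_def)
    finally show ?thesis .
  qed
  have [measurable]: "f \<in> borel_measurable borel" "g \<in> borel_measurable borel"
    by (rule Lp_funD[OF f] Lp_funD[OF g])+
  have "integrable m (\<lambda>x. norm (f x + g x) powr p)"
  proof (rule Bochner_Integration.integrable_bound)
    show "integrable m (\<lambda>x. 2 powr p * (norm (f x) powr p + norm (g x) powr p))"
      using Lp_funD(2)[OF f] Lp_funD(2)[OF g] by simp
    have "norm (norm (f x + g x) powr p) \<le> norm (2 powr p * (norm (f x) powr p + norm (g x) powr p))" for x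
      using order_trans[OF b abs_ge_self] by simp
    then show "AE x in m. norm (norm (f x + g x) powr p) \<le> norm (2 powr p * (norm (f x) powr p + norm (g x) powr p))"
      by (intro AE_I2)
  qed simp
  then show ?thesis using Lp_funD[OF f] Lp_funD[OF g] by (simp add: Lp_fun_def)
qed

lemma Lp_fun_mult:
  fixes f :: "'a \<Rightarrow> 'f::{real_normed_field,euclidean_space}"
  assumes f: "f \<in> Lp_fun m p"
  shows "(\<lambda>x. c * f x) \<in> Lp_fun m p"
  using Lp_funD[OF f] by (simp add: Lp_fun_def norm_mult powr_mult)

lemma Lp_fun_0 [simp]: "(\<lambda>x. 0) \<in> Lp_fun m p"
  using p by (simp add: Lp_fun_def)

lemma Lp_fun_indicator:
  assumes "A \<in> sets borel" "emeasure m A < \<infinity>"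
  shows "indicat_real A \<in> Lp_fun m p"
proof -
  have "(\<lambda>x. norm (indicat_real A x) powr p) = indicat_real A" using p by (auto simp: indicator_def)
  then show ?thesis using assms by (simp add: Lp_fun_def integrable_indicator_iff)
qed

text \<open>The L1-estimate for |g|^p makes its inner integral finite at almost every
  \<open>s\<close>; as \<open>N\<close> is finite and 1 \<le> p, the same holds for |g|. This is the
  existence of the integral that defines the operators.\<close>

lemma shift_Lp_AE:
  fixes g :: "'a \<Rightarrow> 'f::{real_normed_field,euclidean_space}"
  assumes N: "radon N" and g: "g \<in> Lp_fun m p"
  shows "AE s in m. integrable N (\<lambda>t. norm (g (- t + s)) powr p)"
    and "AE s in m. integrable N (\<lambda>t. g (- t + s))"
proof -
  have [measurable]: "g \<in> borel_measurable borel" by (rule Lp_funD[OF g])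
  interpret N: radon_pair N N by unfold_locales (rule N)+
  have b: "(\<lambda>t. g (- t + s)) \<in> borel_measurable N" for s by simp
  have gm: "(\<lambda>x. ennreal (norm (g x) powr p)) \<in> borel_measurable borel" by measurable
  have "(\<integral>\<^sup>+s. (\<integral>\<^sup>+t. ennreal (norm (g (- t + s)) powr p) \<partial>N) \<partial>m) \<le> emeasure N UNIV * (\<integral>\<^sup>+s. ennreal (norm (g s) powr p) \<partial>m)"
    using nn_integral_shift_le[OF N gm] .
  also have "\<dots> < \<infinity>"
    using Lp_fun_iff[OF Lp_funD(1)[OF g]] g by (simp add: ennreal_mult_less_top N.M.emeasure_eq_measure)
  finally have "AE s in m. (\<integral>\<^sup>+t. ennreal (norm (g (- t + s)) powr p) \<partial>N) \<noteq> \<infinity>"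
    using measurable_nn_integral_shift[OF N gm] by (intro nn_integral_PInf_AE) auto
  then show 1: "AE s in m. integrable N (\<lambda>t. norm (g (- t + s)) powr p)"
    by eventually_elim (simp add: integrable_iff_bounded less_top)
  then show "AE s in m. integrable N (\<lambda>t. g (- t + s))"
    by eventually_elim (rule integrable_of_powr[OF N.M.finite_measure_axioms p b])
qed

context
  fixes \<mu> :: "'a set \<Rightarrow> 'f::{real_normed_field,euclidean_space}" assumes \<mu>: "\<mu> \<in> regular_measures"
begin

interpretation radon_pair "tv \<mu>" "tv \<mu>"
  using regular_measuresD[OF \<mu>] by unfold_locales

lemma pi_integral_exists_AE: "g \<in> Lp_fun m p \<Longrightarrow> AE s in m. pi_integral_exists \<mu> g s"
  unfolding pi_integral_exists_def by (rule shift_Lp_AE(2)[OF regular_measuresD(2)[OF \<mu>]])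

lemma pi_fun_borel:
  assumes g: "g \<in> borel_measurable borel"
  shows "pi_fun \<mu> g \<in> borel_measurable borel"
proof -
  have [measurable]: "g \<in> borel_measurable borel" "tv_density \<mu> \<in> borel_measurable borel"
    using g tv_density_borel[OF regular_measuresD(1)[OF \<mu>]] by auto
  have "{s. pi_integral_exists \<mu> g s} \<in> sets borel"
    unfolding pi_integral_exists_def using measurable_integral_section(2)[of "\<lambda>z. g (- snd z + fst z)"] by simp
  moreover have "(\<lambda>s. vm_integral \<mu> (\<lambda>t. g (- t + s))) \<in> borel_measurable borel"
    unfolding vm_integral_def using measurable_integral_section(1)[of "\<lambda>z. g (- snd z + fst z) * tv_density \<mu> (snd z)"] by simp
  ultimately show ?thesis unfolding pi_fun_def by (intro measurable_If) simp_all
qed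

lemma norm_pi_fun_le: "norm (pi_fun \<mu> g s) \<le> (LINT t|tv \<mu>. norm (g (- t + s)))"
  using norm_vm_integral_le[OF regular_measuresD(1)[OF \<mu>], of "\<lambda>t. g (- t + s)"]
  by (auto simp: pi_fun_def pi_integral_exists_def)

text \<open>With c the total variation of \<mu>, Jensen's inequality in the inner integral
  contributes c^(p - 1), and the L1-estimate for |g|^p one more factor c.\<close>

lemma nn_integral_pi_fun_le:
  assumes g: "g \<in> Lp_fun m p"
  shows "(\<integral>\<^sup>+s. ennreal (norm (pi_fun \<mu> g s) powr p) \<partial>m) \<le>
    ennreal (measure (tv \<mu>) UNIV powr p) * (\<integral>\<^sup>+s. ennreal (norm (g s) powr p) \<partial>m)"
proof -
  have [measurable]: "g \<in> borel_measurable borel" by (rule Lp_funD[OF g])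
  let ?c = "measure (tv \<mu>) UNIV"
  have "(\<integral>\<^sup>+s. ennreal (norm (pi_fun \<mu> g s) powr p) \<partial>m) \<le>
    (\<integral>\<^sup>+s. ennreal (?c powr (p - 1)) * (\<integral>\<^sup>+t. ennreal (norm (g (- t + s)) powr p) \<partial>tv \<mu>) \<partial>m)"
  proof (rule nn_integral_mono_AE)
    show "AE s in m. ennreal (norm (pi_fun \<mu> g s) powr p) \<le> ennreal (?c powr (p - 1)) * (\<integral>\<^sup>+t. ennreal (norm (g (- t + s)) powr p) \<partial>tv \<mu>)"
      using shift_Lp_AE[OF regular_measuresD(2)[OF \<mu>] g]
    proof eventually_elim
      case (elim s)
      have "norm (pi_fun \<mu> g s) powr p \<le> (LINT t|tv \<mu>. norm (g (- t + s))) powr p"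
        using norm_pi_fun_le[of g s] p by (intro powr_mono2) auto
      also have "\<dots> \<le> ?c powr (p - 1) * (LINT t|tv \<mu>. norm (g (- t + s)) powr p)"
        using M.powr_integral_le[OF p integrable_norm[OF elim(2)]] elim by simp
      finally have "ennreal (norm (pi_fun \<mu> g s) powr p) \<le> ennreal (?c powr (p - 1) * (LINT t|tv \<mu>. norm (g (- t + s)) powr p))"
        by (rule ennreal_leI)
      also have "\<dots> = ennreal (?c powr (p - 1)) * (\<integral>\<^sup>+t. ennreal (norm (g (- t + s)) powr p) \<partial>tv \<mu>)"
        using elim(1) by (subst nn_integral_eq_integral) (auto simp: ennreal_mult)
      finally show ?case .
    qed
  qed
  also have "\<dots> = ennreal (?c powr (p - 1)) * (\<integral>\<^sup>+s. (\<integral>\<^sup>+t. ennreal (norm (g (- t + s)) powr p) \<partial>tv \<mu>) \<partial>m)"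
    using measurable_nn_integral_shift[OF M, of "\<lambda>x. ennreal (norm (g x) powr p)"] by (intro nn_integral_cmult) simp
  also have "\<dots> \<le> ennreal (?c powr (p - 1)) * (emeasure (tv \<mu>) UNIV * (\<integral>\<^sup>+s. ennreal (norm (g s) powr p) \<partial>m))"
    by (intro mult_left_mono nn_integral_shift_le[OF M, of "\<lambda>x. ennreal (norm (g x) powr p)"]) auto
  also have "\<dots> = ennreal (?c powr (p - 1) * ?c) * (\<integral>\<^sup>+s. ennreal (norm (g s) powr p) \<partial>m)"
    by (simp add: M.emeasure_eq_measure ennreal_mult mult.assoc)
  also have "?c powr (p - 1) * ?c = ?c powr p"
    by (cases "?c = 0") (auto simp: powr_diff)
  finally show ?thesis .
qed

lemma pi_fun_Lp: "g \<in> Lp_fun m p \<Longrightarrow> pi_fun \<mu> g \<in> Lp_fun m p"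
  using pi_fun_borel[OF Lp_funD(1)] le_less_trans[OF nn_integral_pi_fun_le] Lp_fun_iff[OF Lp_funD(1), of g]
  by (subst Lp_fun_iff) (simp_all add: ennreal_mult_less_top)

lemma pi_fun_norm_le:
  assumes g: "g \<in> Lp_fun m p"
  shows "(LINT s|m. norm (pi_fun \<mu> g s) powr p) powr (1 / p) \<le> measure (tv \<mu>) UNIV * (LINT s|m. norm (g s) powr p) powr (1 / p)"
proof -
  have "ennreal (LINT s|m. norm (pi_fun \<mu> g s) powr p) \<le> ennreal (measure (tv \<mu>) UNIV powr p * (LINT s|m. norm (g s) powr p))"
    using nn_integral_pi_fun_le[OF g] Lp_funD(2)[OF g] Lp_funD(2)[OF pi_fun_Lp[OF g]]
    by (subst (asm) (1 2) nn_integral_eq_integral) (auto simp: ennreal_mult)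
  then have "(LINT s|m. norm (pi_fun \<mu> g s) powr p) \<le> measure (tv \<mu>) UNIV powr p * (LINT s|m. norm (g s) powr p)"
    by (subst (asm) ennreal_le_iff) auto
  then have "(LINT s|m. norm (pi_fun \<mu> g s) powr p) powr (1 / p) \<le> (measure (tv \<mu>) UNIV powr p * (LINT s|m. norm (g s) powr p)) powr (1 / p)"
    using p by (intro powr_mono2) auto
  also have "\<dots> = measure (tv \<mu>) UNIV * (LINT s|m. norm (g s) powr p) powr (1 / p)"
    using p by (simp add: powr_mult powr_powr)
  finally show ?thesis .
qed

text \<open>At almost every \<open>s\<close> the two translates agree almost everywhere for
  \<open>tv \<mu>\<close>, so existence and value of the integral agree.\<close>

lemma pi_fun_cong_AE:
  assumes f: "f \<in> borel_measurable borel" and g: "g \<in> borel_measurable borel" and ae: "AE x in m. f x = g x"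
  shows "AE s in m. pi_fun \<mu> f s = pi_fun \<mu> g s"
  using AE_shift[OF M ae]
proof eventually_elim
  case (elim s)
  have [measurable]: "f \<in> borel_measurable borel" "g \<in> borel_measurable borel" by fact+
  have "integrable (tv \<mu>) (\<lambda>t. f (- t + s)) = integrable (tv \<mu>) (\<lambda>t. g (- t + s))"
    using elim by (intro integrable_cong_AE) auto
  moreover have "vm_integral \<mu> (\<lambda>t. f (- t + s)) = vm_integral \<mu> (\<lambda>t. g (- t + s))"
    using elim by (intro vm_integral_cong_AE[OF regular_measuresD(1)[OF \<mu>]]) auto
  ultimately show ?case by (simp add: pi_fun_def pi_integral_exists_def)
qed

lemma pi_fun_add:
  assumes f: "f \<in> Lp_fun m p" and g: "g \<in> Lp_fun m p"
  shows "AE s in m. pi_fun \<mu> (\<lambda>x. f x + g x) s = pi_fun \<mu> f s + pi_fun \<mu> g s"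
  using shift_Lp_AE(2)[OF M f] shift_Lp_AE(2)[OF M g]
proof eventually_elim
  case (elim s)
  have L: "L1_functional (tv \<mu>) (vm_integral \<mu>)" by (rule vm_integral_functional[OF regular_measuresD(1)[OF \<mu>]]) auto
  show ?case using elim L1_functional_plus[OF L elim] by (simp add: pi_fun_def pi_integral_exists_def)
qed

text \<open>Valid at every \<open>s\<close>: for \<open>c\<close> nonzero the two integrals exist
  together, and where they do not exist both sides are 0 by convention.\<close>

lemma pi_fun_mult: "pi_fun \<mu> (\<lambda>x. c * f x) s = c * pi_fun \<mu> f s"
proof (cases "c = 0")
  case False
  have "integrable (tv \<mu>) (\<lambda>t. f (- t + s))" if "integrable (tv \<mu>) (\<lambda>t. c * f (- t + s))"
    using integrable_mult_right[of "inverse c", OF that] False by (simp add: mult.assoc[symmetric])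
  then show ?thesis by (auto simp: pi_fun_def pi_integral_exists_def vm_integral_def mult.assoc)
qed (simp add: pi_fun_def vm_integral_def)

end

end

section \<open>Sums, multiples and complex parts of measures\<close>

lemma radon_add:
  fixes M N R :: "'a::t2_space measure"
  assumes M: "radon M" and N: "radon N" and R: "sets R = sets borel"
    and eq: "\<And>A. A \<in> sets borel \<Longrightarrow> emeasure R A = emeasure M A + emeasure N A"
  shows "radon R"
proof -
  interpret M: finite_measure M by (rule radonD[OF M])
  interpret N: finite_measure N by (rule radonD[OF N])
  have sp: "space R = UNIV" using sets_eq_imp_space_eq[OF R] by simp
  interpret R: finite_measure R by (intro finite_measureI) (simp add: sp eq M.emeasure_eq_measure N.emeasure_eq_measure)
  have meq: "measure R A = measure M A + measure N A" if "A \<in> sets borel" for A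
    using eq[OF that] by (simp add: M.emeasure_eq_measure N.emeasure_eq_measure R.emeasure_eq_measure flip: ennreal_plus)
  show ?thesis unfolding radon_def
  proof (intro conjI ballI allI impI R R.finite_measure_axioms)
    fix A :: "'a set" and e :: real assume A: "A \<in> sets borel" and e: "0 < e"
    obtain K where K: "compact K" "K \<subseteq> A" "measure M (A - K) < e / 2" using radon_compactE[OF M A half_gt_zero[OF e]] .
    obtain L where L: "compact L" "L \<subseteq> A" "measure N (A - L) < e / 2" using radon_compactE[OF N A half_gt_zero[OF e]] .
    have b: "K \<in> sets borel" "L \<in> sets borel" using K L by (auto intro: borel_compact)
    have "measure M (A - (K \<union> L)) \<le> measure M (A - K)" "measure N (A - (K \<union> L)) \<le> measure N (A - L)"
      using A b radonD[OF M] radonD[OF N] by (auto intro!: M.finite_measure_mono N.finite_measure_mono)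
    then have "measure R (A - (K \<union> L)) < e" using meq[of "A - (K \<union> L)"] A b K L by simp
    then show "\<exists>K. compact K \<and> K \<subseteq> A \<and> measure R (A - K) < e"
      using K L by (intro exI[of _ "K \<union> L"]) (auto intro: compact_Un)
  qed
qed

text \<open>The sum of the two variations is obtained as the variation of a nonnegative set
  function. It is Radon, so it yields regularity of \<mu> + \<nu>, and it provides a common L1-space
  for the integrals.\<close>

lemma regular_measures_dominating:
  fixes \<mu> :: "'a::t2_space set \<Rightarrow> 'f::{real_normed_field,euclidean_space}" and \<nu> :: "'a set \<Rightarrow> 'g::{real_normed_field,euclidean_space}"
  assumes \<mu>: "\<mu> \<in> regular_measures" and \<nu>: "\<nu> \<in> regular_measures"
  obtains R where "radon R" "\<And>A. A \<in> sets borel \<Longrightarrow> emeasure R A = emeasure (tv \<mu>) A + emeasure (tv \<nu>) A"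
proof -
  note M = regular_measuresD[OF \<mu>] and N = regular_measuresD[OF \<nu>]
  interpret M: finite_measure "tv \<mu>" by (rule radonD[OF M(2)])
  interpret N: finite_measure "tv \<nu>" by (rule radonD[OF N(2)])
  let ?\<sigma> = "\<lambda>A. measure (tv \<mu>) A + measure (tv \<nu>) A"
  have "vector_measure ?\<sigma>"
    by (intro vector_measure_add vector_measure_measure M.finite_measure_axioms N.finite_measure_axioms) auto
  then have eq: "emeasure (tv ?\<sigma>) A = emeasure (tv \<mu>) A + emeasure (tv \<nu>) A" for A
    by (subst emeasure_tv_nonneg) (auto simp: M.emeasure_eq_measure N.emeasure_eq_measure)
  show ?thesis using that[of "tv ?\<sigma>"] radon_add[OF M(2) N(2) _ eq] eq by simp
qed

lemma regular_measures_add: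
  fixes \<mu> \<nu> :: "'a::t2_space set \<Rightarrow> 'f::{real_normed_field,euclidean_space}"
  assumes \<mu>: "\<mu> \<in> regular_measures" and \<nu>: "\<nu> \<in> regular_measures"
  shows "(\<lambda>A. \<mu> A + \<nu> A) \<in> regular_measures"
proof -
  note M = regular_measuresD[OF \<mu>] and N = regular_measuresD[OF \<nu>]
  obtain R where R: "radon R" "\<And>A. A \<in> sets borel \<Longrightarrow> emeasure R A = emeasure (tv \<mu>) A + emeasure (tv \<nu>) A"
    using regular_measures_dominating[OF \<mu> \<nu>] by blast
  show ?thesis
  proof (rule regular_measuresI[OF vector_measure_add[OF M(1) N(1)] R(1)])
    fix A :: "'a set" assume A: "A \<in> sets borel"
    have "ennreal (norm (\<mu> A + \<nu> A)) \<le> ennreal (norm (\<mu> A)) + ennreal (norm (\<nu> A))"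
      by (simp add: ennreal_plus[symmetric] norm_triangle_ineq del: ennreal_plus)
    also have "\<dots> \<le> emeasure (tv \<mu>) A + emeasure (tv \<nu>) A"
      using A norm_le_variation[OF M(1) A] norm_le_variation[OF N(1) A] by (intro add_mono) (auto simp: emeasure_tv M N)
    finally show "ennreal (norm (\<mu> A + \<nu> A)) \<le> emeasure R A" using R(2)[OF A] by simp
  qed
qed

lemma regular_measures_le:
  fixes \<mu> :: "'a::t2_space set \<Rightarrow> 'f::{real_normed_field,euclidean_space}" and \<nu> :: "'a set \<Rightarrow> 'g::{real_normed_field,euclidean_space}"
  assumes \<mu>: "\<mu> \<in> regular_measures" and \<nu>: "vector_measure \<nu>" and le: "\<And>A. A \<in> sets borel \<Longrightarrow> norm (\<nu> A) \<le> measure (tv \<mu>) A"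
  shows "\<nu> \<in> regular_measures"
proof (rule regular_measuresI[OF \<nu> regular_measuresD(2)[OF \<mu>]])
  interpret finite_measure "tv \<mu>" by (rule radonD[OF regular_measuresD(2)[OF \<mu>]])
  show "ennreal (norm (\<nu> A)) \<le> emeasure (tv \<mu>) A" if "A \<in> sets borel" for A
    using le[OF that] by (simp add: emeasure_eq_measure ennreal_leI)
qed

lemma regular_measures_mult:
  fixes \<mu> :: "'a::t2_space set \<Rightarrow> 'f::{real_normed_field,euclidean_space}"
  assumes \<mu>: "\<mu> \<in> regular_measures"
  shows "(\<lambda>A. c * \<mu> A) \<in> regular_measures"
  unfolding regular_measures_iff
proof
  note M = regular_measuresD[OF \<mu>]
  interpret M: finite_measure "tv \<mu>" by (rule radonD[OF M(2)])
  show v: "vector_measure (\<lambda>A. c * \<mu> A)" by (rule vector_measure_mult[OF M(1)])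
  interpret C: finite_measure "tv (\<lambda>A. c * \<mu> A)" by (rule finite_measure_tv[OF v])
  have eq: "measure (tv (\<lambda>A. c * \<mu> A)) A = norm c * measure (tv \<mu>) A" if "A \<in> sets borel" for A
    using emeasure_tv_mult[OF M(1) that, of c]
    by (simp add: M.emeasure_eq_measure C.emeasure_eq_measure flip: ennreal_mult)
  show "radon (tv (\<lambda>A. c * \<mu> A))"
    unfolding radon_def
  proof (intro conjI ballI allI impI C.finite_measure_axioms)
    fix A :: "'a set" and e :: real assume A: "A \<in> sets borel" and e: "0 < e"
    have d: "0 < e / (norm c + 1)" using e by (intro divide_pos_pos) (auto simp: add_nonneg_pos)
    obtain K where K: "compact K" "K \<subseteq> A" "measure (tv \<mu>) (A - K) < e / (norm c + 1)"
      using radon_compactE[OF M(2) A d] .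
    have "norm c * measure (tv \<mu>) (A - K) \<le> (norm c + 1) * measure (tv \<mu>) (A - K)" by (intro mult_right_mono) auto
    also have "\<dots> < e" using K(3) by (simp add: pos_less_divide_eq add_nonneg_pos mult.commute)
    finally show "\<exists>K. compact K \<and> K \<subseteq> A \<and> measure (tv (\<lambda>A. c * \<mu> A)) (A - K) < e"
      using K A borel_compact[OF K(1)] by (intro exI[of _ K]) (auto simp: eq)
  qed simp
qed

lemma regular_measures_measure:
  fixes N :: "'a::t2_space measure"
  assumes "radon N" shows "measure N \<in> regular_measures"
  unfolding regular_measures_iff
  using assms vector_measure_measure[of N] tv_measure[of N] radonD[OF assms] by simp

text \<open>The density of a positive measure with respect to itself is a choice known through its
  integrals only, hence the detour through functionals.\<close>

lemma vm_integral_measure: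
  fixes f :: "'a::topological_space \<Rightarrow> real"
  assumes N: "finite_measure N" "sets N = sets borel" and f: "integrable N f"
  shows "vm_integral (measure N) f = (LINT x|N. f x)"
proof -
  interpret finite_measure N by fact
  have v: "vector_measure (measure N)" by (rule vector_measure_measure[OF N])
  show ?thesis
  proof (rule L1_functional_eqI[OF vm_integral_functional[OF v N(2)] _ _ f])
    show "emeasure (tv (measure N)) A \<le> emeasure N A" for A by (simp add: tv_measure[OF N])
    show "L1_functional N (\<lambda>f. LINT x|N. f x :: real)"
      by (rule L1_functionalI[where C=1]) (auto intro: order_trans[OF integral_norm_bound])
    fix A and c :: real assume A: "A \<in> sets N"
    have "vm_integral (measure N) (\<lambda>x. indicat_real A x *\<^sub>R c) = c * measure N A"
      using A N by (intro vm_integral_indicator[OF v]) auto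
    then show "vm_integral (measure N) (\<lambda>x. indicat_real A x *\<^sub>R c) = (LINT x|N. indicat_real A x *\<^sub>R c)"
      using A by simp
  qed
qed

lemma vm_integral_mult_measure:
  fixes \<mu> :: "'a::topological_space set \<Rightarrow> 'f::{real_normed_field,euclidean_space}"
  assumes \<mu>: "vector_measure \<mu>" and f: "integrable (tv \<mu>) f"
  shows "vm_integral (\<lambda>A. c * \<mu> A) f = c * vm_integral \<mu> f"
proof -
  \<comment> \<open>A factor of norm 1 + norm c lets \<open>?R\<close> dominate the variations of
    both \<mu> and c\<mu>, also when \<open>c\<close> is 0.\<close>
  let ?d = "of_real (1 + norm c) :: 'f"
  let ?R = "tv (\<lambda>A. ?d * \<mu> A)"
  note em = emeasure_tv_mult[OF \<mu>]
  have d: "norm ?d = 1 + norm c" by (metis abs_of_nonneg add_nonneg_nonneg norm_ge_zero norm_of_real zero_le_one)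
  have le1: "emeasure (tv (\<lambda>A. c * \<mu> A)) A \<le> emeasure ?R A" if "A \<in> sets borel" for A
    unfolding em[OF that] d by (intro mult_right_mono ennreal_leI) auto
  have le2: "emeasure (tv \<mu>) A \<le> emeasure ?R A" if "A \<in> sets borel" for A
  proof -
    have "(1::ennreal) \<le> ennreal (1 + norm c)" by (subst ennreal_1[symmetric], rule ennreal_leI) simp
    from mult_right_mono[OF this, of "emeasure (tv \<mu>) A"] show ?thesis unfolding em[OF that] d by (simp only: mult_1) simp
  qed
  have c: "vector_measure (\<lambda>A. c * \<mu> A)" by (rule vector_measure_mult[OF \<mu>])
  have fm: "f \<in> borel_measurable borel" using borel_measurable_integrable[OF f] by simp
  have R: "integrable ?R f"
  proof -
    have D: "density (tv \<mu>) (\<lambda>_. ennreal (1 + norm c)) = ?R"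
    proof (rule measure_eqI)
      fix A assume "A \<in> sets (density (tv \<mu>) (\<lambda>_. ennreal (1 + norm c)))"
      then have "A \<in> sets borel" by simp
      then show "emeasure (density (tv \<mu>) (\<lambda>_. ennreal (1 + norm c))) A = emeasure ?R A"
        unfolding em[OF \<open>A \<in> sets borel\<close>] d
        by (subst emeasure_density) (auto simp: nn_integral_cmult_indicator simp del: ennreal_plus)
    qed simp
    have "integrable (density (tv \<mu>) (\<lambda>_. ennreal (1 + norm c))) f"
      using f fm by (subst integrable_density) auto
    then show ?thesis unfolding D .
  qed
  show ?thesis
    by (rule L1_functional_eqI[OF vm_integral_functional[OF c _ le1] L1_functional_compose[OF bounded_linear_mult_right vm_integral_functional[OF \<mu> _ le2]] _ R])
      (auto simp: vm_integral_indicator \<mu> c)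
qed

lemma emeasure_tv_Re_Im:
  fixes \<mu> :: "'a::topological_space set \<Rightarrow> complex"
  assumes \<mu>: "vector_measure \<mu>"
  shows "vector_measure (\<lambda>A. Re (\<mu> A))" "vector_measure (\<lambda>A. Im (\<mu> A))"
    "emeasure (tv (\<lambda>A. Re (\<mu> A))) A \<le> emeasure (tv \<mu>) A" "emeasure (tv (\<lambda>A. Im (\<mu> A))) A \<le> emeasure (tv \<mu>) A"
proof -
  show v: "vector_measure (\<lambda>A. Re (\<mu> A))" "vector_measure (\<lambda>A. Im (\<mu> A))"
    by (rule vector_measure_bounded_linear[OF bounded_linear_Re \<mu>] vector_measure_bounded_linear[OF bounded_linear_Im \<mu>])+
  have "ennreal (norm (Re (\<mu> A))) \<le> emeasure (tv \<mu>) A" "ennreal (norm (Im (\<mu> A))) \<le> emeasure (tv \<mu>) A" if "A \<in> sets borel" for A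
    using norm_le_variation[OF \<mu> that] abs_Re_le_cmod[of "\<mu> A"] abs_Im_le_cmod[of "\<mu> A"]
    by (auto simp: emeasure_tv[OF \<mu> that] intro: order_trans[OF ennreal_leI])
  then show "emeasure (tv (\<lambda>A. Re (\<mu> A))) A \<le> emeasure (tv \<mu>) A" "emeasure (tv (\<lambda>A. Im (\<mu> A))) A \<le> emeasure (tv \<mu>) A"
    using emeasure_tv_le[OF v(1)] emeasure_tv_le[OF v(2)] by auto
qed

text \<open>All terms are L1-bounded functionals on L1 of \<open>tv \<mu>\<close>; on an indicator
  with coefficient \<open>c\<close> the claim is the formula for the product of the complex numbers
  \<open>c\<close> and \<mu> A.\<close>

lemma vm_integral_complex:
  fixes \<mu> :: "'a::topological_space set \<Rightarrow> complex"
  assumes \<mu>: "vector_measure \<mu>" and f: "integrable (tv \<mu>) f"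
  shows "Re (vm_integral \<mu> f) = vm_integral (\<lambda>A. Re (\<mu> A)) (\<lambda>x. Re (f x)) - vm_integral (\<lambda>A. Im (\<mu> A)) (\<lambda>x. Im (f x))"
    and "Im (vm_integral \<mu> f) = vm_integral (\<lambda>A. Re (\<mu> A)) (\<lambda>x. Im (f x)) + vm_integral (\<lambda>A. Im (\<mu> A)) (\<lambda>x. Re (f x))"
proof -
  note v = emeasure_tv_Re_Im[OF \<mu>]
  have L: "L1_functional (tv \<mu>) (vm_integral \<mu>)" by (rule vm_integral_functional[OF \<mu>]) auto
  have L1: "L1_functional (tv \<mu>) (vm_integral (\<lambda>A. Re (\<mu> A)))" by (rule vm_integral_functional[OF v(1) _ v(3)]) auto
  have L2: "L1_functional (tv \<mu>) (vm_integral (\<lambda>A. Im (\<mu> A)))" by (rule vm_integral_functional[OF v(2) _ v(4)]) auto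
  have "Re (vm_integral \<mu> f) = vm_integral (\<lambda>A. Re (\<mu> A)) (\<lambda>x. Re (f x)) + - vm_integral (\<lambda>A. Im (\<mu> A)) (\<lambda>x. Im (f x))"
    by (rule L1_functional_eqI[OF L1_functional_compose[OF bounded_linear_Re L]
        L1_functional_add[OF L1_functional_precompose[OF bounded_linear_Re L1]
          L1_functional_compose[OF bounded_linear_minus[OF bounded_linear_ident] L1_functional_precompose[OF bounded_linear_Im L2]]] _ f])
      (simp add: vm_integral_indicator[OF \<mu>] vm_integral_indicator[OF v(1), simplified] vm_integral_indicator[OF v(2), simplified])
  then show "Re (vm_integral \<mu> f) = vm_integral (\<lambda>A. Re (\<mu> A)) (\<lambda>x. Re (f x)) - vm_integral (\<lambda>A. Im (\<mu> A)) (\<lambda>x. Im (f x))" by simp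
  show "Im (vm_integral \<mu> f) = vm_integral (\<lambda>A. Re (\<mu> A)) (\<lambda>x. Im (f x)) + vm_integral (\<lambda>A. Im (\<mu> A)) (\<lambda>x. Re (f x))"
    by (rule L1_functional_eqI[OF L1_functional_compose[OF bounded_linear_Im L]
        L1_functional_add[OF L1_functional_precompose[OF bounded_linear_Im L1] L1_functional_precompose[OF bounded_linear_Re L2]] _ f])
      (simp add: vm_integral_indicator[OF \<mu>] vm_integral_indicator[OF v(1), simplified] vm_integral_indicator[OF v(2), simplified])
qed

context haar_Lp
begin

text \<open>At almost every \<open>s\<close> the translate of \<open>g\<close> is integrable for the
  sum \<open>R\<close> of the two variations, a common space on which the integral is additive in
  the measure.\<close>

lemma pi_fun_add_measure:
  fixes \<mu> \<nu> :: "'a set \<Rightarrow> 'f::{real_normed_field,euclidean_space}"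
  assumes \<mu>: "\<mu> \<in> regular_measures" and \<nu>: "\<nu> \<in> regular_measures" and g: "g \<in> Lp_fun m p"
  shows "AE s in m. pi_fun (\<lambda>A. \<mu> A + \<nu> A) g s = pi_fun \<mu> g s + pi_fun \<nu> g s"
proof -
  obtain R where R: "radon R" "\<And>A. A \<in> sets borel \<Longrightarrow> emeasure R A = emeasure (tv \<mu>) A + emeasure (tv \<nu>) A"
    using regular_measures_dominating[OF \<mu> \<nu>] by blast
  show ?thesis
    using shift_Lp_AE(2)[OF R(1) g] pi_integral_exists_AE[OF \<mu> g] pi_integral_exists_AE[OF \<nu> g]
      pi_integral_exists_AE[OF regular_measures_add[OF \<mu> \<nu>] g]
  proof eventually_elim
    case (elim s)
    have "vm_integral (\<lambda>A. \<mu> A + \<nu> A) (\<lambda>t. g (- t + s)) = vm_integral \<mu> (\<lambda>t. g (- t + s)) + vm_integral \<nu> (\<lambda>t. g (- t + s))"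
      by (rule vm_integral_add_measure[OF regular_measuresD(1)[OF \<mu>] regular_measuresD(1)[OF \<nu>] radonD(2)[OF R(1)] _ elim(1)])
        (simp add: R)
    then show ?case using elim by (simp add: pi_fun_def)
  qed
qed

lemma pi_fun_mult_measure:
  fixes \<mu> :: "'a set \<Rightarrow> 'f::{real_normed_field,euclidean_space}"
  assumes \<mu>: "\<mu> \<in> regular_measures" and g: "g \<in> Lp_fun m p"
  shows "AE s in m. pi_fun (\<lambda>A. c * \<mu> A) g s = c * pi_fun \<mu> g s"
  using pi_integral_exists_AE[OF \<mu> g] pi_integral_exists_AE[OF regular_measures_mult[OF \<mu>, of c] g]
proof eventually_elim
  case (elim s)
  then show ?case
    using vm_integral_mult_measure[OF regular_measuresD(1)[OF \<mu>], of "\<lambda>t. g (- t + s)"]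
    by (simp add: pi_fun_def pi_integral_exists_def)
qed

lemma pi_fun_conv:
  fixes \<mu> \<nu> :: "'a set \<Rightarrow> 'f::{real_normed_field,euclidean_space}"
  assumes \<mu>: "\<mu> \<in> regular_measures" and \<nu>: "\<nu> \<in> regular_measures" and g: "g \<in> Lp_fun m p"
  shows "AE s in m. pi_fun (convolution \<mu> \<nu>) g s = pi_fun \<mu> (pi_fun \<nu> g) s"
proof -
  interpret regular_pair \<mu> \<nu> by unfold_locales fact+
  have gb [measurable]: "g \<in> borel_measurable borel" by (rule Lp_funD[OF g])
  \<comment> \<open>Integrability of a translate of \<open>g\<close> for this image measure is
    absolute convergence of the double integral; it holds for almost every \<open>s\<close>.\<close>
  have "radon (distr prodm borel (\<lambda>z. fst z + snd z))"
    by (rule radon_distr[OF radon_prod]) (intro continuous_intros)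
  note shift_Lp_AE(2)[OF this g]
  moreover have "AE s in m. pi_integral_exists (conv_fun \<mu> \<nu>) g s" by (rule pi_integral_exists_AE[OF conv_fun_regular g])
  moreover have "AE s in m. pi_integral_exists \<mu> (pi_fun \<nu> g) s" by (rule pi_integral_exists_AE[OF \<mu> pi_fun_Lp[OF \<nu> g]])
  ultimately show ?thesis
    unfolding convolution_eq[OF lc \<mu> \<nu>]
  proof eventually_elim
    case (elim s)
    let ?f = "\<lambda>x. g (- x + s)"
    have fb [measurable]: "?f \<in> borel_measurable borel" by measurable
    have i: "integrable prodm (\<lambda>z. ?f (fst z + snd z))"
      using elim(1) by (subst (asm) integrable_distr_eq) auto
    \<comment> \<open>Negation reverses the order in the group, so \<nu> acts on \<open>g\<close>
      first and \<mu> on the result.\<close>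
    have sh: "- (x + y) + s = - y + (- x + s)" for x y by (simp only: minus_add add.assoc)
    have ae: "AE x in tv \<mu>. integrable (tv \<nu>) (\<lambda>y. ?f (x + y))" using integral_prod(1)[OF i] by simp
    have [measurable]: "tv_density \<nu> \<in> borel_measurable borel" by (rule tv_density_borel[OF \<nu>v])
    have "(\<lambda>z. ?f (fst z + snd z) * tv_density \<nu> (snd z)) \<in> borel_measurable borel" by measurable
    from measurable_integral_section(1)[OF this]
    have m1: "(\<lambda>x. vm_integral \<nu> (\<lambda>y. ?f (x + y))) \<in> borel_measurable borel" by (simp add: vm_integral_def)
    have m2: "(\<lambda>x. pi_fun \<nu> g (- x + s)) \<in> borel_measurable borel"
      by (rule measurable_compose[OF shift_borel1(1) pi_fun_borel[OF \<nu> gb]])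
    have "pi_fun (conv_fun \<mu> \<nu>) g s = vm_integral (conv_fun \<mu> \<nu>) ?f" using elim(2) by (simp add: pi_fun_def)
    also have "\<dots> = vm_integral \<mu> (\<lambda>x. vm_integral \<nu> (\<lambda>y. ?f (x + y)))"
      by (rule vm_integral_conv_fun_left[OF i fb])
    also have "\<dots> = vm_integral \<mu> (\<lambda>x. pi_fun \<nu> g (- x + s))"
      using ae by (intro vm_integral_cong_AE[OF \<mu>v m1 m2]) (auto elim!: eventually_mono simp: pi_fun_def pi_integral_exists_def sh)
    also have "\<dots> = pi_fun \<mu> (pi_fun \<nu> g) s" using elim(3) by (simp add: pi_fun_def)
    finally show ?case .
  qed
qed

lemma pi_fun_complex:
  fixes \<mu> :: "'a set \<Rightarrow> complex"
  assumes \<mu>: "\<mu> \<in> regular_measures" and g: "g \<in> Lp_fun m p"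
  shows "AE s in m. Re (pi_fun \<mu> g s) = pi_fun (\<lambda>A. Re (\<mu> A)) (\<lambda>x. Re (g x)) s - pi_fun (\<lambda>A. Im (\<mu> A)) (\<lambda>x. Im (g x)) s"
    and "AE s in m. Im (pi_fun \<mu> g s) = pi_fun (\<lambda>A. Re (\<mu> A)) (\<lambda>x. Im (g x)) s + pi_fun (\<lambda>A. Im (\<mu> A)) (\<lambda>x. Re (g x)) s"
proof -
  note \<mu>v = regular_measuresD(1)[OF \<mu>]
  note v = emeasure_tv_Re_Im[OF \<mu>v]
  have ex: "pi_integral_exists (\<lambda>A. Re (\<mu> A)) (\<lambda>x. Re (g x)) s" "pi_integral_exists (\<lambda>A. Re (\<mu> A)) (\<lambda>x. Im (g x)) s"
    "pi_integral_exists (\<lambda>A. Im (\<mu> A)) (\<lambda>x. Re (g x)) s" "pi_integral_exists (\<lambda>A. Im (\<mu> A)) (\<lambda>x. Im (g x)) s"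
    if "pi_integral_exists \<mu> g s" for s
  proof -
    have i: "integrable (tv \<mu>) (\<lambda>t. Re (g (- t + s)))" "integrable (tv \<mu>) (\<lambda>t. Im (g (- t + s)))"
      using that by (auto simp: pi_integral_exists_def intro: integrable_Re integrable_Im)
    show "pi_integral_exists (\<lambda>A. Re (\<mu> A)) (\<lambda>x. Re (g x)) s" "pi_integral_exists (\<lambda>A. Re (\<mu> A)) (\<lambda>x. Im (g x)) s"
      unfolding pi_integral_exists_def using v(3) by (auto intro!: integrable_mono_measures(1)[OF _ _ i(1)] integrable_mono_measures(1)[OF _ _ i(2)])
    show "pi_integral_exists (\<lambda>A. Im (\<mu> A)) (\<lambda>x. Re (g x)) s" "pi_integral_exists (\<lambda>A. Im (\<mu> A)) (\<lambda>x. Im (g x)) s"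
      unfolding pi_integral_exists_def using v(4) by (auto intro!: integrable_mono_measures(1)[OF _ _ i(1)] integrable_mono_measures(1)[OF _ _ i(2)])
  qed
  show "AE s in m. Re (pi_fun \<mu> g s) = pi_fun (\<lambda>A. Re (\<mu> A)) (\<lambda>x. Re (g x)) s - pi_fun (\<lambda>A. Im (\<mu> A)) (\<lambda>x. Im (g x)) s"
    using pi_integral_exists_AE[OF \<mu> g]
  proof eventually_elim
    case (elim s)
    then show ?case using ex[OF elim] vm_integral_complex(1)[OF \<mu>v, of "\<lambda>t. g (- t + s)"]
      by (simp add: pi_fun_def) (simp add: pi_integral_exists_def)
  qed
  show "AE s in m. Im (pi_fun \<mu> g s) = pi_fun (\<lambda>A. Re (\<mu> A)) (\<lambda>x. Im (g x)) s + pi_fun (\<lambda>A. Im (\<mu> A)) (\<lambda>x. Re (g x)) s"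
    using pi_integral_exists_AE[OF \<mu> g]
  proof eventually_elim
    case (elim s)
    then show ?case using ex[OF elim] vm_integral_complex(2)[OF \<mu>v, of "\<lambda>t. g (- t + s)"]
      by (simp add: pi_fun_def) (simp add: pi_integral_exists_def)
  qed
qed

lemma pi_fun_measure:
  fixes g :: "'a \<Rightarrow> real"
  assumes N: "radon N" and i: "integrable N (\<lambda>t. g (- t + s))"
  shows "pi_fun (measure N) g s = (LINT t|N. g (- t + s))"
  using i vm_integral_measure[OF radonD(1,2)[OF N] i]
  by (simp add: pi_fun_def pi_integral_exists_def tv_measure[OF radonD(1,2)[OF N]])

end

section \<open>Fine partitions\<close>

text \<open>\<open>V\<close> depends on \<nu> and \<open>e\<close> alone and is fixed before the
  pieces and the translation are given. The error consists of three thirds of \<open>e\<close>: one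
  for the cancellation of \<nu> inside the members of \<open>P\<close>, and twice the mass outside
  the compact cores \<open>C B\<close>.\<close>

lemma fine_translates:
  fixes \<nu> :: "'a::{topological_group_add,t2_space} set \<Rightarrow> 'f::{real_normed_field,euclidean_space}"
  assumes \<nu>: "\<nu> \<in> regular_measures" and e: "0 < e"
  shows "\<exists>V. open V \<and> 0 \<in> V \<and> (\<forall>(J :: nat set) K s. finite J \<longrightarrow> (\<forall>j\<in>J. K j \<in> sets borel) \<longrightarrow>
      disjoint_family_on K J \<longrightarrow> (\<forall>j\<in>J. \<forall>x\<in>K j. \<forall>y\<in>K j. x - y \<in> V) \<longrightarrow>
      measure (tv \<nu>) {t. - t + s \<in> (\<Union>j\<in>J. K j)} \<le> (\<Sum>j\<in>J. norm (\<nu> {t. - t + s \<in> K j})) + e)"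
proof -
  note \<nu>v = regular_measuresD[OF \<nu>]
  define T where "T = measure (tv \<nu>)"
  interpret finite_measure "tv \<nu>" by (rule finite_measure_tv[OF \<nu>v(1)])
  \<comment> \<open>Treating small total variation apart keeps \<open>T UNIV - e / 3\<close>
    nonnegative in the other case, where it is compared with the supremum in
    \<open>ennreal\<close>.\<close>
  have "\<exists>P. finite P \<and> P \<subseteq> sets borel \<and> disjoint P \<and> \<Union>P = UNIV \<and> T UNIV - e / 3 < (\<Sum>B\<in>P. norm (\<nu> B))"
  proof (cases "T UNIV < e / 3")
    case True
    then have "T UNIV - e / 3 < norm (\<nu> UNIV)" using norm_ge_zero[of "\<nu> UNIV"] by linarith
    then show ?thesis by (intro exI[of _ "{UNIV}"]) auto
  next
    case False
    have "ennreal (T UNIV - e / 3) < ennreal (T UNIV)" using e False by (simp add: ennreal_less_iff)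
    also have "\<dots> = variation \<nu> UNIV"
      using emeasure_tv[OF \<nu>v(1), of UNIV] by (simp add: emeasure_eq_measure T_def)
    finally obtain P where P: "finite P" "P \<subseteq> sets borel" "disjoint P" "\<Union>P = UNIV" "ennreal (T UNIV - e / 3) < (\<Sum>B\<in>P. ennreal (norm (\<nu> B)))"
      unfolding variation_def less_SUP_iff by auto
    then have "T UNIV - e / 3 < (\<Sum>B\<in>P. norm (\<nu> B))"
      using False by (simp add: sum_ennreal ennreal_less_iff)
    then show ?thesis using P by blast
  qed
  then obtain P where P: "finite P" "P \<subseteq> sets borel" "disjoint P" "\<Union>P = UNIV" "T UNIV - e / 3 < (\<Sum>B\<in>P. norm (\<nu> B))" by blast
  have PB: "B \<in> sets borel" if "B \<in> P" for B using P(2) that by blast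
  have Pd: "B \<inter> B' = {}" if "B \<in> P" "B' \<in> P" "B \<noteq> B'" for B B'
    using P(3) that by (auto simp: pairwise_def disjnt_def)
  define c where "c = real (card P) + 1"
  have c: "0 < c" by (simp add: c_def)
  \<comment> \<open>The cores lose at most \<eta> for each member of \<open>P\<close>, so e/3 in
    all; the summand 1 in \<open>c\<close> keeps the denominator positive.\<close>
  define \<eta> where "\<eta> = e / (3 * c)"
  have \<eta>: "0 < \<eta>" using e c by (simp add: \<eta>_def)
  have "\<exists>C. compact C \<and> C \<subseteq> B \<and> T (B - C) < \<eta>" if "B \<in> P" for B
    unfolding T_def by (rule radon_compactE[OF \<nu>v(2) PB[OF that] \<eta>]) blast
  then obtain C where C: "\<And>B. B \<in> P \<Longrightarrow> compact (C B)" "\<And>B. B \<in> P \<Longrightarrow> C B \<subseteq> B" "\<And>B. B \<in> P \<Longrightarrow> T (B - C B) < \<eta>"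
    by metis
  have CB: "C B \<in> sets borel" if "B \<in> P" for B using C(1)[OF that] by (rule borel_compact)
  \<comment> \<open>The differences of points from distinct cores form a compact set that misses 0,
    because the cores are disjoint. Its complement is the neighbourhood sought.\<close>
  define D where "D = (\<Union>B\<in>P. \<Union>B'\<in>P - {B}. (\<lambda>z. - fst z + snd z) ` (C B \<times> C B'))"
  have "compact D" unfolding D_def
    using P(1) C(1) by (intro compact_UN finite_Diff compact_continuous_image compact_Times continuous_intros) auto
  then have V: "open (- D)" by (simp add: compact_imp_closed open_Compl)
  have "0 \<notin> D"
  proof
    assume "0 \<in> D"
    then obtain B B' a b where "B \<in> P" "B' \<in> P" "B \<noteq> B'" "a \<in> C B" "b \<in> C B'" "- a + b = 0"
      unfolding D_def by force
    then show False using C(2)[of B] C(2)[of B'] Pd[of B B'] by (auto simp: neg_eq_iff_add_eq_0[symmetric])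
  qed
  then have V0: "0 \<in> - D" by simp
  define C0 where "C0 = (\<Union>B\<in>P. C B)"
  have C0: "C0 \<in> sets borel" unfolding C0_def using P(1) CB by (intro sets.finite_UN) auto
  have TC: "T (UNIV - C0) \<le> e / 3"
  proof -
    have "UNIV - C0 \<subseteq> (\<Union>B\<in>P. B - C B)"
    proof
      fix x assume "x \<in> UNIV - C0"
      moreover have "x \<in> \<Union>P" unfolding P(4) by (rule UNIV_I)
      then obtain B where "B \<in> P" "x \<in> B" by (rule UnionE)
      ultimately show "x \<in> (\<Union>B\<in>P. B - C B)" by (auto simp: C0_def)
    qed
    moreover have "(\<Union>B\<in>P. B - C B) \<in> sets (tv \<nu>)"
      using P(1) by (intro sets.finite_UN sets.Diff) (simp_all add: PB CB)
    ultimately have "T (UNIV - C0) \<le> T (\<Union>B\<in>P. B - C B)"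
      unfolding T_def by (rule finite_measure_mono)
    also have "\<dots> \<le> (\<Sum>B\<in>P. T (B - C B))"
      unfolding T_def using P(1) PB CB by (intro measure_UNION_le) auto
    also have "\<dots> \<le> (\<Sum>B\<in>P. \<eta>)" using C(3) by (intro sum_mono) (simp add: less_imp_le)
    also have "\<dots> \<le> c * \<eta>" using \<eta> by (simp add: c_def mult_right_mono)
    also have "\<dots> = e / 3" using c by (simp add: \<eta>_def)
    finally show ?thesis .
  qed
  show ?thesis
  proof (intro exI[of _ "- D"] conjI V V0 allI impI)
    fix J :: "nat set" and K s
    assume J: "finite J" and "\<forall>j\<in>J. K j \<in> sets borel" and Kd: "disjoint_family_on K J"
      and "\<forall>j\<in>J. \<forall>x\<in>K j. \<forall>y\<in>K j. x - y \<in> - D"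
    then have K: "\<And>j. j \<in> J \<Longrightarrow> K j \<in> sets borel"
      and small: "\<And>j x y. j \<in> J \<Longrightarrow> x \<in> K j \<Longrightarrow> y \<in> K j \<Longrightarrow> x - y \<in> - D" by simp_all
    define E where "E j = {t. - t + s \<in> K j}" for j
    have E: "E j \<in> sets borel" if "j \<in> J" for j
    proof -
      have "(\<lambda>t::'a. - t + s) \<in> measurable borel borel" by (intro borel_measurable_continuous_onI continuous_intros)
      from measurable_sets[OF this K[OF that]] show ?thesis by (simp add: E_def vimage_def)
    qed
    have Ed: "disjoint_family_on E J" using Kd by (auto simp: disjoint_family_on_def E_def)
    have one: "B = B'" if "j \<in> J" "a \<in> E j" "b \<in> E j" "B \<in> P" "B' \<in> P" "a \<in> C B" "b \<in> C B'" for j a b B B'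
    proof (rule ccontr)
      assume ne: "B \<noteq> B'"
      have "(- a + s) - (- b + s) \<in> - D" using that by (intro small[of j]) (auto simp: E_def)
      \<comment> \<open>The translation \<open>s\<close> cancels, also in a noncommutative group.
        This is what makes the estimate uniform in \<open>s\<close>.\<close>
      moreover have "(- a + s) - (- b + s) = - a + b"
      proof -
        have "(- a + s) - (- b + s) = - a + (s - (- b + s))" by (rule add_diff_eq[symmetric])
        also have "s - (- b + s) = s + (- s + - (- b))" by (simp only: diff_conv_add_uminus minus_add)
        also have "\<dots> = b" by (simp only: minus_minus add_minus_cancel)
        finally show ?thesis .
      qed
      ultimately have "- a + b \<notin> D" by simp
      moreover have "- a + b \<in> D" unfolding D_def using that ne
        by (intro UN_I[of B] UN_I[of B'] image_eqI[of _ _ "(a, b)"]) auto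
      ultimately show False by blast
    qed
    define F where "F j = E j \<inter> C0" for j
    have F: "F j \<in> sets borel" if "j \<in> J" for j using E[OF that] C0 by (auto simp: F_def)
    have Fd: "disjoint_family_on F J" using Ed by (auto simp: disjoint_family_on_def F_def)
    define EE where "EE = (\<Union>j\<in>J. E j)"
    define FF where "FF = (\<Union>j\<in>J. F j)"
    have EE: "EE \<in> sets borel" "FF \<in> sets borel" unfolding EE_def FF_def using J E F by (auto intro!: sets.finite_UN)
    \<comment> \<open>Each \<open>E j\<close> meets at most one core, so \<open>F j\<close> lies in
      a single member of \<open>P\<close> and at most one term of the sum is nonzero.\<close>
    have \<nu>F: "norm (\<nu> (F j)) = (\<Sum>B\<in>P. norm (\<nu> (F j \<inter> B)))" if j: "j \<in> J" for j
    proof (cases "F j = {}")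
      case True then show ?thesis using \<nu>v(1) by simp
    next
      case False
      then obtain a where a: "a \<in> E j" "a \<in> C0" by (auto simp: F_def)
      then obtain B where B: "B \<in> P" "a \<in> C B" by (auto simp: C0_def)
      have sub: "F j \<subseteq> C B"
      proof
        fix b assume "b \<in> F j"
        then obtain B' where B': "B' \<in> P" "b \<in> C B'" "b \<in> E j" by (auto simp: F_def C0_def)
        then show "b \<in> C B" using one[OF j a(1) B'(3) B(1) B'(1) B(2) B'(2)] by simp
      qed
      have "(\<Sum>B'\<in>P. norm (\<nu> (F j \<inter> B'))) = (\<Sum>B'\<in>P. if B' = B then norm (\<nu> (F j)) else 0)"
      proof (intro sum.cong refl)
        fix B' assume B': "B' \<in> P"
        show "norm (\<nu> (F j \<inter> B')) = (if B' = B then norm (\<nu> (F j)) else 0)"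
        proof (cases "B' = B")
          case True
          then have "F j \<inter> B' = F j" using sub C(2)[OF B(1)] by auto
          then show ?thesis using True by simp
        next
          case False
          then have "F j \<inter> B' = {}" using sub C(2)[OF B(1)] Pd[OF B(1) B'] by auto
          then show ?thesis using False \<nu>v(1) by simp
        qed
      qed
      then show ?thesis using P(1) B(1) by simp
    qed
    \<comment> \<open>What \<open>B\<close> contains outside all \<open>F j\<close> is paid for by
      its variation; summed over \<open>P\<close> this gives \<open>T (UNIV - FF)\<close>.\<close>
    have B1: "norm (\<nu> B) \<le> (\<Sum>j\<in>J. norm (\<nu> (F j \<inter> B))) + T (B - FF)" if B: "B \<in> P" for B
    proof -
      have FB: "(\<Union>j\<in>J. F j \<inter> B) = FF \<inter> B" by (auto simp: FF_def)
      have "\<nu> B = \<nu> ((FF \<inter> B) \<union> (B - FF))" by (rule arg_cong[of _ _ \<nu>]) auto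
      also have "\<dots> = \<nu> (FF \<inter> B) + \<nu> (B - FF)"
        using EE PB[OF B] by (intro vector_measure_Un \<nu>v(1)) auto
      also have "\<nu> (FF \<inter> B) = (\<Sum>j\<in>J. \<nu> (F j \<inter> B))"
        unfolding FB[symmetric] using J F PB[OF B] Fd
        by (intro vector_measure_UN \<nu>v(1)) (auto simp: disjoint_family_on_def)
      finally have "norm (\<nu> B) \<le> norm (\<Sum>j\<in>J. \<nu> (F j \<inter> B)) + norm (\<nu> (B - FF))" by (simp add: norm_triangle_ineq)
      also have "\<dots> \<le> (\<Sum>j\<in>J. norm (\<nu> (F j \<inter> B))) + T (B - FF)"
        unfolding T_def by (intro add_mono norm_sum norm_le_tv[OF \<nu>v(1)])
      finally show ?thesis .
    qed
    have TB: "(\<Sum>B\<in>P. T (B - FF)) = T (UNIV - FF)"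
    proof -
      have "T (\<Union>B\<in>P. B - FF) = (\<Sum>B\<in>P. T (B - FF))"
        unfolding T_def using P(1) PB EE Pd
        by (intro finite_measure_finite_Union) (auto simp: disjoint_family_on_def)
      moreover have "(\<Union>B\<in>P. B - FF) = UNIV - FF" using P(4) by auto
      ultimately show ?thesis by simp
    qed
    have "T UNIV - e / 3 \<le> (\<Sum>B\<in>P. norm (\<nu> B))" using P(5) by simp
    also have "\<dots> \<le> (\<Sum>B\<in>P. (\<Sum>j\<in>J. norm (\<nu> (F j \<inter> B))) + T (B - FF))" by (intro sum_mono B1)
    also have "\<dots> = (\<Sum>j\<in>J. norm (\<nu> (F j))) + T (UNIV - FF)"
      by (simp add: sum.distrib TB \<nu>F sum.swap[of _ P J])
    finally have 1: "T UNIV - e / 3 \<le> (\<Sum>j\<in>J. norm (\<nu> (F j))) + T (UNIV - FF)" .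
    have 2: "T (UNIV - FF) = T UNIV - T FF" unfolding T_def using EE by (intro finite_measure_Diff) auto
    \<comment> \<open>Going back from \<open>F j\<close> to \<open>E j\<close> costs the mass of
      \<open>E j\<close> off the cores, at most e/3 over all \<open>j\<close>.\<close>
    have 3: "(\<Sum>j\<in>J. norm (\<nu> (F j))) \<le> (\<Sum>j\<in>J. norm (\<nu> (E j))) + T (EE - C0)"
    proof -
      have "norm (\<nu> (F j)) \<le> norm (\<nu> (E j)) + T (E j - C0)" if j: "j \<in> J" for j
      proof -
        have "\<nu> (E j - F j) = \<nu> (E j) - \<nu> (F j)"
          using E[OF j] F[OF j] by (intro vector_measure_Diff \<nu>v(1)) (auto simp: F_def)
        then have "norm (\<nu> (F j)) \<le> norm (\<nu> (E j)) + norm (\<nu> (E j - F j))"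
          using norm_triangle_ineq4[of "\<nu> (E j)" "\<nu> (E j - F j)"] by simp
        moreover have "E j - F j = E j - C0" by (auto simp: F_def)
        ultimately show ?thesis using norm_le_tv[OF \<nu>v(1), of "E j - C0"] by (simp add: T_def)
      qed
      then have "(\<Sum>j\<in>J. norm (\<nu> (F j))) \<le> (\<Sum>j\<in>J. norm (\<nu> (E j)) + T (E j - C0))" by (rule sum_mono)
      also have "(\<Sum>j\<in>J. norm (\<nu> (E j)) + T (E j - C0)) = (\<Sum>j\<in>J. norm (\<nu> (E j))) + T (\<Union>j\<in>J. E j - C0)"
        unfolding sum.distrib T_def using J E C0 Ed
        by (subst finite_measure_finite_Union) (auto simp: disjoint_family_on_def)
      also have "(\<Union>j\<in>J. E j - C0) = EE - C0" by (auto simp: EE_def)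
      finally show ?thesis .
    qed
    have 4: "T (EE - C0) \<le> T (UNIV - C0)" unfolding T_def using EE C0 by (intro finite_measure_mono) auto
    have 5: "T FF = T EE - T (EE - C0)"
    proof -
      have "T (EE - (EE - C0)) = T EE - T (EE - C0)" unfolding T_def using EE C0 by (intro finite_measure_Diff) auto
      moreover have "EE - (EE - C0) = FF" by (auto simp: EE_def FF_def F_def)
      ultimately show ?thesis by simp
    qed
    have "{t. - t + s \<in> (\<Union>j\<in>J. K j)} = EE" by (auto simp: EE_def E_def)
    moreover have "T EE \<le> (\<Sum>j\<in>J. norm (\<nu> (E j))) + e" using 1 2 3 4 5 TC by linarith
    ultimately show "measure (tv \<nu>) {t. - t + s \<in> (\<Union>j\<in>J. K j)} \<le> (\<Sum>j\<in>J. norm (\<nu> {t. - t + s \<in> K j})) + e"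
      by (simp add: T_def E_def)
  qed
qed

text \<open>\<open>K\<close> is covered by finitely many right translates of a neighbourhood
  \<open>W\<close> with W - W inside \<open>V\<close>, and the cover is made disjoint. The centre
  cancels in (x - c) - (y - c), which is why right translates are taken.\<close>

lemma compact_fine_partition:
  fixes K V :: "'a::{topological_group_add,t2_space} set"
  assumes K: "compact K" and V: "open V" "0 \<in> V"
  shows "\<exists>(n :: nat) A. (\<forall>j. A j \<in> sets borel) \<and> disjoint_family_on A {..<n} \<and> (\<Union>j<n. A j) = K \<and>
    (\<forall>j. \<forall>x\<in>A j. \<forall>y\<in>A j. x - y \<in> V)"
proof -
  let ?d = "\<lambda>z :: 'a \<times> 'a. fst z - snd z"
  have "open (?d -` V)" using V by (intro open_vimage continuous_intros) auto
  moreover have "(0, 0) \<in> ?d -` V" using V by simp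
  ultimately obtain W1 W2 where W: "open W1" "open W2" "(0, 0) \<in> W1 \<times> W2" "W1 \<times> W2 \<subseteq> ?d -` V"
    by (rule open_prod_elim)
  define W where "W = W1 \<inter> W2"
  have W: "open W" "0 \<in> W" "\<And>x y. x \<in> W \<Longrightarrow> y \<in> W \<Longrightarrow> x - y \<in> V" using W by (auto simp: W_def subset_iff)
  define U where "U x = (\<lambda>z. z - x) -` W" for x
  have U: "open (U x)" "x \<in> U x" for x unfolding U_def using W by (auto intro!: open_vimage continuous_intros)
  obtain D where D: "D \<subseteq> K" "finite D" "K \<subseteq> (\<Union>x\<in>D. U x)"
    by (rule compactE_image[OF K, of K U]) (use U in auto)
  obtain xs where xs: "set xs = D" using D(2) finite_list by blast
  \<comment> \<open>A point is kept by the least index whose translate contains it.\<close>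
  define A where "A j = K \<inter> (U (xs ! j) - (\<Union>i<j. U (xs ! i)))" for j
  show ?thesis
  proof (intro exI[of _ "length xs"] exI[of _ A] conjI allI ballI)
    show "A j \<in> sets borel" for j unfolding A_def using borel_compact[OF K] U(1) by auto
    show "disjoint_family_on A {..<length xs}"
    proof -
      have "A i \<inter> A j = {}" if "i < j" for i j using that by (auto simp: A_def)
      then show ?thesis unfolding disjoint_family_on_def by (metis Int_commute linorder_neqE_nat)
    qed
    show "(\<Union>j<length xs. A j) = K"
    proof (intro antisym subsetI)
      fix z assume z: "z \<in> K"
      then obtain i where "i < length xs" "z \<in> U (xs ! i)" using D(3) xs by (metis UN_E in_set_conv_nth subsetD)
      then have ex: "\<exists>i. i < length xs \<and> z \<in> U (xs ! i)" by blast
      define i where "i = (LEAST i. i < length xs \<and> z \<in> U (xs ! i))"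
      have i: "i < length xs" "z \<in> U (xs ! i)" unfolding i_def using LeastI_ex[OF ex] by auto
      have "z \<notin> U (xs ! j)" if "j < i" for j
        using not_less_Least[of j "\<lambda>i. i < length xs \<and> z \<in> U (xs ! i)"] that i unfolding i_def[symmetric] by auto
      then show "z \<in> (\<Union>j<length xs. A j)" using i z by (auto simp: A_def intro!: bexI[of _ i])
    qed (auto simp: A_def)
    fix j x y assume "x \<in> A j" "y \<in> A j"
    then have "x - xs ! j \<in> W" "y - xs ! j \<in> W" by (auto simp: A_def U_def)
    then have "(x - xs ! j) - (y - xs ! j) \<in> V" by (rule W(3))
    moreover have "(x - xs ! j) - (y - xs ! j) = x - y"
      by (simp add: diff_conv_add_uminus minus_add add.assoc del: add_uminus_conv_diff)
    ultimately show "x - y \<in> V" by simp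
  qed
qed

section \<open>Haar measure of Borel sets of finite measure and of open sets\<close>

context haar
begin

text \<open>Inner regularity is assumed for open sets only; inside an open set of finite measure the
  restriction is Radon, which extends it to Borel subsets.\<close>

lemma inner_regular_finite:
  assumes A: "A \<in> sets borel" "emeasure m A < \<infinity>" and e: "0 < e"
  obtains K where "compact K" "K \<subseteq> A" "emeasure m (A - K) < ennreal e"
proof -
  obtain U where U: "open U" "A \<subseteq> U" "emeasure m U < \<infinity>" using outer_regular[OF A(1,2)] .
  interpret R: radon_pair "restr U" "restr U" using radon_restr[OF U(1,3)] by unfold_locales
  obtain K where K: "compact K" "K \<subseteq> A" "measure (restr U) (A - K) < e"
    using radon_compactE[OF R.M A(1) e] .
  have "emeasure m (A - K) = emeasure (restr U) (A - K)"
    using U A borel_compact[OF K(1)] by (subst emeasure_restr) (auto intro!: arg_cong[of _ _ "emeasure m"])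
  then have "emeasure m (A - K) < ennreal e" using K(3) e by (simp add: R.M.emeasure_eq_measure ennreal_lessI)
  then show ?thesis using that K by blast
qed

text \<open>If \<open>U\<close> were null, every compact set would be covered by finitely many null
  translates of it, and inner regularity would make the whole group null.\<close>

lemma open_emeasure_pos:
  assumes U: "open U" "U \<noteq> {}"
  shows "emeasure m U \<noteq> 0"
proof
  assume z: "emeasure m U = 0"
  obtain u where u: "u \<in> U" using U by blast
  have K0: "emeasure m K = 0" if K: "compact K" for K
  proof -
    \<comment> \<open>The translate of \<open>U\<close> by k - u, which moves \<open>u\<close> to
      \<open>k\<close>.\<close>
    let ?V = "\<lambda>k. {s. - (k - u) + s \<in> U}"
    have oV: "open (?V k)" for k
    proof -
      have "open ((\<lambda>s. - (k - u) + s) -` U)" using U by (intro open_vimage continuous_intros)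
      then show ?thesis by (simp add: vimage_def)
    qed
    have "- (k - u) + k = u" for k by (simp only: minus_diff_eq diff_add_cancel)
    then have "k \<in> ?V k" for k using u by (simp only: mem_Collect_eq)
    then have cov: "K \<subseteq> (\<Union>k\<in>K. ?V k)" by (intro subsetI UN_I)
    obtain D where D: "D \<subseteq> K" "finite D" "K \<subseteq> (\<Union>k\<in>D. ?V k)"
      by (rule compactE_image[OF K _ cov]) (rule oV)
    have "emeasure m K \<le> emeasure m (\<Union>k\<in>D. ?V k)" using D oV by (intro emeasure_mono) auto
    also have "\<dots> \<le> (\<Sum>k\<in>D. emeasure m (?V k))" using D oV by (intro emeasure_subadditive_finite) auto
    also have "\<dots> = 0" by (intro sum.neutral ballI) (simp only: emeasure_translate[OF borel_open[OF U(1)]] z)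
    finally show ?thesis by simp
  qed
  have "emeasure m UNIV \<le> 0" unfolding inner_regular[OF open_UNIV] by (intro SUP_least) (simp add: K0)
  then show False using haar by (simp add: left_haar_measure_def)
qed

end

section \<open>Domination of the variation by positive operators\<close>

context haar_Lp
begin

text \<open>The function \<tau> is a positive linear operator acting on representatives, so each of
  its laws has an exceptional null set that depends on the functions. Every passage to a limit below
  therefore runs along a countable family. Only norms of values of \<nu> enter, so real and complex
  measures are treated alike.\<close>

lemma abs_least:
  fixes \<nu> :: "'a set \<Rightarrow> 'f::{real_normed_field,euclidean_space}" and \<tau> :: "('a \<Rightarrow> real) \<Rightarrow> 'a \<Rightarrow> real"
  assumes \<nu>: "\<nu> \<in> regular_measures"
    and add: "\<And>f g. f \<in> Lp_fun m p \<Longrightarrow> g \<in> Lp_fun m p \<Longrightarrow> AE x in m. \<tau> (\<lambda>x. f x + g x) x = \<tau> f x + \<tau> g x"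
    and mult: "\<And>c f. f \<in> Lp_fun m p \<Longrightarrow> AE x in m. \<tau> (\<lambda>x. c * f x) x = c * \<tau> f x"
    and pos: "\<And>f. f \<in> Lp_fun m p \<Longrightarrow> (\<And>x. 0 \<le> f x) \<Longrightarrow> AE x in m. 0 \<le> \<tau> f x"
    and ind: "\<And>A. A \<in> sets borel \<Longrightarrow> emeasure m A < \<infinity> \<Longrightarrow> AE s in m. norm (\<nu> {t. - t + s \<in> A}) \<le> \<tau> (indicator A) s"
    and g: "g \<in> Lp_fun m p" "\<And>x. 0 \<le> g x"
  shows "AE s in m. pi_fun (measure (tv \<nu>)) g s \<le> \<tau> g s"
proof -
  note \<nu>v = regular_measuresD[OF \<nu>]
  interpret finite_measure "tv \<nu>" by (rule finite_measure_tv[OF \<nu>v(1)])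
  let ?T = "measure (tv \<nu>)"
  have T: "?T \<in> regular_measures" by (rule regular_measures_measure[OF \<nu>v(2)])
  have shB: "{t. - t + s \<in> A} \<in> sets borel" if "A \<in> sets borel" for A and s :: 'a
    by (rule shift_vimage_borel(1)[OF that])
  have mono: "AE x in m. \<tau> f x \<le> \<tau> h x" if f: "f \<in> Lp_fun m p" and h: "h \<in> Lp_fun m p" and le: "\<And>x. f x \<le> h x" for f h
  proof -
    have d: "(\<lambda>x. h x + (- 1) * f x) \<in> Lp_fun m p" by (intro Lp_fun_add Lp_fun_mult f h)
    have eq: "(\<lambda>x. f x + (h x + (- 1) * f x)) = h" by auto
    have "AE x in m. \<tau> h x = \<tau> f x + \<tau> (\<lambda>x. h x + (- 1) * f x) x" using add[OF f d] unfolding eq .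
    moreover have "AE x in m. 0 \<le> \<tau> (\<lambda>x. h x + (- 1) * f x) x" using le by (intro pos d) auto
    ultimately show ?thesis by eventually_elim simp
  qed
  have zero: "AE x in m. \<tau> (\<lambda>x. 0) x = 0" using mult[OF Lp_fun_0, of 0] by simp
  have fin: "emeasure m B < \<infinity>" if "B \<subseteq> A" "A \<in> sets borel" "emeasure m A < \<infinity>" for A B
    using emeasure_mono[of B A m] that by (auto intro: le_less_trans)
  have sums: "AE x in m. \<tau> (indicator (\<Union>j<n. A j)) x = (\<Sum>j<n. \<tau> (indicator (A j)) x)"
    if "\<And>j. j < n \<Longrightarrow> A j \<in> sets borel \<and> emeasure m (A j) < \<infinity>" "disjoint_family_on A {..<n}" for A :: "nat \<Rightarrow> 'a set" and n
    using that
  proof (induction n)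
    case 0
    have "indicat_real ({} :: 'a set) = (\<lambda>x. 0)" by auto
    then show ?case using zero by simp
  next
    case (Suc n)
    have IH: "AE x in m. \<tau> (indicator (\<Union>j<n. A j)) x = (\<Sum>j<n. \<tau> (indicator (A j)) x)"
      using Suc.prems by (intro Suc.IH) (auto intro: disjoint_family_on_mono[rotated])
    have "emeasure m (\<Union>j<n. A j) \<le> (\<Sum>j<n. emeasure m (A j))"
      using Suc.prems by (intro emeasure_subadditive_finite) auto
    also have "\<dots> < \<infinity>" using Suc.prems by simp
    finally have "indicat_real (\<Union>j<n. A j) \<in> Lp_fun m p" using Suc.prems by (intro Lp_fun_indicator) auto
    moreover have "indicat_real (A n) \<in> Lp_fun m p" using Suc.prems by (intro Lp_fun_indicator) auto
    ultimately have "AE x in m. \<tau> (\<lambda>x. indicator (\<Union>j<n. A j) x + indicator (A n) x) x = \<tau> (indicator (\<Union>j<n. A j)) x + \<tau> (indicator (A n)) x"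
      by (rule add)
    moreover have "A j \<inter> A n = {}" if "j < n" for j
      using Suc.prems(2) that by (intro disjoint_family_onD[of A "{..<Suc n}"]) auto
    then have "(\<lambda>x. indicator (\<Union>j<n. A j) x + indicat_real (A n) x) = indicator (\<Union>j<Suc n. A j)"
      by (auto simp: indicator_def fun_eq_iff less_Suc_eq)
    ultimately have "AE x in m. \<tau> (indicator (\<Union>j<Suc n. A j)) x = \<tau> (indicator (\<Union>j<n. A j)) x + \<tau> (indicator (A n)) x" by metis
    from this IH show ?case by eventually_elim simp
  qed
  \<comment> \<open>The errors are taken as 1/(k + 1), so that only countably many null sets are
    discarded.\<close>
  have compact: "AE s in m. ?T {t. - t + s \<in> K} \<le> \<tau> (indicator K) s" if K: "compact K" for K
  proof -
    have "AE s in m. ?T {t. - t + s \<in> K} \<le> \<tau> (indicator K) s + 1 / real (Suc k)" for k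
    proof -
      have k: "0 < 1 / real (Suc k)" by simp
      obtain V where V: "open V" "0 \<in> V" and V3: "\<forall>(J :: nat set) K s. finite J \<longrightarrow> (\<forall>j\<in>J. K j \<in> sets borel) \<longrightarrow>
          disjoint_family_on K J \<longrightarrow> (\<forall>j\<in>J. \<forall>x\<in>K j. \<forall>y\<in>K j. x - y \<in> V) \<longrightarrow>
          ?T {t. - t + s \<in> (\<Union>j\<in>J. K j)} \<le> (\<Sum>j\<in>J. norm (\<nu> {t. - t + s \<in> K j})) + 1 / real (Suc k)"
        using fine_translates[OF \<nu> k] by (elim exE conjE) (rule that)
      obtain n :: nat and A where A: "\<forall>j. A j \<in> sets borel" "disjoint_family_on A {..<n}" "(\<Union>j<n. A j) = K"
        "\<forall>j. \<forall>x\<in>A j. \<forall>y\<in>A j. x - y \<in> V"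
        using compact_fine_partition[OF K V] by metis
      have Af: "emeasure m (A j) < \<infinity>" if "j < n" for j
      proof (rule fin[OF _ borel_compact[OF K] emeasure_compact_finite[OF K]])
        show "A j \<subseteq> K" unfolding A(3)[symmetric] using that by (intro UN_upper) simp
      qed
      have ij: "AE s in m. norm (\<nu> {t. - t + s \<in> A j}) \<le> \<tau> (indicator (A j)) s" if "j < n" for j
        by (rule ind[OF A(1)[rule_format] Af[OF that]])
      have "AE s in m. \<forall>j\<in>{..<n}. norm (\<nu> {t. - t + s \<in> A j}) \<le> \<tau> (indicator (A j)) s"
        by (intro AE_finite_allI) (simp_all add: ij)
      moreover have "AE s in m. \<tau> (indicator K) s = (\<Sum>j<n. \<tau> (indicator (A j)) s)"
        using sums[of n A] A(1,2) Af unfolding A(3) by simp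
      ultimately show ?thesis
      proof eventually_elim
        case (elim s)
        have "?T {t. - t + s \<in> (\<Union>j<n. A j)} \<le> (\<Sum>j<n. norm (\<nu> {t. - t + s \<in> A j})) + 1 / real (Suc k)"
          by (rule V3[rule_format]) (use A(1,2,4) in simp_all)
        also have "(\<Sum>j<n. norm (\<nu> {t. - t + s \<in> A j})) \<le> (\<Sum>j<n. \<tau> (indicator (A j)) s)"
          using elim(1) by (intro sum_mono) auto
        finally show ?case using elim(2) A(3) by simp
      qed
    qed
    then have "AE s in m. \<forall>k. ?T {t. - t + s \<in> K} \<le> \<tau> (indicator K) s + 1 / real (Suc k)"
      by (simp add: AE_all_countable del: of_nat_Suc)
    then show ?thesis
    proof eventually_elim
      case (elim s)
      show ?case
      proof (rule field_le_epsilon)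
        fix e :: real assume "0 < e"
        then obtain k where "1 / real (Suc k) < e" using nat_approx_posE by blast
        then show "?T {t. - t + s \<in> K} \<le> \<tau> (indicator K) s + e" using elim[rule_format, of k] by linarith
      qed
    qed
  qed
  \<comment> \<open>Increasing compact sets \<open>L n\<close> fill \<open>A\<close> up to a Haar
    null set. For almost every \<open>s\<close> that set has a translate which is null for the
    variation, so it does not change the left side.\<close>
  have set: "AE s in m. ?T {t. - t + s \<in> A} \<le> \<tau> (indicator A) s" if A: "A \<in> sets borel" "emeasure m A < \<infinity>" for A
  proof -
    have "\<exists>K. compact K \<and> K \<subseteq> A \<and> emeasure m (A - K) < ennreal (1 / real (Suc n))" for n
      by (rule inner_regular_finite[OF A, of "1 / real (Suc n)"]) auto
    then obtain K where K: "\<And>n. compact (K n)" "\<And>n. K n \<subseteq> A" "\<And>n. emeasure m (A - K n) < ennreal (1 / real (Suc n))"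
      by metis
    define L where "L n = (\<Union>i\<le>n. K i)" for n
    have L: "compact (L n)" "L n \<subseteq> A" for n unfolding L_def using K by (auto intro!: compact_UN)
    have LB: "L n \<in> sets borel" for n using L(1) by (rule borel_compact)
    define B where "B = (\<Union>n. L n)"
    have B: "B \<in> sets borel" unfolding B_def using LB by auto
    have "emeasure m (A - B) \<le> ennreal (1 / real (Suc n))" for n
    proof -
      have "emeasure m (A - B) \<le> emeasure m (A - K n)"
        using A(1) borel_compact[OF K(1)] by (intro emeasure_mono) (auto simp: B_def L_def)
      then show ?thesis using K(3)[of n] by simp
    qed
    then have "emeasure m (A - B) = 0"
    proof -
      assume le: "\<And>n. emeasure m (A - B) \<le> ennreal (1 / real (Suc n))"
      have "(\<lambda>n. ennreal (1 / real (Suc n))) \<longlonglongrightarrow> ennreal 0"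
        by (intro tendsto_ennrealI LIMSEQ_Suc lim_1_over_n)
      from LIMSEQ_le_const[OF this, of "emeasure m (A - B)"] le show ?thesis by auto
    qed
    then have "AE x in m. x \<notin> A - B" using A B by (intro AE_not_in) (auto simp: null_sets_def)
    from AE_shift[OF \<nu>v(2) this]
    have "AE s in m. ?T {t. - t + s \<in> A} = ?T {t. - t + s \<in> B}"
    proof eventually_elim
      case (elim s)
      have BA: "B \<subseteq> A" using L by (auto simp: B_def)
      show ?case
        using elim BA shB[OF A(1)] shB[OF B] by (intro finite_measure_eq_AE) (auto elim!: eventually_mono)
    qed
    moreover have "AE s in m. \<forall>n. ?T {t. - t + s \<in> L n} \<le> \<tau> (indicator A) s"
      unfolding AE_all_countable
    proof
      fix n
      have "indicat_real (L n) \<in> Lp_fun m p" "indicat_real A \<in> Lp_fun m p"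
        using fin[OF L(2) A] A LB by (auto intro!: Lp_fun_indicator)
      moreover have "indicat_real (L n) x \<le> indicator A x" for x using L(2) by (auto simp: indicator_def)
      ultimately have "AE s in m. \<tau> (indicator (L n)) s \<le> \<tau> (indicator A) s" by (intro mono)
      with compact[OF L(1), of n] show "AE s in m. ?T {t. - t + s \<in> L n} \<le> \<tau> (indicator A) s" by eventually_elim simp
    qed
    ultimately show ?thesis
    proof eventually_elim
      case (elim s)
      have "(\<lambda>n. ?T {t. - t + s \<in> L n}) \<longlonglongrightarrow> ?T (\<Union>n. {t. - t + s \<in> L n})"
      proof (rule finite_Lim_measure_incseq)
        show "range (\<lambda>n. {t. - t + s \<in> L n}) \<subseteq> sets (tv \<nu>)" using shB[OF LB] by auto
        have "L i \<subseteq> L j" if "i \<le> j" for i j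
          unfolding L_def using that by (intro UN_mono) auto
        then show "incseq (\<lambda>n. {t. - t + s \<in> L n})" by (auto simp: incseq_def)
      qed
      moreover have "(\<Union>n. {t. - t + s \<in> L n}) = {t. - t + s \<in> B}" by (auto simp: B_def)
      ultimately have "?T {t. - t + s \<in> B} \<le> \<tau> (indicator A) s"
        using elim(2) by (intro LIMSEQ_le_const2[of "\<lambda>n. ?T {t. - t + s \<in> L n}"]) auto
      then show ?case using elim(1) by simp
    qed
  qed
  have pi_ind: "pi_fun ?T (indicator A) s = ?T {t. - t + s \<in> A}" if A: "A \<in> sets borel" for A and s :: 'a
  proof -
    have eq: "(\<lambda>t. indicat_real A (- t + s)) = indicator {t. - t + s \<in> A}" by (auto simp: indicator_def)
    show ?thesis using shB[OF A, of s]
      by (subst pi_fun_measure[OF \<nu>v(2)]) (auto simp: eq integrable_indicator_iff emeasure_eq_measure)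
  qed
  have simple: "AE s in m. pi_fun ?T h s \<le> \<tau> h s" if h: "simple_function m h" "\<And>x. 0 \<le> h x" "h \<in> Lp_fun m p" for h
  proof -
    have hB: "h -` {y} \<in> sets borel" for y using simple_functionD(2)[OF h(1), of "{y}"] by simp
    \<comment> \<open>By Chebyshev's inequality, as \<open>h\<close> is in L^p.\<close>
    have hf: "emeasure m (h -` {y}) < \<infinity>" if "0 < y" for y
    proof -
      have "ennreal (y powr p) * emeasure m (h -` {y}) = (\<integral>\<^sup>+x. ennreal (y powr p) * indicator (h -` {y}) x \<partial>m)"
        using hB by (simp add: nn_integral_cmult_indicator)
      also have "\<dots> \<le> (\<integral>\<^sup>+x. ennreal (norm (h x) powr p) \<partial>m)"
        using that by (intro nn_integral_mono) (auto simp: indicator_def)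
      also have "\<dots> < \<infinity>" using Lp_fun_iff[OF Lp_funD(1)[OF h(3)]] h(3) by simp
      finally show ?thesis using that by (auto simp: ennreal_mult_less_top)
    qed
    have sm: "(\<lambda>x. \<Sum>y\<in>Y. y * indicator (h -` {y}) x) \<in> Lp_fun m p \<and>
      (AE s in m. pi_fun ?T (\<lambda>x. \<Sum>y\<in>Y. y * indicator (h -` {y}) x) s \<le> \<tau> (\<lambda>x. \<Sum>y\<in>Y. y * indicator (h -` {y}) x) s)"
      if "finite Y" "Y \<subseteq> {0<..}" for Y
      using that
    proof (induction Y)
      case empty
      have "pi_fun ?T (\<lambda>x. 0) s = 0" for s using pi_fun_mult[OF T, of 0 "\<lambda>x. 0" s] by simp
      then show ?case using zero by (auto elim!: eventually_mono)
    next
      case (insert y Y)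
      let ?S = "\<lambda>x. \<Sum>y\<in>Y. y * indicat_real (h -` {y}) x" and ?I = "indicat_real (h -` {y})"
      have S: "?S \<in> Lp_fun m p" and IH: "AE s in m. pi_fun ?T ?S s \<le> \<tau> ?S s" using insert by auto
      have y: "0 < y" using insert.prems by simp
      have I: "?I \<in> Lp_fun m p" using hB hf[OF y] by (intro Lp_fun_indicator)
      have yI: "(\<lambda>x. y * ?I x) \<in> Lp_fun m p" by (rule Lp_fun_mult[OF I])
      have eq: "(\<lambda>x. \<Sum>y\<in>insert y Y. y * indicat_real (h -` {y}) x) = (\<lambda>x. y * ?I x + ?S x)"
        by (simp only: sum.insert[OF insert.hyps])
      have "AE s in m. pi_fun ?T (\<lambda>x. y * ?I x + ?S x) s \<le> \<tau> (\<lambda>x. y * ?I x + ?S x) s"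
        using pi_fun_add[OF T yI S] add[OF yI S] mult[OF I, of y] IH set[OF hB hf[OF y]]
      proof eventually_elim
        case (elim s)
        have "y * ?T {t. - t + s \<in> h -` {y}} \<le> y * \<tau> ?I s" using elim(5) y by (intro mult_left_mono) auto
        then show ?case using elim pi_fun_mult[OF T, of y ?I s] pi_ind[OF hB] by simp
      qed
      then show ?case unfolding eq using Lp_fun_add[OF yI S] by blast
    qed
    \<comment> \<open>The value 0 is left out: its level set may have infinite measure.\<close>
    have r: "finite (range h - {0})" "range h - {0} \<subseteq> {0<..}"
      using h(2) simple_functionD(1)[OF h(1)] by (auto simp: less_le)
    note * = conjunct2[OF sm[OF r]]
    have "(\<Sum>y\<in>range h - {0}. y * indicator (h -` {y}) x) = h x" for x
    proof -
      have "(\<Sum>y\<in>range h - {0}. y * indicator (h -` {y}) x) = (\<Sum>y\<in>range h - {0}. if y = h x then h x else 0)"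
        by (intro sum.cong) (auto simp: indicator_def)
      then show ?thesis using simple_functionD(1)[OF h(1)] by simp
    qed
    with * show ?thesis by (simp only:)
  qed
  \<comment> \<open>No continuity of \<tau> is at hand. Monotonicity bounds every \<tau> (G i) by
    \<tau> g, and on the left the integrals of the \<open>G i\<close> converge.\<close>
  obtain G where G: "incseq G" "\<forall>i. simple_function m (G i)" "\<forall>x. bdd_above (range (\<lambda>i. G i x))"
    "\<forall>i x. 0 \<le> G i x" "g = (SUP i. G i)"
    using borel_measurable_implies_simple_function_sequence_real[of g m] g(2) Lp_funD(1)[OF g(1)] by auto
  have gx: "g x = (SUP i. G i x)" for x using G(5) by (simp add: image_image)
  have Gle: "G i x \<le> g x" for i x unfolding gx using G(3) by (intro cSUP_upper) auto
  have Glim: "(\<lambda>i. G i x) \<longlonglongrightarrow> g x" for x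
    unfolding gx using G(1,3) by (intro LIMSEQ_incseq_SUP) (auto simp: incseq_def le_fun_def)
  have GL: "G i \<in> Lp_fun m p" for i
  proof (rule Lp_fun_bound[OF g(1)])
    show "G i \<in> borel_measurable borel" using borel_measurable_simple_function[OF G(2)[rule_format, of i]] by simp
    show "norm (G i x) \<le> norm (g x)" for x using G(4) Gle[of i x] g(2)[of x] by simp
  qed
  have "AE s in m. pi_fun ?T (G i) s \<le> \<tau> g s" for i
    using simple[OF G(2)[rule_format, of i] G(4)[rule_format] GL] mono[OF GL g(1) Gle, of i] by eventually_elim simp
  then have "AE s in m. \<forall>i. pi_fun ?T (G i) s \<le> \<tau> g s" by (simp add: AE_all_countable)
  then show ?thesis using shift_Lp_AE(2)[OF \<nu>v(2) g(1)]
  proof eventually_elim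
    case (elim s)
    have gm: "g \<in> borel_measurable borel" "\<And>i. G i \<in> borel_measurable borel" using Lp_funD(1)[OF g(1)] Lp_funD(1)[OF GL] by auto
    have m: "(\<lambda>t. g (- t + s)) \<in> borel_measurable (tv \<nu>)" "\<And>i. (\<lambda>t. G i (- t + s)) \<in> borel_measurable (tv \<nu>)"
      using measurable_compose[OF shift_borel1(1) gm(1)] measurable_compose[OF shift_borel1(1) gm(2)] by auto
    have Gi: "integrable (tv \<nu>) (\<lambda>t. G i (- t + s))" for i
      using Gle G(4) g(2) by (intro Bochner_Integration.integrable_bound[OF elim(2) m(2)]) auto
    have "(\<lambda>i. LINT t|tv \<nu>. G i (- t + s)) \<longlonglongrightarrow> (LINT t|tv \<nu>. g (- t + s))"
      using Glim Gle G(4) g(2)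
      by (intro integral_dominated_convergence[where w="\<lambda>t. g (- t + s)"] m elim(2)) auto
    then have "(\<lambda>i. pi_fun ?T (G i) s) \<longlonglongrightarrow> pi_fun ?T g s"
      by (simp add: pi_fun_measure[OF \<nu>v(2) Gi] pi_fun_measure[OF \<nu>v(2) elim(2)])
    then show ?case using elim(1) by (intro LIMSEQ_le_const2) auto
  qed
qed

end

section \<open>Classes of functions and regular operators\<close>

lemma nonneg_regular_measure:
  fixes \<sigma> :: "'a::t2_space set \<Rightarrow> real"
  assumes \<sigma>: "\<sigma> \<in> regular_measures" and nn: "\<And>A. A \<in> sets borel \<Longrightarrow> 0 \<le> \<sigma> A"
  shows "measure (tv \<sigma>) = \<sigma>"
proof
  fix A
  note v = regular_measuresD(1)[OF \<sigma>]
  have nn: "0 \<le> \<sigma> A" for A using nn vector_measure_nonborel[OF v] by (cases "A \<in> sets borel") auto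
  show "measure (tv \<sigma>) A = \<sigma> A" using emeasure_tv_nonneg[OF v nn, of A] nn by (simp add: measure_def)
qed

context haar_Lp
begin

lemma pi_fun_zero [simp]:
  fixes \<mu> :: "'a set \<Rightarrow> 'f::{real_normed_field,euclidean_space}"
  shows "pi_fun \<mu> (\<lambda>x. 0) s = 0"
  by (simp add: pi_fun_def vm_integral_def)

lemma pi_fun_indicator:
  fixes \<mu> :: "'a set \<Rightarrow> 'f::{real_normed_field,euclidean_space}"
  assumes \<mu>: "\<mu> \<in> regular_measures" and A: "A \<in> sets borel"
  shows "pi_fun \<mu> (\<lambda>x. indicat_real A x *\<^sub>R 1) s = \<mu> {t. - t + s \<in> A}"
proof -
  note v = regular_measuresD(1)[OF \<mu>]
  interpret finite_measure "tv \<mu>" by (rule finite_measure_tv[OF v])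
  have eq: "(\<lambda>t. indicat_real A (- t + s) *\<^sub>R (1 :: 'f)) = (\<lambda>t. indicator {t. - t + s \<in> A} t *\<^sub>R 1)"
    by (auto simp: indicator_def)
  have B: "{t. - t + s \<in> A} \<in> sets borel" by (rule shift_vimage_borel(1)[OF A])
  then show ?thesis
    using vm_integral_indicator[OF v B, of 1]
    by (simp add: pi_fun_def pi_integral_exists_def eq integrable_indicator_iff emeasure_eq_measure)
qed

lemma pi_fun_nonneg:
  assumes N: "radon N" and f: "f \<in> Lp_fun m p" and nn: "AE x in m. 0 \<le> f x"
  shows "AE s in m. 0 \<le> pi_fun (measure N) f s"
  using AE_shift[OF N nn] shift_Lp_AE(2)[OF N f]
  by eventually_elim (simp add: pi_fun_measure[OF N] integral_nonneg_AE)

text \<open>Domination with \<tau> = 0 gives |\<sigma>|(s - U) = 0 for almost every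
  \<open>s\<close>, where \<open>U\<close> is an open neighbourhood of 0. The exceptional set is
  open by lower semicontinuity, hence empty. Finitely many sets s - U cover a compact set, so
  |\<sigma>| vanishes on compact sets.\<close>

lemma regular_measure_zero:
  fixes \<sigma> :: "'a set \<Rightarrow> 'f::{real_normed_field,euclidean_space}"
  assumes \<sigma>: "\<sigma> \<in> regular_measures"
    and z: "\<And>A. A \<in> sets borel \<Longrightarrow> emeasure m A < \<infinity> \<Longrightarrow> AE s in m. \<sigma> {t. - t + s \<in> A} = 0"
  shows "\<sigma> = (\<lambda>A. 0)"
proof -
  note v = regular_measuresD[OF \<sigma>]
  interpret radon_pair "tv \<sigma>" "tv \<sigma>" using v by unfold_locales
  let ?T = "measure (tv \<sigma>)"
  obtain U where U: "open U" "{0} \<subseteq> U" "emeasure m U < \<infinity>"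
    by (rule outer_regular[OF borel_compact emeasure_compact_finite, of "{0}"]) simp_all
  have UL: "indicat_real U \<in> Lp_fun m p" using U by (intro Lp_fun_indicator) auto
  have T: "?T \<in> regular_measures" by (rule regular_measures_measure[OF v(2)])
  have "AE s in m. pi_fun ?T (indicator U) s \<le> 0"
  proof (rule abs_least[OF \<sigma>, where \<tau>="\<lambda>f x. 0"])
    fix A :: "'a set" assume A: "A \<in> sets borel" "emeasure m A < \<infinity>"
    show "AE s in m. norm (\<sigma> {t. - t + s \<in> A}) \<le> 0" using z[OF A] by simp
  qed (use UL in \<open>simp_all add: indicator_def\<close>)
  moreover have "pi_fun ?T (indicator U) s = ?T {t. - t + s \<in> U}" for s
    using pi_fun_indicator[OF T borel_open[OF U(1)], of s] by simp
  ultimately have ae: "AE s in m. \<not> 0 < ?T {t. - t + s \<in> U}" by (simp add: not_less)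
  have "open ((\<lambda>z :: 'a \<times> 'a. - snd z + fst z) -` U)" using U(1) by (intro open_vimage continuous_intros)
  from open_superlevel_section[OF this, of 0] have o: "open {s. 0 < ?T {t. - t + s \<in> U}}" by (simp add: vimage_def)
  have "emeasure m {s. 0 < ?T {t. - t + s \<in> U}} = 0"
    using ae o by (subst (asm) AE_iff_measurable[OF _ refl]) auto
  then have "{s. 0 < ?T {t. - t + s \<in> U}} = {}" using open_emeasure_pos[OF o] by blast
  then have T0: "?T {t. - t + s \<in> U} = 0" for s
    using measure_nonneg[of "tv \<sigma>" "{t. - t + s \<in> U}"] by (auto simp: less_le)
  have K0: "?T K = 0" if K: "compact K" for K
  proof -
    have oV: "open {t. - t + s \<in> U}" for s
    proof -
      have "open ((\<lambda>t. - t + s) -` U)" using U(1) by (intro open_vimage continuous_intros)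
      then show ?thesis by (simp add: vimage_def)
    qed
    have cov: "K \<subseteq> (\<Union>s\<in>K. {t. - t + s \<in> U})" using U(2) by auto
    obtain D where D: "D \<subseteq> K" "finite D" "K \<subseteq> (\<Union>s\<in>D. {t. - t + s \<in> U})"
      by (rule compactE_image[OF K _ cov]) (rule oV)
    have "?T K \<le> ?T (\<Union>s\<in>D. {t. - t + s \<in> U})" using D oV by (intro M.finite_measure_mono) auto
    also have "\<dots> \<le> (\<Sum>s\<in>D. ?T {t. - t + s \<in> U})" using D oV by (intro measure_UNION_le) auto
    finally show ?thesis using T0 by (simp add: measure_le_0_iff)
  qed
  have TU: "?T UNIV = 0"
  proof (rule ccontr)
    assume "?T UNIV \<noteq> 0"
    then have pos: "0 < ?T UNIV" by (simp add: less_le)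
    obtain K where K: "compact K" "?T (UNIV - K) < ?T UNIV" using radon_compactE[OF v(2) _ pos, of UNIV] by auto
    have "?T (UNIV - K) = ?T UNIV - ?T K" using borel_compact[OF K(1)] by (intro M.finite_measure_Diff) auto
    then show False using K K0 by simp
  qed
  show ?thesis
  proof
    fix A
    have "?T A \<le> ?T UNIV" by (rule M.bounded_measure[unfolded space_tv])
    then show "\<sigma> A = 0" using norm_le_tv[OF v(1), of A] TU by (metis norm_le_zero_iff order_trans)
  qed
qed

section \<open>Classes of functions\<close>

abbreviation cl :: "('a \<Rightarrow> 'f::{real_normed_field,euclidean_space}) \<Rightarrow> ('a \<Rightarrow> 'f) set" where
  "cl \<equiv> Lp_class m p"

lemma cl_self: "f \<in> Lp_fun m p \<Longrightarrow> f \<in> cl f"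
  by (simp add: Lp_class_def)

lemma clD: "g \<in> cl f \<Longrightarrow> g \<in> Lp_fun m p" "g \<in> cl f \<Longrightarrow> AE x in m. g x = f x"
  by (auto simp: Lp_class_def)

lemma cl_eqI: "AE x in m. f x = g x \<Longrightarrow> cl f = cl g"
  unfolding Lp_class_def by (auto elim: eventually_elim2)

lemma cl_eqD: "f \<in> Lp_fun m p \<Longrightarrow> cl f = cl g \<Longrightarrow> AE x in m. f x = g x"
  using cl_self clD(2) by blast

text \<open>The operations on classes are unions over all representatives; when the result does not
  depend on the representative, this is a union of equal sets.\<close>

lemma cl_UN:
  assumes "f \<in> Lp_fun m p" "\<And>f'. f' \<in> cl f \<Longrightarrow> X f' = X f"
  shows "(\<Union>f'\<in>cl f. X f') = X f"
  using assms cl_self by blast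

lemma Lp_add_cl:
  fixes f g :: "'a \<Rightarrow> 'f::{real_normed_field,euclidean_space}"
  assumes f: "f \<in> Lp_fun m p" and g: "g \<in> Lp_fun m p"
  shows "(\<Union>f\<in>cl f. \<Union>g\<in>cl g. cl (\<lambda>x. f x + g x)) = cl (\<lambda>x. f x + g x)"
proof -
  have "(\<Union>g'\<in>cl g. cl (\<lambda>x. f' x + g' x)) = cl (\<lambda>x. f x + g x)" if f': "f' \<in> cl f" for f'
  proof -
    have "(\<Union>g'\<in>cl g. cl (\<lambda>x. f' x + g' x)) = cl (\<lambda>x. f' x + g x)"
      using g by (intro cl_UN cl_eqI) (auto dest: clD(2) elim!: eventually_mono)
    also have "\<dots> = cl (\<lambda>x. f x + g x)" using clD(2)[OF f'] by (intro cl_eqI) (auto elim!: eventually_mono)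
    finally show ?thesis .
  qed
  then show ?thesis using cl_self[OF f] by blast
qed

lemma Lp_map_cl:
  fixes f :: "'a \<Rightarrow> 'f::{real_normed_field,euclidean_space}" and \<phi> :: "'f \<Rightarrow> 'g::{real_normed_field,euclidean_space}"
  assumes f: "f \<in> Lp_fun m p"
  shows "(\<Union>f\<in>cl f. cl (\<lambda>x. \<phi> (f x))) = cl (\<lambda>x. \<phi> (f x))"
  using f by (intro cl_UN cl_eqI) (auto dest: clD(2) elim!: eventually_mono)

lemma Lp_norm_cl:
  fixes f :: "'a \<Rightarrow> 'f::{real_normed_field,euclidean_space}"
  assumes f: "f \<in> Lp_fun m p"
  shows "Lp_norm m p (cl f) = (LINT x|m. norm (f x) powr p) powr (1 / p)"
proof -
  have eq: "(LINT x|m. norm (g x) powr p) = (LINT x|m. norm (f x) powr p)" if "g \<in> cl f" for g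
    using clD[OF that] Lp_funD(1)[OF f] Lp_funD(1)[OF clD(1)[OF that]]
    by (intro integral_cong_AE) (auto elim!: eventually_mono)
  show ?thesis unfolding Lp_norm_def
  proof (rule the_equality)
    show "\<exists>g\<in>cl f. (LINT x|m. norm (f x) powr p) powr (1 / p) = (LINT x|m. norm (g x) powr p) powr (1 / p)"
      by (rule bexI[OF refl cl_self[OF f]])
    fix r assume "\<exists>g\<in>cl f. r = (LINT x|m. norm (g x) powr p) powr (1 / p)"
    then obtain g where "g \<in> cl f" "r = (LINT x|m. norm (g x) powr p) powr (1 / p)" by (elim bexE)
    then show "r = (LINT x|m. norm (f x) powr p) powr (1 / p)" using eq[of g] by simp
  qed
qed

lemma pi_op_cl:
  fixes \<mu> :: "'a set \<Rightarrow> 'f::{real_normed_field,euclidean_space}"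
  assumes \<mu>: "\<mu> \<in> regular_measures" and f: "f \<in> Lp_fun m p"
  shows "pi_op m p \<mu> (cl f) = cl (pi_fun \<mu> f)"
proof -
  have "(\<Union>g\<in>cl f. cl (pi_fun \<mu> g)) = cl (pi_fun \<mu> f)"
  proof (intro cl_UN f cl_eqI)
    fix g assume "g \<in> cl f"
    then show "AE s in m. pi_fun \<mu> g s = pi_fun \<mu> f s"
      using Lp_funD(1)[OF f] Lp_funD(1)[OF clD(1)] clD(2) by (intro pi_fun_cong_AE[OF \<mu>]) auto
  qed
  then show ?thesis using f by (simp add: pi_op_def)
qed

lemma pi_op_extensional: "pi_op m p \<mu> \<in> extensional (cl ` Lp_fun m p)"
  by (simp add: pi_op_def)

abbreviation E where "E \<equiv> Lp_real m p"

lemma E_carrier [simp]: "vs_carrier E = cl ` Lp_fun m p" by (simp add: Lp_real_def)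
lemma E_zero [simp]: "vs_zero E = cl (\<lambda>x. 0)" by (simp add: Lp_real_def)

lemma E_add: "f \<in> Lp_fun m p \<Longrightarrow> g \<in> Lp_fun m p \<Longrightarrow> vs_add E (cl f) (cl g) = cl (\<lambda>x. f x + g x)"
  by (simp add: Lp_real_def Lp_add_cl)

lemma E_scale: "f \<in> Lp_fun m p \<Longrightarrow> vs_scale E c (cl f) = cl (\<lambda>x. c * f x)"
  by (simp add: Lp_real_def Lp_map_cl)

lemma E_diff: "f \<in> Lp_fun m p \<Longrightarrow> g \<in> Lp_fun m p \<Longrightarrow> vs_diff E (cl f) (cl g) = cl (\<lambda>x. f x + - 1 * g x)"
  by (simp only: vs_diff_def E_scale E_add Lp_fun_mult)

lemma E_norm: "f \<in> Lp_fun m p \<Longrightarrow> vs_norm E (cl f) = (LINT x|m. norm (f x) powr p) powr (1 / p)"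
  by (simp add: Lp_real_def Lp_norm_cl del: real_norm_def)

lemma E_le:
  assumes f: "f \<in> Lp_fun m p" and g: "g \<in> Lp_fun m p"
  shows "bl_le E (cl f) (cl g) \<longleftrightarrow> (AE x in m. f x \<le> g x)"
proof
  assume "bl_le E (cl f) (cl g)"
  then obtain f' g' where "f' \<in> cl f" "g' \<in> cl g" "AE x in m. f' x \<le> g' x" by (auto simp: Lp_real_def)
  from clD(2)[OF this(1)] clD(2)[OF this(2)] this(3) show "AE x in m. f x \<le> g x" by eventually_elim simp
qed (use cl_self f g in \<open>auto simp: Lp_real_def\<close>)

text \<open>The positive part of any representative: it is nonnegative everywhere, as
  \<open>abs_least\<close> asks.\<close>

lemma nonneg_cl:
  assumes x: "x \<in> vs_carrier E" and nn: "bl_le E (vs_zero E) x"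
  obtains f where "f \<in> Lp_fun m p" "\<And>s. 0 \<le> f s" "x = cl f"
proof -
  obtain h where h: "h \<in> Lp_fun m p" "x = cl h" using x by auto
  have ae: "AE s in m. 0 \<le> h s" using nn h E_le[OF Lp_fun_0 h(1)] by simp
  have hm: "h \<in> borel_measurable borel" by (rule Lp_funD[OF h(1)])
  show ?thesis
  proof (rule that[of "\<lambda>s. max 0 (h s)"])
    show "(\<lambda>s. max 0 (h s)) \<in> Lp_fun m p" using hm by (intro Lp_fun_bound[OF h(1)]) auto
    show "x = cl (\<lambda>s. max 0 (h s))" unfolding h(2) using ae by (intro cl_eqI) (auto elim!: eventually_mono)
  qed simp
qed

section \<open>Regular operators through representatives\<close>

text \<open>Lets an operator on classes act on functions, in the form that \<open>abs_least\<close>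
  expects. The representative is an arbitrary choice, so linearity turns into equations that hold
  almost everywhere.\<close>

definition lift :: "(('a \<Rightarrow> real) set \<Rightarrow> ('a \<Rightarrow> real) set) \<Rightarrow> ('a \<Rightarrow> real) \<Rightarrow> 'a \<Rightarrow> real" where
  "lift T f = (SOME h. h \<in> Lp_fun m p \<and> T (cl f) = cl h)"

lemma liftI:
  assumes "T (cl f) \<in> cl ` Lp_fun m p"
  shows "lift T f \<in> Lp_fun m p" "T (cl f) = cl (lift T f)"
  using someI_ex[of "\<lambda>h. h \<in> Lp_fun m p \<and> T (cl f) = cl h"] assms unfolding lift_def by auto

lemma linear_map_lift:
  assumes T: "linear_map E E T" and f: "f \<in> Lp_fun m p"
  shows "lift T f \<in> Lp_fun m p" "T (cl f) = cl (lift T f)"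
    and "g \<in> Lp_fun m p \<Longrightarrow> AE x in m. lift T (\<lambda>x. f x + g x) x = lift T f x + lift T g x"
    and "AE x in m. lift T (\<lambda>x. c * f x) x = c * lift T f x"
proof -
  have c: "T (cl f) \<in> cl ` Lp_fun m p" if "f \<in> Lp_fun m p" for f using T that by (auto simp: linear_map_def)
  note l = liftI[of T, OF c]
  show "lift T f \<in> Lp_fun m p" "T (cl f) = cl (lift T f)" using l[OF f] .
  show "AE x in m. lift T (\<lambda>x. f x + g x) x = lift T f x + lift T g x" if g: "g \<in> Lp_fun m p"
  proof -
    have fg: "(\<lambda>x. f x + g x) \<in> Lp_fun m p" by (rule Lp_fun_add[OF f g])
    have "T (vs_add E (cl f) (cl g)) = vs_add E (T (cl f)) (T (cl g))" using T f g by (auto simp: linear_map_def)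
    then have "cl (lift T (\<lambda>x. f x + g x)) = cl (\<lambda>x. lift T f x + lift T g x)"
      unfolding E_add[OF f g] l(2)[OF f] l(2)[OF g] E_add[OF l(1)[OF f] l(1)[OF g]] l(2)[OF fg] .
    from cl_eqD[OF l(1)[OF fg] this] show ?thesis .
  qed
  show "AE x in m. lift T (\<lambda>x. c * f x) x = c * lift T f x"
  proof -
    have cf: "(\<lambda>x. c * f x) \<in> Lp_fun m p" by (rule Lp_fun_mult[OF f])
    have "T (vs_scale E c (cl f)) = vs_scale E c (T (cl f))" using T f by (auto simp: linear_map_def)
    then have "cl (lift T (\<lambda>x. c * f x)) = cl (\<lambda>x. c * lift T f x)"
      unfolding E_scale[OF f] l(2)[OF f] E_scale[OF l(1)[OF f]] l(2)[OF cf] .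
    from cl_eqD[OF l(1)[OF cf] this] show ?thesis .
  qed
qed

lemma linear_map_E_I:
  assumes T: "\<And>f. f \<in> Lp_fun m p \<Longrightarrow> T (cl f) = cl (F f) \<and> F f \<in> Lp_fun m p"
    and "\<And>f g. f \<in> Lp_fun m p \<Longrightarrow> g \<in> Lp_fun m p \<Longrightarrow> AE x in m. F (\<lambda>x. f x + g x) x = F f x + F g x"
    and "\<And>c f. f \<in> Lp_fun m p \<Longrightarrow> AE x in m. F (\<lambda>x. c * f x) x = c * F f x"
  shows "linear_map E E T"
  unfolding linear_map_def
proof (intro conjI ballI allI)
  show "T \<in> vs_carrier E \<rightarrow> vs_carrier E" using T by auto
next
  fix x y assume "x \<in> vs_carrier E" "y \<in> vs_carrier E"
  then obtain f g where "x = cl f" "y = cl g" and fg: "f \<in> Lp_fun m p" "g \<in> Lp_fun m p" by auto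
  then show "T (vs_add E x y) = vs_add E (T x) (T y)"
    using T[OF fg(1)] T[OF fg(2)] T[OF Lp_fun_add[OF fg]] cl_eqI[OF assms(2)[OF fg]] by (simp add: E_add)
next
  fix c x assume "x \<in> vs_carrier E"
  then obtain f where "x = cl f" and f: "f \<in> Lp_fun m p" by auto
  then show "T (vs_scale E c x) = vs_scale E c (T x)"
    using T[OF f] T[OF Lp_fun_mult[OF f, of c]] cl_eqI[OF assms(3)[OF f, of c]] by (simp add: E_scale)
qed

lemma reg_ops_linear:
  assumes "T \<in> reg_ops E" shows "linear_map E E T"
proof -
  obtain A B where A: "linear_map E E A" and B: "linear_map E E B" and T: "\<And>x. x \<in> vs_carrier E \<Longrightarrow> T x = vs_diff E (A x) (B x)"
    using assms unfolding reg_ops_def positive_op_def by blast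
  note a = linear_map_lift[OF A] and b = linear_map_lift[OF B]
  show ?thesis
  proof (rule linear_map_E_I[where F="\<lambda>f x. lift A f x + - 1 * lift B f x"])
    fix f :: "'a \<Rightarrow> real" assume f: "f \<in> Lp_fun m p"
    have "T (cl f) = cl (\<lambda>x. lift A f x + - 1 * lift B f x)"
      using f by (subst T) (auto simp: a(2)[OF f] b(2)[OF f] E_diff[OF a(1)[OF f] b(1)[OF f]])
    then show "T (cl f) = cl (\<lambda>x. lift A f x + - 1 * lift B f x) \<and> (\<lambda>x. lift A f x + - 1 * lift B f x) \<in> Lp_fun m p"
      using Lp_fun_add[OF a(1)[OF f] Lp_fun_mult[OF b(1)[OF f]]] by blast
    show "AE x in m. lift A (\<lambda>x. c * f x) x + - 1 * lift B (\<lambda>x. c * f x) x = c * (lift A f x + - 1 * lift B f x)" for c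
      using a(4)[OF f, of c] b(4)[OF f, of c] by eventually_elim (simp add: algebra_simps)
    fix g :: "'a \<Rightarrow> real" assume g: "g \<in> Lp_fun m p"
    show "AE x in m. lift A (\<lambda>x. f x + g x) x + - 1 * lift B (\<lambda>x. f x + g x) x
      = lift A f x + - 1 * lift B f x + (lift A g x + - 1 * lift B g x)"
      using a(3)[OF f g] b(3)[OF f g] by eventually_elim simp
  qed
qed

lemma reg_le_lift:
  assumes S: "linear_map E E S" and T: "linear_map E E T"
  shows "reg_le E S T \<longleftrightarrow> (\<forall>f\<in>Lp_fun m p. (\<forall>x. 0 \<le> f x) \<longrightarrow> (AE x in m. lift S f x \<le> lift T f x))" (is "_ = ?R")
proof
  assume le: "reg_le E S T"
  show ?R
  proof (intro ballI impI)
    fix f :: "'a \<Rightarrow> real" assume f: "f \<in> Lp_fun m p" "\<forall>x. 0 \<le> f x"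
    then have "bl_le E (vs_zero E) (cl f)" by (simp add: E_le)
    then have "bl_le E (S (cl f)) (T (cl f))" using le f by (simp add: reg_le_def)
    then show "AE x in m. lift S f x \<le> lift T f x"
      using linear_map_lift(1,2)[OF S f(1)] linear_map_lift(1,2)[OF T f(1)] by (simp add: E_le)
  qed
next
  assume R: ?R
  show "reg_le E S T" unfolding reg_le_def
  proof (intro ballI impI)
    fix x assume "x \<in> vs_carrier E" "bl_le E (vs_zero E) x"
    then obtain f where f: "f \<in> Lp_fun m p" "\<And>s. 0 \<le> f s" "x = cl f" by (rule nonneg_cl) blast
    then show "bl_le E (S x) (T x)"
      using R linear_map_lift(1,2)[OF S f(1)] linear_map_lift(1,2)[OF T f(1)] by (simp add: E_le)
  qed
qed

text \<open>The order tests nonnegative elements only. For general \<open>f\<close> the operators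
  agree on the positive and the negative part, and f plus its negative part is its positive
  part.\<close>

lemma reg_ops_eqI:
  assumes S: "S \<in> reg_ops E" and T: "T \<in> reg_ops E" and "reg_le E S T" "reg_le E T S"
  shows "S = T"
proof (rule extensionalityI)
  show "S \<in> extensional (vs_carrier E)" "T \<in> extensional (vs_carrier E)" using S T by (auto simp: reg_ops_def)
  note s = linear_map_lift[OF reg_ops_linear[OF S]] and t = linear_map_lift[OF reg_ops_linear[OF T]]
  fix x assume "x \<in> vs_carrier E"
  then obtain f where f: "f \<in> Lp_fun m p" "x = cl f" by auto
  have fm: "f \<in> borel_measurable borel" by (rule Lp_funD[OF f(1)])
  let ?p = "\<lambda>x. max 0 (f x)" and ?n = "\<lambda>x. max 0 (- f x)"
  have P: "?p \<in> Lp_fun m p" "?n \<in> Lp_fun m p" using fm by (intro Lp_fun_bound[OF f(1)]; auto)+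
  have eq: "(\<lambda>x. f x + ?n x) = ?p" by auto
  have h: "AE x in m. lift S h x = lift T h x" if "h \<in> Lp_fun m p" "\<And>x. 0 \<le> h x" for h
  proof -
    have "AE x in m. lift S h x \<le> lift T h x"
      using assms(3) that by (simp add: reg_le_lift[OF reg_ops_linear[OF S] reg_ops_linear[OF T]])
    moreover have "AE x in m. lift T h x \<le> lift S h x"
      using assms(4) that by (simp add: reg_le_lift[OF reg_ops_linear[OF T] reg_ops_linear[OF S]])
    ultimately show ?thesis by eventually_elim simp
  qed
  have "AE x in m. lift S ?p x = lift T ?p x" "AE x in m. lift S ?n x = lift T ?n x"
    by (rule h[OF P(1)] h[OF P(2)], simp)+
  then have "AE x in m. lift S f x = lift T f x"
    using s(3)[OF f(1) P(2), unfolded eq] t(3)[OF f(1) P(2), unfolded eq] by eventually_elim simp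
  then show "S x = T x" using s(2)[OF f(1)] t(2)[OF f(1)] f(2) cl_eqI by simp
qed

lemma least_ub_reg:
  assumes "S \<in> reg_ops E" "\<And>T. T \<in> X \<Longrightarrow> reg_le E T S"
    and "\<And>U. U \<in> reg_ops E \<Longrightarrow> (\<And>T. T \<in> X \<Longrightarrow> reg_le E T U) \<Longrightarrow> reg_le E S U"
  shows "least_ub (reg_ops E) (reg_le E) X = S"
  unfolding least_ub_def
proof (rule the_equality)
  fix U assume U: "U \<in> reg_ops E \<and> (\<forall>a\<in>X. reg_le E a U) \<and> (\<forall>u\<in>reg_ops E. (\<forall>a\<in>X. reg_le E a u) \<longrightarrow> reg_le E U u)"
  then show "U = S" using assms by (intro reg_ops_eqI) auto
qed (use assms in auto)

end

section \<open>The real case\<close>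

text \<open>The last assumption says that an upper bound of \<open>X\<close> dominates the norm of
  \<nu>. In this form the lemma serves the pair \<mu>, -\<mu> as well as the rotations of a complex
  measure.\<close>

lemma least_ub_measures:
  fixes \<nu> :: "'a::t2_space set \<Rightarrow> 'f::{real_normed_field,euclidean_space}"
  assumes \<nu>: "\<nu> \<in> regular_measures"
    and ub: "\<And>x A. x \<in> X \<Longrightarrow> A \<in> sets borel \<Longrightarrow> x A \<le> measure (tv \<nu>) A"
    and le: "\<And>u A. u \<in> regular_measures \<Longrightarrow> (\<And>x A. x \<in> X \<Longrightarrow> A \<in> sets borel \<Longrightarrow> x A \<le> u A) \<Longrightarrow> A \<in> sets borel \<Longrightarrow> norm (\<nu> A) \<le> u A"
  shows "least_ub regular_measures (\<lambda>\<mu> \<nu>. \<forall>A\<in>sets borel. \<mu> A \<le> \<nu> A) X = measure (tv \<nu>)"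
proof -
  note v = regular_measuresD[OF \<nu>]
  interpret finite_measure "tv \<nu>" by (rule finite_measure_tv[OF v(1)])
  have T: "measure (tv \<nu>) \<in> regular_measures" by (rule regular_measures_measure[OF v(2)])
  have least: "measure (tv \<nu>) A \<le> u A" if u: "u \<in> regular_measures" "\<And>x A. x \<in> X \<Longrightarrow> A \<in> sets borel \<Longrightarrow> x A \<le> u A" and A: "A \<in> sets borel" for u A
  proof -
    have n: "norm (\<nu> A) \<le> u A" if "A \<in> sets borel" for A by (rule le[OF u(1) _ that]) (rule u(2))
    \<comment> \<open>An upper bound dominates a norm, so it is a positive measure and equals its
      own variation.\<close>
    then have "0 \<le> u A" if "A \<in> sets borel" for A using that norm_ge_zero order_trans by blast
    from nonneg_regular_measure[OF u(1) this] have eq: "measure (tv u) = u" .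
    interpret U: finite_measure "tv u" by (rule finite_measure_tv[OF regular_measuresD(1)[OF u(1)]])
    have "emeasure (tv \<nu>) A \<le> emeasure (tv u) A"
    proof (rule emeasure_tv_le[OF v(1)])
      fix B :: "'a set" assume "B \<in> sets borel"
      then show "ennreal (norm (\<nu> B)) \<le> emeasure (tv u) B" using n[of B] by (simp add: U.emeasure_eq_measure eq ennreal_leI)
    qed simp
    then have "measure (tv \<nu>) A \<le> measure (tv u) A"
      unfolding emeasure_eq_measure U.emeasure_eq_measure by (subst (asm) ennreal_le_iff) simp_all
    then show ?thesis by (simp add: eq)
  qed
  show ?thesis unfolding least_ub_def
  proof (rule the_equality)
    show "measure (tv \<nu>) \<in> regular_measures \<and> (\<forall>a\<in>X. \<forall>A\<in>sets borel. a A \<le> measure (tv \<nu>) A) \<and>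
      (\<forall>u\<in>regular_measures. (\<forall>a\<in>X. \<forall>A\<in>sets borel. a A \<le> u A) \<longrightarrow> (\<forall>A\<in>sets borel. measure (tv \<nu>) A \<le> u A))"
      using T ub least by blast
    fix s assume s: "s \<in> regular_measures \<and> (\<forall>a\<in>X. \<forall>A\<in>sets borel. a A \<le> s A) \<and>
      (\<forall>u\<in>regular_measures. (\<forall>a\<in>X. \<forall>A\<in>sets borel. a A \<le> u A) \<longrightarrow> (\<forall>A\<in>sets borel. s A \<le> u A))"
    show "s = measure (tv \<nu>)"
    proof
      fix A show "s A = measure (tv \<nu>) A"
      proof (cases "A \<in> sets borel")
        case True
        then show ?thesis using s T ub least[of s A] by (intro antisym) blast+
      next
        case False
        have "vector_measure s" using s regular_measuresD(1) by blast
        then show ?thesis using False by (simp add: vector_measure_nonborel measure_notin_sets)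
      qed
    qed
  qed
qed

context haar_Lp
begin

lemma pi_op_linear:
  fixes \<mu> :: "'a set \<Rightarrow> real"
  assumes \<mu>: "\<mu> \<in> regular_measures" shows "linear_map E E (pi_op m p \<mu>)"
  by (rule linear_map_E_I[where F="pi_fun \<mu>"])
    (auto simp: pi_op_cl[OF \<mu>] pi_fun_Lp[OF \<mu>] pi_fun_mult[OF \<mu>] intro: pi_fun_add[OF \<mu>])

lemma lift_pi_op:
  fixes \<mu> :: "'a set \<Rightarrow> real"
  assumes \<mu>: "\<mu> \<in> regular_measures" and f: "f \<in> Lp_fun m p"
  shows "AE x in m. lift (pi_op m p \<mu>) f x = pi_fun \<mu> f x"
  using linear_map_lift(1,2)[OF pi_op_linear[OF \<mu>] f] pi_op_cl[OF \<mu> f] by (intro cl_eqD) auto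

lemma pi_op_mono:
  fixes \<mu> \<nu> :: "'a set \<Rightarrow> real"
  assumes \<mu>: "\<mu> \<in> regular_measures" and \<nu>: "\<nu> \<in> regular_measures" and le: "\<And>A. A \<in> sets borel \<Longrightarrow> \<mu> A \<le> \<nu> A"
  shows "reg_le E (pi_op m p \<mu>) (pi_op m p \<nu>)"
  unfolding reg_le_lift[OF pi_op_linear[OF \<mu>] pi_op_linear[OF \<nu>]]
proof (intro ballI impI)
  fix f :: "'a \<Rightarrow> real" assume f: "f \<in> Lp_fun m p" "\<forall>x. 0 \<le> f x"
  define \<sigma> where "\<sigma> A = \<nu> A + - 1 * \<mu> A" for A
  have \<sigma>: "\<sigma> \<in> regular_measures" unfolding \<sigma>_def by (intro regular_measures_add regular_measures_mult \<mu> \<nu>)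
  have eq: "measure (tv \<sigma>) = \<sigma>" using le by (intro nonneg_regular_measure \<sigma>) (simp add: \<sigma>_def)
  have sum: "(\<lambda>A. \<mu> A + \<sigma> A) = \<nu>" by (simp add: \<sigma>_def)
  have "AE s in m. 0 \<le> pi_fun \<sigma> f s" using pi_fun_nonneg[OF regular_measuresD(2)[OF \<sigma>] f(1)] f(2) by (simp add: eq)
  then show "AE x in m. lift (pi_op m p \<mu>) f x \<le> lift (pi_op m p \<nu>) f x"
    using pi_fun_add_measure[OF \<mu> \<sigma> f(1), unfolded sum] lift_pi_op[OF \<mu> f(1)] lift_pi_op[OF \<nu> f(1)]
    by eventually_elim simp
qed

lemma pi_op_positive:
  fixes \<sigma> :: "'a set \<Rightarrow> real"
  assumes \<sigma>: "\<sigma> \<in> regular_measures" and nn: "\<And>A. A \<in> sets borel \<Longrightarrow> 0 \<le> \<sigma> A"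
  shows "positive_op E (pi_op m p \<sigma>)"
  unfolding positive_op_def
proof (intro conjI ballI impI pi_op_linear[OF \<sigma>])
  fix x assume "x \<in> vs_carrier E" "bl_le E (vs_zero E) x"
  then obtain f where f: "f \<in> Lp_fun m p" "\<And>s. 0 \<le> f s" "x = cl f" by (rule nonneg_cl) blast
  have "AE s in m. 0 \<le> pi_fun \<sigma> f s"
    using pi_fun_nonneg[OF regular_measuresD(2)[OF \<sigma>] f(1)] f(2) by (simp add: nonneg_regular_measure[OF \<sigma> nn])
  then show "bl_le E (vs_zero E) (pi_op m p \<sigma> x)"
    using pi_op_cl[OF \<sigma> f(1)] pi_fun_Lp[OF \<sigma> f(1)] by (simp add: f(3) E_le)
qed

lemma op_scale_pi_op:
  fixes \<mu> :: "'a set \<Rightarrow> real"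
  assumes \<mu>: "\<mu> \<in> regular_measures"
  shows "op_scale E c (pi_op m p \<mu>) = pi_op m p (\<lambda>A. c * \<mu> A)"
proof (rule extensionalityI)
  show "op_scale E c (pi_op m p \<mu>) \<in> extensional (cl ` Lp_fun m p)" by (simp add: op_scale_def)
  fix x assume "x \<in> cl ` (Lp_fun m p :: ('a \<Rightarrow> real) set)"
  then obtain f where f: "f \<in> Lp_fun m p" "x = cl f" by auto
  have "cl (\<lambda>s. c * pi_fun \<mu> f s) = cl (pi_fun (\<lambda>A. c * \<mu> A) f)"
    using pi_fun_mult_measure[OF \<mu> f(1), of c] by (intro cl_eqI) (auto elim!: eventually_mono)
  then show "op_scale E c (pi_op m p \<mu>) x = pi_op m p (\<lambda>A. c * \<mu> A) x"
    using f by (simp add: op_scale_def pi_op_cl[OF \<mu>] pi_op_cl[OF regular_measures_mult[OF \<mu>]] E_scale pi_fun_Lp[OF \<mu>])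
qed (rule pi_op_extensional)

lemma op_add_pi_op:
  fixes \<mu> \<nu> :: "'a set \<Rightarrow> real"
  assumes \<mu>: "\<mu> \<in> regular_measures" and \<nu>: "\<nu> \<in> regular_measures"
  shows "op_add E (pi_op m p \<mu>) (pi_op m p \<nu>) = pi_op m p (\<lambda>A. \<mu> A + \<nu> A)"
proof (rule extensionalityI)
  show "op_add E (pi_op m p \<mu>) (pi_op m p \<nu>) \<in> extensional (cl ` Lp_fun m p)" by (simp add: op_add_def)
  fix x assume "x \<in> cl ` (Lp_fun m p :: ('a \<Rightarrow> real) set)"
  then obtain f where f: "f \<in> Lp_fun m p" "x = cl f" by auto
  have "cl (\<lambda>s. pi_fun \<mu> f s + pi_fun \<nu> f s) = cl (pi_fun (\<lambda>A. \<mu> A + \<nu> A) f)"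
    using pi_fun_add_measure[OF \<mu> \<nu> f(1)] by (intro cl_eqI) (auto elim!: eventually_mono)
  then show "op_add E (pi_op m p \<mu>) (pi_op m p \<nu>) x = pi_op m p (\<lambda>A. \<mu> A + \<nu> A) x"
    using f by (simp add: op_add_def pi_op_cl[OF \<mu>] pi_op_cl[OF \<nu>] pi_op_cl[OF regular_measures_add[OF \<mu> \<nu>]] E_add pi_fun_Lp[OF \<mu>] pi_fun_Lp[OF \<nu>])
qed (rule pi_op_extensional)

text \<open>Instead of a Jordan decomposition: \<mu> is |\<mu>| minus the positive measure |\<mu>| -
  \<mu>.\<close>

lemma pi_op_reg:
  fixes \<mu> :: "'a set \<Rightarrow> real"
  assumes \<mu>: "\<mu> \<in> regular_measures" shows "pi_op m p \<mu> \<in> reg_ops E"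
proof -
  let ?T = "measure (tv \<mu>)"
  define \<sigma> where "\<sigma> A = ?T A + - 1 * \<mu> A" for A
  have T: "?T \<in> regular_measures" by (rule regular_measures_measure[OF regular_measuresD(2)[OF \<mu>]])
  have \<sigma>: "\<sigma> \<in> regular_measures" unfolding \<sigma>_def by (intro regular_measures_add regular_measures_mult \<mu> T)
  have nn: "0 \<le> \<sigma> A" for A using norm_le_tv[OF regular_measuresD(1)[OF \<mu>], of A] by (simp add: \<sigma>_def abs_le_iff)
  have sum: "(\<lambda>A. \<mu> A + \<sigma> A) = ?T" by (simp add: \<sigma>_def)
  have eq: "pi_op m p \<mu> x = vs_diff E (pi_op m p ?T x) (pi_op m p \<sigma> x)" if x: "x \<in> vs_carrier E" for x
  proof -
    obtain f where f: "f \<in> Lp_fun m p" "x = cl f" using x by auto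
    have "AE s in m. pi_fun \<mu> f s = pi_fun ?T f s + - 1 * pi_fun \<sigma> f s"
      using pi_fun_add_measure[OF \<mu> \<sigma> f(1), unfolded sum] by eventually_elim simp
    then show ?thesis using cl_eqI f
      by (simp add: pi_op_cl[OF \<mu>] pi_op_cl[OF \<sigma>] pi_op_cl[OF T] E_diff pi_fun_Lp[OF \<sigma>] pi_fun_Lp[OF T])
  qed
  show ?thesis unfolding reg_ops_def
    using pi_op_positive[OF T] pi_op_positive[OF \<sigma>] nn eq pi_op_extensional by auto
qed

lemma abs_reg_le:
  fixes \<nu> :: "'a set \<Rightarrow> 'f::{real_normed_field,euclidean_space}"
  assumes \<nu>: "\<nu> \<in> regular_measures" and U: "U \<in> reg_ops E"
    and pos: "\<And>f. f \<in> Lp_fun m p \<Longrightarrow> (\<And>x. 0 \<le> f x) \<Longrightarrow> AE x in m. 0 \<le> lift U f x"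
    and ind: "\<And>A. A \<in> sets borel \<Longrightarrow> emeasure m A < \<infinity> \<Longrightarrow> AE s in m. norm (\<nu> {t. - t + s \<in> A}) \<le> lift U (indicator A) s"
  shows "reg_le E (pi_op m p (measure (tv \<nu>))) U"
proof -
  have T: "measure (tv \<nu>) \<in> regular_measures" by (rule regular_measures_measure[OF regular_measuresD(2)[OF \<nu>]])
  note l = linear_map_lift[OF reg_ops_linear[OF U]]
  show ?thesis unfolding reg_le_lift[OF pi_op_linear[OF T] reg_ops_linear[OF U]]
  proof (intro ballI impI)
    fix f :: "'a \<Rightarrow> real" assume f: "f \<in> Lp_fun m p" "\<forall>x. 0 \<le> f x"
    have "AE s in m. pi_fun (measure (tv \<nu>)) f s \<le> lift U f s"
      by (rule abs_least[OF \<nu> l(3) l(4) pos ind f(1)]) (use f in auto)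
    then show "AE x in m. lift (pi_op m p (measure (tv \<nu>))) f x \<le> lift U f x"
      using lift_pi_op[OF T f(1)] by eventually_elim simp
  qed
qed

text \<open>An upper bound \<open>U\<close> satisfies \<bar>pi_fun \<mu> f\<bar> \<le> U f almost
  everywhere for nonnegative \<open>f\<close>. This gives the positivity of \<open>U\<close> and,
  for indicators, the hypothesis of the domination lemma.\<close>

lemma modulus_pi_op:
  fixes \<mu> :: "'a set \<Rightarrow> real"
  assumes \<mu>: "\<mu> \<in> regular_measures"
  shows "least_ub (reg_ops E) (reg_le E) {pi_op m p \<mu>, op_scale E (- 1) (pi_op m p \<mu>)} = pi_op m p (measure (tv \<mu>))"
  unfolding op_scale_pi_op[OF \<mu>]
proof (rule least_ub_reg)
  let ?\<mu>' = "\<lambda>A. - 1 * \<mu> A"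
  have \<mu>': "?\<mu>' \<in> regular_measures" by (rule regular_measures_mult[OF \<mu>])
  have T: "measure (tv \<mu>) \<in> regular_measures" by (rule regular_measures_measure[OF regular_measuresD(2)[OF \<mu>]])
  show "pi_op m p (measure (tv \<mu>)) \<in> reg_ops E" by (rule pi_op_reg[OF T])
  have n: "\<bar>\<mu> A\<bar> \<le> measure (tv \<mu>) A" for A using norm_le_tv[OF regular_measuresD(1)[OF \<mu>], of A] by simp
  have "\<mu> A \<le> measure (tv \<mu>) A" "- 1 * \<mu> A \<le> measure (tv \<mu>) A" for A using n[of A] by linarith+
  then show "reg_le E S (pi_op m p (measure (tv \<mu>)))" if "S \<in> {pi_op m p \<mu>, pi_op m p ?\<mu>'}" for S
    using that pi_op_mono[OF \<mu> T] pi_op_mono[OF \<mu>' T] by auto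
  fix U assume U: "U \<in> reg_ops E" and ub: "\<And>S. S \<in> {pi_op m p \<mu>, pi_op m p ?\<mu>'} \<Longrightarrow> reg_le E S U"
  have both: "AE x in m. \<bar>pi_fun \<mu> f x\<bar> \<le> lift U f x" if f: "f \<in> Lp_fun m p" "\<And>x. 0 \<le> f x" for f
  proof -
    have "AE x in m. lift (pi_op m p \<mu>) f x \<le> lift U f x"
      using ub[of "pi_op m p \<mu>"] f by (simp add: reg_le_lift[OF pi_op_linear[OF \<mu>] reg_ops_linear[OF U]])
    moreover have "AE x in m. lift (pi_op m p ?\<mu>') f x \<le> lift U f x"
      using ub[of "pi_op m p ?\<mu>'"] f by (simp add: reg_le_lift[OF pi_op_linear[OF \<mu>'] reg_ops_linear[OF U], simplified])
    ultimately show ?thesis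
      using lift_pi_op[OF \<mu> f(1)] lift_pi_op[OF \<mu>' f(1)] pi_fun_mult_measure[OF \<mu> f(1), of "-1"]
      by eventually_elim (simp add: abs_le_iff)
  qed
  show "reg_le E (pi_op m p (measure (tv \<mu>))) U"
  proof (rule abs_reg_le[OF \<mu> U])
    fix f :: "'a \<Rightarrow> real" assume "f \<in> Lp_fun m p" "\<And>x. 0 \<le> f x"
    from both[OF this] show "AE x in m. 0 \<le> lift U f x" by eventually_elim (metis abs_ge_zero order_trans)
  next
    fix A :: "'a set" assume A: "A \<in> sets borel" "emeasure m A < \<infinity>"
    have "AE x in m. \<bar>pi_fun \<mu> (indicator A) x\<bar> \<le> lift U (indicator A) x"
      by (rule both[OF Lp_fun_indicator[OF A]]) simp
    then show "AE s in m. norm (\<mu> {t. - t + s \<in> A}) \<le> lift U (indicator A) s"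
      using pi_fun_indicator[OF \<mu> A(1)] by simp
  qed
qed

lemma op_norm_pi_op:
  fixes \<mu> :: "'a set \<Rightarrow> real"
  assumes \<mu>: "\<mu> \<in> regular_measures"
  shows "op_norm E (pi_op m p \<mu>) \<le> measure (tv \<mu>) UNIV"
  unfolding op_norm_def
proof (rule cSUP_least)
  have "vs_norm E (cl (\<lambda>x. 0)) \<le> 1" using p E_norm[OF Lp_fun_0] by simp
  then show "{x \<in> vs_carrier E. vs_norm E x \<le> 1} \<noteq> {}" using Lp_fun_0 by auto
  fix x assume "x \<in> {x \<in> vs_carrier E. vs_norm E x \<le> 1}"
  then obtain f where f: "f \<in> Lp_fun m p" "x = cl f" "vs_norm E (cl f) \<le> 1" by auto
  have "vs_norm E (pi_op m p \<mu> x) \<le> measure (tv \<mu>) UNIV * vs_norm E (cl f)"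
    using pi_fun_norm_le[OF \<mu> f(1)] by (simp only: f(2) pi_op_cl[OF \<mu> f(1)] E_norm[OF f(1)] E_norm[OF pi_fun_Lp[OF \<mu> f(1)]])
  also have "\<dots> \<le> measure (tv \<mu>) UNIV" using f(3) by (intro mult_left_le) auto
  finally show "vs_norm E (pi_op m p \<mu> x) \<le> measure (tv \<mu>) UNIV" .
qed

text \<open>With the modulus identified, the regular norm is the operator norm for |\<mu>|, a
  measure of the same total variation.\<close>

lemma regular_norm_pi_op:
  fixes \<mu> :: "'a set \<Rightarrow> real"
  assumes \<mu>: "\<mu> \<in> regular_measures"
  shows "regular_norm E (pi_op m p \<mu>) \<le> measure (tv \<mu>) UNIV"
  unfolding regular_norm_def modulus_pi_op[OF \<mu>]
  using op_norm_pi_op[OF regular_measures_measure[OF regular_measuresD(2)[OF \<mu>]]]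
    tv_measure[OF radonD(1,2)[OF regular_measuresD(2)[OF \<mu>]]] by simp

lemma convolution_regular:
  fixes \<mu> \<nu> :: "'a set \<Rightarrow> 'f::{real_normed_field,euclidean_space}"
  assumes \<mu>: "\<mu> \<in> regular_measures" and \<nu>: "\<nu> \<in> regular_measures"
  shows "convolution \<mu> \<nu> \<in> regular_measures"
proof -
  interpret regular_pair \<mu> \<nu> by unfold_locales fact+
  show ?thesis unfolding convolution_eq[OF lc \<mu> \<nu>] by (rule conv_fun_regular)
qed

lemma pi_op_convolution:
  fixes \<mu> \<nu> :: "'a set \<Rightarrow> 'f::{real_normed_field,euclidean_space}"
  assumes \<mu>: "\<mu> \<in> regular_measures" and \<nu>: "\<nu> \<in> regular_measures"
  shows "pi_op m p (convolution \<mu> \<nu>) = compose (cl ` Lp_fun m p) (pi_op m p \<mu>) (pi_op m p \<nu>)"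
proof (rule extensionalityI)
  fix x assume "x \<in> cl ` (Lp_fun m p :: ('a \<Rightarrow> 'f) set)"
  then obtain f where f: "f \<in> Lp_fun m p" "x = cl f" by auto
  show "pi_op m p (convolution \<mu> \<nu>) x = compose (cl ` Lp_fun m p) (pi_op m p \<mu>) (pi_op m p \<nu>) x"
    using f cl_eqI[OF pi_fun_conv[OF \<mu> \<nu> f(1)]]
    by (simp add: compose_def pi_op_cl[OF convolution_regular[OF \<mu> \<nu>]] pi_op_cl[OF \<nu>] pi_op_cl[OF \<mu>] pi_fun_Lp[OF \<nu>])
qed (auto simp: pi_op_extensional)

text \<open>On indicators, equality of the operators says that the difference measure vanishes on s
  - A for almost every \<open>s\<close>.\<close>

lemma inj_pi_op: "inj_on (pi_op m p) (regular_measures :: ('a set \<Rightarrow> 'f::{real_normed_field,euclidean_space}) set)"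
proof (rule inj_onI)
  fix \<mu> \<nu> :: "'a set \<Rightarrow> 'f" assume \<mu>: "\<mu> \<in> regular_measures" and \<nu>: "\<nu> \<in> regular_measures" and eq: "pi_op m p \<mu> = pi_op m p \<nu>"
  define \<sigma> where "\<sigma> A = \<mu> A + - 1 * \<nu> A" for A
  have \<nu>': "(\<lambda>A. - 1 * \<nu> A) \<in> regular_measures" by (rule regular_measures_mult[OF \<nu>])
  have \<sigma>: "\<sigma> \<in> regular_measures" unfolding \<sigma>_def by (intro regular_measures_add \<mu> \<nu>')
  have "\<sigma> = (\<lambda>A. 0)"
  proof (rule regular_measure_zero[OF \<sigma>])
    fix A :: "'a set" assume A: "A \<in> sets borel" "emeasure m A < \<infinity>"
    let ?f = "\<lambda>x. indicat_real A x *\<^sub>R (1 :: 'f)"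
    have f: "?f \<in> Lp_fun m p"
      using A(1) by (intro Lp_fun_bound[OF Lp_fun_indicator[OF A]]) auto
    have "cl (pi_fun \<mu> ?f) = cl (pi_fun \<nu> ?f)" using pi_op_cl[OF \<mu> f] pi_op_cl[OF \<nu> f] eq by simp
    from cl_eqD[OF pi_fun_Lp[OF \<mu> f] this] show "AE s in m. \<sigma> {t. - t + s \<in> A} = 0"
      unfolding pi_fun_indicator[OF \<mu> A(1)] pi_fun_indicator[OF \<nu> A(1)] by eventually_elim (simp add: \<sigma>_def)
  qed
  then show "\<mu> = \<nu>" by (auto simp: \<sigma>_def fun_eq_iff)
qed

lemma modulus_MG_real:
  fixes \<mu> :: "'a set \<Rightarrow> real"
  assumes \<mu>: "\<mu> \<in> regular_measures"
  shows "modulus MG_real \<mu> = measure (tv \<mu>)"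
proof -
  have n: "\<bar>\<mu> A\<bar> \<le> measure (tv \<mu>) A" for A using norm_le_tv[OF regular_measuresD(1)[OF \<mu>], of A] by simp
  have "least_ub regular_measures (\<lambda>\<mu> \<nu>. \<forall>A\<in>sets borel. \<mu> A \<le> \<nu> A) {\<mu>, (\<lambda>A. - 1 * \<mu> A)} = measure (tv \<mu>)"
  proof (rule least_ub_measures[OF \<mu>])
    fix x :: "'a set \<Rightarrow> real" and A :: "'a set" assume "x \<in> {\<mu>, (\<lambda>A. - 1 * \<mu> A)}"
    then show "x A \<le> measure (tv \<mu>) A" using n[of A] by auto
  next
    fix u :: "'a set \<Rightarrow> real" and A :: "'a set" assume "\<And>x A. x \<in> {\<mu>, (\<lambda>A. - 1 * \<mu> A)} \<Longrightarrow> A \<in> sets borel \<Longrightarrow> x A \<le> u A" and A: "A \<in> sets borel"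
    from this(1)[of \<mu> A] this(1)[of "\<lambda>A. - 1 * \<mu> A" A] A show "norm (\<mu> A) \<le> u A" by (simp add: abs_le_iff)
  qed
  then show ?thesis by (simp add: modulus_def MG_real_def)
qed

theorem bla_hom_pi_op: "bla_hom (MG_real :: ('a set \<Rightarrow> real) bla) (Lr E) (pi_op m p)"
  unfolding bla_hom_def
proof (intro conjI ballI)
  have car: "vs_carrier (MG_real :: ('a set \<Rightarrow> real) bla) = regular_measures" "vs_carrier (Lr E) = reg_ops E"
    by (simp_all add: MG_real_def Lr_def)
  show "linear_map (MG_real :: ('a set \<Rightarrow> real) bla) (Lr E) (pi_op m p)"
    unfolding linear_map_def car
    by (auto simp: pi_op_reg MG_real_def Lr_def op_scale_pi_op op_add_pi_op)
  show "continuous_map_nvs (MG_real :: ('a set \<Rightarrow> real) bla) (Lr E) (pi_op m p)"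
    unfolding continuous_map_nvs_def car
  proof (intro ballI allI impI)
    fix \<mu> :: "'a set \<Rightarrow> real" and e :: real assume \<mu>: "\<mu> \<in> regular_measures" and e: "0 < e"
    show "\<exists>d>0. \<forall>\<nu>\<in>regular_measures. vs_norm MG_real (vs_diff MG_real \<nu> \<mu>) < d \<longrightarrow>
      vs_norm (Lr E) (vs_diff (Lr E) (pi_op m p \<nu>) (pi_op m p \<mu>)) < e"
    \<comment> \<open>The radius is \<open>e\<close> itself: the map is linear and does not increase
      norms.\<close>
    proof (intro exI[of _ e] conjI ballI impI e)
      fix \<nu> :: "'a set \<Rightarrow> real" assume \<nu>: "\<nu> \<in> regular_measures" and d: "vs_norm MG_real (vs_diff MG_real \<nu> \<mu>) < e"
      have \<mu>': "(\<lambda>A. - 1 * \<mu> A) \<in> regular_measures" by (rule regular_measures_mult[OF \<mu>])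
      have s: "(\<lambda>A. \<nu> A + - 1 * \<mu> A) \<in> regular_measures" by (rule regular_measures_add[OF \<nu> \<mu>'])
      have "vs_diff (Lr E) (pi_op m p \<nu>) (pi_op m p \<mu>) = op_add E (pi_op m p \<nu>) (op_scale E (- 1) (pi_op m p \<mu>))"
        by (simp add: vs_diff_def Lr_def)
      then have "vs_diff (Lr E) (pi_op m p \<nu>) (pi_op m p \<mu>) = pi_op m p (\<lambda>A. \<nu> A + - 1 * \<mu> A)"
        unfolding op_scale_pi_op[OF \<mu>] op_add_pi_op[OF \<nu> \<mu>'] .
      then show "vs_norm (Lr E) (vs_diff (Lr E) (pi_op m p \<nu>) (pi_op m p \<mu>)) < e"
        using regular_norm_pi_op[OF s] d by (simp add: Lr_def MG_real_def vs_diff_def)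
    qed
  qed
next
  fix \<mu> \<nu> :: "'a set \<Rightarrow> real" assume "\<mu> \<in> vs_carrier MG_real" "\<nu> \<in> vs_carrier MG_real"
  then show "pi_op m p (bla_mult MG_real \<mu> \<nu>) = bla_mult (Lr E) (pi_op m p \<mu>) (pi_op m p \<nu>)"
    by (simp add: MG_real_def Lr_def pi_op_convolution)
next
  fix \<mu> :: "'a set \<Rightarrow> real" assume "\<mu> \<in> vs_carrier MG_real"
  then have \<mu>: "\<mu> \<in> regular_measures" by (simp add: MG_real_def)
  show "modulus (Lr E) (pi_op m p \<mu>) = pi_op m p (modulus MG_real \<mu>)"
    unfolding modulus_MG_real[OF \<mu>] using modulus_pi_op[OF \<mu>] by (simp add: modulus_def Lr_def)
qed

end

section \<open>The complex case\<close>

lemma cos_sin_le_cmod: "cos \<theta> * Re z + sin \<theta> * Im z \<le> cmod z"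
proof -
  have "cos \<theta> * Re z + sin \<theta> * Im z = Re (cnj (cis \<theta>) * z)" by simp
  also have "\<dots> \<le> cmod (cnj (cis \<theta>) * z)" by (rule complex_Re_le_cmod)
  finally show ?thesis by (simp add: norm_mult)
qed

lemma cmod_eq_cos_sin: "\<exists>\<theta>. 0 \<le> \<theta> \<and> \<theta> \<le> 2 * pi \<and> cmod z = cos \<theta> * Re z + sin \<theta> * Im z"
proof (cases "z = 0")
  case False
  have "(Re z / cmod z)\<^sup>2 + (Im z / cmod z)\<^sup>2 = 1"
    using False by (simp add: power_divide add_divide_distrib[symmetric] cmod_power2[symmetric])
  then obtain t where t: "0 \<le> t" "t < 2 * pi" "Re z / cmod z = cos t" "Im z / cmod z = sin t"
    by (rule sincos_total_2pi)
  have "cos t * Re z + sin t * Im z = (Re z * Re z + Im z * Im z) / cmod z"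
    unfolding t(3,4)[symmetric] by (simp add: add_divide_distrib)
  also have "\<dots> = cmod z" using False by (simp add: power2_eq_square[symmetric] cmod_power2[symmetric]) (simp add: power2_eq_square)
  finally show ?thesis using t by (intro exI[of _ t]) auto
qed (auto intro!: exI[of _ 0])

text \<open>The angle that attains the modulus may be irrational, but exceeding \<open>c\<close> is
  an open condition on the angle. Inequalities that hold almost everywhere for each angle can thus
  be collected over countably many of them.\<close>

lemma cmod_le_of_rational_angles:
  assumes "\<And>q. q \<in> \<rat> \<Longrightarrow> cos q * Re z + sin q * Im z \<le> c"
  shows "cmod z \<le> c"
proof (rule ccontr)
  assume "\<not> cmod z \<le> c"
  obtain t where "cmod z = cos t * Re z + sin t * Im z" using cmod_eq_cos_sin by blast
  with \<open>\<not> cmod z \<le> c\<close> have t: "t \<in> {\<theta>. c < cos \<theta> * Re z + sin \<theta> * Im z}" by simp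
  have "open {\<theta>. c < cos \<theta> * Re z + sin \<theta> * Im z}" by (intro open_Collect_less continuous_intros)
  with t obtain e where e: "0 < e" "ball t e \<subseteq> {\<theta>. c < cos \<theta> * Re z + sin \<theta> * Im z}" by (meson openE)
  obtain q where q: "q \<in> \<rat>" "t < q" "q < t + e" using Rats_dense_in_real[of t "t + e"] e by auto
  then have "q \<in> ball t e" by (simp add: dist_real_def)
  then show False using e(2) assms[OF q(1)] by fastforce
qed

lemma regular_Re_Im:
  fixes \<mu> :: "'a::t2_space set \<Rightarrow> complex"
  assumes \<mu>: "\<mu> \<in> regular_measures"
  shows "(\<lambda>A. Re (\<mu> A)) \<in> regular_measures" "(\<lambda>A. Im (\<mu> A)) \<in> regular_measures"
proof -
  note v = regular_measuresD(1)[OF \<mu>]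
  have "norm (Re (\<mu> A)) \<le> measure (tv \<mu>) A" "norm (Im (\<mu> A)) \<le> measure (tv \<mu>) A" for A
    using norm_le_tv[OF v, of A] abs_Re_le_cmod[of "\<mu> A"] abs_Im_le_cmod[of "\<mu> A"] by auto
  then show "(\<lambda>A. Re (\<mu> A)) \<in> regular_measures" "(\<lambda>A. Im (\<mu> A)) \<in> regular_measures"
    using emeasure_tv_Re_Im(1,2)[OF v] by (auto intro: regular_measures_le[OF \<mu>])
qed

lemma regular_of_real:
  fixes \<nu> :: "'a::t2_space set \<Rightarrow> real"
  assumes \<nu>: "\<nu> \<in> regular_measures"
  shows "(\<lambda>A. complex_of_real (\<nu> A)) \<in> regular_measures"
  using norm_le_tv[OF regular_measuresD(1)[OF \<nu>]]
  by (intro regular_measures_le[OF \<nu>] vector_measure_bounded_linear[OF bounded_linear_of_real] regular_measuresD(1)[OF \<nu>]) auto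

text \<open>On each Borel set \<open>A\<close> some rotation attains the modulus of \<mu> A, with an
  angle depending on \<open>A\<close>; so an upper bound of all rotations dominates the norm of
  \<mu>.\<close>

lemma cx_modulus_MG_complex:
  fixes \<mu> :: "'a::{topological_group_add,t2_space} set \<Rightarrow> complex"
  assumes \<mu>: "\<mu> \<in> regular_measures"
  shows "cx_modulus MG_complex \<mu> = measure (tv \<mu>)"
proof -
  let ?X = "{(\<lambda>A. cos \<theta> * Re (\<mu> A) + sin \<theta> * Im (\<mu> A)) |\<theta>. 0 \<le> \<theta> \<and> \<theta> \<le> 2 * pi}"
  have "least_ub regular_measures (\<lambda>\<mu> \<nu>. \<forall>A\<in>sets borel. \<mu> A \<le> \<nu> A) ?X = measure (tv \<mu>)"
  proof (rule least_ub_measures[OF \<mu>])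
    fix x :: "'a set \<Rightarrow> real" and A :: "'a set" assume "x \<in> ?X"
    then show "x A \<le> measure (tv \<mu>) A"
      using order_trans[OF cos_sin_le_cmod norm_le_tv[OF regular_measuresD(1)[OF \<mu>]]] by auto
  next
    fix u :: "'a set \<Rightarrow> real" and A :: "'a set"
    assume u: "\<And>x A. x \<in> ?X \<Longrightarrow> A \<in> sets borel \<Longrightarrow> x A \<le> u A" and A: "A \<in> sets borel"
    obtain \<theta> where \<theta>: "0 \<le> \<theta>" "\<theta> \<le> 2 * pi" "cmod (\<mu> A) = cos \<theta> * Re (\<mu> A) + sin \<theta> * Im (\<mu> A)"
      using cmod_eq_cos_sin by blast
    have "(\<lambda>A. cos \<theta> * Re (\<mu> A) + sin \<theta> * Im (\<mu> A)) \<in> ?X" using \<theta> by blast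
    from u[OF this A] show "norm (\<mu> A) \<le> u A" by (simp add: \<theta>(3))
  qed
  then show ?thesis
    by (simp add: cx_modulus_def MG_complex_def MG_real_def blat.truncate_def Let_def)
qed

lemma cx_embed_MG_complex:
  fixes \<nu> :: "'a::{topological_group_add,t2_space} set \<Rightarrow> real"
  assumes \<nu>: "\<nu> \<in> regular_measures"
  shows "cx_embed MG_complex \<nu> = (\<lambda>A. complex_of_real (\<nu> A))"
  unfolding cx_embed_def
proof (rule the_equality)
  show "(\<lambda>A. complex_of_real (\<nu> A)) \<in> vs_carrier MG_complex \<and>
    cx_re MG_complex (\<lambda>A. complex_of_real (\<nu> A)) = \<nu> \<and>
    cx_im MG_complex (\<lambda>A. complex_of_real (\<nu> A)) = vs_zero (cx_real MG_complex)"
    using regular_of_real[OF \<nu>] by (simp add: MG_complex_def MG_real_def blat.truncate_def)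
  fix z :: "'a set \<Rightarrow> complex"
  assume "z \<in> vs_carrier MG_complex \<and> cx_re MG_complex z = \<nu> \<and> cx_im MG_complex z = vs_zero (cx_real MG_complex)"
  then have "(\<lambda>A. Re (z A)) = \<nu>" "(\<lambda>A. Im (z A)) = (\<lambda>A. 0)"
    by (simp_all add: MG_complex_def MG_real_def blat.truncate_def)
  then show "z = (\<lambda>A. complex_of_real (\<nu> A))"
    by (intro ext complex_eqI) (simp_all add: fun_eq_iff)
qed

section \<open>The complexification of L^p and its operators\<close>

context haar_Lp
begin

abbreviation V where "V \<equiv> Lp_complex m p"

lemma V_simps [simp]: "vs_carrier V = cl ` Lp_fun m p" "vs_zero V = cl (\<lambda>x. 0)" "cx_real V = E"
  by (simp_all add: Lp_complex_def)

lemma V_add: "f \<in> Lp_fun m p \<Longrightarrow> g \<in> Lp_fun m p \<Longrightarrow> vs_add V (cl f) (cl g) = cl (\<lambda>x. f x + g x)"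
  by (simp add: Lp_complex_def Lp_add_cl)

lemma V_scale: "f \<in> Lp_fun m p \<Longrightarrow> vs_scale V c (cl f) = cl (\<lambda>x. c * f x)"
  by (simp add: Lp_complex_def Lp_map_cl)

lemma V_re: "f \<in> Lp_fun m p \<Longrightarrow> cx_re V (cl f) = cl (\<lambda>x. Re (f x))"
  and V_im: "f \<in> Lp_fun m p \<Longrightarrow> cx_im V (cl f) = cl (\<lambda>x. Im (f x))"
  by (simp_all add: Lp_complex_def Lp_map_cl)

lemma Lp_fun_Re_Im:
  fixes f :: "'a \<Rightarrow> complex"
  assumes f: "f \<in> Lp_fun m p"
  shows "(\<lambda>x. Re (f x)) \<in> Lp_fun m p" "(\<lambda>x. Im (f x)) \<in> Lp_fun m p"
proof -
  have [measurable]: "f \<in> borel_measurable borel" by (rule Lp_funD[OF f])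
  show "(\<lambda>x. Re (f x)) \<in> Lp_fun m p" "(\<lambda>x. Im (f x)) \<in> Lp_fun m p"
    by (rule Lp_fun_bound[OF f], simp, simp add: abs_Re_le_cmod abs_Im_le_cmod)+
qed

lemma Lp_fun_of_real:
  fixes f :: "'a \<Rightarrow> real"
  assumes f: "f \<in> Lp_fun m p"
  shows "(\<lambda>x. complex_of_real (f x)) \<in> Lp_fun m p"
  using Lp_funD(1)[OF f] by (intro Lp_fun_bound[OF f]) auto

lemma V_eqI:
  assumes "z \<in> vs_carrier V" "w \<in> vs_carrier V" "cx_re V z = cx_re V w" "cx_im V z = cx_im V w"
  shows "z = w"
proof -
  obtain f g where f: "f \<in> Lp_fun m p" "z = cl f" and g: "g \<in> Lp_fun m p" "w = cl g" using assms(1,2) by auto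
  have "AE x in m. Re (f x) = Re (g x)" "AE x in m. Im (f x) = Im (g x)"
    using assms(3,4) by (auto simp: f g V_re V_im intro!: cl_eqD Lp_fun_Re_Im)
  then have "AE x in m. f x = g x" by eventually_elim (rule complex_eqI)
  then show ?thesis unfolding f g by (rule cl_eqI)
qed

lemma cx_embed_V:
  assumes f: "f \<in> Lp_fun m p"
  shows "cx_embed V (cl f) = cl (\<lambda>x. complex_of_real (f x))"
  unfolding cx_embed_def
proof (rule the_equality)
  show "cl (\<lambda>x. complex_of_real (f x)) \<in> vs_carrier V \<and> cx_re V (cl (\<lambda>x. complex_of_real (f x))) = cl f \<and>
    cx_im V (cl (\<lambda>x. complex_of_real (f x))) = vs_zero (cx_real V)"
    using Lp_fun_of_real[OF f] by (simp add: V_re V_im)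
  then show "z = cl (\<lambda>x. complex_of_real (f x))" if "z \<in> vs_carrier V \<and> cx_re V z = cl f \<and> cx_im V z = vs_zero (cx_real V)" for z
    using that by (intro V_eqI) auto
qed

lemma pi_op_linear_complex:
  fixes \<mu> :: "'a set \<Rightarrow> complex"
  assumes \<mu>: "\<mu> \<in> regular_measures" shows "linear_map V V (pi_op m p \<mu>)"
  unfolding linear_map_def
proof (intro conjI ballI allI)
  show "pi_op m p \<mu> \<in> vs_carrier V \<rightarrow> vs_carrier V" by (auto simp: pi_op_cl[OF \<mu>] pi_fun_Lp[OF \<mu>])
next
  fix x y assume "x \<in> vs_carrier V" "y \<in> vs_carrier V"
  then obtain f g where "x = cl f" "y = cl g" and fg: "f \<in> Lp_fun m p" "g \<in> Lp_fun m p" by auto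
  then show "pi_op m p \<mu> (vs_add V x y) = vs_add V (pi_op m p \<mu> x) (pi_op m p \<mu> y)"
    using cl_eqI[OF pi_fun_add[OF \<mu> fg]] by (simp add: V_add pi_op_cl[OF \<mu>] Lp_fun_add pi_fun_Lp[OF \<mu>])
next
  fix c x assume "x \<in> vs_carrier V"
  then obtain f where "x = cl f" and f: "f \<in> Lp_fun m p" by auto
  then show "pi_op m p \<mu> (vs_scale V c x) = vs_scale V c (pi_op m p \<mu> x)"
    by (simp add: V_scale pi_op_cl[OF \<mu>] Lp_fun_mult pi_fun_Lp[OF \<mu>] pi_fun_mult[OF \<mu>, abs_def])
qed

lemma
  fixes \<mu> :: "'a set \<Rightarrow> complex"
  assumes \<mu>: "\<mu> \<in> regular_measures" and z: "z \<in> vs_carrier V"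
  shows cx_re_pi_op: "cx_re V (pi_op m p \<mu> z) =
      vs_diff E (pi_op m p (\<lambda>A. Re (\<mu> A)) (cx_re V z)) (pi_op m p (\<lambda>A. Im (\<mu> A)) (cx_im V z))"
    and cx_im_pi_op: "cx_im V (pi_op m p \<mu> z) =
      vs_add E (pi_op m p (\<lambda>A. Re (\<mu> A)) (cx_im V z)) (pi_op m p (\<lambda>A. Im (\<mu> A)) (cx_re V z))"
proof -
  obtain f where f: "f \<in> Lp_fun m p" "z = cl f" using z by auto
  note c = pi_fun_complex[OF \<mu> f(1)] and r = regular_Re_Im[OF \<mu>] and l = Lp_fun_Re_Im[OF f(1)]
  have "AE s in m. Re (pi_fun \<mu> f s) = pi_fun (\<lambda>A. Re (\<mu> A)) (\<lambda>x. Re (f x)) s + - 1 * pi_fun (\<lambda>A. Im (\<mu> A)) (\<lambda>x. Im (f x)) s"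
    using c(1) by eventually_elim simp
  from cl_eqI[OF this] show "cx_re V (pi_op m p \<mu> z) =
      vs_diff E (pi_op m p (\<lambda>A. Re (\<mu> A)) (cx_re V z)) (pi_op m p (\<lambda>A. Im (\<mu> A)) (cx_im V z))"
    using f l by (simp only: f(2) pi_op_cl[OF \<mu>] V_re V_im pi_fun_Lp[OF \<mu>] pi_op_cl[OF r(1)] pi_op_cl[OF r(2)] E_diff pi_fun_Lp[OF r(1)] pi_fun_Lp[OF r(2)])
  from cl_eqI[OF c(2)] show "cx_im V (pi_op m p \<mu> z) =
      vs_add E (pi_op m p (\<lambda>A. Re (\<mu> A)) (cx_im V z)) (pi_op m p (\<lambda>A. Im (\<mu> A)) (cx_re V z))"
    using f l by (simp only: f(2) pi_op_cl[OF \<mu>] V_re V_im pi_fun_Lp[OF \<mu>] pi_op_cl[OF r(1)] pi_op_cl[OF r(2)] E_add pi_fun_Lp[OF r(1)] pi_fun_Lp[OF r(2)])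
qed

lemma pi_op_creg:
  fixes \<mu> :: "'a set \<Rightarrow> complex"
  assumes \<mu>: "\<mu> \<in> regular_measures"
  shows "pi_op m p \<mu> \<in> creg_ops V"
  unfolding creg_ops_def
proof (intro CollectI conjI)
  show "pi_op m p \<mu> \<in> extensional (vs_carrier V)" using pi_op_extensional by simp
  show "linear_map V V (pi_op m p \<mu>)" by (rule pi_op_linear_complex[OF \<mu>])
  show "\<exists>S\<^sub>1\<in>reg_ops (cx_real V). \<exists>S\<^sub>2\<in>reg_ops (cx_real V). \<forall>z\<in>vs_carrier V.
        cx_re V (pi_op m p \<mu> z) = vs_diff (cx_real V) (S\<^sub>1 (cx_re V z)) (S\<^sub>2 (cx_im V z)) \<and>
        cx_im V (pi_op m p \<mu> z) = vs_add (cx_real V) (S\<^sub>1 (cx_im V z)) (S\<^sub>2 (cx_re V z))"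
    unfolding V_simps(3)
    by (rule bexI[OF _ pi_op_reg[OF regular_Re_Im(1)[OF \<mu>]]], rule bexI[OF _ pi_op_reg[OF regular_Re_Im(2)[OF \<mu>]]])
      (intro ballI conjI cx_re_pi_op[OF \<mu>] cx_im_pi_op[OF \<mu>])
qed

lemma linear_map_zero:
  assumes S: "linear_map E E S" shows "S (cl (\<lambda>x. 0)) = cl (\<lambda>x. 0)"
proof -
  note l = linear_map_lift[OF S Lp_fun_0]
  have "AE x in m. lift S (\<lambda>x. 0) x = 0" using l(4)[of 0] by simp
  then show ?thesis unfolding l(2) by (rule cl_eqI)
qed

text \<open>\<open>creg_ops\<close> only asserts that two real operators exist. Evaluation on real
  elements recovers them as \<open>op_re V T\<close> and \<open>op_im V T\<close>.\<close>

lemma creg_ops_parts: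
  assumes T: "T \<in> creg_ops V" and z: "z \<in> vs_carrier V"
  shows "cx_re V (T z) = vs_diff E (op_re V T (cx_re V z)) (op_im V T (cx_im V z))"
    and "cx_im V (T z) = vs_add E (op_re V T (cx_im V z)) (op_im V T (cx_re V z))"
proof -
  obtain S1 S2 where S: "S1 \<in> reg_ops E" "S2 \<in> reg_ops E"
    and Tz: "\<And>z. z \<in> vs_carrier V \<Longrightarrow> cx_re V (T z) = vs_diff E (S1 (cx_re V z)) (S2 (cx_im V z))"
      "\<And>z. z \<in> vs_carrier V \<Longrightarrow> cx_im V (T z) = vs_add E (S1 (cx_im V z)) (S2 (cx_re V z))"
    using T unfolding creg_ops_def V_simps(3) by blast
  note lin = reg_ops_linear[OF S(1)] reg_ops_linear[OF S(2)]
  have eq: "op_re V T x = S1 x \<and> op_im V T x = S2 x" if x: "x \<in> vs_carrier E" for x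
  proof -
    obtain f where f: "f \<in> Lp_fun m p" "x = cl f" using x by auto
    let ?z = "cl (\<lambda>x. complex_of_real (f x))"
    have z: "?z \<in> vs_carrier V" "cx_re V ?z = cl f" "cx_im V ?z = cl (\<lambda>x. 0)"
      using Lp_fun_of_real[OF f(1)] by (simp_all add: V_re V_im)
    note l1 = linear_map_lift(1,2)[OF lin(1) f(1)] and l2 = linear_map_lift(1,2)[OF lin(2) f(1)]
    have "op_re V T x = S1 x"
      using f Tz(1)[OF z(1)] unfolding z linear_map_zero[OF lin(2)] l1(2) E_diff[OF l1(1) Lp_fun_0]
      by (simp add: op_re_def cx_embed_V l1(2)[symmetric])
    moreover have "op_im V T x = S2 x"
      using f Tz(2)[OF z(1)] unfolding z linear_map_zero[OF lin(1)] l2(2) E_add[OF Lp_fun_0 l2(1)]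
      by (simp add: op_im_def cx_embed_V l2(2)[symmetric])
    ultimately show ?thesis ..
  qed
  have c: "cx_re V z \<in> vs_carrier E" "cx_im V z \<in> vs_carrier E"
    using z Lp_fun_Re_Im by (auto simp: V_re V_im)
  show "cx_re V (T z) = vs_diff E (op_re V T (cx_re V z)) (op_im V T (cx_im V z))"
    "cx_im V (T z) = vs_add E (op_re V T (cx_im V z)) (op_im V T (cx_re V z))"
    using Tz[OF z] eq[OF c(1)] eq[OF c(2)] by simp_all
qed

text \<open>This is the uniqueness behind the description of
  \<open>cx_embed (cLr V)\<close>.\<close>

lemma creg_ops_eqI:
  assumes S: "S \<in> creg_ops V" and T: "T \<in> creg_ops V" and "op_re V S = op_re V T" "op_im V S = op_im V T"
  shows "S = T"
proof (rule extensionalityI)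
  show "S \<in> extensional (vs_carrier V)" "T \<in> extensional (vs_carrier V)" using S T by (auto simp: creg_ops_def)
  fix z assume z: "z \<in> vs_carrier V"
  have "S \<in> vs_carrier V \<rightarrow> vs_carrier V" "T \<in> vs_carrier V \<rightarrow> vs_carrier V"
    using S T unfolding creg_ops_def linear_map_def by blast+
  then have "S z \<in> vs_carrier V" "T z \<in> vs_carrier V" using z by (blast intro: funcset_mem)+
  then show "S z = T z"
    using creg_ops_parts[OF S z] creg_ops_parts[OF T z] assms(3,4) by (intro V_eqI) auto
qed

text \<open>The imaginary part of an embedded real operator must be the zero of \<open>Lr E\<close>
  as a function, including its values off the carrier.\<close>

lemma pi_op_zero: "pi_op m p (\<lambda>A. 0 :: real) = (\<lambda>x\<in>vs_carrier E. vs_zero E)"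
proof (rule extensionalityI)
  have z: "(\<lambda>A :: 'a set. 0 :: real) \<in> regular_measures"
    \<comment> \<open>\<open>restr {}\<close> is the zero measure, already known to be
      Radon.\<close>
    by (rule regular_measuresI[of _ "restr {}"]) (auto simp: vector_measure_def intro: radon_restr)
  fix x assume "x \<in> cl ` (Lp_fun m p :: ('a \<Rightarrow> real) set)"
  then obtain f where f: "f \<in> Lp_fun m p" "x = cl f" by auto
  have "AE s in m. pi_fun (\<lambda>A. 0) f s = 0" using pi_fun_mult_measure[OF z f(1), of 0] by simp
  then show "pi_op m p (\<lambda>A. 0 :: real) x = (\<lambda>x\<in>vs_carrier E. vs_zero E) x"
    using f cl_eqI by (simp add: pi_op_cl[OF z])
qed (simp_all add: pi_op_extensional)

lemma
  fixes \<mu> :: "'a set \<Rightarrow> complex"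
  assumes \<mu>: "\<mu> \<in> regular_measures"
  shows op_re_pi_op: "op_re V (pi_op m p \<mu>) = pi_op m p (\<lambda>A. Re (\<mu> A))"
    and op_im_pi_op: "op_im V (pi_op m p \<mu>) = pi_op m p (\<lambda>A. Im (\<mu> A))"
proof -
  note r = regular_Re_Im[OF \<mu>]
  have eq: "op_re V (pi_op m p \<mu>) x = pi_op m p (\<lambda>A. Re (\<mu> A)) x \<and> op_im V (pi_op m p \<mu>) x = pi_op m p (\<lambda>A. Im (\<mu> A)) x"
    if x: "x \<in> cl ` (Lp_fun m p :: ('a \<Rightarrow> real) set)" for x
  proof -
    obtain f where f: "f \<in> Lp_fun m p" "x = cl f" using x by auto
    let ?z = "cl (\<lambda>x. complex_of_real (f x))"
    have z: "?z \<in> vs_carrier V" "cx_re V ?z = cl f" "cx_im V ?z = cl (\<lambda>x. 0)"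
      using Lp_fun_of_real[OF f(1)] by (simp_all add: V_re V_im)
    have "cx_re V (pi_op m p \<mu> ?z) = pi_op m p (\<lambda>A. Re (\<mu> A)) x"
      unfolding cx_re_pi_op[OF \<mu> z(1)] z linear_map_zero[OF pi_op_linear[OF r(2)]] f(2) pi_op_cl[OF r(1) f(1)]
      by (subst E_diff) (simp_all add: pi_fun_Lp[OF r(1) f(1)])
    moreover have "cx_im V (pi_op m p \<mu> ?z) = pi_op m p (\<lambda>A. Im (\<mu> A)) x"
      unfolding cx_im_pi_op[OF \<mu> z(1)] z linear_map_zero[OF pi_op_linear[OF r(1)]] f(2) pi_op_cl[OF r(2) f(1)]
      by (subst E_add) (simp_all add: pi_fun_Lp[OF r(2) f(1)])
    ultimately show ?thesis using f by (simp add: op_re_def op_im_def cx_embed_V)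
  qed
  show "op_re V (pi_op m p \<mu>) = pi_op m p (\<lambda>A. Re (\<mu> A))"
    by (rule extensionalityI[where A="cl ` (Lp_fun m p :: ('a \<Rightarrow> real) set)"]) (simp_all add: pi_op_extensional eq, simp add: op_re_def)
  show "op_im V (pi_op m p \<mu>) = pi_op m p (\<lambda>A. Im (\<mu> A))"
    by (rule extensionalityI[where A="cl ` (Lp_fun m p :: ('a \<Rightarrow> real) set)"]) (simp_all add: pi_op_extensional eq, simp add: op_im_def)
qed

text \<open>As for real measures, with the rotations r \<theta> in place of \<mu> and -\<mu>; their
  countably many rational angles suffice to dominate the modulus of \<mu> on each translate.\<close>

lemma creg_modulus_pi_op:
  fixes \<mu> :: "'a set \<Rightarrow> complex"
  assumes \<mu>: "\<mu> \<in> regular_measures"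
  shows "creg_modulus V (pi_op m p \<mu>) = pi_op m p (measure (tv \<mu>))"
proof -
  define r where "r \<theta> A = cos \<theta> * Re (\<mu> A) + sin \<theta> * Im (\<mu> A)" for \<theta> A
  note ri = regular_Re_Im[OF \<mu>]
  have r: "r \<theta> \<in> regular_measures" for \<theta>
    unfolding r_def by (intro regular_measures_add regular_measures_mult ri)
  have T: "measure (tv \<mu>) \<in> regular_measures" by (rule regular_measures_measure[OF regular_measuresD(2)[OF \<mu>]])
  have op: "op_add E (op_scale E (cos \<theta>) (op_re V (pi_op m p \<mu>))) (op_scale E (sin \<theta>) (op_im V (pi_op m p \<mu>))) = pi_op m p (r \<theta>)" for \<theta>
    unfolding op_re_pi_op[OF \<mu>] op_im_pi_op[OF \<mu>] op_scale_pi_op[OF ri(1)] op_scale_pi_op[OF ri(2)] r_def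
    by (rule op_add_pi_op[OF regular_measures_mult[OF ri(1)] regular_measures_mult[OF ri(2)]])
  have "least_ub (reg_ops E) (reg_le E) {pi_op m p (r \<theta>) |\<theta>. 0 \<le> \<theta> \<and> \<theta> \<le> 2 * pi} = pi_op m p (measure (tv \<mu>))"
  proof (rule least_ub_reg)
    show "pi_op m p (measure (tv \<mu>)) \<in> reg_ops E" by (rule pi_op_reg[OF T])
    fix S assume "S \<in> {pi_op m p (r \<theta>) |\<theta>. 0 \<le> \<theta> \<and> \<theta> \<le> 2 * pi}"
    then obtain \<theta> where S: "S = pi_op m p (r \<theta>)" by blast
    have "r \<theta> A \<le> measure (tv \<mu>) A" for A
      unfolding r_def by (rule order_trans[OF cos_sin_le_cmod norm_le_tv[OF regular_measuresD(1)[OF \<mu>]]])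
    then show "reg_le E S (pi_op m p (measure (tv \<mu>)))" unfolding S by (intro pi_op_mono r T)
  next
    fix U assume U: "U \<in> reg_ops E"
      and ub: "\<And>S. S \<in> {pi_op m p (r \<theta>) |\<theta>. 0 \<le> \<theta> \<and> \<theta> \<le> 2 * pi} \<Longrightarrow> reg_le E S U"
    have all: "AE x in m. pi_fun (r \<theta>) f x \<le> lift U f x" if f: "f \<in> Lp_fun m p" "\<And>x. 0 \<le> f x" for \<theta> f
    proof -
      \<comment> \<open>The family is indexed by angles between 0 and 2\<pi>, while rational angles
        are arbitrary; periodicity reduces to the former.\<close>
      obtain t where t: "0 \<le> t" "t < 2 * pi" "cos \<theta> = cos t" "sin \<theta> = sin t"
        by (rule sincos_total_2pi[of "cos \<theta>" "sin \<theta>"]) auto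
      have "r \<theta> = r t" unfolding r_def t ..
      moreover have "reg_le E (pi_op m p (r t)) U" using t by (intro ub) (auto intro!: exI[of _ t])
      ultimately have "AE x in m. lift (pi_op m p (r \<theta>)) f x \<le> lift U f x"
        using f by (simp add: reg_le_lift[OF pi_op_linear[OF r] reg_ops_linear[OF U]])
      then show ?thesis using lift_pi_op[OF r[of \<theta>] f(1)] by eventually_elim simp
    qed
    show "reg_le E (pi_op m p (measure (tv \<mu>))) U"
    proof (rule abs_reg_le[OF \<mu> U])
      fix f :: "'a \<Rightarrow> real" assume f: "f \<in> Lp_fun m p" "\<And>x. 0 \<le> f x"
      \<comment> \<open>The rotations by 0 and \<pi> are opposite real measures, so
        \<open>U f\<close> dominates a number and its negative.\<close>
      have eq: "(\<lambda>A. - 1 * r 0 A) = r pi" by (simp add: r_def fun_eq_iff)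
      show "AE x in m. 0 \<le> lift U f x"
        using all[OF f, of 0] all[OF f, of pi] pi_fun_mult_measure[OF r[of 0] f(1), of "-1", unfolded eq]
        by eventually_elim simp
    next
      fix A :: "'a set" assume A: "A \<in> sets borel" "emeasure m A < \<infinity>"
      have "AE x in m. pi_fun (r \<theta>) (indicator A) x \<le> lift U (indicator A) x" for \<theta>
        by (rule all[OF Lp_fun_indicator[OF A]]) simp
      moreover have "pi_fun (r \<theta>) (indicator A) s = r \<theta> {t. - t + s \<in> A}" for \<theta> s
        using pi_fun_indicator[OF r A(1)] by simp
      \<comment> \<open>One null set now serves all rational angles.\<close>
      ultimately have "AE s in m. \<forall>q\<in>\<rat>. r q {t. - t + s \<in> A} \<le> lift U (indicator A) s"
        by (simp add: AE_ball_countable countable_rat)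
      then show "AE s in m. norm (\<mu> {t. - t + s \<in> A}) \<le> lift U (indicator A) s"
        by eventually_elim (rule cmod_le_of_rational_angles, simp add: r_def)
    qed
  qed
  then show ?thesis by (simp add: creg_modulus_def Let_def op)
qed

lemma op_scale_pi_op_complex:
  fixes \<mu> :: "'a set \<Rightarrow> complex"
  assumes \<mu>: "\<mu> \<in> regular_measures"
  shows "op_scale V c (pi_op m p \<mu>) = pi_op m p (\<lambda>A. c * \<mu> A)"
proof (rule extensionalityI)
  show "op_scale V c (pi_op m p \<mu>) \<in> extensional (cl ` Lp_fun m p)" by (simp add: op_scale_def)
  fix x assume "x \<in> cl ` (Lp_fun m p :: ('a \<Rightarrow> complex) set)"
  then obtain f where f: "f \<in> Lp_fun m p" "x = cl f" by auto
  have "cl (\<lambda>s. c * pi_fun \<mu> f s) = cl (pi_fun (\<lambda>A. c * \<mu> A) f)"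
    using pi_fun_mult_measure[OF \<mu> f(1), of c] by (intro cl_eqI) (auto elim!: eventually_mono)
  then show "op_scale V c (pi_op m p \<mu>) x = pi_op m p (\<lambda>A. c * \<mu> A) x"
    using f by (simp add: op_scale_def pi_op_cl[OF \<mu>] pi_op_cl[OF regular_measures_mult[OF \<mu>]] V_scale pi_fun_Lp[OF \<mu>])
qed (rule pi_op_extensional)

lemma op_add_pi_op_complex:
  fixes \<mu> \<nu> :: "'a set \<Rightarrow> complex"
  assumes \<mu>: "\<mu> \<in> regular_measures" and \<nu>: "\<nu> \<in> regular_measures"
  shows "op_add V (pi_op m p \<mu>) (pi_op m p \<nu>) = pi_op m p (\<lambda>A. \<mu> A + \<nu> A)"
proof (rule extensionalityI)
  show "op_add V (pi_op m p \<mu>) (pi_op m p \<nu>) \<in> extensional (cl ` Lp_fun m p)" by (simp add: op_add_def)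
  fix x assume "x \<in> cl ` (Lp_fun m p :: ('a \<Rightarrow> complex) set)"
  then obtain f where f: "f \<in> Lp_fun m p" "x = cl f" by auto
  have "cl (\<lambda>s. pi_fun \<mu> f s + pi_fun \<nu> f s) = cl (pi_fun (\<lambda>A. \<mu> A + \<nu> A) f)"
    using pi_fun_add_measure[OF \<mu> \<nu> f(1)] by (intro cl_eqI) (auto elim!: eventually_mono)
  then show "op_add V (pi_op m p \<mu>) (pi_op m p \<nu>) x = pi_op m p (\<lambda>A. \<mu> A + \<nu> A) x"
    using f by (simp add: op_add_def pi_op_cl[OF \<mu>] pi_op_cl[OF \<nu>] pi_op_cl[OF regular_measures_add[OF \<mu> \<nu>]] V_add pi_fun_Lp[OF \<mu>] pi_fun_Lp[OF \<nu>])
qed (rule pi_op_extensional)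

lemma cx_embed_cLr:
  fixes \<nu> :: "'a set \<Rightarrow> real"
  assumes \<nu>: "\<nu> \<in> regular_measures"
  shows "cx_embed (cLr V) (pi_op m p \<nu>) = pi_op m p (\<lambda>A. complex_of_real (\<nu> A))"
  unfolding cx_embed_def
proof (rule the_equality)
  let ?T = "pi_op m p (\<lambda>A. complex_of_real (\<nu> A))"
  note c = regular_of_real[OF \<nu>]
  have parts: "op_re V ?T = pi_op m p \<nu>" "op_im V ?T = (\<lambda>x\<in>vs_carrier E. vs_zero E)"
    using op_re_pi_op[OF c] op_im_pi_op[OF c] pi_op_zero by simp_all
  then show "?T \<in> vs_carrier (cLr V) \<and> cx_re (cLr V) ?T = pi_op m p \<nu> \<and> cx_im (cLr V) ?T = vs_zero (cx_real (cLr V))"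
    using pi_op_creg[OF c] by (simp add: cLr_def Lr_def blat.truncate_def)
  fix T assume "T \<in> vs_carrier (cLr V) \<and> cx_re (cLr V) T = pi_op m p \<nu> \<and> cx_im (cLr V) T = vs_zero (cx_real (cLr V))"
  then show "T = ?T"
    using parts by (intro creg_ops_eqI pi_op_creg[OF c]) (simp_all add: cLr_def Lr_def blat.truncate_def)
qed

theorem cbla_hom_pi_op: "cbla_hom (MG_complex :: ('a set \<Rightarrow> real, 'a set \<Rightarrow> complex) cbla) (cLr V) (pi_op m p)"
  unfolding cbla_hom_def
proof (intro conjI ballI)
  let ?M = "MG_complex :: ('a set \<Rightarrow> real, 'a set \<Rightarrow> complex) cbla"
  have car: "vs_carrier ?M = regular_measures" "vs_carrier (cLr V) = creg_ops V"
    by (simp_all add: MG_complex_def cLr_def)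
  show "linear_map ?M (cLr V) (pi_op m p)"
    unfolding linear_map_def car
    by (auto simp: pi_op_creg MG_complex_def cLr_def op_scale_pi_op_complex op_add_pi_op_complex)
  show "continuous_map_nvs ?M (cLr V) (pi_op m p)"
    unfolding continuous_map_nvs_def car
  proof (intro ballI allI impI)
    fix \<mu> :: "'a set \<Rightarrow> complex" and e :: real assume \<mu>: "\<mu> \<in> regular_measures" and e: "0 < e"
    show "\<exists>d>0. \<forall>\<nu>\<in>regular_measures. vs_norm ?M (vs_diff ?M \<nu> \<mu>) < d \<longrightarrow>
      vs_norm (cLr V) (vs_diff (cLr V) (pi_op m p \<nu>) (pi_op m p \<mu>)) < e"
    proof (intro exI[of _ e] conjI ballI impI e)
      fix \<nu> :: "'a set \<Rightarrow> complex" assume \<nu>: "\<nu> \<in> regular_measures" and d: "vs_norm ?M (vs_diff ?M \<nu> \<mu>) < e"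
      have \<mu>': "(\<lambda>A. - 1 * \<mu> A) \<in> regular_measures" by (rule regular_measures_mult[OF \<mu>])
      have s: "(\<lambda>A. \<nu> A + - 1 * \<mu> A) \<in> regular_measures" by (rule regular_measures_add[OF \<nu> \<mu>'])
      have "vs_diff (cLr V) (pi_op m p \<nu>) (pi_op m p \<mu>) = op_add V (pi_op m p \<nu>) (op_scale V (- 1) (pi_op m p \<mu>))"
        by (simp add: vs_diff_def cLr_def)
      then have eq: "vs_diff (cLr V) (pi_op m p \<nu>) (pi_op m p \<mu>) = pi_op m p (\<lambda>A. \<nu> A + - 1 * \<mu> A)"
        unfolding op_scale_pi_op_complex[OF \<mu>] op_add_pi_op_complex[OF \<nu> \<mu>'] .
      let ?T = "measure (tv (\<lambda>A. \<nu> A + - 1 * \<mu> A))"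
      note rad = regular_measuresD(2)[OF s]
      \<comment> \<open>The norm of \<open>cLr V\<close> is the regular norm of the modulus, and the
        modulus is the operator of the variation, a positive measure that is its own
        variation.\<close>
      have "vs_norm (cLr V) (vs_diff (cLr V) (pi_op m p \<nu>) (pi_op m p \<mu>)) = regular_norm E (pi_op m p ?T)"
        unfolding eq creg_modulus_pi_op[OF s, symmetric] by (simp add: cLr_def)
      also have "\<dots> \<le> measure (tv ?T) UNIV" by (rule regular_norm_pi_op[OF regular_measures_measure[OF rad]])
      also have "\<dots> = ?T UNIV" by (simp only: tv_measure[OF radonD(1,2)[OF rad]])
      also have "\<dots> < e" using d by (simp add: MG_complex_def vs_diff_def)
      finally show "vs_norm (cLr V) (vs_diff (cLr V) (pi_op m p \<nu>) (pi_op m p \<mu>)) < e" .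
    qed
  qed
next
  fix \<mu> \<nu> :: "'a set \<Rightarrow> complex" assume "\<mu> \<in> vs_carrier MG_complex" "\<nu> \<in> vs_carrier MG_complex"
  then show "pi_op m p (cbla_mult MG_complex \<mu> \<nu>) = cbla_mult (cLr V) (pi_op m p \<mu>) (pi_op m p \<nu>)"
    by (simp add: MG_complex_def cLr_def pi_op_convolution)
next
  fix \<mu> :: "'a set \<Rightarrow> complex" assume "\<mu> \<in> vs_carrier MG_complex"
  then have \<mu>: "\<mu> \<in> regular_measures" by (simp add: MG_complex_def)
  have T: "measure (tv \<mu>) \<in> regular_measures" by (rule regular_measures_measure[OF regular_measuresD(2)[OF \<mu>]])
  have "cx_modulus (cLr V) (pi_op m p \<mu>) = creg_modulus V (pi_op m p \<mu>)"
    by (simp add: cx_modulus_def creg_modulus_def cLr_def Lr_def blat.truncate_def Let_def)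
  then show "cx_embed (cLr V) (cx_modulus (cLr V) (pi_op m p \<mu>)) = pi_op m p (cx_embed MG_complex (cx_modulus MG_complex \<mu>))"
    unfolding cx_modulus_MG_complex[OF \<mu>] cx_embed_MG_complex[OF T] creg_modulus_pi_op[OF \<mu>]
    by (simp only: cx_embed_cLr[OF T])
qed

end

theorem theorem11p2:
  fixes m :: "'a::{topological_group_add, t2_space} measure" and p :: real
  assumes "locally_compact_space (euclidean :: 'a topology)"
    and "left_haar_measure m"
    and "1 \<le> p"
  shows
    "((\<forall>\<mu>\<in>(regular_measures :: ('a set \<Rightarrow> real) set). \<forall>g\<in>Lp_fun m p.
         (AE s in m. pi_integral_exists \<mu> g s) \<and> pi_fun \<mu> g \<in> Lp_fun m p) \<and>
      (\<forall>\<mu>\<in>vs_carrier (MG_real :: ('a set \<Rightarrow> real) bla).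
         pi_op m p \<mu> \<in> vs_carrier (Lr (Lp_real m p))) \<and>
      bla_hom (MG_real :: ('a set \<Rightarrow> real) bla) (Lr (Lp_real m p)) (pi_op m p) \<and>
      inj_on (pi_op m p) (vs_carrier (MG_real :: ('a set \<Rightarrow> real) bla)))
   \<and>
     ((\<forall>\<mu>\<in>(regular_measures :: ('a set \<Rightarrow> complex) set). \<forall>g\<in>Lp_fun m p.
         (AE s in m. pi_integral_exists \<mu> g s) \<and> pi_fun \<mu> g \<in> Lp_fun m p) \<and>
      (\<forall>\<mu>\<in>vs_carrier (MG_complex :: ('a set \<Rightarrow> real, 'a set \<Rightarrow> complex) cbla).
         pi_op m p \<mu> \<in> vs_carrier (cLr (Lp_complex m p))) \<and>
      cbla_hom (MG_complex :: ('a set \<Rightarrow> real, 'a set \<Rightarrow> complex) cbla)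
        (cLr (Lp_complex m p)) (pi_op m p) \<and>
      inj_on (pi_op m p) (vs_carrier (MG_complex :: ('a set \<Rightarrow> real, 'a set \<Rightarrow> complex) cbla)))"
proof -
  interpret haar_Lp m p using assms by unfold_locales
  have MG: "vs_carrier (MG_real :: ('a set \<Rightarrow> real) bla) = regular_measures"
    "vs_carrier (MG_complex :: ('a set \<Rightarrow> real, 'a set \<Rightarrow> complex) cbla) = regular_measures"
    by (simp_all add: MG_real_def MG_complex_def)
  have Lr: "vs_carrier (Lr E) = reg_ops E" "vs_carrier (cLr V) = creg_ops V" by (simp_all add: Lr_def cLr_def)
  show ?thesis unfolding MG Lr
    by (intro conjI ballI pi_integral_exists_AE pi_fun_Lp pi_op_reg pi_op_creg bla_hom_pi_op cbla_hom_pi_op inj_pi_op)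
qed

end
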